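(* Let $g$ be an adapted metric on $(M;\mathcal D_1,\ldots,\mathcal D_k)$ critical for the action $J_{\mathcal D}:g\mapsto\int_M{\rm S}_{\mathcal D_1,\ldots,\mathcal D_k}\,{\rm d\,vol}_g$ with respect to adapted variations. Suppose that there exists $\mu\in\{1,\ldots,k\}$ such that either $n_\mu\ge3$, or $n_\mu=2$ and $\tilde H_\mu=0$. Then there exists a contorsion tensor $\mathfrak T\ne0$ of a statistical connection on $(M,g)$ such that the pair $(g,\mathfrak T)$ is critical for the action $\bar J_{\mathcal D}:(g,\mathfrak T)\mapsto\int_M\overline{\rm S}_{\mathcal D_1,\ldots,\mathcal D_k}\,{\rm d\,vol}_g$ with respect to adapted variations of $g$ and variations of $\mathfrak T$ corresponding to statistical connections.
   Context: Setting. $M$ is a connected smooth manifold with $TM=\mathcal D_1+\ldots+\mathcal D_k$ a direct sum of $k\ge2$ subbundles (distributions) of ranks $n_\mu$. A pseudo-Riemannian metric $g=\langle\cdot,\cdot\rangle$ is adapted if all $\mathcal D_\mu$ are non-degenerate and pairwise orthogonal. $P_\mu$ is the orthoprojector onto $\mathcal D_\mu$, $\mathcal D_\mu^\bot=\bigoplus_{\nu\ne\mu}\mathcal D_\nu$. $\{E_{\mu,a}\}$ are local orthonormal frames of $\mathcal D_\mu$; $\varepsilon=\pm1$ is the square of the corresponding frame vector. $\nabla$ is the Levi-Civita connection, $\bar\nabla=\nabla+\mathfrak T$ with contorsion $(1,2)$-tensor $\mathfrak T$. $\bar\nabla$ is statistical if $\langle\mathfrak T_XY,Z\rangle$ is totally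 symmetric. $\tilde H_\mu$ is the mean curvature vector of $\mathcal D_\mu^\bot$: the metric trace of $\tilde h_\mu(X,Y)=\frac12P_\mu(\nabla_XY+\nabla_YX)$, $X,Y\in\mathcal D_\mu^\bot$. Mixed scalar curvature: with $\bar R_{X,Y}=[\bar\nabla_Y,\bar\nabla_X]+\bar\nabla_{[X,Y]}$, $\overline{\rm S}_{\mathcal D_1,\ldots,\mathcal D_k}=\frac12\sum_{\nu<\mu}\sum_{a,b}\varepsilon_a\varepsilon_b(\langle\bar R_{E_{\nu,a},E_{\mu,b}}E_{\nu,a},E_{\mu,b}\rangle+\langle\bar R_{E_{\mu,b},E_{\nu,a}}E_{\mu,b},E_{\nu,a}\rangle)$; ${\rm S}_{\mathcal D_1,\ldots,\mathcal D_k}$ is the same function for $\mathfrak T=0$. If $M$ is non-compact, integrals are over a relatively compact domain $\Omega$ containing the supports of variations. Adapted variation: smooth family $g_t$ of adapted metrics, $g_0=g$, $\partial_tg_t$ supported in $\Omega$. The pair is critical if the derivative of the action at $t=0$ vanishes for all adapted variations of $g$ with $\mathfrak T$ fixed (as a $(1,2)$-tensor), and for all smooth families $\mathfrak T_t$ of contorsion tensors of statistical connections for $g$, with $\mathfrak T_0=\mathfrak T$, $\partial_t\mathfrak T_t$ supported in $\Omega$, and $g$ fixed. *)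

theory Defs
  imports "HOL-Analysis.Analysis"
begin

section \<open>Smooth maps between Euclidean spaces\<close>

text \<open>Only meant for open sets, where differentiability within the set is differentiability
  at its points.\<close>

primrec Ck_on :: "nat \<Rightarrow> 'a::euclidean_space set \<Rightarrow> ('a \<Rightarrow> 'b::real_normed_vector) \<Rightarrow> bool" where
  "Ck_on 0 S f \<longleftrightarrow> continuous_on S f"
| "Ck_on (Suc r) S f \<longleftrightarrow>
     f differentiable_on S \<and> (\<forall>v. Ck_on r S (\<lambda>x. frechet_derivative f (at x) v))"

definition smooth_on :: "'a::euclidean_space set \<Rightarrow> ('a \<Rightarrow> 'b::real_normed_vector) \<Rightarrow> bool" where
  "smooth_on S f \<longleftrightarrow> (\<forall>r. Ck_on r S f)"


section \<open>Smooth manifolds\<close>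

text \<open>The points of the manifold form a whole Hausdorff, second countable type 'm; a chart is
  a pair of a domain and a coordinate map, of which only the values on the domain matter.\<close>

type_synonym ('m, 'n) chart = "'m set \<times> ('m \<Rightarrow> real^'n)"

definition chart_inv :: "('m, 'n::finite) chart \<Rightarrow> real^'n \<Rightarrow> 'm" where
  "chart_inv c = inv_into (fst c) (snd c)"

definition smooth_atlas ::
  "('m::{t2_space,second_countable_topology}, 'n::finite) chart set \<Rightarrow> bool" where
  "smooth_atlas A \<longleftrightarrow>
     (\<Union>c\<in>A. fst c) = UNIV \<and>
     (\<forall>c\<in>A. open (fst c) \<and> open (snd c ` fst c) \<and>
        homeomorphism (fst c) (snd c ` fst c) (snd c) (chart_inv c)) \<and>
     (\<forall>c\<in>A. \<forall>c'\<in>A. smooth_on (snd c ` (fst c \<inter> fst c')) (\<lambda>y. snd c' (chart_inv c y)))"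

text \<open>The tangent space at \<open>p\<close> is the model space \<open>real^'n\<close>: a vector is represented by its
  components in one fixed chart of the atlas around \<open>p\<close>, the preferred chart \<open>chart_at A p\<close>.
  Components in other charts are obtained with the derivative of the change of coordinates.
  Thus pointwise linear algebra takes place in \<open>real^'n\<close>, whereas smoothness of fields has to be
  tested in genuine coordinates, because the preferred chart jumps with the point.\<close>

definition chart_at :: "('m, 'n::finite) chart set \<Rightarrow> 'm \<Rightarrow> ('m, 'n) chart" where
  "chart_at A p = (SOME c. c \<in> A \<and> p \<in> fst c)"

definition change_coord ::
  "('m, 'n::finite) chart \<Rightarrow> ('m, 'n) chart \<Rightarrow> 'm \<Rightarrow> real^'n \<Rightarrow> real^'n" where
  "change_coord c c' p = frechet_derivative (\<lambda>y. snd c' (chart_inv c y)) (at (snd c p))"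

definition components ::
  "('m, 'n::finite) chart set \<Rightarrow> ('m, 'n) chart \<Rightarrow> 'm \<Rightarrow> real^'n \<Rightarrow> real^'n" where
  "components A c p = change_coord (chart_at A p) c p"

definition coord_field ::
  "('m, 'n::finite) chart set \<Rightarrow> ('m, 'n) chart \<Rightarrow> 'n \<Rightarrow> 'm \<Rightarrow> real^'n" where
  "coord_field A c i p = change_coord c (chart_at A p) p (axis i 1)"

definition field_rep ::
  "('m, 'n::finite) chart set \<Rightarrow> ('m, 'n) chart \<Rightarrow> ('m \<Rightarrow> real^'n) \<Rightarrow> real^'n \<Rightarrow> real^'n" where
  "field_rep A c X y = components A c (chart_inv c y) (X (chart_inv c y))"

definition smooth_fun ::
  "('m, 'n::finite) chart set \<Rightarrow> 'm set \<Rightarrow> ('m \<Rightarrow> real) \<Rightarrow> bool" where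
  "smooth_fun A U f \<longleftrightarrow> (\<forall>c\<in>A. smooth_on (snd c ` (fst c \<inter> U)) (\<lambda>y. f (chart_inv c y)))"

definition smooth_field ::
  "('m, 'n::finite) chart set \<Rightarrow> 'm set \<Rightarrow> ('m \<Rightarrow> real^'n) \<Rightarrow> bool" where
  "smooth_field A U X \<longleftrightarrow> (\<forall>c\<in>A. smooth_on (snd c ` (fst c \<inter> U)) (field_rep A c X))"

definition smooth_fun_family ::
  "('m, 'n::finite) chart set \<Rightarrow> real set \<Rightarrow> 'm set \<Rightarrow> (real \<Rightarrow> 'm \<Rightarrow> real) \<Rightarrow> bool" where
  "smooth_fun_family A I U f \<longleftrightarrow>
     (\<forall>c\<in>A. smooth_on (I \<times> snd c ` (fst c \<inter> U)) (\<lambda>(t, y). f t (chart_inv c y)))"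

definition smooth_field_family ::
  "('m, 'n::finite) chart set \<Rightarrow> real set \<Rightarrow> 'm set \<Rightarrow> (real \<Rightarrow> 'm \<Rightarrow> real^'n) \<Rightarrow> bool" where
  "smooth_field_family A I U X \<longleftrightarrow>
     (\<forall>c\<in>A. smooth_on (I \<times> snd c ` (fst c \<inter> U)) (\<lambda>(t, y). field_rep A c (X t) y))"

definition dir_deriv ::
  "('m, 'n::finite) chart set \<Rightarrow> 'm \<Rightarrow> real^'n \<Rightarrow> ('m \<Rightarrow> real) \<Rightarrow> real" where
  "dir_deriv A p v f =
     (let c = chart_at A p in frechet_derivative (\<lambda>y. f (chart_inv c y)) (at (snd c p)) v)"

definition lie_bracket ::
  "('m, 'n::finite) chart set \<Rightarrow> ('m \<Rightarrow> real^'n) \<Rightarrow> ('m \<Rightarrow> real^'n) \<Rightarrow> 'm \<Rightarrow> real^'n" where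
  "lie_bracket A X Y p =
     (let c = chart_at A p; x = snd c p in
        frechet_derivative (field_rep A c Y) (at x) (field_rep A c X x)
      - frechet_derivative (field_rep A c X) (at x) (field_rep A c Y x))"


section \<open>Metrics, tensors, connections\<close>

type_synonym ('m, 'n) metric = "'m \<Rightarrow> real^'n \<Rightarrow> real^'n \<Rightarrow> real"
type_synonym ('m, 'n) tensor12 = "'m \<Rightarrow> real^'n \<Rightarrow> real^'n \<Rightarrow> real^'n"

text \<open>A connection \<open>\<nabla> p v Y\<close> differentiates a field \<open>Y\<close>, smooth near \<open>p\<close>, at \<open>p\<close> in
  direction \<open>v\<close>.\<close>

type_synonym ('m, 'n) connection = "'m \<Rightarrow> real^'n \<Rightarrow> ('m \<Rightarrow> real^'n) \<Rightarrow> real^'n"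

definition pseudo_riemannian :: "('m::topological_space, 'n::finite) chart set \<Rightarrow> ('m, 'n) metric \<Rightarrow> bool" where
  "pseudo_riemannian A g \<longleftrightarrow>
     (\<forall>p. bilinear (g p) \<and> (\<forall>u v. g p u v = g p v u) \<and>
          (\<forall>u. (\<forall>v. g p u v = 0) \<longrightarrow> u = 0)) \<and>
     (\<forall>U X Y. open U \<and> smooth_field A U X \<and> smooth_field A U Y \<longrightarrow>
        smooth_fun A U (\<lambda>p. g p (X p) (Y p)))"

definition tensor_field12 :: "('m::topological_space, 'n::finite) chart set \<Rightarrow> ('m, 'n) tensor12 \<Rightarrow> bool" where
  "tensor_field12 A T \<longleftrightarrow>
     (\<forall>p. bilinear (T p)) \<and>
     (\<forall>U X Y. open U \<and> smooth_field A U X \<and> smooth_field A U Y \<longrightarrow>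
        smooth_field A U (\<lambda>p. T p (X p) (Y p)))"

definition affine_connection ::
  "('m::topological_space, 'n::finite) chart set \<Rightarrow> ('m, 'n) connection \<Rightarrow> bool" where
  "affine_connection A nab \<longleftrightarrow> (\<forall>U. open U \<longrightarrow>
     (\<forall>p\<in>U. \<forall>Y. smooth_field A U Y \<longrightarrow> linear (\<lambda>v. nab p v Y)) \<and>
     (\<forall>p\<in>U. \<forall>v Y Z. smooth_field A U Y \<and> smooth_field A U Z \<longrightarrow>
        nab p v (\<lambda>q. Y q + Z q) = nab p v Y + nab p v Z) \<and>
     (\<forall>p\<in>U. \<forall>v f Y. smooth_fun A U f \<and> smooth_field A U Y \<longrightarrow>
        nab p v (\<lambda>q. f q *\<^sub>R Y q) = dir_deriv A p v f *\<^sub>R Y p + f p *\<^sub>R nab p v Y) \<and>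
     (\<forall>X Y. smooth_field A U X \<and> smooth_field A U Y \<longrightarrow>
        smooth_field A U (\<lambda>p. nab p (X p) Y)))"

definition is_levi_civita ::
  "('m::topological_space, 'n::finite) chart set \<Rightarrow> ('m, 'n) metric \<Rightarrow> ('m, 'n) connection \<Rightarrow> bool" where
  "is_levi_civita A g nab \<longleftrightarrow>
     affine_connection A nab \<and>
     (\<forall>U. open U \<longrightarrow>
       (\<forall>p\<in>U. \<forall>X Y. smooth_field A U X \<and> smooth_field A U Y \<longrightarrow>
          nab p (X p) Y - nab p (Y p) X = lie_bracket A X Y p) \<and>
       (\<forall>p\<in>U. \<forall>v Y Z. smooth_field A U Y \<and> smooth_field A U Z \<longrightarrow>
          dir_deriv A p v (\<lambda>q. g q (Y q) (Z q)) = g p (nab p v Y) (Z p) + g p (Y p) (nab p v Z)))"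

text \<open>The choice is harmless: the values on fields smooth near the point are determined by the
  axioms; values on other arguments are never used.\<close>

definition levi_civita ::
  "('m::topological_space, 'n::finite) chart set \<Rightarrow> ('m, 'n) metric \<Rightarrow> ('m, 'n) connection" where
  "levi_civita A g = (SOME nab. is_levi_civita A g nab)"

definition add_contorsion ::
  "('m, 'n::finite) connection \<Rightarrow> ('m, 'n) tensor12 \<Rightarrow> ('m, 'n) connection" where
  "add_contorsion nab T p v Y = nab p v Y + T p v (Y p)"

text \<open>Sign convention \<open>R\<^bsub>X,Y\<^esub> = [\<nabla>\<^sub>Y, \<nabla>\<^sub>X] + \<nabla>\<^bsub>[X,Y]\<^esub>\<close>.\<close>

definition curvature ::
  "('m, 'n::finite) chart set \<Rightarrow> ('m, 'n) connection \<Rightarrow>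
   ('m \<Rightarrow> real^'n) \<Rightarrow> ('m \<Rightarrow> real^'n) \<Rightarrow> ('m \<Rightarrow> real^'n) \<Rightarrow> 'm \<Rightarrow> real^'n" where
  "curvature A nab X Y Z p =
     nab p (Y p) (\<lambda>q. nab q (X q) Z) - nab p (X p) (\<lambda>q. nab q (Y q) Z)
     + nab p (lie_bracket A X Y p) Z"

definition statistical ::
  "('m::topological_space, 'n::finite) chart set \<Rightarrow> ('m, 'n) metric \<Rightarrow> ('m, 'n) tensor12 \<Rightarrow> bool" where
  "statistical A g T \<longleftrightarrow>
     tensor_field12 A T \<and>
     (\<forall>p u v w. g p (T p u v) w = g p (T p v u) w \<and> g p (T p u v) w = g p (T p u w) v)"


section \<open>Almost multi-product structures\<close>

type_synonym ('m, 'n) dist = "nat \<Rightarrow> 'm \<Rightarrow> (real^'n) set"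

definition smooth_distribution ::
  "('m::topological_space, 'n::finite) chart set \<Rightarrow> nat \<Rightarrow> ('m \<Rightarrow> (real^'n) set) \<Rightarrow> bool" where
  "smooth_distribution A r F \<longleftrightarrow>
     (\<forall>p. subspace (F p) \<and> dim (F p) = r) \<and>
     (\<forall>p. \<exists>U X. open U \<and> p \<in> U \<and> (\<forall>a\<in>{1..r}. smooth_field A U (X a)) \<and>
        (\<forall>q\<in>U. F q = span ((\<lambda>a. X a q) ` {1..r})))"

definition tangent_splitting ::
  "('m::topological_space, 'n::finite) chart set \<Rightarrow> nat \<Rightarrow> (nat \<Rightarrow> nat) \<Rightarrow> ('m, 'n) dist \<Rightarrow> bool" where
  "tangent_splitting A k n D \<longleftrightarrow>
     (\<forall>\<mu>\<in>{1..k}. smooth_distribution A (n \<mu>) (D \<mu>)) \<and>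
     (\<forall>p v. \<exists>!w. w \<in> (\<Pi>\<^sub>E \<mu>\<in>{1..k}. D \<mu> p) \<and> v = (\<Sum>\<mu>\<in>{1..k}. w \<mu>))"

definition adapted_metric ::
  "('m::topological_space, 'n::finite) chart set \<Rightarrow> nat \<Rightarrow> ('m, 'n) dist \<Rightarrow> ('m, 'n) metric \<Rightarrow> bool" where
  "adapted_metric A k D g \<longleftrightarrow>
     pseudo_riemannian A g \<and>
     (\<forall>\<mu>\<in>{1..k}. \<forall>p. \<forall>u\<in>D \<mu> p. (\<forall>v\<in>D \<mu> p. g p u v = 0) \<longrightarrow> u = 0) \<and>
     (\<forall>\<mu>\<in>{1..k}. \<forall>\<nu>\<in>{1..k}. \<mu> \<noteq> \<nu> \<longrightarrow> (\<forall>p. \<forall>u\<in>D \<mu> p. \<forall>v\<in>D \<nu> p. g p u v = 0))"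

definition orthoprojector ::
  "('m, 'n::finite) metric \<Rightarrow> ('m \<Rightarrow> (real^'n) set) \<Rightarrow> 'm \<Rightarrow> real^'n \<Rightarrow> real^'n" where
  "orthoprojector g F p v = (THE u. u \<in> F p \<and> (\<forall>w\<in>F p. g p (v - u) w = 0))"

definition adapted_frame ::
  "('m::topological_space, 'n::finite) chart set \<Rightarrow> nat \<Rightarrow> (nat \<Rightarrow> nat) \<Rightarrow> ('m, 'n) dist \<Rightarrow>
   ('m, 'n) metric \<Rightarrow> 'm set \<Rightarrow> (nat \<Rightarrow> nat \<Rightarrow> 'm \<Rightarrow> real^'n) \<Rightarrow> bool" where
  "adapted_frame A k n D g U E \<longleftrightarrow>
     (\<forall>\<mu>\<in>{1..k}. \<forall>a\<in>{1..n \<mu>}. smooth_field A U (E \<mu> a) \<and>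
        (\<forall>p\<in>U. E \<mu> a p \<in> D \<mu> p \<and> \<bar>g p (E \<mu> a p) (E \<mu> a p)\<bar> = 1 \<and>
           (\<forall>b\<in>{1..n \<mu>}. b \<noteq> a \<longrightarrow> g p (E \<mu> a p) (E \<mu> b p) = 0)))"

text \<open>Some local orthonormal frame around \<open>p\<close>; the traces below do not depend on the choice.\<close>

definition frame_at ::
  "('m::topological_space, 'n::finite) chart set \<Rightarrow> nat \<Rightarrow> (nat \<Rightarrow> nat) \<Rightarrow> ('m, 'n) dist \<Rightarrow>
   ('m, 'n) metric \<Rightarrow> 'm \<Rightarrow> nat \<Rightarrow> nat \<Rightarrow> 'm \<Rightarrow> real^'n" where
  "frame_at A k n D g p = (SOME E. \<exists>U. open U \<and> p \<in> U \<and> adapted_frame A k n D g U E)"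

definition mean_curvature ::
  "('m::topological_space, 'n::finite) chart set \<Rightarrow> nat \<Rightarrow> (nat \<Rightarrow> nat) \<Rightarrow> ('m, 'n) dist \<Rightarrow>
   ('m, 'n) metric \<Rightarrow> nat \<Rightarrow> 'm \<Rightarrow> real^'n" where
  "mean_curvature A k n D g \<mu> p =
     (let E = frame_at A k n D g p; nab = levi_civita A g;
          h = (\<lambda>X Y. (1/2) *\<^sub>R orthoprojector g (D \<mu>) p (nab p (X p) Y + nab p (Y p) X))
      in \<Sum>\<nu>\<in>{1..k} - {\<mu>}. \<Sum>a\<in>{1..n \<nu>}. g p (E \<nu> a p) (E \<nu> a p) *\<^sub>R h (E \<nu> a) (E \<nu> a))"

definition mixed_scalar_curvature ::
  "('m::topological_space, 'n::finite) chart set \<Rightarrow> nat \<Rightarrow> (nat \<Rightarrow> nat) \<Rightarrow> ('m, 'n) dist \<Rightarrow>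
   ('m, 'n) metric \<Rightarrow> ('m, 'n) tensor12 \<Rightarrow> 'm \<Rightarrow> real" where
  "mixed_scalar_curvature A k n D g T p =
     (let E = frame_at A k n D g p; R = curvature A (add_contorsion (levi_civita A g) T)
      in (1/2) * (\<Sum>\<mu>\<in>{1..k}. \<Sum>\<nu>\<in>{1..<\<mu>}. \<Sum>a\<in>{1..n \<nu>}. \<Sum>b\<in>{1..n \<mu>}.
           g p (E \<nu> a p) (E \<nu> a p) * g p (E \<mu> b p) (E \<mu> b p) *
           (g p (R (E \<nu> a) (E \<mu> b) (E \<nu> a) p) (E \<mu> b p)
            + g p (R (E \<mu> b) (E \<nu> a) (E \<mu> b) p) (E \<nu> a p))))"


section \<open>The actions and their critical points\<close>

definition volume_density ::
  "('m, 'n::finite) chart set \<Rightarrow> ('m, 'n) metric \<Rightarrow> ('m, 'n) chart \<Rightarrow> real^'n \<Rightarrow> real" where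
  "volume_density A g c y =
     (let p = chart_inv c y in
        sqrt \<bar>det (\<chi> i j. g p (coord_field A c i p) (coord_field A c j p))\<bar>)"

text \<open>The Riemannian measure: the Borel measure that is \<open>\<surd>\<bar>det g\<bar> dx\<close> in every chart.\<close>

definition vol ::
  "('m::topological_space, 'n::finite) chart set \<Rightarrow> ('m, 'n) metric \<Rightarrow> 'm measure" where
  "vol A g = (THE M. sets M = sets borel \<and>
     (\<forall>c\<in>A. \<forall>B\<in>sets borel. B \<subseteq> fst c \<longrightarrow>
        emeasure M B = (\<integral>\<^sup>+y\<in>snd c ` B. ennreal (volume_density A g c y) \<partial>lborel)))"

text \<open>The case \<open>T = 0\<close> is the action of the metric alone.\<close>

definition action ::
  "('m::topological_space, 'n::finite) chart set \<Rightarrow> nat \<Rightarrow> (nat \<Rightarrow> nat) \<Rightarrow> ('m, 'n) dist \<Rightarrow>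
   'm set \<Rightarrow> ('m, 'n) metric \<Rightarrow> ('m, 'n) tensor12 \<Rightarrow> real" where
  "action A k n D \<Omega> g T = (LINT p:\<Omega>|vol A g. mixed_scalar_curvature A k n D g T p)"

text \<open>On a non-compact manifold only variations supported in \<open>\<Omega>\<close> are tested on \<open>\<Omega>\<close>.\<close>

definition integration_domain :: "'m::topological_space set \<Rightarrow> bool" where
  "integration_domain \<Omega> \<longleftrightarrow>
     (if compact (UNIV :: 'm set) then \<Omega> = UNIV
      else open \<Omega> \<and> connected \<Omega> \<and> compact (closure \<Omega>))"

definition adapted_variation ::
  "('m::topological_space, 'n::finite) chart set \<Rightarrow> nat \<Rightarrow> ('m, 'n) dist \<Rightarrow> 'm set \<Rightarrow>
   ('m, 'n) metric \<Rightarrow> real \<Rightarrow> (real \<Rightarrow> ('m, 'n) metric) \<Rightarrow> bool" where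
  "adapted_variation A k D \<Omega> g \<epsilon> G \<longleftrightarrow>
     \<epsilon> > 0 \<and> G 0 = g \<and>
     (\<forall>t\<in>{-\<epsilon><..<\<epsilon>}. adapted_metric A k D (G t)) \<and>
     (\<forall>U X Y. open U \<and> smooth_field A U X \<and> smooth_field A U Y \<longrightarrow>
        smooth_fun_family A {-\<epsilon><..<\<epsilon>} U (\<lambda>t p. G t p (X p) (Y p))) \<and>
     (\<forall>t\<in>{-\<epsilon><..<\<epsilon>}. closure {p. \<exists>u v. deriv (\<lambda>s. G s p u v) t \<noteq> 0} \<subseteq> \<Omega>)"

definition statistical_variation ::
  "('m::topological_space, 'n::finite) chart set \<Rightarrow> 'm set \<Rightarrow>
   ('m, 'n) metric \<Rightarrow> ('m, 'n) tensor12 \<Rightarrow> real \<Rightarrow> (real \<Rightarrow> ('m, 'n) tensor12) \<Rightarrow> bool" where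
  "statistical_variation A \<Omega> g T \<epsilon> S \<longleftrightarrow>
     \<epsilon> > 0 \<and> S 0 = T \<and>
     (\<forall>t\<in>{-\<epsilon><..<\<epsilon>}. statistical A g (S t)) \<and>
     (\<forall>U X Y. open U \<and> smooth_field A U X \<and> smooth_field A U Y \<longrightarrow>
        smooth_field_family A {-\<epsilon><..<\<epsilon>} U (\<lambda>t p. S t p (X p) (Y p))) \<and>
     (\<forall>t\<in>{-\<epsilon><..<\<epsilon>}.
        closure {p. \<exists>u v. vector_derivative (\<lambda>s. S s p u v) (at t) \<noteq> 0} \<subseteq> \<Omega>)"

definition metric_critical ::
  "('m::topological_space, 'n::finite) chart set \<Rightarrow> nat \<Rightarrow> (nat \<Rightarrow> nat) \<Rightarrow> ('m, 'n) dist \<Rightarrow>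
   ('m, 'n) metric \<Rightarrow> ('m, 'n) tensor12 \<Rightarrow> bool" where
  "metric_critical A k n D g T \<longleftrightarrow>
     (\<forall>\<Omega> \<epsilon> G. integration_domain \<Omega> \<and> adapted_variation A k D \<Omega> g \<epsilon> G \<longrightarrow>
        ((\<lambda>t. action A k n D \<Omega> (G t) T) has_real_derivative 0) (at 0))"

definition contorsion_critical ::
  "('m::topological_space, 'n::finite) chart set \<Rightarrow> nat \<Rightarrow> (nat \<Rightarrow> nat) \<Rightarrow> ('m, 'n) dist \<Rightarrow>
   ('m, 'n) metric \<Rightarrow> ('m, 'n) tensor12 \<Rightarrow> bool" where
  "contorsion_critical A k n D g T \<longleftrightarrow>
     (\<forall>\<Omega> \<epsilon> S. integration_domain \<Omega> \<and> statistical_variation A \<Omega> g T \<epsilon> S \<longrightarrow>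
        ((\<lambda>t. action A k n D \<Omega> g (S t)) has_real_derivative 0) (at 0))"

end

theory Submission
  imports Defs
begin

text \<open>
  The contorsion is a cubic form supported on a single distribution \<open>D\<^sub>\<mu>\<close>, built from two orthogonal sections
  that are also orthogonal to \<open>H\<^sub>\<mu>\<close>, and normalised to be trace-free. Such sections exist by a
  bump function construction as soon as \<open>n\<^sub>\<mu> \<ge> 3\<close>, or \<open>n\<^sub>\<mu> = 2\<close> and \<open>H\<^sub>\<mu> = 0\<close>.

  When the metric varies with \<open>T\<close> fixed, the mixed scalar curvature differs from the Levi-Civita one by
  \<open>-1/2 \<langle>tr T, H\<^sub>\<mu>\<rangle>\<close>, a sum of products of two factors both vanishing at \<open>t = 0\<close>. When \<open>T\<close> varies through
  statistical tensors \<open>S = T + R\<close>, the difference is a quadratic form \<open>Q(S)\<close>, and \<open>Q(T + R) = Q(R)\<close> because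
  \<open>T\<close> is trace-free and has no mixed components. In both cases the actions agree with those for
  \<open>T = 0\<close> up to \<open>O(t\<^sup>2)\<close>, so criticality of \<open>g\<close> carries over. The perturbation is locally
  \<open>O(t\<^sup>2)\<close>, hence integrable on \<open>\<Omega>\<close>; if the unperturbed integrand is not integrable, then
  neither is the perturbed one, and both Bochner integrals are \<open>0\<close>.
\<close>


section \<open>Smooth functions\<close>

text \<open>The same \<open>T\<close> must serve for every metric of a variation, although for the
  varied metric it is in general neither statistical nor trace-free. Hence two curvature
  comparisons: one for symmetric tensors living on a single distribution, a property that mentions
  no metric, and one for arbitrary statistical tensors. A single vanishing factor in \<langle>tr T,
  H\<rangle> would leave a first-order term in t, so trace-freeness alone is not enough and the
  sections must also avoid the direction of H. Two directions off H account for the dimension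
  hypothesis. In indefinite signature H may be null everywhere without vanishing; then H is
  orthogonal to itself, and the cube of its dual covector is already a suitable form. The frames in
  the definitions are chosen point by point and need not vary smoothly with the point or with t. The
  corrections are therefore rewritten with inverse Gram matrices, directional derivatives and
  brackets of fixed fields, or with one fixed smooth frame. This gives joint smoothness in t and the
  point, and from it bounds that are uniform.\<close>

lemma Ck_on_subset: "Ck_on r S f \<Longrightarrow> T \<subseteq> S \<Longrightarrow> Ck_on r T f"
  by (induction r arbitrary: f) (auto intro: continuous_on_subset differentiable_on_subset)

lemma Ck_on_Suc_imp: "Ck_on (Suc r) S f \<Longrightarrow> Ck_on r S f"
  by (induction r arbitrary: f) (auto intro: differentiable_imp_continuous_on)

lemma smooth_on_subset: "smooth_on S f \<Longrightarrow> T \<subseteq> S \<Longrightarrow> smooth_on T f"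
  unfolding smooth_on_def using Ck_on_subset by blast

lemma differentiable_at_local:
  assumes "f differentiable (at x)" "open U" "x \<in> U" "\<And>y. y \<in> U \<Longrightarrow> f y = g y"
  shows "g differentiable (at x)"
  using assms by (meson differentiable_def has_derivative_transform_within_open)

text \<open>\<open>frechet_derivative\<close> is a choice among all derivatives at the point.
  Functions that agree near \<open>x\<close> have the same derivatives there, so the choice is the
  same even when no derivative exists.\<close>

lemma frechet_derivative_local:
  assumes "open U" "x \<in> U" "\<And>y. y \<in> U \<Longrightarrow> f y = g y"
  shows "frechet_derivative f (at x) = frechet_derivative g (at x)"
proof -
  have "(f has_derivative f') (at x) \<longleftrightarrow> (g has_derivative f') (at x)" for f'
    using assms by (auto intro: has_derivative_transform_within_open)
  then show ?thesis by (simp add: frechet_derivative_def)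
qed

lemma Ck_on_cong:
  assumes "open S" "\<And>x. x \<in> S \<Longrightarrow> f x = g x" "Ck_on r S f"
  shows "Ck_on r S g"
  using assms(2,3)
proof (induction r arbitrary: f g)
  case 0
  then show ?case using continuous_on_cong by fastforce
next
  case (Suc r)
  have "g differentiable_on S"
    using Suc.prems assms(1) differentiable_at_local[of f _ S g]
    by (simp add: differentiable_on_eq_differentiable_at)
  moreover have "Ck_on r S (\<lambda>x. frechet_derivative g (at x) v)" for v
  proof (rule Suc.IH)
    show "Ck_on r S (\<lambda>x. frechet_derivative f (at x) v)"
      using Suc.prems by simp
    show "frechet_derivative f (at x) v = frechet_derivative g (at x) v" if "x \<in> S" for x
      using frechet_derivative_local[OF assms(1) that, of f g] Suc.prems(1) by simp
  qed
  ultimately show ?case by simp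
qed

lemma smooth_on_cong:
  assumes "open S" "\<And>x. x \<in> S \<Longrightarrow> f x = g x" "smooth_on S f"
  shows "smooth_on S g"
  using assms(3) Ck_on_cong[OF assms(1,2)] unfolding smooth_on_def by auto

lemma Ck_on_local:
  assumes "\<And>x. x \<in> S \<Longrightarrow> \<exists>U. open U \<and> x \<in> U \<and> Ck_on r U f"
  shows "Ck_on r S f"
  using assms
proof (induction r arbitrary: f)
  case 0
  then show ?case
    unfolding Ck_on.simps
    by (intro continuous_at_imp_continuous_on ballI) (metis continuous_on_eq_continuous_at)
next
  case (Suc r)
  have "f differentiable_on S"
    unfolding differentiable_on_def
  proof
    fix x assume "x \<in> S"
    with Suc.prems obtain U where "open U" "x \<in> U" "Ck_on (Suc r) U f" by blast
    then show "f differentiable at x within S"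
      by (auto simp: differentiable_on_eq_differentiable_at intro: differentiable_at_withinI)
  qed
  moreover have "Ck_on r S (\<lambda>x. frechet_derivative f (at x) v)" for v
  proof (rule Suc.IH)
    fix x assume "x \<in> S"
    with Suc.prems obtain U where "open U" "x \<in> U" "Ck_on (Suc r) U f" by blast
    then show "\<exists>U. open U \<and> x \<in> U \<and> Ck_on r U (\<lambda>x. frechet_derivative f (at x) v)" by auto
  qed
  ultimately show ?case by simp
qed

lemma smooth_on_local:
  assumes "\<And>x. x \<in> S \<Longrightarrow> \<exists>U. open U \<and> x \<in> U \<and> smooth_on U f"
  shows "smooth_on S f"
  unfolding smooth_on_def
proof
  fix r show "Ck_on r S f"
    by (rule Ck_on_local) (use assms smooth_on_def in blast)
qed

text \<open>Lets an explicit derivative \<open>f'\<close> stand in for the chosen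
  \<open>frechet_derivative\<close>; most closure rules below are inductions on the order through
  this rule.\<close>

lemma Ck_on_SucI:
  assumes "open S" "\<And>x. x \<in> S \<Longrightarrow> (f has_derivative f' x) (at x)"
    and "\<And>v. Ck_on r S (\<lambda>x. f' x v)"
  shows "Ck_on (Suc r) S f"
proof -
  have "f differentiable_on S"
    using assms(1,2) by (auto simp: differentiable_on_eq_differentiable_at differentiable_def)
  moreover have "Ck_on r S (\<lambda>x. frechet_derivative f (at x) v)" for v
    using assms(1) _ assms(3)[of v]
    by (rule Ck_on_cong) (use frechet_derivative_at[OF assms(2)] in simp)
  ultimately show ?thesis by simp
qed

lemma Ck_on_has_derivative:
  assumes "Ck_on (Suc r) S f" "open S" "x \<in> S"
  shows "(f has_derivative frechet_derivative f (at x)) (at x)"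
  using assms by (simp add: differentiable_on_eq_differentiable_at frechet_derivative_works)

lemma smooth_on_has_derivative:
  assumes "smooth_on S f" "open S" "x \<in> S"
  shows "(f has_derivative frechet_derivative f (at x)) (at x)"
  using assms Ck_on_has_derivative smooth_on_def by blast

lemma smooth_on_differentiable:
  "smooth_on S f \<Longrightarrow> open S \<Longrightarrow> x \<in> S \<Longrightarrow> f differentiable (at x)"
  using smooth_on_has_derivative differentiable_def by blast

lemma smooth_on_derivative: "smooth_on S f \<Longrightarrow> smooth_on S (\<lambda>x. frechet_derivative f (at x) v)"
  unfolding smooth_on_def by (metis Ck_on.simps(2))

lemma smooth_on_continuous: "smooth_on S f \<Longrightarrow> continuous_on S f"
  unfolding smooth_on_def by (metis Ck_on.simps(1))

lemma Ck_on_const: "Ck_on r S (\<lambda>x. c)"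
  by (induction r arbitrary: c) (auto)

lemma Ck_on_add:
  assumes "open S" "Ck_on r S f" "Ck_on r S g"
  shows "Ck_on r S (\<lambda>x. f x + g x)"
  using assms(2,3)
proof (induction r arbitrary: f g)
  case 0 then show ?case by (auto intro: continuous_on_add)
next
  case (Suc r)
  show ?case
    by (rule Ck_on_SucI[OF assms(1) has_derivative_add[OF Ck_on_has_derivative[OF Suc.prems(1) assms(1)]
          Ck_on_has_derivative[OF Suc.prems(2) assms(1)]]])
       (use Suc in auto)
qed

lemma Ck_on_bounded_linear:
  assumes "open S" "bounded_linear L" "Ck_on r S f"
  shows "Ck_on r S (\<lambda>x. L (f x))"
  using assms(3)
proof (induction r arbitrary: f)
  case 0 then show ?case by (auto intro: bounded_linear.continuous_on[OF assms(2)])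
next
  case (Suc r)
  show ?case
    by (rule Ck_on_SucI[OF assms(1) bounded_linear.has_derivative[OF assms(2)
          Ck_on_has_derivative[OF Suc.prems(1) assms(1)]]])
       (use Suc in auto)
qed

text \<open>Covers multiplication, scaling and inner products at once. The derivative is a sum of
  two terms of the same bilinear shape, so the induction hypothesis applies to each.\<close>

lemma Ck_on_bounded_bilinear:
  assumes "open S" "bounded_bilinear h" "Ck_on r S f" "Ck_on r S g"
  shows "Ck_on r S (\<lambda>x. h (f x) (g x))"
  using assms(3,4)
proof (induction r arbitrary: f g)
  case 0 then show ?case by (auto intro: bounded_bilinear.continuous_on[OF assms(2)])
next
  case (Suc r)
  show ?case
    by (rule Ck_on_SucI[OF assms(1) bounded_bilinear.FDERIV[OF assms(2)
          Ck_on_has_derivative[OF Suc.prems(1) assms(1)] Ck_on_has_derivative[OF Suc.prems(2) assms(1)]]])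
       (assumption | intro Ck_on_add[OF assms(1)] Suc.IH; use Suc.prems Ck_on_Suc_imp[OF Suc.prems(1)]
         Ck_on_Suc_imp[OF Suc.prems(2)] in simp)+
qed

lemma Ck_on_id: "open S \<Longrightarrow> Ck_on r S (\<lambda>x. x)"
proof (induction r)
  case (Suc r)
  show ?case by (rule Ck_on_SucI[OF Suc.prems, where f' = "\<lambda>x v. v"]) (auto intro: Ck_on_const)
qed auto

lemma Ck_on_sum:
  assumes "open S" "\<And>i. i \<in> I \<Longrightarrow> Ck_on r S (f i)"
  shows "Ck_on r S (\<lambda>x. \<Sum>i\<in>I. f i x)"
  using assms(2) by (induction I rule: infinite_finite_induct) (auto intro: Ck_on_const Ck_on_add[OF assms(1)])

text \<open>\<open>Ck_on\<close> differentiates in fixed directions only, while the chain rule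
  differentiates \<open>g\<close> in the moving direction
  \<open>frechet_derivative f (at x) v\<close>. Expanding that direction in \<open>Basis\<close>
  leaves fixed directions with scalar coefficients of class \<open>r\<close>.\<close>

lemma Ck_on_compose:
  fixes f :: "'a::euclidean_space \<Rightarrow> 'b::euclidean_space" and g :: "'b \<Rightarrow> 'c::real_normed_vector"
  assumes "open S" "open T" "f ` S \<subseteq> T" "Ck_on r S f" "Ck_on r T g"
  shows "Ck_on r S (\<lambda>x. g (f x))"
  using assms(4,5)
proof (induction r arbitrary: g)
  case 0 then show ?case using assms(3) by (auto intro: continuous_on_compose2)
next
  case (Suc r)
  let ?D = "\<lambda>x v. \<Sum>b\<in>Basis. (frechet_derivative f (at x) v \<bullet> b) *\<^sub>R frechet_derivative g (at (f x)) b"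
  show ?case
  proof (rule Ck_on_SucI[OF assms(1)])
    fix x assume x: "x \<in> S"
    have df: "(f has_derivative frechet_derivative f (at x)) (at x)"
      using Ck_on_has_derivative[OF Suc.prems(1) assms(1) x] .
    have dg: "(g has_derivative frechet_derivative g (at (f x))) (at (f x))"
      using Ck_on_has_derivative[OF Suc.prems(2) assms(2)] x assms(3) by blast
    have "linear (frechet_derivative g (at (f x)))"
      using dg has_derivative_linear by blast
    then have lin: "frechet_derivative g (at (f x)) w = (\<Sum>b\<in>Basis. (w \<bullet> b) *\<^sub>R frechet_derivative g (at (f x)) b)"
      for w
      using linear_sum[of "frechet_derivative g (at (f x))" "\<lambda>b. (w \<bullet> b) *\<^sub>R b" Basis]
      by (simp add: linear_scale euclidean_representation)
    show "((\<lambda>x. g (f x)) has_derivative ?D x) (at x)"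
      by (rule has_derivative_eq_rhs[OF has_derivative_compose[OF df dg]]) (rule ext, rule lin)
  next
    fix v
    have a: "Ck_on r S (\<lambda>x. frechet_derivative f (at x) v)" using Suc.prems(1) by simp
    have b: "Ck_on r S (\<lambda>x. frechet_derivative g (at (f x)) b)" for b
      using Suc.prems by (intro Suc.IH) (auto intro: Ck_on_Suc_imp)
    show "Ck_on r S (\<lambda>x. ?D x v)"
      by (intro Ck_on_sum Ck_on_bounded_bilinear[OF assms(1) bounded_bilinear_scaleR] b
           Ck_on_bounded_linear[OF assms(1) bounded_linear_inner_left] a assms(1))
  qed
qed

lemma smooth_on_const [intro]: "smooth_on S (\<lambda>x. c)"
  by (simp add: smooth_on_def Ck_on_const)

lemma smooth_on_id: "open S \<Longrightarrow> smooth_on S (\<lambda>x. x)"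
  by (simp add: smooth_on_def Ck_on_id)

lemma smooth_on_add: "open S \<Longrightarrow> smooth_on S f \<Longrightarrow> smooth_on S g \<Longrightarrow> smooth_on S (\<lambda>x. f x + g x)"
  by (simp add: smooth_on_def Ck_on_add)

lemma smooth_on_bounded_linear:
  "open S \<Longrightarrow> bounded_linear L \<Longrightarrow> smooth_on S f \<Longrightarrow> smooth_on S (\<lambda>x. L (f x))"
  by (simp add: smooth_on_def Ck_on_bounded_linear)

lemma smooth_on_bounded_bilinear:
  "open S \<Longrightarrow> bounded_bilinear h \<Longrightarrow> smooth_on S f \<Longrightarrow> smooth_on S g \<Longrightarrow> smooth_on S (\<lambda>x. h (f x) (g x))"
  by (simp add: smooth_on_def Ck_on_bounded_bilinear)

lemmas smooth_on_mult = smooth_on_bounded_bilinear[OF _ bounded_bilinear_mult]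
lemmas smooth_on_scaleR = smooth_on_bounded_bilinear[OF _ bounded_bilinear_scaleR]
lemmas smooth_on_minus = smooth_on_bounded_linear[OF _ bounded_linear_minus[OF bounded_linear_ident]]

lemma smooth_on_diff: "open S \<Longrightarrow> smooth_on S f \<Longrightarrow> smooth_on S g \<Longrightarrow> smooth_on S (\<lambda>x. f x - g x)"
  using smooth_on_add[of S f "\<lambda>x. - g x"] smooth_on_minus[of S g] by simp

lemma smooth_on_sum:
  "open S \<Longrightarrow> (\<And>i. i \<in> I \<Longrightarrow> smooth_on S (f i)) \<Longrightarrow> smooth_on S (\<lambda>x. \<Sum>i\<in>I. f i x)"
  by (simp add: smooth_on_def Ck_on_sum)

lemma smooth_on_prod:
  fixes f :: "'i \<Rightarrow> 'a::euclidean_space \<Rightarrow> real"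
  assumes "open S" "\<And>i. i \<in> I \<Longrightarrow> smooth_on S (f i)"
  shows "smooth_on S (\<lambda>x. \<Prod>i\<in>I. f i x)"
  using assms(2) by (induction I rule: infinite_finite_induct) (auto intro: smooth_on_mult[OF assms(1)])

lemma smooth_on_compose:
  fixes f :: "'a::euclidean_space \<Rightarrow> 'b::euclidean_space"
  shows "open S \<Longrightarrow> open T \<Longrightarrow> smooth_on S f \<Longrightarrow> smooth_on T g \<Longrightarrow> f ` S \<subseteq> T \<Longrightarrow>
    smooth_on S (\<lambda>x. g (f x))"
  by (simp add: smooth_on_def Ck_on_compose[of S T f])

lemma smooth_on_vec_nth: "open S \<Longrightarrow> smooth_on S f \<Longrightarrow> smooth_on S (\<lambda>x. f x $ i)"
  using smooth_on_bounded_linear[OF _ bounded_linear_vec_nth] .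

lemma smooth_on_Pair:
  fixes f :: "'a::euclidean_space \<Rightarrow> 'b::real_normed_vector" and g :: "'a \<Rightarrow> 'c::real_normed_vector"
  assumes "open S" "smooth_on S f" "smooth_on S g"
  shows "smooth_on S (\<lambda>x. (f x, g x))"
proof -
  have "bounded_linear (\<lambda>a. (a, 0))" "bounded_linear (\<lambda>a. (0, a))"
    by (auto intro: bounded_linear_Pair bounded_linear_ident bounded_linear_zero)
  from smooth_on_add[OF assms(1) smooth_on_bounded_linear[OF assms(1) this(1) assms(2)]
      smooth_on_bounded_linear[OF assms(1) this(2) assms(3)]]
  show ?thesis by simp
qed

text \<open>The derivative of the inverse is a product of the derivative of \<open>f\<close> with
  two copies of the inverse itself, so the induction on the order closes up.\<close>

lemma smooth_on_inverse:
  fixes f :: "'a::euclidean_space \<Rightarrow> real"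
  assumes "open S" "smooth_on S f" "\<And>x. x \<in> S \<Longrightarrow> f x \<noteq> 0"
  shows "smooth_on S (\<lambda>x. inverse (f x))"
proof -
  have "Ck_on r S (\<lambda>x. inverse (f x))" for r
  proof (induction r)
    case 0
    then show ?case using assms smooth_on_continuous by (auto intro!: continuous_on_inverse)
  next
    case (Suc r)
    show ?case
    proof (rule Ck_on_SucI[OF assms(1) Deriv.has_derivative_inverse[OF assms(3) smooth_on_has_derivative[OF assms(2,1)]]])
      have "Ck_on r S (\<lambda>x. - (inverse (f x) * frechet_derivative f (at x) v * inverse (f x)))" for v
        using Suc smooth_on_derivative[OF assms(2), of v] unfolding smooth_on_def
        by (intro Ck_on_bounded_linear[OF assms(1) bounded_linear_minus[OF bounded_linear_ident]]
            Ck_on_bounded_bilinear[OF assms(1) bounded_bilinear_mult]) auto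
      then show "Ck_on r S (\<lambda>x. - (inverse (f x) * frechet_derivative f (at x) v * inverse (f x)))" for v .
    qed
  qed
  then show ?thesis by (simp add: smooth_on_def)
qed

lemma smooth_on_divide:
  fixes f g :: "'a::euclidean_space \<Rightarrow> real"
  assumes "open S" "smooth_on S f" "smooth_on S g" "\<And>x. x \<in> S \<Longrightarrow> g x \<noteq> 0"
  shows "smooth_on S (\<lambda>x. f x / g x)"
  using smooth_on_mult[OF assms(1,2) smooth_on_inverse[OF assms(1,3,4)]]
  by (simp add: divide_inverse)

text \<open>The induction runs on 1 / sqrt f, whose derivative is -1/2 times its own cube times that
  of \<open>f\<close>; afterwards sqrt f is \<open>f\<close> times this function.\<close>

lemma smooth_on_sqrt:
  fixes f :: "'a::euclidean_space \<Rightarrow> real"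
  assumes "open S" "smooth_on S f" "\<And>x. x \<in> S \<Longrightarrow> f x > 0"
  shows "smooth_on S (\<lambda>x. sqrt (f x))"
proof -
  have "Ck_on r S (\<lambda>x. inverse (sqrt (f x)))" for r
  proof (induction r)
    case 0
    then show ?case using assms smooth_on_continuous
      by (auto intro!: continuous_on_inverse continuous_on_real_sqrt) (metis less_numeral_extra(3))
  next
    case (Suc r)
    let ?i = "\<lambda>x. inverse (sqrt (f x))"
    show ?case
    proof (rule Ck_on_SucI[OF assms(1)])
      fix x assume x: "x \<in> S"
      from assms(3)[OF x] have "sqrt (f x) \<noteq> 0" by simp
      show "(?i has_derivative (\<lambda>v. (-1/2) * ((?i x * (?i x * ?i x)) * frechet_derivative f (at x) v))) (at x)"
      proof -
        have "((\<lambda>z. inverse (sqrt z)) has_real_derivative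
            - (inverse (sqrt (f x)) * (inverse (sqrt (f x)) / 2) * inverse (sqrt (f x)))) (at (f x))"
          using assms(3)[OF x] DERIV_inverse'[OF DERIV_real_sqrt[of "f x"]] by simp
        then have "((\<lambda>z. inverse (sqrt z)) has_derivative
            (\<lambda>w. (-1/2) * ((?i x * (?i x * ?i x)) * w))) (at (f x))"
          unfolding has_field_derivative_def by (rule has_derivative_eq_rhs) (auto simp: fun_eq_iff)
        from has_derivative_compose[OF smooth_on_has_derivative[OF assms(2,1) x] this]
        show ?thesis .
      qed
    next
      show "Ck_on r S (\<lambda>x. (-1/2) * ((?i x * (?i x * ?i x)) * frechet_derivative f (at x) v))" for v
        using Suc smooth_on_derivative[OF assms(2), of v] unfolding smooth_on_def
        by (intro Ck_on_bounded_bilinear[OF assms(1) bounded_bilinear_mult]) (auto intro: Ck_on_const)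
    qed
  qed
  then have "smooth_on S (\<lambda>x. inverse (sqrt (f x)))" by (simp add: smooth_on_def)
  from smooth_on_mult[OF assms(1,2) this] show ?thesis
    by (rule smooth_on_cong[OF assms(1), rotated]) (use assms(3) in \<open>simp add: divide_inverse[symmetric] real_div_sqrt less_imp_le\<close>)
qed

text \<open>Near each point the sign of \<open>f\<close> is constant, so the absolute value is
  locally a constant multiple of \<open>f\<close>.\<close>

lemma smooth_on_abs:
  fixes f :: "'a::euclidean_space \<Rightarrow> real"
  assumes "open S" "smooth_on S f" "\<And>x. x \<in> S \<Longrightarrow> f x \<noteq> 0"
  shows "smooth_on S (\<lambda>x. \<bar>f x\<bar>)"
proof (rule smooth_on_local)
  fix x assume x: "x \<in> S"
  define U where "U = {y\<in>S. 0 < sgn (f x) * f y}"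
  have "continuous_on S (\<lambda>y. sgn (f x) * f y)"
    using smooth_on_continuous[OF assms(2)] by (intro continuous_intros)
  from continuous_open_preimage[OF this assms(1), of "{0<..}"] have U: "open U"
    by (simp add: U_def vimage_def Int_def open_greaterThan greaterThan_def[symmetric])
  have "x \<in> U" using x assms(3)[OF x] by (auto simp: U_def sgn_if)
  moreover have "smooth_on U (\<lambda>y. sgn (f x) * f y)"
    using smooth_on_subset[OF assms(2)] by (intro smooth_on_mult U) (auto simp: U_def)
  then have "smooth_on U (\<lambda>y. \<bar>f y\<bar>)"
    by (rule smooth_on_cong[OF U, rotated]) (auto simp: U_def sgn_if split: if_splits)
  ultimately show "\<exists>U. open U \<and> x \<in> U \<and> smooth_on U (\<lambda>y. \<bar>f y\<bar>)" using U by blast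
qed

lemma frechet_derivative_slice:
  assumes "(\<lambda>p. f p) differentiable (at (t, y))"
  shows "frechet_derivative (\<lambda>y. f (t, y)) (at y) v = frechet_derivative f (at (t, y)) (0, v)"
proof -
  have d: "((\<lambda>y. (t, y)) has_derivative (\<lambda>v. (0, v))) (at y)"
    by (auto intro!: derivative_eq_intros)
  have "((\<lambda>y. f (t, y)) has_derivative (\<lambda>v. frechet_derivative f (at (t, y)) (0, v))) (at y)"
    using assms by (intro has_derivative_compose[OF d]) (simp add: frechet_derivative_works)
  then show ?thesis by (metis frechet_derivative_at)
qed

section \<open>Symmetry of second derivatives\<close>

lemma second_difference_mean_value:
  fixes f :: "'a::euclidean_space \<Rightarrow> real"
  assumes S: "open S" "smooth_on S f" and s: "s > 0"
    and sub: "\<And>a b. a \<in> {0..s} \<Longrightarrow> b \<in> {0..s} \<Longrightarrow> x + a *\<^sub>R u + b *\<^sub>R v \<in> S"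
  shows "\<exists>a\<in>{0..s}. \<exists>b\<in>{0..s}. f (x + s *\<^sub>R u + s *\<^sub>R v) - f (x + s *\<^sub>R u) - f (x + s *\<^sub>R v) + f x
    = s * s * frechet_derivative (\<lambda>y. frechet_derivative f (at y) u) (at (x + a *\<^sub>R u + b *\<^sub>R v)) v"
proof -
  define D where "D y = frechet_derivative f (at y) u" for y
  have der: "((\<lambda>a. h (w + a *\<^sub>R z)) has_real_derivative frechet_derivative h (at (w + a *\<^sub>R z)) z) (at a)"
    if "smooth_on S h" "w + a *\<^sub>R z \<in> S" for h :: "'a \<Rightarrow> real" and w z a
  proof -
    have "((\<lambda>a. w + a *\<^sub>R z) has_derivative (\<lambda>t. t *\<^sub>R z)) (at a)"
      by (auto intro!: derivative_eq_intros)
    from has_derivative_compose[OF this smooth_on_has_derivative[OF that(1) S(1) that(2)]]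
    have "((\<lambda>a. h (w + a *\<^sub>R z)) has_derivative (\<lambda>t. frechet_derivative h (at (w + a *\<^sub>R z)) (t *\<^sub>R z))) (at a)" .
    moreover have "linear (frechet_derivative h (at (w + a *\<^sub>R z)))"
      using smooth_on_differentiable[OF that(1) S(1) that(2)] linear_frechet_derivative by blast
    ultimately show ?thesis
      by (simp add: has_field_derivative_def linear_scale mult.commute[of _ "frechet_derivative h _ z"])
  qed
  \<comment> \<open>Mean value theorem in direction \<open>u\<close> for the difference between
    \<open>f\<close> at the point shifted by \<open>v\<close> and at the unshifted one; a second
    application, in direction \<open>v\<close>, follows for \<open>D\<close>.\<close>
  have "\<exists>a. 0 < a \<and> a < s \<and> (f (x + s *\<^sub>R v + s *\<^sub>R u) - f (x + s *\<^sub>R u)) - (f (x + s *\<^sub>R v + 0 *\<^sub>R u) - f (x + 0 *\<^sub>R u))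
     = (s - 0) * (D (x + s *\<^sub>R v + a *\<^sub>R u) - D (x + a *\<^sub>R u))"
    unfolding D_def
  proof (rule MVT2[OF s])
    fix a assume "0 \<le> a" "a \<le> s"
    then show "((\<lambda>a. f (x + s *\<^sub>R v + a *\<^sub>R u) - f (x + a *\<^sub>R u)) has_real_derivative
        frechet_derivative f (at (x + s *\<^sub>R v + a *\<^sub>R u)) u - frechet_derivative f (at (x + a *\<^sub>R u)) u) (at a)"
      using sub[of a s] sub[of a 0] s by (intro DERIV_diff der S) (auto simp: add_ac)
  qed
  then obtain a where a: "0 < a" "a < s" and
    e1: "f (x + s *\<^sub>R u + s *\<^sub>R v) - f (x + s *\<^sub>R u) - f (x + s *\<^sub>R v) + f x
      = s * (D (x + s *\<^sub>R v + a *\<^sub>R u) - D (x + a *\<^sub>R u))"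
    by (auto simp: add_ac)
  have "smooth_on S D" unfolding D_def by (rule smooth_on_derivative[OF S(2)])
  then have "\<exists>b. 0 < b \<and> b < s \<and> D (x + a *\<^sub>R u + s *\<^sub>R v) - D (x + a *\<^sub>R u + 0 *\<^sub>R v)
     = (s - 0) * frechet_derivative D (at (x + a *\<^sub>R u + b *\<^sub>R v)) v"
    by (intro MVT2[OF s] der) (use sub[of a] a in auto)
  then obtain b where b: "0 < b" "b < s" and e2: "D (x + a *\<^sub>R u + s *\<^sub>R v) - D (x + a *\<^sub>R u)
     = s * frechet_derivative D (at (x + a *\<^sub>R u + b *\<^sub>R v)) v" by auto
  have "f (x + s *\<^sub>R u + s *\<^sub>R v) - f (x + s *\<^sub>R u) - f (x + s *\<^sub>R v) + f x
    = s * s * frechet_derivative D (at (x + a *\<^sub>R u + b *\<^sub>R v)) v"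
    using e1 e2 by (simp add: add_ac)
  then show ?thesis using a b unfolding D_def
    by (intro bexI[of _ a] bexI[of _ b]) auto
qed

text \<open>The second difference over a small parallelogram is symmetric in \<open>u\<close> and
  \<open>v\<close>. The two orders of the mean value theorem express it through either mixed
  derivative at nearby points, and continuity of both brings these points back to
  \<open>x\<close>.\<close>

lemma second_derivative_symmetric_real:
  fixes f :: "'a::euclidean_space \<Rightarrow> real"
  assumes S: "open S" "smooth_on S f" and x: "x \<in> S"
  shows "frechet_derivative (\<lambda>y. frechet_derivative f (at y) u) (at x) v =
         frechet_derivative (\<lambda>y. frechet_derivative f (at y) v) (at x) u"
proof -
  define B where "B u v y = frechet_derivative (\<lambda>y. frechet_derivative f (at y) u) (at y) v" for u v y
  have cont: "isCont (B u v) x" for u v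
    unfolding B_def using smooth_on_continuous[OF smooth_on_derivative[OF smooth_on_derivative[OF S(2)]]] S(1) x
    by (simp add: continuous_on_eq_continuous_at)
  obtain r where r: "r > 0" "ball x r \<subseteq> S" using S(1) x open_contains_ball by blast
  have "\<bar>B u v x - B v u x\<bar> \<le> e" if e: "e > 0" for e
  proof -
    have ev: "\<forall>\<^sub>F y in nhds x. dist (B u v y) (B u v x) < e/2" for u v
    proof -
      have "(B u v \<longlongrightarrow> B u v x) (nhds x)"
        using cont[of u v] by (simp add: isCont_def tendsto_at_iff_tendsto_nhds)
      from tendstoD[OF this, of "e/2"] e show ?thesis by simp
    qed
    have "\<forall>\<^sub>F y in nhds x. dist (B u v y) (B u v x) < e/2 \<and> dist (B v u y) (B v u x) < e/2 \<and> y \<in> ball x r"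
      using r(1) by (intro eventually_conj ev eventually_nhds_in_open) auto
    then obtain d where d: "d > 0" "\<And>y. dist y x < d \<Longrightarrow> dist (B u v y) (B u v x) < e/2 \<and>
        dist (B v u y) (B v u x) < e/2 \<and> y \<in> ball x r"
      unfolding eventually_nhds_metric by blast
    \<comment> \<open>With this size every point of the parallelogram is within d/2 of
      \<open>x\<close>; the 1 keeps the denominator positive when both vectors vanish.\<close>
    define s where "s = d / (2 * (norm u + norm v + 1))"
    have s: "s > 0" using d by (simp add: s_def add_nonneg_pos)
    have near: "dist (x + a *\<^sub>R u + b *\<^sub>R v) x < d" if "a \<in> {0..s}" "b \<in> {0..s}" for a b
    proof -
      have "norm (a *\<^sub>R u + b *\<^sub>R v) \<le> s * norm u + s * norm v"
        using that by (intro norm_triangle_le) (auto intro!: add_mono mult_right_mono)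
      also have "\<dots> = s * (norm u + norm v)" by (simp add: algebra_simps)
      also have "\<dots> \<le> s * (norm u + norm v + 1)" using s by simp
      also have "\<dots> = d / 2"
      proof -
        have "norm u + norm v + 1 \<noteq> 0" using norm_ge_zero[of u] norm_ge_zero[of v] by linarith
        then show ?thesis unfolding s_def by (simp add: divide_simps)
      qed
      also have "\<dots> < d" using d by simp
      finally show ?thesis by (simp add: dist_norm add.assoc)
    qed
    have in1: "x + a *\<^sub>R u + b *\<^sub>R v \<in> S" if "a \<in> {0..s}" "b \<in> {0..s}" for a b
      using d(2)[OF near[OF that]] r by blast
    have in2: "x + a *\<^sub>R v + b *\<^sub>R u \<in> S" if "a \<in> {0..s}" "b \<in> {0..s}" for a b
      using in1[OF that(2,1)] by (simp add: add_ac)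
    obtain a b where ab: "a \<in> {0..s}" "b \<in> {0..s}"
      "f (x + s *\<^sub>R u + s *\<^sub>R v) - f (x + s *\<^sub>R u) - f (x + s *\<^sub>R v) + f x = s * s * B u v (x + a *\<^sub>R u + b *\<^sub>R v)"
      using second_difference_mean_value[OF S s in1] unfolding B_def by blast
    obtain a' b' where ab': "a' \<in> {0..s}" "b' \<in> {0..s}"
      "f (x + s *\<^sub>R v + s *\<^sub>R u) - f (x + s *\<^sub>R v) - f (x + s *\<^sub>R u) + f x = s * s * B v u (x + a' *\<^sub>R v + b' *\<^sub>R u)"
      using second_difference_mean_value[OF S s in2] unfolding B_def by blast
    have "s * s * B u v (x + a *\<^sub>R u + b *\<^sub>R v) = s * s * B v u (x + b' *\<^sub>R u + a' *\<^sub>R v)"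
    proof -
      have e: "x + s *\<^sub>R v + s *\<^sub>R u = x + s *\<^sub>R u + s *\<^sub>R v"
        "x + a' *\<^sub>R v + b' *\<^sub>R u = x + b' *\<^sub>R u + a' *\<^sub>R v" by (simp_all add: add_ac)
      show ?thesis using ab(3) ab'(3) unfolding e by linarith
    qed
    then have "B u v (x + a *\<^sub>R u + b *\<^sub>R v) = B v u (x + b' *\<^sub>R u + a' *\<^sub>R v)" using s by simp
    then show ?thesis
      using d(2)[OF near[OF ab(1,2)], unfolded dist_real_def] d(2)[OF near[OF ab'(2,1)], unfolded dist_real_def]
      by linarith
  qed
  then have "\<bar>B u v x - B v u x\<bar> \<le> 0" using field_le_epsilon[of "\<bar>B u v x - B v u x\<bar>" 0] by simp
  then show ?thesis by (simp add: B_def)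
qed

lemma frechet_derivative_vec_nth:
  assumes "f differentiable (at x)"
  shows "frechet_derivative (\<lambda>y. f y $ i) (at x) v = frechet_derivative f (at x) v $ i"
proof -
  have "((\<lambda>y. f y $ i) has_derivative (\<lambda>v. frechet_derivative f (at x) v $ i)) (at x)"
    using assms by (intro bounded_linear.has_derivative[OF bounded_linear_vec_nth])
      (simp add: frechet_derivative_works)
  then show ?thesis by (metis frechet_derivative_at)
qed

lemma second_derivative_symmetric:
  fixes f :: "'a::euclidean_space \<Rightarrow> real^'n::finite"
  assumes S: "open S" "smooth_on S f" and x: "x \<in> S"
  shows "frechet_derivative (\<lambda>y. frechet_derivative f (at y) u) (at x) v =
         frechet_derivative (\<lambda>y. frechet_derivative f (at y) v) (at x) u"
proof -
  have "frechet_derivative (\<lambda>y. frechet_derivative f (at y) u) (at x) v $ i =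
        frechet_derivative (\<lambda>y. frechet_derivative (\<lambda>y. f y $ i) (at y) u) (at x) v" for u v i
  proof -
    have "frechet_derivative (\<lambda>y. frechet_derivative f (at y) u) (at x) v $ i =
        frechet_derivative (\<lambda>y. frechet_derivative f (at y) u $ i) (at x) v"
      by (rule frechet_derivative_vec_nth[symmetric])
         (rule smooth_on_differentiable[OF smooth_on_derivative[OF S(2)] S(1) x])
    also have "\<dots> = frechet_derivative (\<lambda>y. frechet_derivative (\<lambda>y. f y $ i) (at y) u) (at x) v"
      by (subst frechet_derivative_local[OF S(1) x])
         (auto simp: frechet_derivative_vec_nth[OF smooth_on_differentiable[OF S(2,1)]])
    finally show ?thesis .
  qed
  then show ?thesis
    using second_derivative_symmetric_real[OF S(1) smooth_on_vec_nth[OF S] x]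
    by (simp add: vec_eq_iff)
qed

section \<open>Charts, fields and brackets\<close>

text \<open>Used to replace a derivative in a varying direction by a combination of derivatives in
  the fixed coordinate directions.\<close>

lemma linear_axis_expansion:
  fixes L :: "real^'n::finite \<Rightarrow> 'b::real_vector"
  assumes "linear L" shows "L w = (\<Sum>j\<in>UNIV. w $ j *\<^sub>R L (axis j 1))"
proof -
  have "w = (\<Sum>i\<in>UNIV. w $ i *\<^sub>R axis i 1)"
    by (simp add: vec_eq_iff axis_def if_distrib sum.delta cong: if_cong)
  then have "L w = L (\<Sum>i\<in>UNIV. w $ i *\<^sub>R axis i 1)" by simp
  then show ?thesis by (simp only: linear_sum[OF assms] linear_scale[OF assms])
qed

locale smooth_manifold =
  fixes A :: "('m::{t2_space,second_countable_topology}, 'n::finite) chart set"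
  assumes atlas: "smooth_atlas A"
begin

lemma chart_open: "c \<in> A \<Longrightarrow> open (fst c)"
  and chart_image_open: "c \<in> A \<Longrightarrow> open (snd c ` fst c)"
  and chart_homeomorphism: "c \<in> A \<Longrightarrow> homeomorphism (fst c) (snd c ` fst c) (snd c) (chart_inv c)"
  and charts_cover: "\<exists>c\<in>A. p \<in> fst c"
  and transition_smooth: "c \<in> A \<Longrightarrow> c' \<in> A \<Longrightarrow>
    smooth_on (snd c ` (fst c \<inter> fst c')) (\<lambda>y. snd c' (chart_inv c y))"
  using atlas by (auto simp: smooth_atlas_def)

lemma chart_inv_left [simp]: "c \<in> A \<Longrightarrow> p \<in> fst c \<Longrightarrow> chart_inv c (snd c p) = p"
  using chart_homeomorphism by (auto simp: homeomorphism_def)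

lemma chart_at_in [simp]: "chart_at A p \<in> A" and in_chart_at [simp]: "p \<in> fst (chart_at A p)"
proof -
  have "chart_at A p \<in> A \<and> p \<in> fst (chart_at A p)"
    unfolding chart_at_def by (rule someI_ex) (use charts_cover[of p] in blast)
  then show "chart_at A p \<in> A" "p \<in> fst (chart_at A p)" by auto
qed

lemma chart_open_map: "c \<in> A \<Longrightarrow> open U \<Longrightarrow> open (snd c ` (fst c \<inter> U))"
proof -
  assume c: "c \<in> A" and "open U"
  then have "openin (top_of_set (snd c ` fst c)) (snd c ` (fst c \<inter> U))"
    by (intro homeomorphism_imp_open_map[OF chart_homeomorphism]) (auto simp: openin_open)
  then show ?thesis using chart_image_open[OF c] by (simp add: openin_open_eq)
qed

lemma chart_open_map': "c \<in> A \<Longrightarrow> open U \<Longrightarrow> U \<subseteq> fst c \<Longrightarrow> open (snd c ` U)"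
  using chart_open_map[of c U] by (simp add: inf.absorb2)

lemma continuous_on_chart: "c \<in> A \<Longrightarrow> continuous_on (fst c) (snd c)"
  and continuous_on_chart_inv: "c \<in> A \<Longrightarrow> continuous_on (snd c ` fst c) (chart_inv c)"
  using chart_homeomorphism by (auto simp: homeomorphism_def)

lemma transition_differentiable:
  assumes "c \<in> A" "c' \<in> A" "p \<in> fst c" "p \<in> fst c'"
  shows "((\<lambda>y. snd c' (chart_inv c y)) has_derivative change_coord c c' p) (at (snd c p))"
  unfolding change_coord_def using assms
  by (intro smooth_on_has_derivative[OF transition_smooth chart_open_map]) (auto intro: chart_open)

lemma linear_change_coord:
  "c \<in> A \<Longrightarrow> c' \<in> A \<Longrightarrow> p \<in> fst c \<Longrightarrow> p \<in> fst c' \<Longrightarrow> linear (change_coord c c' p)"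
  using transition_differentiable has_derivative_linear by blast

lemma change_coord_compose:
  assumes c: "c \<in> A" "c' \<in> A" "c'' \<in> A" and p: "p \<in> fst c" "p \<in> fst c'" "p \<in> fst c''"
  shows "change_coord c' c'' p (change_coord c c' p v) = change_coord c c'' p v"
proof -
  have "((\<lambda>y. snd c'' (chart_inv c' (snd c' (chart_inv c y)))) has_derivative
      (\<lambda>v. change_coord c' c'' p (change_coord c c' p v))) (at (snd c p))"
    using has_derivative_compose[OF transition_differentiable[OF c(1,2) p(1,2)],
        of "\<lambda>y. snd c'' (chart_inv c' y)"] transition_differentiable[OF c(2,3) p(2,3)] c p by simp
  moreover have "open (snd c ` (fst c \<inter> fst c'))" "snd c p \<in> snd c ` (fst c \<inter> fst c')"
    using chart_open_map[OF c(1) chart_open[OF c(2)]] p by auto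
  ultimately have "((\<lambda>y. snd c'' (chart_inv c y)) has_derivative
      (\<lambda>v. change_coord c' c'' p (change_coord c c' p v))) (at (snd c p))"
    by (rule has_derivative_transform_within_open) (use c in auto)
  then show ?thesis
    using transition_differentiable[OF c(1,3) p(1,3)] has_derivative_unique by (metis (no_types, lifting))
qed

lemma change_coord_same [simp]:
  assumes "c \<in> A" "p \<in> fst c" shows "change_coord c c p v = v"
proof -
  have "((\<lambda>y. snd c (chart_inv c y)) has_derivative (\<lambda>v. v)) (at (snd c p))"
    by (rule has_derivative_transform_within_open[of "\<lambda>y. y" _ _ UNIV "snd c ` fst c", OF _ chart_image_open])
       (use assms in auto)
  then show ?thesis using transition_differentiable[OF assms(1,1,2,2)] has_derivative_unique
    by (metis (no_types, lifting))
qed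

lemma linear_components: "c \<in> A \<Longrightarrow> p \<in> fst c \<Longrightarrow> linear (components A c p)"
  unfolding components_def by (intro linear_change_coord) auto

lemma components_chart_at [simp]: "components A (chart_at A p) p v = v"
  by (simp add: components_def)

lemma components_change:
  "c \<in> A \<Longrightarrow> c' \<in> A \<Longrightarrow> p \<in> fst c \<Longrightarrow> p \<in> fst c' \<Longrightarrow>
    components A c' p v = change_coord c c' p (components A c p v)"
  unfolding components_def by (simp add: change_coord_compose)

lemma components_coord_field [simp]:
  "c \<in> A \<Longrightarrow> p \<in> fst c \<Longrightarrow> components A c p (coord_field A c i p) = axis i 1"
  unfolding components_def coord_field_def by (simp add: change_coord_compose)

lemma coord_expansion:
  assumes "c \<in> A" "p \<in> fst c"
  shows "v = (\<Sum>i\<in>UNIV. components A c p v $ i *\<^sub>R coord_field A c i p)"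
proof -
  have "v = change_coord c (chart_at A p) p (components A c p v)"
    using assms by (simp add: components_def change_coord_compose)
  also have "\<dots> = (\<Sum>i\<in>UNIV. components A c p v $ i *\<^sub>R coord_field A c i p)"
    unfolding coord_field_def using assms by (intro linear_axis_expansion linear_change_coord) auto
  finally show ?thesis .
qed

lemma field_rep_at [simp]: "c \<in> A \<Longrightarrow> p \<in> fst c \<Longrightarrow> field_rep A c X (snd c p) = components A c p (X p)"
  by (simp add: field_rep_def)

lemma field_rep_chart_at [simp]: "field_rep A (chart_at A p) X (snd (chart_at A p) p) = X p"
  by simp

text \<open>The transformation law of vector components, with the Jacobian taken column by column so
  that each factor is a smooth function of \<open>y\<close>.\<close>

lemma field_rep_change:
  assumes "c \<in> A" "c' \<in> A" "y \<in> snd c ` (fst c \<inter> fst c')"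
  shows "field_rep A c X y = (\<Sum>j\<in>UNIV. field_rep A c' X (snd c' (chart_inv c y)) $ j *\<^sub>R
     frechet_derivative (\<lambda>z. snd c (chart_inv c' z)) (at (snd c' (chart_inv c y))) (axis j 1))"
proof -
  from assms obtain p where p: "p \<in> fst c" "p \<in> fst c'" "y = snd c p" by auto
  show ?thesis
    using assms p linear_axis_expansion[OF linear_change_coord[of c' c p], of "components A c' p (X p)"] by (simp add: components_change[of c' c] change_coord_def)
qed

text \<open>One chart around each point suffices: in any other chart the representative is composed
  with a smooth change of coordinates.\<close>

lemma smooth_funI:
  assumes "\<And>p. p \<in> U \<Longrightarrow> \<exists>c\<in>A. \<exists>N. open N \<and> p \<in> N \<and> N \<subseteq> fst c \<and> smooth_on (snd c ` N) (\<lambda>y. f (chart_inv c y))"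
  shows "smooth_fun A U f"
  unfolding smooth_fun_def
proof (intro ballI smooth_on_local)
  fix c y assume c: "c \<in> A" and "y \<in> snd c ` (fst c \<inter> U)"
  then obtain p where p: "p \<in> fst c" "p \<in> U" "y = snd c p" by auto
  from assms[OF p(2)] obtain c' N where N: "c' \<in> A" "open N" "p \<in> N" "N \<subseteq> fst c'"
    "smooth_on (snd c' ` N) (\<lambda>y. f (chart_inv c' y))" by blast
  let ?W = "snd c ` (fst c \<inter> N)"
  have W: "open ?W" using chart_open_map[OF c N(2)] .
  have "smooth_on ?W (\<lambda>y. f (chart_inv c' (snd c' (chart_inv c y))))"
  proof (rule smooth_on_compose[OF W _ _ N(5)])
    show "open (snd c' ` N)" using chart_open_map'[OF N(1,2,4)] .
    show "smooth_on ?W (\<lambda>y. snd c' (chart_inv c y))"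
      by (rule smooth_on_subset[OF transition_smooth[OF c N(1)]]) (use N in auto)
    show "(\<lambda>y. snd c' (chart_inv c y)) ` ?W \<subseteq> snd c' ` N" using c by auto
  qed
  then have "smooth_on ?W (\<lambda>y. f (chart_inv c y))"
    by (rule smooth_on_cong[OF W, rotated]) (use c N in auto)
  then show "\<exists>W. open W \<and> y \<in> W \<and> smooth_on W (\<lambda>y. f (chart_inv c y))"
    using W p N by blast
qed

text \<open>As for functions, except that the components are also multiplied by the Jacobian of the
  change of coordinates, which is itself smooth.\<close>

lemma smooth_fieldI:
  assumes "\<And>p. p \<in> U \<Longrightarrow> \<exists>c\<in>A. \<exists>N. open N \<and> p \<in> N \<and> N \<subseteq> fst c \<and> smooth_on (snd c ` N) (field_rep A c X)"
  shows "smooth_field A U X"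
  unfolding smooth_field_def
proof (intro ballI smooth_on_local)
  fix c y assume c: "c \<in> A" and "y \<in> snd c ` (fst c \<inter> U)"
  then obtain p where p: "p \<in> fst c" "p \<in> U" "y = snd c p" by auto
  from assms[OF p(2)] obtain c' N where N: "c' \<in> A" "open N" "p \<in> N" "N \<subseteq> fst c'"
    "smooth_on (snd c' ` N) (field_rep A c' X)" by blast
  let ?W = "snd c ` (fst c \<inter> N)"
  have W: "open ?W" using chart_open_map[OF c N(2)] .
  have tr: "smooth_on ?W (\<lambda>y. snd c' (chart_inv c y))"
    by (rule smooth_on_subset[OF transition_smooth[OF c N(1)]]) (use N in auto)
  have sub: "(\<lambda>y. snd c' (chart_inv c y)) ` ?W \<subseteq> snd c' ` (fst c' \<inter> (fst c \<inter> N))" using c N(4) by auto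
  have op: "open (snd c' ` (fst c' \<inter> (fst c \<inter> N)))"
    using chart_open_map[OF N(1) open_Int[OF chart_open[OF c] N(2)]] .
  have "smooth_on ?W (\<lambda>y. \<Sum>j\<in>UNIV. field_rep A c' X (snd c' (chart_inv c y)) $ j *\<^sub>R
     frechet_derivative (\<lambda>z. snd c (chart_inv c' z)) (at (snd c' (chart_inv c y))) (axis j 1))"
    by (intro smooth_on_sum smooth_on_scaleR W smooth_on_vec_nth
        smooth_on_compose[OF W op tr smooth_on_subset[OF N(5)] sub]
        smooth_on_compose[OF W op tr smooth_on_derivative[OF smooth_on_subset[OF transition_smooth[OF N(1) c]]] sub])
       auto
  then have "smooth_on ?W (field_rep A c X)"
    by (rule smooth_on_cong[OF W, rotated]) (rule field_rep_change[OF c N(1), symmetric], use N(4) in auto)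
  then show "\<exists>W. open W \<and> y \<in> W \<and> smooth_on W (field_rep A c X)"
    using W p N by blast
qed

lemma smooth_fun_chart:
  "smooth_fun A U f \<Longrightarrow> c \<in> A \<Longrightarrow> N \<subseteq> U \<Longrightarrow> N \<subseteq> fst c \<Longrightarrow> smooth_on (snd c ` N) (\<lambda>y. f (chart_inv c y))"
  unfolding smooth_fun_def by (rule smooth_on_subset, blast) auto

lemma smooth_field_chart:
  "smooth_field A U X \<Longrightarrow> c \<in> A \<Longrightarrow> N \<subseteq> U \<Longrightarrow> N \<subseteq> fst c \<Longrightarrow> smooth_on (snd c ` N) (field_rep A c X)"
  unfolding smooth_field_def by (rule smooth_on_subset, blast) auto

lemma smooth_fun_chartI:
  "c \<in> A \<Longrightarrow> open N \<Longrightarrow> N \<subseteq> fst c \<Longrightarrow> smooth_on (snd c ` N) (\<lambda>y. f (chart_inv c y)) \<Longrightarrow> smooth_fun A N f"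
  by (rule smooth_funI) blast

lemma smooth_field_chartI:
  "c \<in> A \<Longrightarrow> open N \<Longrightarrow> N \<subseteq> fst c \<Longrightarrow> smooth_on (snd c ` N) (field_rep A c X) \<Longrightarrow> smooth_field A N X"
  by (rule smooth_fieldI) blast

lemma smooth_fun_subset: "smooth_fun A U f \<Longrightarrow> V \<subseteq> U \<Longrightarrow> smooth_fun A V f"
  unfolding smooth_fun_def by (blast intro: smooth_on_subset)

lemma smooth_field_subset: "smooth_field A U X \<Longrightarrow> V \<subseteq> U \<Longrightarrow> smooth_field A V X"
  unfolding smooth_field_def by (blast intro: smooth_on_subset)

lemma ex_chart_nbhd:
  assumes "open U" "p \<in> U"
  shows "\<exists>c\<in>A. \<exists>N. open N \<and> p \<in> N \<and> N \<subseteq> fst c \<and> N \<subseteq> U"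
  using assms charts_cover[of p] chart_open by (metis Int_iff Int_lower1 Int_lower2 open_Int)

lemma smooth_fun_local:
  assumes "\<And>p. p \<in> U \<Longrightarrow> \<exists>N. open N \<and> p \<in> N \<and> smooth_fun A N f"
  shows "smooth_fun A U f"
proof (rule smooth_funI)
  fix p assume "p \<in> U"
  with assms obtain N where N: "open N" "p \<in> N" "smooth_fun A N f" by blast
  from ex_chart_nbhd[OF N(1,2)] obtain c N' where "c \<in> A" "open N'" "p \<in> N'" "N' \<subseteq> fst c" "N' \<subseteq> N" by blast
  then show "\<exists>c\<in>A. \<exists>N. open N \<and> p \<in> N \<and> N \<subseteq> fst c \<and> smooth_on (snd c ` N) (\<lambda>y. f (chart_inv c y))"
    using smooth_fun_chart[OF N(3)] by blast
qed

lemma smooth_field_local: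
  assumes "\<And>p. p \<in> U \<Longrightarrow> \<exists>N. open N \<and> p \<in> N \<and> smooth_field A N X"
  shows "smooth_field A U X"
proof (rule smooth_fieldI)
  fix p assume "p \<in> U"
  with assms obtain N where N: "open N" "p \<in> N" "smooth_field A N X" by blast
  from ex_chart_nbhd[OF N(1,2)] obtain c N' where "c \<in> A" "open N'" "p \<in> N'" "N' \<subseteq> fst c" "N' \<subseteq> N" by blast
  then show "\<exists>c\<in>A. \<exists>N. open N \<and> p \<in> N \<and> N \<subseteq> fst c \<and> smooth_on (snd c ` N) (field_rep A c X)"
    using smooth_field_chart[OF N(3)] by blast
qed

lemma smooth_fun_cong:
  assumes "open U" "\<And>q. q \<in> U \<Longrightarrow> f q = g q" "smooth_fun A U f"
  shows "smooth_fun A U g"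
  unfolding smooth_fun_def
proof
  fix c assume c: "c \<in> A"
  show "smooth_on (snd c ` (fst c \<inter> U)) (\<lambda>y. g (chart_inv c y))"
    by (rule smooth_on_cong[OF chart_open_map[OF c assms(1)], of "\<lambda>y. f (chart_inv c y)"])
       (use c assms in \<open>auto simp: smooth_fun_def\<close>)
qed

lemma smooth_field_cong:
  assumes "open U" "\<And>q. q \<in> U \<Longrightarrow> X q = Y q" "smooth_field A U X"
  shows "smooth_field A U Y"
  unfolding smooth_field_def
proof
  fix c assume c: "c \<in> A"
  show "smooth_on (snd c ` (fst c \<inter> U)) (field_rep A c Y)"
    by (rule smooth_on_cong[OF chart_open_map[OF c assms(1)], of "field_rep A c X"])
       (use c assms in \<open>auto simp: smooth_field_def\<close>)
qed

context
  fixes U :: "'m set"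
  assumes U: "open U"
begin

lemma smooth_fun_const: "smooth_fun A U (\<lambda>q. a)"
  by (auto simp: smooth_fun_def)

lemma smooth_fun_add: "smooth_fun A U f \<Longrightarrow> smooth_fun A U h \<Longrightarrow> smooth_fun A U (\<lambda>q. f q + h q)"
  by (auto simp: smooth_fun_def intro!: smooth_on_add chart_open_map U)

lemma smooth_fun_diff: "smooth_fun A U f \<Longrightarrow> smooth_fun A U h \<Longrightarrow> smooth_fun A U (\<lambda>q. f q - h q)"
  by (auto simp: smooth_fun_def intro!: smooth_on_diff chart_open_map U)

lemma smooth_fun_mult: "smooth_fun A U f \<Longrightarrow> smooth_fun A U h \<Longrightarrow> smooth_fun A U (\<lambda>q. f q * h q)"
  by (auto simp: smooth_fun_def intro!: smooth_on_mult chart_open_map U)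

lemma smooth_fun_sum: "(\<And>i. i \<in> I \<Longrightarrow> smooth_fun A U (f i)) \<Longrightarrow> smooth_fun A U (\<lambda>q. \<Sum>i\<in>I. f i q)"
  by (auto simp: smooth_fun_def intro!: smooth_on_sum chart_open_map U)

text \<open>The factor that normalises a vector of square \<open>f\<close>, possibly negative, to
  square plus or minus one.\<close>

lemma smooth_fun_inverse_sqrt_abs:
  assumes "smooth_fun A U f" "\<And>q. q \<in> U \<Longrightarrow> f q \<noteq> 0"
  shows "smooth_fun A U (\<lambda>q. inverse (sqrt \<bar>f q\<bar>))"
  unfolding smooth_fun_def
proof
  fix c assume c: "c \<in> A"
  have nz: "f (chart_inv c y) \<noteq> 0" if "y \<in> snd c ` (fst c \<inter> U)" for y using that assms(2) c by auto
  show "smooth_on (snd c ` (fst c \<inter> U)) (\<lambda>y. inverse (sqrt \<bar>f (chart_inv c y)\<bar>))"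
    by (rule smooth_on_inverse smooth_on_sqrt smooth_on_abs chart_open_map c U)+
       (use assms c nz in \<open>auto simp: smooth_fun_def\<close>)
qed

lemma smooth_field_zero: "smooth_field A U (\<lambda>q. 0)"
proof (rule smooth_field_cong[OF U])
  show "smooth_field A U (\<lambda>q. 0)"
    unfolding smooth_field_def
  proof
    fix c assume c: "c \<in> A"
    show "smooth_on (snd c ` (fst c \<inter> U)) (field_rep A c (\<lambda>q. 0))"
      by (rule smooth_on_cong[OF chart_open_map[OF c U], of "\<lambda>_. 0"])
         (use c in \<open>auto simp: linear_0[OF linear_components[OF c]]\<close>)
  qed
qed simp

lemma smooth_field_add:
  assumes "smooth_field A U X" "smooth_field A U Y" shows "smooth_field A U (\<lambda>q. X q + Y q)"
  unfolding smooth_field_def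
proof
  fix c assume c: "c \<in> A"
  show "smooth_on (snd c ` (fst c \<inter> U)) (field_rep A c (\<lambda>q. X q + Y q))"
    by (rule smooth_on_cong[OF chart_open_map[OF c U], of "\<lambda>y. field_rep A c X y + field_rep A c Y y"])
       (use c assms in
         \<open>auto simp: linear_add[OF linear_components[OF c]] smooth_field_def intro!: smooth_on_add chart_open_map U\<close>)
qed

lemma smooth_field_scaleR:
  assumes "smooth_fun A U f" "smooth_field A U Y" shows "smooth_field A U (\<lambda>q. f q *\<^sub>R Y q)"
  unfolding smooth_field_def
proof
  fix c assume c: "c \<in> A"
  show "smooth_on (snd c ` (fst c \<inter> U)) (field_rep A c (\<lambda>q. f q *\<^sub>R Y q))"
    by (rule smooth_on_cong[OF chart_open_map[OF c U], of "\<lambda>y. f (chart_inv c y) *\<^sub>R field_rep A c Y y"])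
       (use c assms in
         \<open>auto simp: linear_scale[OF linear_components[OF c]] smooth_field_def smooth_fun_def intro!: smooth_on_scaleR chart_open_map U\<close>)
qed

lemma smooth_field_scale_const: "smooth_field A U Y \<Longrightarrow> smooth_field A U (\<lambda>q. a *\<^sub>R Y q)"
  using smooth_field_scaleR smooth_fun_const by blast

lemma smooth_field_diff:
  "smooth_field A U X \<Longrightarrow> smooth_field A U Y \<Longrightarrow> smooth_field A U (\<lambda>q. X q - Y q)"
  using smooth_field_add[of X "\<lambda>q. (-1) *\<^sub>R Y q"] smooth_field_scale_const[of Y "-1"] by simp

lemma smooth_field_sum:
  "(\<And>i. i \<in> I \<Longrightarrow> smooth_field A U (X i)) \<Longrightarrow> smooth_field A U (\<lambda>q. \<Sum>i\<in>I. X i q)"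
  by (induction I rule: infinite_finite_induct) (auto intro: smooth_field_zero smooth_field_add)

end

lemma smooth_coord_field: "c \<in> A \<Longrightarrow> smooth_field A (fst c) (coord_field A c i)"
  by (rule smooth_field_chartI[of c], assumption, erule chart_open, simp)
     (rule smooth_on_cong[OF chart_image_open, of c "\<lambda>_. axis i 1"], auto)

lemma smooth_fun_continuous:
  assumes "open U" "smooth_fun A U f" shows "continuous_on U f"
proof (intro continuous_at_imp_continuous_on ballI)
  fix p assume "p \<in> U"
  from ex_chart_nbhd[OF assms(1) this] obtain c N where N: "c \<in> A" "open N" "p \<in> N" "N \<subseteq> fst c" "N \<subseteq> U" by blast
  have "continuous_on (snd c ` N) (\<lambda>y. f (chart_inv c y))"
    using smooth_on_continuous[OF smooth_fun_chart[OF assms(2) N(1,5,4)]] .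
  moreover have "continuous_on N (snd c)"
    using continuous_on_chart[OF N(1)] N(4) continuous_on_subset by blast
  ultimately have "continuous_on N (\<lambda>q. f (chart_inv c (snd c q)))"
    using continuous_on_compose2[of "snd c ` N"] by blast
  then have "continuous_on N f"
    by (rule continuous_on_eq) (use N in auto)
  then show "isCont f p" using N continuous_on_eq_continuous_at by blast
qed

subsection \<open>Directional derivatives and Lie brackets\<close>

lemma smooth_fun_rep_derivative:
  assumes "c \<in> A" "open U" "p \<in> U" "p \<in> fst c" "smooth_fun A U f"
  shows "((\<lambda>y. f (chart_inv c y)) has_derivative frechet_derivative (\<lambda>y. f (chart_inv c y)) (at (snd c p))) (at (snd c p))"
  using assms by (intro smooth_on_has_derivative[OF _ chart_open_map[OF assms(1,2)]]) (auto simp: smooth_fun_def)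

lemma smooth_field_rep_derivative:
  assumes "c \<in> A" "open U" "p \<in> U" "p \<in> fst c" "smooth_field A U X"
  shows "(field_rep A c X has_derivative frechet_derivative (field_rep A c X) (at (snd c p))) (at (snd c p))"
  using assms by (intro smooth_on_has_derivative[OF _ chart_open_map[OF assms(1,2)]]) (auto simp: smooth_field_def)

text \<open>\<open>dir_deriv\<close> is computed in the preferred chart of \<open>p\<close>, which
  jumps with the point. The chain rule moves the computation into one chart \<open>c\<close>, where
  the dependence on the point can be studied.\<close>

lemma dir_deriv_chart:
  assumes "c \<in> A" "open U" "p \<in> U" "p \<in> fst c" "smooth_fun A U f"
  shows "dir_deriv A p v f = frechet_derivative (\<lambda>y. f (chart_inv c y)) (at (snd c p)) (components A c p v)"
proof -
  let ?c = "chart_at A p"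
  let ?D = "frechet_derivative (\<lambda>y. f (chart_inv c y)) (at (snd c p))"
  have "((\<lambda>y. f (chart_inv c (snd c (chart_inv ?c y)))) has_derivative (\<lambda>v. ?D (change_coord ?c c p v))) (at (snd ?c p))"
    using has_derivative_compose[OF transition_differentiable[of ?c c p], of "\<lambda>y. f (chart_inv c y)" ?D]
      smooth_fun_rep_derivative[OF assms] assms by simp
  then have "((\<lambda>y. f (chart_inv ?c y)) has_derivative (\<lambda>v. ?D (change_coord ?c c p v))) (at (snd ?c p))"
    by (rule has_derivative_transform_within_open[OF _ chart_open_map[OF chart_at_in chart_open[OF assms(1)]]])
       (use assms in auto)
  then show ?thesis
    unfolding dir_deriv_def Let_def components_def by (metis frechet_derivative_at)
qed

lemma dir_deriv_local:
  assumes "open U" "p \<in> U" "\<And>q. q \<in> U \<Longrightarrow> f q = h q"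
  shows "dir_deriv A p v f = dir_deriv A p v h"
proof -
  have "frechet_derivative (\<lambda>y. f (chart_inv (chart_at A p) y)) (at (snd (chart_at A p) p)) =
    frechet_derivative (\<lambda>y. h (chart_inv (chart_at A p) y)) (at (snd (chart_at A p) p))"
    by (rule frechet_derivative_local[OF chart_open_map[OF chart_at_in assms(1)]]) (use assms in auto)
  then show ?thesis by (simp add: dir_deriv_def)
qed

lemma dir_deriv_const [simp]: "dir_deriv A p v (\<lambda>q. a) = 0"
  by (simp add: dir_deriv_def)

lemma smooth_dir_deriv:
  assumes "open U" "smooth_fun A U f" "smooth_field A U X"
  shows "smooth_fun A U (\<lambda>q. dir_deriv A q (X q) f)"
proof (rule smooth_funI)
  fix p assume "p \<in> U"
  from ex_chart_nbhd[OF assms(1) this] obtain c N where N: "c \<in> A" "open N" "p \<in> N" "N \<subseteq> fst c" "N \<subseteq> U" by blast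
  let ?f = "\<lambda>y. f (chart_inv c y)"
  have op: "open (snd c ` N)" using chart_open_map'[OF N(1,2,4)] .
  have f: "smooth_on (snd c ` N) ?f" using smooth_fun_chart[OF assms(2) N(1,5,4)] .
  have X: "smooth_on (snd c ` N) (field_rep A c X)" using smooth_field_chart[OF assms(3) N(1,5,4)] .
  have "smooth_on (snd c ` N) (\<lambda>y. \<Sum>j\<in>UNIV. field_rep A c X y $ j * frechet_derivative ?f (at y) (axis j 1))"
    by (intro smooth_on_sum smooth_on_mult smooth_on_vec_nth op X smooth_on_derivative f)
  then have "smooth_on (snd c ` N) (\<lambda>y. dir_deriv A (chart_inv c y) (X (chart_inv c y)) f)"
  proof (rule smooth_on_cong[OF op, rotated])
    fix y assume "y \<in> snd c ` N"
    then obtain q where q: "q \<in> N" "y = snd c q" by auto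
    then have q': "q \<in> fst c" "q \<in> U" using N by auto
    have "frechet_derivative ?f (at (snd c q)) w = (\<Sum>j\<in>UNIV. w $ j * frechet_derivative ?f (at (snd c q)) (axis j 1))"
        if w: "w = components A c q (X q)" for w
      using linear_axis_expansion[OF has_derivative_linear[OF smooth_fun_rep_derivative[OF N(1) assms(1) q'(2,1) assms(2)]], of w]
      by simp
    then show "(\<Sum>j\<in>UNIV. field_rep A c X y $ j * frechet_derivative ?f (at y) (axis j 1)) =
        dir_deriv A (chart_inv c y) (X (chart_inv c y)) f"
      using q q' N(1) by (simp add: dir_deriv_chart[OF N(1) assms(1) q'(2,1) assms(2)])
  qed
  then show "\<exists>c\<in>A. \<exists>N. open N \<and> p \<in> N \<and> N \<subseteq> fst c \<and>
      smooth_on (snd c ` N) (\<lambda>y. dir_deriv A (chart_inv c y) (X (chart_inv c y)) f)"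
    using N by blast
qed

text \<open>Invariance of the bracket: the second derivatives of the change of coordinates cancel by symmetry.\<close>

lemma lie_bracket_chart:
  assumes c: "c \<in> A" and U: "open U" "p \<in> U" and p: "p \<in> fst c"
    and X: "smooth_field A U X" and Y: "smooth_field A U Y"
  shows "components A c p (lie_bracket A X Y p) =
      frechet_derivative (field_rep A c Y) (at (snd c p)) (components A c p (X p))
    - frechet_derivative (field_rep A c X) (at (snd c p)) (components A c p (Y p))"
proof -
  define c0 where "c0 = chart_at A p"
  have c0: "c0 \<in> A" "p \<in> fst c0" by (auto simp: c0_def)
  define \<sigma> where "\<sigma> = (\<lambda>z. snd c (chart_inv c0 z))"
  define x where "x = snd c0 p"
  define W where "W = snd c0 ` (fst c0 \<inter> (fst c \<inter> U))"
  have W: "open W" "x \<in> W" unfolding W_def x_def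
    using chart_open_map[OF c0(1) open_Int[OF chart_open[OF c] U(1)]] c0 p U by auto
  have \<sigma>: "smooth_on W \<sigma>"
    unfolding \<sigma>_def by (rule smooth_on_subset[OF transition_smooth[OF c0(1) c]]) (auto simp: W_def)
  have \<sigma>x: "\<sigma> x = snd c p" using c0 by (simp add: \<sigma>_def x_def)
  define D2 where "D2 u v = frechet_derivative (\<lambda>z. frechet_derivative \<sigma> (at z) u) (at x) v" for u v
  have D2sym: "D2 u v = D2 v u" for u v
    unfolding D2_def using second_derivative_symmetric[OF W(1) \<sigma> W(2)] .
  have D\<sigma>: "change_coord c0 c p = frechet_derivative \<sigma> (at x)"
    by (simp add: change_coord_def \<sigma>_def x_def)
  have lin: "linear (frechet_derivative \<sigma> (at z))" if "z \<in> W" for z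
    using smooth_on_differentiable[OF \<sigma> W(1) that] linear_frechet_derivative by blast
  have D2lin: "D2 w v = (\<Sum>j\<in>UNIV. w $ j *\<^sub>R D2 (axis j 1) v)" for w v
    unfolding D2sym[of _ v]
    by (rule linear_axis_expansion) (auto simp: D2_def intro!: linear_frechet_derivative
        smooth_on_differentiable[OF smooth_on_derivative[OF \<sigma>] W])
  \<comment> \<open>Product rule for the Jacobian applied to \<open>field_rep A c0 Y\<close>. The
    term \<open>D2 (Y p) w\<close> is the failure of the derivative to be tensorial; for
    \<open>w = X p\<close> it is symmetric in the two fields and drops out of the bracket.\<close>
  have main: "frechet_derivative (field_rep A c Y) (at (snd c p)) (frechet_derivative \<sigma> (at x) w) =
      D2 (Y p) w + frechet_derivative \<sigma> (at x) (frechet_derivative (field_rep A c0 Y) (at x) w)"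
    if Y: "smooth_field A U Y" for Y w
  proof -
    let ?Y0 = "field_rep A c0 Y"
    let ?D = "frechet_derivative \<sigma>"
    have Y0: "(?Y0 has_derivative frechet_derivative ?Y0 (at x)) (at x)"
      using smooth_field_rep_derivative[OF c0(1) U c0(2) Y] by (simp add: x_def)
    have "((\<lambda>z. field_rep A c Y (\<sigma> z)) has_derivative
        (\<lambda>w. frechet_derivative (field_rep A c Y) (at (snd c p)) (?D (at x) w))) (at x)"
      by (rule has_derivative_compose[OF smooth_on_has_derivative[OF \<sigma> W]])
         (use smooth_field_rep_derivative[OF c U p Y] \<sigma>x in simp)
    then have 1: "((\<lambda>z. \<Sum>j\<in>UNIV. ?Y0 z $ j *\<^sub>R ?D (at z) (axis j 1)) has_derivative
        (\<lambda>w. frechet_derivative (field_rep A c Y) (at (snd c p)) (?D (at x) w))) (at x)"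
    proof (rule has_derivative_transform_within_open[OF _ W])
      fix z assume z: "z \<in> W"
      then obtain q where q: "q \<in> fst c0" "q \<in> fst c" "z = snd c0 q" unfolding W_def by auto
      have "field_rep A c Y (\<sigma> z) = ?D (at z) (?Y0 z)"
        using q c c0 by (simp add: \<sigma>_def components_change[of c0 c] change_coord_def)
      then show "field_rep A c Y (\<sigma> z) = (\<Sum>j\<in>UNIV. ?Y0 z $ j *\<^sub>R ?D (at z) (axis j 1))"
        using linear_axis_expansion[OF lin[OF z], of "?Y0 z"] by simp
    qed
    have "((\<lambda>z. \<Sum>j\<in>UNIV. ?Y0 z $ j *\<^sub>R ?D (at z) (axis j 1)) has_derivative
      (\<lambda>w. \<Sum>j\<in>UNIV. ?Y0 x $ j *\<^sub>R D2 (axis j 1) w + frechet_derivative ?Y0 (at x) w $ j *\<^sub>R ?D (at x) (axis j 1))) (at x)"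
      unfolding D2_def
      by (intro has_derivative_sum has_derivative_scaleR bounded_linear.has_derivative[OF bounded_linear_vec_nth] Y0
          smooth_on_has_derivative[OF smooth_on_derivative[OF \<sigma>] W])
    from has_derivative_unique[OF 1 this]
    have "frechet_derivative (field_rep A c Y) (at (snd c p)) (?D (at x) w) =
      (\<Sum>j\<in>UNIV. ?Y0 x $ j *\<^sub>R D2 (axis j 1) w + frechet_derivative ?Y0 (at x) w $ j *\<^sub>R ?D (at x) (axis j 1))"
      by (rule fun_cong)
    also have "\<dots> = D2 (?Y0 x) w + ?D (at x) (frechet_derivative ?Y0 (at x) w)"
      using D2lin[of "?Y0 x" w] linear_axis_expansion[OF lin[OF W(2)], of "frechet_derivative ?Y0 (at x) w"]
      by (simp add: sum.distrib)
    also have "?Y0 x = Y p" unfolding x_def c0_def by simp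
    finally show ?thesis .
  qed
  have comp: "components A c p v = frechet_derivative \<sigma> (at x) v" for v
    by (simp add: components_def c0_def[symmetric] D\<sigma>)
  have "lie_bracket A X Y p = frechet_derivative (field_rep A c0 Y) (at x) (X p)
    - frechet_derivative (field_rep A c0 X) (at x) (Y p)"
    by (simp add: lie_bracket_def Let_def c0_def x_def)
  then have "components A c p (lie_bracket A X Y p) =
      frechet_derivative \<sigma> (at x) (frechet_derivative (field_rep A c0 Y) (at x) (X p))
    - frechet_derivative \<sigma> (at x) (frechet_derivative (field_rep A c0 X) (at x) (Y p))"
    unfolding comp by (simp add: linear_diff[OF lin[OF W(2)]])
  then show ?thesis
    unfolding comp main[OF X] main[OF Y] using D2sym by simp
qed

lemma smooth_lie_bracket:
  assumes "open U" "smooth_field A U X" "smooth_field A U Y"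
  shows "smooth_field A U (lie_bracket A X Y)"
proof (rule smooth_fieldI)
  fix p assume "p \<in> U"
  from ex_chart_nbhd[OF assms(1) this] obtain c N where N: "c \<in> A" "open N" "p \<in> N" "N \<subseteq> fst c" "N \<subseteq> U" by blast
  have op: "open (snd c ` N)" using chart_open_map'[OF N(1,2,4)] .
  have sm: "smooth_on (snd c ` N) (field_rep A c Z)" if "smooth_field A U Z" for Z
    using smooth_field_chart[OF that N(1,5,4)] .
  define E where "E Z Z' y = (\<Sum>j\<in>UNIV. field_rep A c Z y $ j *\<^sub>R frechet_derivative (field_rep A c Z') (at y) (axis j 1))" for Z Z' y
  have E: "smooth_on (snd c ` N) (E Z Z')" if "smooth_field A U Z" "smooth_field A U Z'" for Z Z'
    unfolding E_def[abs_def] by (intro smooth_on_sum smooth_on_scaleR smooth_on_vec_nth op sm smooth_on_derivative that)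
  have "smooth_on (snd c ` N) (\<lambda>y. E X Y y - E Y X y)"
    by (intro smooth_on_diff op E assms)
  then have "smooth_on (snd c ` N) (field_rep A c (lie_bracket A X Y))"
  proof (rule smooth_on_cong[OF op, rotated])
    fix y assume "y \<in> snd c ` N"
    then obtain q where q: "q \<in> N" "y = snd c q" by auto
    then have q': "q \<in> fst c" "q \<in> U" using N by auto
    have "E Z Z' y = frechet_derivative (field_rep A c Z') (at y) (components A c q (Z q))" if "smooth_field A U Z'" for Z Z'
    proof -
      have "linear (frechet_derivative (field_rep A c Z') (at y))"
        using has_derivative_linear[OF smooth_field_rep_derivative[OF N(1) assms(1) q'(2,1) that]] q by simp
      from linear_axis_expansion[OF this, of "components A c q (Z q)"] show ?thesis unfolding E_def using q q' N(1) by simp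
    qed
    then show "E X Y y - E Y X y = field_rep A c (lie_bracket A X Y) y"
      using lie_bracket_chart[OF N(1) assms(1) q'(2,1) assms(2,3)] q q' N(1) assms by simp
  qed
  then show "\<exists>c\<in>A. \<exists>N. open N \<and> p \<in> N \<and> N \<subseteq> fst c \<and> smooth_on (snd c ` N) (field_rep A c (lie_bracket A X Y))"
    using N by blast
qed

end

section \<open>The Levi-Civita connection\<close>

text \<open>Riesz representation for an indefinite form: the map sending \<open>w\<close> to its
  pairings with the axes is injective by nondegeneracy, hence onto for reasons of dimension.\<close>

lemma nondegenerate_representation:
  fixes B :: "real^'n::finite \<Rightarrow> real^'n \<Rightarrow> real"
  assumes B: "bilinear B" and nondeg: "\<And>u. (\<forall>v. B u v = 0) \<Longrightarrow> u = 0" and \<phi>: "linear \<phi>"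
  shows "\<exists>!w. \<forall>z. B w z = \<phi> z"
proof (rule ex_ex1I)
  interpret L: linear "B u" for u using B by (simp add: bilinear_def)
  interpret R: linear "\<lambda>u. B u v" for v using B by (simp add: bilinear_def)
  define F where "F w = (\<chi> i. B w (axis i 1))" for w
  have lin: "linear F" unfolding F_def by (rule linearI) (auto simp: vec_eq_iff R.add R.scaleR)
  have ext: "B w z = \<phi>' z" if "linear \<phi>'" "\<And>i. B w (axis i 1) = \<phi>' (axis i 1)" for w z \<phi>'
    using linear_axis_expansion[OF L.linear_axioms, of w z] linear_axis_expansion[OF that(1), of z] that(2) by simp
  have "inj F"
  proof (subst linear_injective_0[OF lin], intro allI impI)
    fix w assume "F w = 0"
    then have "B w (axis i 1) = 0" for i by (simp add: F_def vec_eq_iff)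
    then have "B w z = 0" for z using ext[of "\<lambda>z. 0"] by (simp add: module_hom_zero)
    then show "w = 0" using nondeg by blast
  qed
  then have "surj F" using linear_injective_imp_surjective[OF lin] by blast
  then obtain w where "F w = (\<chi> i. \<phi> (axis i 1))" by (metis surjD)
  then have "B w (axis i 1) = \<phi> (axis i 1)" for i by (simp add: F_def vec_eq_iff)
  then show "\<exists>w. \<forall>z. B w z = \<phi> z" using ext[OF \<phi>] by blast
  fix w w' assume "\<forall>z. B w z = \<phi> z" "\<forall>z. B w' z = \<phi> z"
  then have "\<forall>z. B (w - w') z = 0" by (simp add: R.diff)
  then show "w = w'" using nondeg[of "w - w'"] by simp
qed

lemma
  fixes M :: "real^'n::finite^'n"
  assumes "det M \<noteq> 0"
  shows matrix_inv_right: "M ** matrix_inv M = mat 1" and matrix_inv_left: "matrix_inv M ** M = mat 1"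
proof -
  have "\<exists>M'. M ** M' = mat 1 \<and> M' ** M = mat 1"
    using assms by (simp add: invertible_det_nz[symmetric] invertible_def)
  from someI_ex[OF this] show "M ** matrix_inv M = mat 1" "matrix_inv M ** M = mat 1"
    by (auto simp: matrix_inv_def)
qed

text \<open>Cramer's rule makes the entries quotients of polynomials in the entries of
  \<open>M\<close>; this is how smoothness passes to inverse matrices.\<close>

lemma matrix_inv_entry:
  fixes M :: "real^'n::finite^'n"
  assumes "det M \<noteq> 0"
  shows "matrix_inv M $ i $ j = det (\<chi> r s. if s = i then axis j 1 $ r else M $ r $ s) / det M"
proof -
  have "M ** matrix_inv M = mat 1" using assms by (rule matrix_inv_right)
  then have "M *v (matrix_inv M *v axis j 1) = axis j 1" by (simp add: matrix_vector_mul_assoc)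
  then have "matrix_inv M *v axis j 1 = (\<chi> k. det (\<chi> r s. if s = k then axis j 1 $ r else M $ r $ s) / det M)"
    using cramer[OF assms] by blast
  then show ?thesis by (simp add: vec_eq_iff matrix_vector_mult_basis column_def)
qed

lemma smooth_on_det:
  fixes a :: "'n::finite \<Rightarrow> 'n \<Rightarrow> 'a::euclidean_space \<Rightarrow> real"
  assumes "open S" "\<And>i j. smooth_on S (a i j)"
  shows "smooth_on S (\<lambda>z. det (\<chi> i j. a i j z))"
  unfolding det_def
  by (intro smooth_on_sum smooth_on_mult smooth_on_prod assms smooth_on_const) (simp add: assms(2))

lemma smooth_on_matrix_inv:
  fixes a :: "'n::finite \<Rightarrow> 'n \<Rightarrow> 'a::euclidean_space \<Rightarrow> real"
  assumes "open S" "\<And>i j. smooth_on S (a i j)" "\<And>z. z \<in> S \<Longrightarrow> det (\<chi> i j. a i j z) \<noteq> 0"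
  shows "smooth_on S (\<lambda>z. matrix_inv (\<chi> i j. a i j z) $ i $ j)"
proof (rule smooth_on_cong[OF assms(1)])
  have "smooth_on S (\<lambda>z. if s = i then axis j 1 $ r else a r s z)" for r s
    using assms(2) by (cases "s = i") auto
  then show "smooth_on S (\<lambda>z. det (\<chi> r s. if s = i then axis j 1 $ r else a r s z) / det (\<chi> i j. a i j z))"
    by (intro smooth_on_divide smooth_on_det assms) auto
qed (simp add: matrix_inv_entry assms(3) cong: if_cong)

context smooth_manifold
begin

lemma smooth_field_coordI:
  assumes "c \<in> A" "open N" "N \<subseteq> fst c" "\<And>i. smooth_fun A N (f i)"
    and "\<And>q. q \<in> N \<Longrightarrow> X q = (\<Sum>i\<in>UNIV. f i q *\<^sub>R coord_field A c i q)"
  shows "smooth_field A N X"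
  by (rule smooth_field_cong[OF assms(2), of "\<lambda>q. \<Sum>i\<in>UNIV. f i q *\<^sub>R coord_field A c i q"])
     (auto simp: assms(5) intro!: smooth_field_sum smooth_field_scaleR assms smooth_field_subset[OF smooth_coord_field])

end

locale pseudo_riemannian_manifold = smooth_manifold A
  for A :: "('m::{t2_space,second_countable_topology}, 'n::finite) chart set" +
  fixes g :: "('m, 'n) metric"
  assumes metric: "pseudo_riemannian A g"
begin

lemma bilinear_g: "bilinear (g p)" and g_sym: "g p u v = g p v u"
  and g_nondeg: "(\<And>v. g p u v = 0) \<Longrightarrow> u = 0"
  and smooth_g: "open U \<Longrightarrow> smooth_field A U X \<Longrightarrow> smooth_field A U Y \<Longrightarrow> smooth_fun A U (\<lambda>p. g p (X p) (Y p))"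
  using metric unfolding pseudo_riemannian_def by blast+

lemma linear_g_right: "linear (g p u)" and linear_g_left: "linear (\<lambda>u. g p u v)"
  using bilinear_g by (simp_all add: bilinear_def)

lemmas g_linear = linear_add[OF linear_g_right] linear_diff[OF linear_g_right] linear_scale[OF linear_g_right]
  linear_0[OF linear_g_right] linear_neg[OF linear_g_right]
  linear_add[OF linear_g_left] linear_diff[OF linear_g_left] linear_scale[OF linear_g_left]
  linear_0[OF linear_g_left] linear_neg[OF linear_g_left]

lemma g_eqI: "(\<And>z. g p u z = g p v z) \<Longrightarrow> u = v"
  using g_nondeg[of p "u - v"] by (simp add: g_linear)

lemma g_sum_left: "g p (sum f I) v = (\<Sum>i\<in>I. g p (f i) v)"
  by (rule linear_sum[OF linear_g_left])

lemma g_sum_right: "g p v (sum f I) = (\<Sum>i\<in>I. g p v (f i))"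
  by (rule linear_sum[OF linear_g_right])

definition gram :: "('m, 'n) chart \<Rightarrow> 'm \<Rightarrow> real^'n^'n" where
  "gram c q = (\<chi> i j. g q (coord_field A c i q) (coord_field A c j q))"

lemma g_coord:
  assumes "c \<in> A" "q \<in> fst c"
  shows "g q u v = (\<Sum>i\<in>UNIV. \<Sum>j\<in>UNIV. components A c q u $ i * (components A c q v $ j * gram c q $ i $ j))"
  by (subst coord_expansion[OF assms, of u], subst coord_expansion[OF assms, of v])
     (unfold g_sum_left, unfold g_sum_right, simp add: g_linear gram_def mult.left_commute)

lemma gram_mult:
  assumes "c \<in> A" "q \<in> fst c"
  shows "gram c q *v components A c q v = (\<chi> i. g q (coord_field A c i q) v)"
  by (subst (2) coord_expansion[OF assms, of v])
     (simp add: g_sum_right g_linear gram_def matrix_vector_mult_def mult.commute)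

text \<open>A kernel vector of the Gram matrix gives the components of a vector orthogonal to all
  coordinate fields, and nondegeneracy makes that vector zero.\<close>

lemma det_gram:
  assumes "c \<in> A" "q \<in> fst c"
  shows "det (gram c q) \<noteq> 0"
proof -
  have "x = 0" if "gram c q *v x = 0" for x
  proof -
    define v where "v = (\<Sum>i\<in>UNIV. x $ i *\<^sub>R coord_field A c i q)"
    have x: "components A c q v = x"
      unfolding v_def using assms linear_components[OF assms]
      by (simp add: linear_sum linear_scale vec_eq_iff axis_def if_distrib sum.delta cong: if_cong)
    have "g q v w = 0" for w
      using gram_mult[OF assms, of v] that x
      by (subst coord_expansion[OF assms, of w]) (simp add: g_sum_right g_linear vec_eq_iff g_sym[of q v])
    then have "v = 0" using g_nondeg by blast
    then show "x = 0" using x linear_0[OF linear_components[OF assms]] by simp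
  qed
  then show ?thesis
    using invertible_det_nz[of "gram c q"] invertible_left_inverse matrix_left_invertible_ker by blast
qed

lemma gram_inv_mult:
  assumes "c \<in> A" "q \<in> fst c"
  shows "components A c q v $ i = (\<Sum>j\<in>UNIV. matrix_inv (gram c q) $ i $ j * g q (coord_field A c j q) v)"
proof -
  have "matrix_inv (gram c q) ** gram c q = mat 1"
    using matrix_inv_left[OF det_gram[OF assms]] .
  then have "matrix_inv (gram c q) *v (gram c q *v components A c q v) = components A c q v"
    by (simp add: matrix_vector_mul_assoc)
  then show ?thesis
    unfolding gram_mult[OF assms] by (simp add: vec_eq_iff matrix_vector_mult_def)
qed

lemma smooth_gram:
  assumes "c \<in> A" shows "smooth_on (snd c ` fst c) (\<lambda>y. gram c (chart_inv c y) $ i $ j)"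
  using smooth_fun_chart[OF smooth_g[OF chart_open[OF assms] smooth_coord_field[OF assms] smooth_coord_field[OF assms]] assms order_refl order_refl]
  by (simp add: gram_def)

lemma smooth_gram_inv:
  assumes "c \<in> A" shows "smooth_fun A (fst c) (\<lambda>q. matrix_inv (gram c q) $ i $ j)"
proof (rule smooth_fun_chartI[OF assms chart_open[OF assms] order_refl])
  have "smooth_on (snd c ` fst c) (\<lambda>y. matrix_inv (\<chi> i j. gram c (chart_inv c y) $ i $ j) $ i $ j)"
    by (rule smooth_on_matrix_inv[OF chart_image_open[OF assms] smooth_gram[OF assms]])
       (use det_gram[OF assms] assms in \<open>auto simp: vec_nth_inverse\<close>)
  then show "smooth_on (snd c ` fst c) (\<lambda>y. matrix_inv (gram c (chart_inv c y)) $ i $ j)" by simp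
qed

text \<open>The inverse Gram matrix recovers components from the pairings with coordinate fields.
  This suits fields known only through a formula for their pairings, as the covariant derivative is
  through Koszul's formula.\<close>

lemma smooth_fieldI_g:
  assumes U: "open U"
    and "\<And>N Z. open N \<Longrightarrow> N \<subseteq> U \<Longrightarrow> smooth_field A N Z \<Longrightarrow> smooth_fun A N (\<lambda>q. g q (W q) (Z q))"
  shows "smooth_field A U W"
proof (rule smooth_field_local)
  fix p assume "p \<in> U"
  from ex_chart_nbhd[OF U this] obtain c N where N: "c \<in> A" "open N" "p \<in> N" "N \<subseteq> fst c" "N \<subseteq> U" by blast
  have "smooth_field A N W"
  proof (rule smooth_field_coordI[OF N(1,2,4)])
    show "smooth_fun A N (\<lambda>q. \<Sum>j\<in>UNIV. matrix_inv (gram c q) $ i $ j * g q (W q) (coord_field A c j q))" for i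
      by (intro smooth_fun_sum[OF N(2)] smooth_fun_mult[OF N(2)] smooth_fun_subset[OF smooth_gram_inv[OF N(1)] N(4)]
          assms(2)[OF N(2,5)] smooth_field_subset[OF smooth_coord_field[OF N(1)] N(4)])
    show "W q = (\<Sum>i\<in>UNIV. (\<Sum>j\<in>UNIV. matrix_inv (gram c q) $ i $ j * g q (W q) (coord_field A c j q)) *\<^sub>R coord_field A c i q)"
      if "q \<in> N" for q
      using coord_expansion[of c q "W q"] gram_inv_mult[of c q "W q"] that N by (simp add: g_sym[of q "W q"] subset_iff)
  qed
  then show "\<exists>N. open N \<and> p \<in> N \<and> smooth_field A N W" using N by blast
qed

text \<open>The derivative in direction \<open>w\<close> of the coefficients of \<open>g\<close>,
  with \<open>u\<close> and \<open>v\<close> held constant in the preferred chart of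
  \<open>p\<close>; it is not a tensor.\<close>

definition metric_deriv :: "'m \<Rightarrow> real^'n \<Rightarrow> real^'n \<Rightarrow> real^'n \<Rightarrow> real" where
  "metric_deriv p w u v = (let c = chart_at A p in \<Sum>i\<in>UNIV. \<Sum>j\<in>UNIV.
     frechet_derivative (\<lambda>y. gram c (chart_inv c y) $ i $ j) (at (snd c p)) w * (u $ i * v $ j))"

text \<open>The Christoffel symbols, with the upper index obtained from the pairing instead of from
  an inverse matrix.\<close>

definition christoffel :: "'m \<Rightarrow> real^'n \<Rightarrow> real^'n \<Rightarrow> real^'n" where
  "christoffel p v u = (THE w. \<forall>z. g p w z = (metric_deriv p v u z + metric_deriv p u z v - metric_deriv p z v u) / 2)"

text \<open>Each point uses its own preferred chart. The torsion and metric identities are pointwise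
  and can be checked in this form; smoothness in the point needs another argument.\<close>

definition chart_connection :: "('m, 'n) connection" where
  "chart_connection p v Y = (let c = chart_at A p in
     frechet_derivative (field_rep A c Y) (at (snd c p)) v + christoffel p v (Y p))"

lemma gram_sym: "gram c q $ i $ j = gram c q $ j $ i"
  by (simp add: gram_def g_sym)

lemma metric_deriv_sym: "metric_deriv p w u v = metric_deriv p w v u"
  unfolding metric_deriv_def Let_def
  by (subst sum.swap) (simp add: gram_sym mult.commute)

lemma linear_metric_deriv1: "linear (\<lambda>w. metric_deriv p w u v)"
proof -
  have "linear (frechet_derivative (\<lambda>y. gram (chart_at A p) (chart_inv (chart_at A p) y) $ i $ j) (at (snd (chart_at A p) p)))" for i j
    by (intro linear_frechet_derivative smooth_on_differentiable[OF smooth_gram chart_image_open]) auto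
  then show ?thesis
    unfolding metric_deriv_def Let_def
    by (intro linearI) (simp_all add: linear_add linear_scale algebra_simps sum.distrib sum_distrib_left)
qed

lemma linear_metric_deriv2: "linear (\<lambda>u. metric_deriv p w u v)"
  unfolding metric_deriv_def Let_def
  by (intro linearI) (simp_all add: algebra_simps sum.distrib sum_distrib_left)

lemma linear_metric_deriv3: "linear (\<lambda>v. metric_deriv p w u v)"
  using linear_metric_deriv2[of p w u] by (simp add: metric_deriv_sym[of p w u])

lemmas metric_deriv_linear = linear_add[OF linear_metric_deriv1] linear_add[OF linear_metric_deriv2]
  linear_add[OF linear_metric_deriv3] linear_scale[OF linear_metric_deriv1] linear_scale[OF linear_metric_deriv2]
  linear_scale[OF linear_metric_deriv3]

lemma g_christoffel:
  "g p (christoffel p v u) z = (metric_deriv p v u z + metric_deriv p u z v - metric_deriv p z v u) / 2"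
proof -
  have "linear (\<lambda>z. (metric_deriv p v u z + metric_deriv p u z v - metric_deriv p z v u) / 2)"
    by (intro linearI) (simp_all add: metric_deriv_linear algebra_simps add_divide_distrib diff_divide_distrib)
  from theI'[OF nondegenerate_representation[OF bilinear_g _ this, of p]]
  show ?thesis unfolding christoffel_def using g_nondeg by blast
qed

lemma christoffel_sym: "christoffel p u v = christoffel p v u"
proof (rule g_eqI[of p])
  show "g p (christoffel p u v) z = g p (christoffel p v u) z" for z
    using metric_deriv_sym[of p z u v] metric_deriv_sym[of p u v z] metric_deriv_sym[of p v z u]
    unfolding g_christoffel by (smt (verit))
qed

lemma linear_christoffel: "linear (\<lambda>v. christoffel p v u)"
  by (intro linearI; rule g_eqI[of p])
     (simp_all add: g_christoffel g_linear metric_deriv_linear algebra_simps add_divide_distrib diff_divide_distrib)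

lemma dir_deriv_g:
  assumes U: "open U" "p \<in> U" and Y: "smooth_field A U Y" and Z: "smooth_field A U Z"
  defines "c \<equiv> chart_at A p"
  shows "dir_deriv A p v (\<lambda>q. g q (Y q) (Z q)) = metric_deriv p v (Y p) (Z p)
    + g p (frechet_derivative (field_rep A c Y) (at (snd c p)) v) (Z p)
    + g p (Y p) (frechet_derivative (field_rep A c Z) (at (snd c p)) v)"
proof -
  have c: "c \<in> A" "p \<in> fst c" by (auto simp: c_def)
  let ?x = "snd c p"
  let ?Y = "field_rep A c Y" and ?Z = "field_rep A c Z" and ?G = "\<lambda>i j y. gram c (chart_inv c y) $ i $ j"
  let ?DY = "frechet_derivative ?Y (at ?x)" and ?DZ = "frechet_derivative ?Z (at ?x)"
  let ?DG = "\<lambda>i j. frechet_derivative (?G i j) (at ?x)"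
  have DY: "(?Y has_derivative ?DY) (at ?x)" and DZ: "(?Z has_derivative ?DZ) (at ?x)"
    using smooth_field_rep_derivative[OF c(1) U c(2)] Y Z by auto
  have DG: "(?G i j has_derivative ?DG i j) (at ?x)" for i j
    using c by (intro smooth_on_has_derivative[OF smooth_gram chart_image_open]) auto
  have "((\<lambda>y. \<Sum>i\<in>UNIV. \<Sum>j\<in>UNIV. ?Y y $ i * (?Z y $ j * ?G i j y)) has_derivative
     (\<lambda>v. \<Sum>i\<in>UNIV. \<Sum>j\<in>UNIV. ?Y ?x $ i * (?Z ?x $ j * ?DG i j v + ?DZ v $ j * ?G i j ?x)
        + ?DY v $ i * (?Z ?x $ j * ?G i j ?x))) (at ?x)"
    by (intro has_derivative_sum has_derivative_mult bounded_linear.has_derivative[OF bounded_linear_vec_nth] DY DZ DG)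
  then have "((\<lambda>y. g (chart_inv c y) (Y (chart_inv c y)) (Z (chart_inv c y))) has_derivative
     (\<lambda>v. \<Sum>i\<in>UNIV. \<Sum>j\<in>UNIV. ?Y ?x $ i * (?Z ?x $ j * ?DG i j v + ?DZ v $ j * ?G i j ?x)
        + ?DY v $ i * (?Z ?x $ j * ?G i j ?x))) (at ?x)"
    by (rule has_derivative_transform_within_open[OF _ chart_image_open[OF c(1)]])
       (use c in \<open>auto simp: g_coord[OF c(1)]\<close>)
  from fun_cong[OF frechet_derivative_at[OF this], of v]
  have "dir_deriv A p v (\<lambda>q. g q (Y q) (Z q)) = (\<Sum>i\<in>UNIV. \<Sum>j\<in>UNIV. ?Y ?x $ i * (?Z ?x $ j * ?DG i j v + ?DZ v $ j * ?G i j ?x)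
        + ?DY v $ i * (?Z ?x $ j * ?G i j ?x))"
    unfolding dir_deriv_def Let_def c_def[symmetric] by (rule sym)
  moreover have "?Y ?x = Y p" "?Z ?x = Z p" by (simp_all add: c_def)
  moreover have cw: "components A c p w = w" for w by (simp add: c_def)
  have "metric_deriv p v (Y p) (Z p) + g p (?DY v) (Z p) + g p (Y p) (?DZ v)
    = (\<Sum>i\<in>UNIV. \<Sum>j\<in>UNIV. Y p $ i * (Z p $ j * ?DG i j v + ?DZ v $ j * ?G i j ?x) + ?DY v $ i * (Z p $ j * ?G i j ?x))"
    unfolding metric_deriv_def Let_def c_def[symmetric] g_coord[OF c] cw chart_inv_left[OF c] sum.distrib[symmetric]
    by (intro sum.cong refl) (simp add: algebra_simps)
  ultimately show ?thesis by (simp only:)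
qed

lemma chart_connection_torsion:
  assumes "open U" "p \<in> U" "smooth_field A U X" "smooth_field A U Y"
  shows "chart_connection p (X p) Y - chart_connection p (Y p) X = lie_bracket A X Y p"
  using christoffel_sym[of p "X p" "Y p"]
  by (simp only: chart_connection_def lie_bracket_def Let_def field_rep_chart_at) simp

lemma chart_connection_metric:
  assumes "open U" "p \<in> U" "smooth_field A U Y" "smooth_field A U Z"
  shows "dir_deriv A p v (\<lambda>q. g q (Y q) (Z q)) = g p (chart_connection p v Y) (Z p) + g p (Y p) (chart_connection p v Z)"
proof -
  have "g p (christoffel p v (Y p)) (Z p) + g p (Y p) (christoffel p v (Z p)) = metric_deriv p v (Y p) (Z p)"
  proof -
    have half: "(a + b - c) / 2 + (a + c - b) / 2 = a" for a b c :: real by (simp add: field_simps)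
    show ?thesis
      unfolding g_sym[of p "Y p" "christoffel p v (Z p)"] g_christoffel metric_deriv_sym[of p v "Z p" "Y p"]
        metric_deriv_sym[of p "Y p" "Z p" v] metric_deriv_sym[of p "Z p" "Y p" v] by (rule half)
  qed
  then show ?thesis
    by (simp add: dir_deriv_g[OF assms] chart_connection_def Let_def g_linear)
qed

text \<open>The defining formula changes chart from point to point and cannot show smoothness. The
  torsion and metric identities imply Koszul's formula, whose right-hand side consists of
  directional derivatives and brackets of smooth data.\<close>

lemma chart_connection_smooth:
  assumes U: "open U" and X: "smooth_field A U X" and Y: "smooth_field A U Y"
  shows "smooth_field A U (\<lambda>p. chart_connection p (X p) Y)"
proof (rule smooth_fieldI_g[OF U])
  fix N Z assume N: "open N" "N \<subseteq> U" and Z: "smooth_field A N Z"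
  have X: "smooth_field A N X" and Y: "smooth_field A N Y"
    using X Y N smooth_field_subset by blast+
  define K where "K X Y Z q = dir_deriv A q (X q) (\<lambda>q. g q (Y q) (Z q))" for X Y Z q
  have K: "smooth_fun A N (K X Y Z)" if "smooth_field A N X" "smooth_field A N Y" "smooth_field A N Z" for X Y Z
    unfolding K_def[abs_def] by (intro smooth_dir_deriv smooth_g that N)
  have "smooth_fun A N (\<lambda>q. (1/2) * (K X Y Z q + K Y Z X q - K Z X Y q + g q (lie_bracket A X Y q) (Z q)
     - g q (lie_bracket A X Z q) (Y q) - g q (lie_bracket A Y Z q) (X q)))"
    by (intro smooth_fun_add smooth_fun_diff smooth_fun_mult smooth_fun_const K smooth_g smooth_lie_bracket N X Y Z)
  then show "smooth_fun A N (\<lambda>q. g q (chart_connection q (X q) Y) (Z q))"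
  proof (rule smooth_fun_cong[OF N(1), rotated])
    fix q assume q: "q \<in> N"
    note T = chart_connection_torsion[OF N(1) q] and M = chart_connection_metric[OF N(1) q]
    show "(1/2) * (K X Y Z q + K Y Z X q - K Z X Y q + g q (lie_bracket A X Y q) (Z q)
     - g q (lie_bracket A X Z q) (Y q) - g q (lie_bracket A Y Z q) (X q)) = g q (chart_connection q (X q) Y) (Z q)"
      unfolding K_def M[OF Y Z] M[OF Z X] M[OF X Y] T[OF X Y, symmetric] T[OF X Z, symmetric] T[OF Y Z, symmetric]
      using g_sym[of q "X q"] g_sym[of q "Y q"] g_sym[of q "Z q"]
      by (simp only: g_linear) argo
  qed
qed

lemma chart_connection_levi_civita: "is_levi_civita A g chart_connection"
proof -
  let ?c = "\<lambda>p. chart_at A p"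
  have lin: "linear (\<lambda>v. chart_connection p v Y)" if "open U" "p \<in> U" "smooth_field A U Y" for U p Y
    unfolding chart_connection_def Let_def
  proof -
    have "linear (frechet_derivative (field_rep A (?c p) Y) (at (snd (?c p) p)))"
      using smooth_field_rep_derivative[OF chart_at_in that(1,2) in_chart_at that(3)] by (rule has_derivative_linear)
    from linear_add[OF this] linear_scale[OF this]
      linear_add[OF linear_christoffel[of p "Y p"]] linear_scale[OF linear_christoffel[of p "Y p"]]
    show "linear (\<lambda>v. frechet_derivative (field_rep A (?c p) Y) (at (snd (?c p) p)) v + christoffel p v (Y p))"
      by (intro linearI) (simp_all add: scaleR_add_right)
  qed
  have add: "chart_connection p v (\<lambda>q. Y q + Z q) = chart_connection p v Y + chart_connection p v Z"
    if "open U" "p \<in> U" "smooth_field A U Y" "smooth_field A U Z" for U p v Y Z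
  proof -
    note D = smooth_field_rep_derivative[OF chart_at_in that(1,2) in_chart_at]

    have "(field_rep A (?c p) (\<lambda>q. Y q + Z q) has_derivative (\<lambda>v. frechet_derivative (field_rep A (?c p) Y) (at (snd (?c p) p)) v
        + frechet_derivative (field_rep A (?c p) Z) (at (snd (?c p) p)) v)) (at (snd (?c p) p))"
      by (rule has_derivative_transform_within_open[OF has_derivative_add[OF D[OF that(3)] D[OF that(4)]] chart_image_open[OF chart_at_in[of p]]])
         (auto simp: linear_add[OF linear_components[OF chart_at_in]])
    from fun_cong[OF frechet_derivative_at[OF this], of v]
    have "frechet_derivative (field_rep A (?c p) (\<lambda>q. Y q + Z q)) (at (snd (?c p) p)) v
      = frechet_derivative (field_rep A (?c p) Y) (at (snd (?c p) p)) v + frechet_derivative (field_rep A (?c p) Z) (at (snd (?c p) p)) v"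
      by (rule sym)
    then show ?thesis
      using linear_add[OF linear_christoffel[of p v]] by (simp add: chart_connection_def Let_def christoffel_sym[of p v])
  qed
  have scale: "chart_connection p v (\<lambda>q. f q *\<^sub>R Y q) = dir_deriv A p v f *\<^sub>R Y p + f p *\<^sub>R chart_connection p v Y"
    if "open U" "p \<in> U" "smooth_fun A U f" "smooth_field A U Y" for U p v f Y
  proof -
    let ?x = "snd (?c p) p"
    note D = smooth_field_rep_derivative[OF chart_at_in that(1,2) in_chart_at that(4)]
    note Df = smooth_fun_rep_derivative[OF chart_at_in that(1,2) in_chart_at that(3)]
    have "(field_rep A (?c p) (\<lambda>q. f q *\<^sub>R Y q) has_derivative
       (\<lambda>v. f (chart_inv (?c p) ?x) *\<^sub>R frechet_derivative (field_rep A (?c p) Y) (at ?x) v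
         + frechet_derivative (\<lambda>y. f (chart_inv (?c p) y)) (at ?x) v *\<^sub>R field_rep A (?c p) Y ?x)) (at ?x)"
      by (rule has_derivative_transform_within_open[OF has_derivative_scaleR[OF Df D] chart_image_open[OF chart_at_in[of p]]])
         (auto simp: linear_scale[OF linear_components[OF chart_at_in]])
    then have "frechet_derivative (field_rep A (?c p) (\<lambda>q. f q *\<^sub>R Y q)) (at ?x) v
      = f p *\<^sub>R frechet_derivative (field_rep A (?c p) Y) (at ?x) v + dir_deriv A p v f *\<^sub>R Y p"
      unfolding dir_deriv_def Let_def by (subst frechet_derivative_at[symmetric], assumption) simp
    then show ?thesis
      using linear_scale[OF linear_christoffel[of p v]]
      by (simp add: chart_connection_def Let_def christoffel_sym[of p v] algebra_simps)
  qed
  show ?thesis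
    unfolding is_levi_civita_def affine_connection_def
    by (intro conjI allI impI ballI; (elim conjE)?)
       (rule lin add scale chart_connection_smooth chart_connection_torsion chart_connection_metric; assumption)+
qed

abbreviation nabla ("\<nabla>") where "\<nabla> \<equiv> levi_civita A g"

lemma levi_civita: "is_levi_civita A g \<nabla>"
  unfolding levi_civita_def using chart_connection_levi_civita by (rule someI[of "is_levi_civita A g"])

context
  fixes U :: "'m set" and p :: 'm
  assumes U: "open U" "p \<in> U"
begin

lemma linear_nabla: "smooth_field A U Y \<Longrightarrow> linear (\<lambda>v. \<nabla> p v Y)"
  and nabla_add: "smooth_field A U Y \<Longrightarrow> smooth_field A U Z \<Longrightarrow> \<nabla> p v (\<lambda>q. Y q + Z q) = \<nabla> p v Y + \<nabla> p v Z"
  and nabla_scaleR: "smooth_fun A U f \<Longrightarrow> smooth_field A U Y \<Longrightarrow>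
    \<nabla> p v (\<lambda>q. f q *\<^sub>R Y q) = dir_deriv A p v f *\<^sub>R Y p + f p *\<^sub>R \<nabla> p v Y"
  and nabla_torsion: "smooth_field A U X \<Longrightarrow> smooth_field A U Y \<Longrightarrow> lie_bracket A X Y p = \<nabla> p (X p) Y - \<nabla> p (Y p) X"
  and nabla_metric: "smooth_field A U Y \<Longrightarrow> smooth_field A U Z \<Longrightarrow>
    dir_deriv A p v (\<lambda>q. g q (Y q) (Z q)) = g p (\<nabla> p v Y) (Z p) + g p (Y p) (\<nabla> p v Z)"
proof -
  have aff: "affine_connection A \<nabla>"
    and tor: "\<forall>p\<in>U. \<forall>X Y. smooth_field A U X \<and> smooth_field A U Y \<longrightarrow> \<nabla> p (X p) Y - \<nabla> p (Y p) X = lie_bracket A X Y p"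
    and met: "\<forall>p\<in>U. \<forall>v Y Z. smooth_field A U Y \<and> smooth_field A U Z \<longrightarrow>
       dir_deriv A p v (\<lambda>q. g q (Y q) (Z q)) = g p (\<nabla> p v Y) (Z p) + g p (Y p) (\<nabla> p v Z)"
    using levi_civita U unfolding is_levi_civita_def by simp_all
  show "smooth_field A U Y \<Longrightarrow> linear (\<lambda>v. \<nabla> p v Y)"
    and "smooth_field A U Y \<Longrightarrow> smooth_field A U Z \<Longrightarrow> \<nabla> p v (\<lambda>q. Y q + Z q) = \<nabla> p v Y + \<nabla> p v Z"
    and "smooth_fun A U f \<Longrightarrow> smooth_field A U Y \<Longrightarrow>
      \<nabla> p v (\<lambda>q. f q *\<^sub>R Y q) = dir_deriv A p v f *\<^sub>R Y p + f p *\<^sub>R \<nabla> p v Y"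
    using aff U unfolding affine_connection_def by simp_all
  show "smooth_field A U X \<Longrightarrow> smooth_field A U Y \<Longrightarrow> lie_bracket A X Y p = \<nabla> p (X p) Y - \<nabla> p (Y p) X"
    using tor U by simp
  show "smooth_field A U Y \<Longrightarrow> smooth_field A U Z \<Longrightarrow>
    dir_deriv A p v (\<lambda>q. g q (Y q) (Z q)) = g p (\<nabla> p v Y) (Z p) + g p (Y p) (\<nabla> p v Z)"
    using met U by simp
qed

end

lemma smooth_nabla:
  "open U \<Longrightarrow> smooth_field A U X \<Longrightarrow> smooth_field A U Y \<Longrightarrow> smooth_field A U (\<lambda>p. \<nabla> p (X p) Y)"
  using levi_civita unfolding is_levi_civita_def affine_connection_def by simp

text \<open>The axioms do not say that \<nabla> depends only on the germ of the field. Multiplying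
  by the indicator of \<open>U\<close>, which is smooth on \<open>U\<close> with derivative 0, turns
  both fields into the same function everywhere, and the product rule gives back the two
  sides.\<close>

lemma nabla_local:
  assumes U: "open U" "p \<in> U" and Y: "smooth_field A U Y" and eq: "\<And>q. q \<in> U \<Longrightarrow> Y q = Y' q"
  shows "\<nabla> p v Y = \<nabla> p v Y'"
proof -
  let ?f = "\<lambda>q. if q \<in> U then 1 else 0 :: real"
  have f: "smooth_fun A U ?f" using smooth_fun_const[OF U(1), of 1] by (rule smooth_fun_cong[OF U(1), rotated]) simp
  have df: "dir_deriv A p v ?f = 0" using dir_deriv_local[OF U, of ?f "\<lambda>q. 1"] by simp
  have Y': "smooth_field A U Y'" using smooth_field_cong[OF U(1) eq Y] .
  have "(\<lambda>q. ?f q *\<^sub>R Y q) = (\<lambda>q. ?f q *\<^sub>R Y' q)" using eq by auto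
  then show ?thesis
    using nabla_scaleR[OF U f Y, of v] nabla_scaleR[OF U f Y', of v] df U by simp
qed

end

section \<open>Adapted frames\<close>

lemma span_family_representation:
  fixes X :: "nat \<Rightarrow> 'a::real_vector"
  assumes "v \<in> span (X ` I)" "finite I"
  shows "\<exists>c. v = (\<Sum>a\<in>I. c a *\<^sub>R X a)"
proof -
  let ?S = "{v. \<exists>c. v = (\<Sum>a\<in>I. c a *\<^sub>R X a)}"
  have "subspace ?S"
  proof (rule subspaceI)
    show "0 \<in> ?S" by (auto intro!: exI[of _ "\<lambda>_. 0"])
    fix x y assume "x \<in> ?S" "y \<in> ?S"
    then obtain c d where "x = (\<Sum>a\<in>I. c a *\<^sub>R X a)" "y = (\<Sum>a\<in>I. d a *\<^sub>R X a)" by auto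
    then show "x + y \<in> ?S"
      by (auto intro!: exI[of _ "\<lambda>a. c a + d a"] simp: scaleR_add_left sum.distrib)
  next
    fix r :: real and x assume "x \<in> ?S"
    then obtain c where "x = (\<Sum>a\<in>I. c a *\<^sub>R X a)" by auto
    then show "r *\<^sub>R x \<in> ?S" by (auto intro!: exI[of _ "\<lambda>a. r * c a"] simp: scaleR_sum_right)
  qed
  moreover have "X ` I \<subseteq> ?S"
  proof clarify
    fix a assume "a \<in> I"
    then show "\<exists>c. X a = (\<Sum>a\<in>I. c a *\<^sub>R X a)"
      using assms(2) by (intro exI[of _ "\<lambda>b. if b = a then 1 else 0"]) (simp add: if_distrib[of "\<lambda>r. r *\<^sub>R _"] cong: if_cong)
  qed
  ultimately have "span (X ` I) \<subseteq> ?S" by (rule span_minimal[rotated])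
  then show ?thesis using assms by blast
qed

lemma linear_sum_scaleR:
  "linear L \<Longrightarrow> L (\<Sum>i\<in>I. r i *\<^sub>R x i) = (\<Sum>i\<in>I. r i *\<^sub>R L (x i))"
  by (simp add: linear_sum linear_scale)

lemma sum_swap4:
  "(\<Sum>\<mu>\<in>S. \<Sum>a\<in>T \<mu>. \<Sum>i\<in>I. \<Sum>j\<in>J. f \<mu> a i j) = (\<Sum>i\<in>I. \<Sum>j\<in>J. \<Sum>\<mu>\<in>S. \<Sum>a\<in>T \<mu>. f \<mu> a i j)"
proof -
  have "(\<Sum>\<mu>\<in>S. \<Sum>a\<in>T \<mu>. \<Sum>i\<in>I. \<Sum>j\<in>J. f \<mu> a i j) = (\<Sum>\<mu>\<in>S. \<Sum>i\<in>I. \<Sum>a\<in>T \<mu>. \<Sum>j\<in>J. f \<mu> a i j)"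
    by (rule sum.cong[OF refl], rule sum.swap)
  also have "\<dots> = (\<Sum>i\<in>I. \<Sum>\<mu>\<in>S. \<Sum>a\<in>T \<mu>. \<Sum>j\<in>J. f \<mu> a i j)" by (rule sum.swap)
  also have "\<dots> = (\<Sum>i\<in>I. \<Sum>\<mu>\<in>S. \<Sum>j\<in>J. \<Sum>a\<in>T \<mu>. f \<mu> a i j)"
    by (rule sum.cong[OF refl], rule sum.cong[OF refl], rule sum.swap)
  also have "\<dots> = (\<Sum>i\<in>I. \<Sum>j\<in>J. \<Sum>\<mu>\<in>S. \<Sum>a\<in>T \<mu>. f \<mu> a i j)"
    by (rule sum.cong[OF refl], rule sum.swap)
  finally show ?thesis .
qed

locale adapted_manifold = smooth_manifold A
  for A :: "('m::{t2_space,second_countable_topology}, 'n::finite) chart set" +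
  fixes k :: nat and n :: "nat \<Rightarrow> nat" and D :: "('m, 'n) dist" and g :: "('m, 'n) metric"
  assumes splitting: "tangent_splitting A k n D"
    and adapted: "adapted_metric A k D g"
begin

sublocale pseudo_riemannian_manifold A g
  using adapted by unfold_locales (simp add: adapted_metric_def)

lemma subspace_D: "\<mu> \<in> {1..k} \<Longrightarrow> subspace (D \<mu> p)"
  and dim_D: "\<mu> \<in> {1..k} \<Longrightarrow> dim (D \<mu> p) = n \<mu>"
  using splitting by (auto simp: tangent_splitting_def smooth_distribution_def)

lemma D_nondeg: "\<mu> \<in> {1..k} \<Longrightarrow> u \<in> D \<mu> p \<Longrightarrow> (\<And>v. v \<in> D \<mu> p \<Longrightarrow> g p u v = 0) \<Longrightarrow> u = 0"
  and D_orth: "\<mu> \<in> {1..k} \<Longrightarrow> \<nu> \<in> {1..k} \<Longrightarrow> \<mu> \<noteq> \<nu> \<Longrightarrow> u \<in> D \<mu> p \<Longrightarrow> v \<in> D \<nu> p \<Longrightarrow> g p u v = 0"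
  using adapted unfolding adapted_metric_def by blast+

lemma D_decomposition:
  obtains w where "\<And>\<mu>. \<mu> \<in> {1..k} \<Longrightarrow> w \<mu> \<in> D \<mu> p" "v = (\<Sum>\<mu>\<in>{1..k}. w \<mu>)"
proof -
  from splitting have "\<exists>!w. w \<in> (\<Pi>\<^sub>E \<mu>\<in>{1..k}. D \<mu> p) \<and> v = (\<Sum>\<mu>\<in>{1..k}. w \<mu>)"
    by (simp add: tangent_splitting_def)
  then obtain w where "w \<in> (\<Pi>\<^sub>E \<mu>\<in>{1..k}. D \<mu> p)" "v = (\<Sum>\<mu>\<in>{1..k}. w \<mu>)" by blast
  then show ?thesis using that[of w] by (auto simp: PiE_iff)
qed

text \<open>The coefficients of \<open>v\<close> with respect to local spanning fields are kept
  constant.\<close>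

lemma D_extension:
  assumes "\<mu> \<in> {1..k}" "v \<in> D \<mu> p"
  obtains U X where "open U" "p \<in> U" "smooth_field A U X" "X p = v" "\<And>q. q \<in> U \<Longrightarrow> X q \<in> D \<mu> q"
proof -
  have "smooth_distribution A (n \<mu>) (D \<mu>)" using splitting assms by (simp add: tangent_splitting_def)
  then obtain U X where U: "open U" "p \<in> U" "\<And>a. a \<in> {1..n \<mu>} \<Longrightarrow> smooth_field A U (X a)"
    "\<And>q. q \<in> U \<Longrightarrow> D \<mu> q = span ((\<lambda>a. X a q) ` {1..n \<mu>})"
    unfolding smooth_distribution_def by metis
  then have "v \<in> span ((\<lambda>a. X a p) ` {1..n \<mu>})" using assms by auto
  then obtain c where c: "v = (\<Sum>a\<in>{1..n \<mu>}. c a *\<^sub>R X a p)"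
    using span_family_representation[of v "\<lambda>a. X a p"] by blast
  show ?thesis
  proof (rule that[OF U(1,2), of "\<lambda>q. \<Sum>a\<in>{1..n \<mu>}. c a *\<^sub>R X a q"])
    show "smooth_field A U (\<lambda>q. \<Sum>a\<in>{1..n \<mu>}. c a *\<^sub>R X a q)"
      by (intro smooth_field_sum smooth_field_scale_const U)
    show "(\<Sum>a\<in>{1..n \<mu>}. c a *\<^sub>R X a q) \<in> D \<mu> q" if "q \<in> U" for q
      unfolding U(4)[OF that] by (intro span_sum span_scale span_base) auto
  qed (simp add: c)
qed

section \<open>Gram-Schmidt in indefinite signature\<close>

definition ortho_system :: "nat \<Rightarrow> nat \<Rightarrow> 'm \<Rightarrow> (nat \<Rightarrow> real^'n) \<Rightarrow> bool" where
  "ortho_system \<mu> m p e \<longleftrightarrow> (\<forall>a\<in>{1..m}. e a \<in> D \<mu> p \<and> \<bar>g p (e a) (e a)\<bar> = 1 \<and>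
     (\<forall>b\<in>{1..m}. b \<noteq> a \<longrightarrow> g p (e a) (e b) = 0))"

text \<open>The number \<open>m\<close> of fields may be smaller than the rank, so that a frame can
  be built one field at a time and can start from prescribed fields.\<close>

definition section_frame :: "nat \<Rightarrow> nat \<Rightarrow> 'm set \<Rightarrow> (nat \<Rightarrow> 'm \<Rightarrow> real^'n) \<Rightarrow> bool" where
  "section_frame \<mu> m U E \<longleftrightarrow> (\<forall>a\<in>{1..m}. smooth_field A U (E a)) \<and> (\<forall>p\<in>U. ortho_system \<mu> m p (\<lambda>a. E a p))"

lemma ortho_systemD:
  assumes "ortho_system \<mu> m p e" "a \<in> {1..m}"
  shows "e a \<in> D \<mu> p" "g p (e a) (e a) * g p (e a) (e a) = 1" "g p (e a) (e a) \<noteq> 0"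
    "\<And>b. b \<in> {1..m} \<Longrightarrow> b \<noteq> a \<Longrightarrow> g p (e a) (e b) = 0"
proof -
  from assms have e: "e a \<in> D \<mu> p" "\<bar>g p (e a) (e a)\<bar> = 1" "\<forall>b\<in>{1..m}. b \<noteq> a \<longrightarrow> g p (e a) (e b) = 0"
    unfolding ortho_system_def by blast+
  show "e a \<in> D \<mu> p" "\<And>b. b \<in> {1..m} \<Longrightarrow> b \<noteq> a \<Longrightarrow> g p (e a) (e b) = 0" using e by blast+
  from e(2) have "g p (e a) (e a) = 1 \<or> g p (e a) (e a) = -1" by linarith
  then show "g p (e a) (e a) * g p (e a) (e a) = 1" "g p (e a) (e a) \<noteq> 0" by auto
qed

lemma ortho_system_delta:
  assumes "ortho_system \<mu> m p e" "a \<in> {1..m}" "b \<in> {1..m}"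
  shows "g p (e a) (e b) = (if a = b then g p (e a) (e a) else 0)"
  using ortho_systemD(4)[OF assms(1,2,3)] by auto

text \<open>The coefficients carry the factor \<open>g p (e a) (e a)\<close>, which is plus or minus
  one and hence its own inverse.\<close>

lemma ortho_system_projection:
  assumes e: "ortho_system \<mu> m p e" and b: "b \<in> {1..m}"
  shows "g p (u - (\<Sum>a\<in>{1..m}. (g p (e a) (e a) * g p u (e a)) *\<^sub>R e a)) (e b) = 0"
proof -
  have "(\<Sum>a\<in>{1..m}. (g p (e a) (e a) * g p u (e a)) * g p (e a) (e b))
      = (\<Sum>a\<in>{1..m}. if a = b then g p u (e b) else 0)"
  proof (intro sum.cong refl)
    fix a assume a: "a \<in> {1..m}"
    show "(g p (e a) (e a) * g p u (e a)) * g p (e a) (e b) = (if a = b then g p u (e b) else 0)"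
    proof (cases "a = b")
      case True
      have "(g p (e b) (e b) * g p u (e b)) * g p (e b) (e b) = (g p (e b) (e b) * g p (e b) (e b)) * g p u (e b)"
        by (simp only: mult_ac)
      then show ?thesis using True ortho_systemD(2)[OF e b] by simp
    qed (use ortho_systemD(4)[OF e a b] in auto)
  qed
  also have "\<dots> = g p u (e b)" using b by simp
  finally show ?thesis by (simp add: g_linear g_sum_left)
qed

text \<open>Otherwise the form is identically zero on the orthogonal complement of the system inside
  \<open>D \<mu> p\<close>, by polarisation. Nondegeneracy on the distribution then makes the
  complement zero, so \<open>m\<close> vectors span a space of dimension greater than
  \<open>m\<close>.\<close>

lemma ortho_system_complement:
  assumes \<mu>: "\<mu> \<in> {1..k}" and e: "ortho_system \<mu> m p e" and m: "m < n \<mu>"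
  obtains v where "v \<in> D \<mu> p" "\<And>a. a \<in> {1..m} \<Longrightarrow> g p v (e a) = 0" "g p v v \<noteq> 0"
proof (rule ccontr)
  note that' = that
  assume "\<not> thesis"
  have null: "g p v v = 0" if "v \<in> D \<mu> p" "\<And>a. a \<in> {1..m} \<Longrightarrow> g p v (e a) = 0" for v
    using \<open>\<not> thesis\<close> that that'[of v] by blast
  let ?pr = "\<lambda>u. \<Sum>a\<in>{1..m}. (g p (e a) (e a) * g p u (e a)) *\<^sub>R e a"
  have pr: "?pr u \<in> D \<mu> p" for u
    using ortho_systemD(1)[OF e] by (intro subspace_sum subspace_scale subspace_D[OF \<mu>])
  have zero: "v = 0" if v: "v \<in> D \<mu> p" "\<And>a. a \<in> {1..m} \<Longrightarrow> g p v (e a) = 0" for v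
  proof (rule D_nondeg[OF \<mu> v(1)])
    fix u assume u: "u \<in> D \<mu> p"
    define w where "w = u - ?pr u"
    have w: "w \<in> D \<mu> p" unfolding w_def by (intro subspace_diff subspace_D \<mu> u pr)
    have we: "g p w (e a) = 0" if "a \<in> {1..m}" for a
      unfolding w_def using ortho_system_projection[OF e that] .
    \<comment> \<open>Polarisation: \<open>v\<close>, \<open>w\<close> and \<open>v + w\<close> are
      all null, hence \<open>g p v w\<close> vanishes.\<close>
    have "g p (v + w) (v + w) = 0"
      using v w we by (intro null subspace_add[OF subspace_D[OF \<mu>]]) (simp_all add: g_linear)
    then have "g p v w = 0"
      using null[OF v] null[OF w we] by (simp add: g_linear g_sym[of p w v])
    moreover have "g p v (?pr u) = 0" using v(2) by (simp add: g_sum_right g_linear)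
    ultimately show "g p v u = 0" unfolding w_def by (simp add: g_linear)
  qed
  have "D \<mu> p \<subseteq> span (e ` {1..m})"
  proof
    fix u assume u: "u \<in> D \<mu> p"
    have "u - ?pr u = 0"
      using ortho_system_projection[OF e] by (intro zero subspace_diff subspace_D \<mu> u pr)
    then have "u = ?pr u" by simp
    moreover have "?pr u \<in> span (e ` {1..m})" by (intro span_sum span_scale span_base) auto
    ultimately show "u \<in> span (e ` {1..m})" by simp
  qed
  then have "dim (D \<mu> p) \<le> card (e ` {1..m})" by (intro dim_le_card) auto
  also have "\<dots> \<le> m" using card_image_le[of "{1..m}" e] by simp
  finally show False using dim_D[OF \<mu>] m by simp
qed

text \<open>One Gram-Schmidt step: a non-null vector orthogonal to the frame at \<open>p\<close> is
  extended to a section, made orthogonal to the frame, and normalised on the open set where it stays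
  non-null.\<close>

lemma section_frame_extend:
  assumes \<mu>: "\<mu> \<in> {1..k}" and U: "open U" "p \<in> U" and E: "section_frame \<mu> m U E" and m: "m < n \<mu>"
  obtains V F where "open V" "p \<in> V" "V \<subseteq> U" "section_frame \<mu> (Suc m) V F" "\<And>a. a \<in> {1..m} \<Longrightarrow> F a = E a"
proof -
  have Eq: "ortho_system \<mu> m q (\<lambda>a. E a q)" if "q \<in> U" for q using E that by (simp add: section_frame_def)
  have Es: "smooth_field A U (E a)" if "a \<in> {1..m}" for a using E that by (simp add: section_frame_def)
  obtain v where v: "v \<in> D \<mu> p" "\<And>a. a \<in> {1..m} \<Longrightarrow> g p v (E a p) = 0" "g p v v \<noteq> 0"
    using ortho_system_complement[OF \<mu> Eq[OF U(2)] m] by blast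
  obtain U' X where X: "open U'" "p \<in> U'" "smooth_field A U' X" "X p = v" "\<And>q. q \<in> U' \<Longrightarrow> X q \<in> D \<mu> q"
    using D_extension[OF \<mu> v(1)] by blast
  define W where "W = U \<inter> U'"
  have W: "open W" "p \<in> W" "W \<subseteq> U" "W \<subseteq> U'" using U X by (auto simp: W_def)
  define X' where "X' q = X q - (\<Sum>a\<in>{1..m}. (g q (E a q) (E a q) * g q (X q) (E a q)) *\<^sub>R E a q)" for q
  have EW: "smooth_field A W (E a)" if "a \<in> {1..m}" for a using smooth_field_subset[OF Es[OF that] W(3)] .
  have XW: "smooth_field A W X" using smooth_field_subset[OF X(3) W(4)] .
  have X's: "smooth_field A W X'" unfolding X'_def[abs_def]
    by (intro smooth_field_diff smooth_field_sum smooth_field_scaleR smooth_fun_mult smooth_g W(1) EW XW)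
  have X'D: "X' q \<in> D \<mu> q" if "q \<in> W" for q
    unfolding X'_def using that W X(5) ortho_systemD(1)[OF Eq]
    by (intro subspace_diff subspace_sum subspace_scale subspace_D \<mu>) auto
  have X'E: "g q (X' q) (E a q) = 0" if "q \<in> W" "a \<in> {1..m}" for q a
    unfolding X'_def using ortho_system_projection[OF Eq, of q a] that W by auto
  have X'p: "X' p = v" unfolding X'_def X(4) using v(2) by simp
  define h where "h q = g q (X' q) (X' q)" for q
  have hs: "smooth_fun A W h" unfolding h_def[abs_def] by (intro smooth_g W X's)
  define V where "V = {q\<in>W. h q \<noteq> 0}"
  have "open (W \<inter> h -` (- {0}))"
    using smooth_fun_continuous[OF W(1) hs] W(1) by (intro continuous_open_preimage) auto
  moreover have "W \<inter> h -` (- {0}) = V" by (auto simp: V_def)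
  ultimately have V: "open V" "p \<in> V" "V \<subseteq> W"
    using W v(3) X'p by (auto simp: V_def h_def)
  define F where "F a = (if a = Suc m then (\<lambda>q. inverse (sqrt \<bar>h q\<bar>) *\<^sub>R X' q) else E a)" for a
  have Fs: "smooth_field A V (F a)" if "a \<in> {1..Suc m}" for a
  proof (cases "a = Suc m")
    case True
    have "smooth_fun A V h" "smooth_field A V X'"
      using smooth_fun_subset[OF hs V(3)] smooth_field_subset[OF X's V(3)] by auto
    then show ?thesis unfolding F_def using True
      by (simp, intro smooth_field_scaleR smooth_fun_inverse_sqrt_abs V(1)) (auto simp: V_def)
  next
    case False
    then show ?thesis using that EW[of a] smooth_field_subset[OF _ V(3)] by (auto simp: F_def)
  qed
  have "ortho_system \<mu> (Suc m) q (\<lambda>a. F a q)" if q: "q \<in> V" for q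
    unfolding ortho_system_def
  proof (intro ballI conjI impI)
    have hq: "h q \<noteq> 0" "q \<in> W" "q \<in> U" using q V W by (auto simp: V_def)
    fix a assume a: "a \<in> {1..Suc m}"
    show "F a q \<in> D \<mu> q"
      using a hq X'D[of q] ortho_systemD(1)[OF Eq, of q a] by (auto simp: F_def intro: subspace_scale[OF subspace_D[OF \<mu>]])
    show "\<bar>g q (F a q) (F a q)\<bar> = 1"
    proof (cases "a = Suc m")
      case True
      have gen: "inverse s * (inverse s * x) = x / (s * s)" for s x :: real
        by (simp add: divide_inverse mult_ac)
      have "g q (F a q) (F a q) = inverse (sqrt \<bar>h q\<bar>) * (inverse (sqrt \<bar>h q\<bar>) * h q)"
        by (simp add: F_def True g_linear h_def)
      also have "\<dots> = h q / (sqrt \<bar>h q\<bar> * sqrt \<bar>h q\<bar>)" by (rule gen)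
      also have "\<dots> = h q / \<bar>h q\<bar>" by simp
      finally show ?thesis using hq by (simp add: abs_divide)
    next
      case False
      then show ?thesis using a Eq[OF hq(3)] by (auto simp: F_def ortho_system_def)
    qed
    fix b assume b: "b \<in> {1..Suc m}" and ne: "b \<noteq> a"
    show "g q (F a q) (F b q) = 0"
      using a b ne X'E[OF hq(2)] ortho_systemD(4)[OF Eq[OF hq(3)], of a b] g_sym[of q "E a q" "X' q"]
      by (auto simp: F_def g_linear le_Suc_eq)
  qed
  then have "section_frame \<mu> (Suc m) V F" using Fs by (simp add: section_frame_def)
  then show ?thesis using that[of V F] V W by (auto simp: F_def)
qed

text \<open>The first \<open>m\<close> fields survive unchanged, which makes it possible to keep a
  normalised mean curvature vector as the first field.\<close>

lemma section_frame_complete: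
  assumes \<mu>: "\<mu> \<in> {1..k}" and "open U" "p \<in> U" "section_frame \<mu> m U E" "m \<le> m'" "m' \<le> n \<mu>"
  shows "\<exists>V F. open V \<and> p \<in> V \<and> V \<subseteq> U \<and> section_frame \<mu> m' V F \<and> (\<forall>a\<in>{1..m}. F a = E a)"
  using assms(5,6)
proof (induction m' rule: dec_induct)
  case base
  then show ?case using assms(2,3,4) by blast
next
  case (step j)
  then obtain V F where V: "open V" "p \<in> V" "V \<subseteq> U" "section_frame \<mu> j V F" "\<forall>a\<in>{1..m}. F a = E a" by auto
  from section_frame_extend[OF \<mu> V(1,2,4)] step.prems obtain V' F' where
    "open V'" "p \<in> V'" "V' \<subseteq> V" "section_frame \<mu> (Suc j) V' F'" "\<And>a. a \<in> {1..j} \<Longrightarrow> F' a = F a" by auto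
  moreover have "{1..m} \<subseteq> {1..j}" using step.hyps by auto
  ultimately show ?case using V by (metis subset_eq)
qed

lemma adapted_frame_exists: "\<exists>U E. open U \<and> p \<in> U \<and> adapted_frame A k n D g U E"
proof -
  have "\<exists>V F. open V \<and> p \<in> V \<and> section_frame \<mu> (n \<mu>) V F" if "\<mu> \<in> {1..k}" for \<mu>
    using section_frame_complete[OF that open_UNIV UNIV_I, of 0 "\<lambda>_ _. 0" "n \<mu>" p]
    by (auto simp: section_frame_def ortho_system_def)
  then obtain V F where VF: "\<And>\<mu>. \<mu> \<in> {1..k} \<Longrightarrow> open (V \<mu>) \<and> p \<in> V \<mu> \<and> section_frame \<mu> (n \<mu>) (V \<mu>) (F \<mu>)"
    by metis
  let ?U = "\<Inter>\<mu>\<in>{1..k}. V \<mu>"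
  have "open ?U" "p \<in> ?U" using VF by auto
  moreover have "adapted_frame A k n D g ?U F"
    unfolding adapted_frame_def
  proof (rule ballI, rule ballI, rule conjI)
    fix \<mu> a assume \<mu>: "\<mu> \<in> {1..k}" and a: "a \<in> {1..n \<mu>}"
    then have "section_frame \<mu> (n \<mu>) (V \<mu>) (F \<mu>)" "?U \<subseteq> V \<mu>" using VF by auto
    then show "smooth_field A ?U (F \<mu> a)"
      using a by (rule_tac smooth_field_subset[of "V \<mu>" "F \<mu> a"]) (auto simp: section_frame_def)
    show "\<forall>q\<in>?U. F \<mu> a q \<in> D \<mu> q \<and> \<bar>g q (F \<mu> a q) (F \<mu> a q)\<bar> = 1 \<and>
      (\<forall>b\<in>{1..n \<mu>}. b \<noteq> a \<longrightarrow> g q (F \<mu> a q) (F \<mu> b q) = 0)"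
    proof
    fix q assume "q \<in> ?U"
    then have "ortho_system \<mu> (n \<mu>) q (\<lambda>a. F \<mu> a q)"
      using \<open>section_frame \<mu> (n \<mu>) (V \<mu>) (F \<mu>)\<close> \<mu> by (auto simp: section_frame_def)
    then show "F \<mu> a q \<in> D \<mu> q \<and> \<bar>g q (F \<mu> a q) (F \<mu> a q)\<bar> = 1 \<and>
      (\<forall>b\<in>{1..n \<mu>}. b \<noteq> a \<longrightarrow> g q (F \<mu> a q) (F \<mu> b q) = 0)"
      using a by (auto simp: ortho_system_def)
    qed
  qed
  ultimately show ?thesis by blast
qed

lemma frame_at_adapted:
  obtains U where "open U" "p \<in> U" "adapted_frame A k n D g U (frame_at A k n D g p)"
proof -
  have "\<exists>E U. open U \<and> p \<in> U \<and> adapted_frame A k n D g U E" using adapted_frame_exists by blast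
  from someI_ex[OF this] show ?thesis using that unfolding frame_at_def by blast
qed

definition ortho_basis :: "'m \<Rightarrow> (nat \<Rightarrow> nat \<Rightarrow> real^'n) \<Rightarrow> bool" where
  "ortho_basis p e \<longleftrightarrow> (\<forall>\<mu>\<in>{1..k}. ortho_system \<mu> (n \<mu>) p (e \<mu>))"

lemma adapted_frame_basis: "adapted_frame A k n D g U E \<Longrightarrow> p \<in> U \<Longrightarrow> ortho_basis p (\<lambda>\<mu> a. E \<mu> a p)"
  by (auto simp: adapted_frame_def ortho_basis_def ortho_system_def)

lemma adapted_frame_smooth:
  "adapted_frame A k n D g U E \<Longrightarrow> \<mu> \<in> {1..k} \<Longrightarrow> a \<in> {1..n \<mu>} \<Longrightarrow> smooth_field A U (E \<mu> a)"
  by (auto simp: adapted_frame_def)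

lemma ortho_basis_D:
  assumes "ortho_basis p e" "\<mu> \<in> {1..k}" "a \<in> {1..n \<mu>}" shows "e \<mu> a \<in> D \<mu> p"
  using assms ortho_systemD(1)[of \<mu> "n \<mu>" p "e \<mu>" a] by (simp add: ortho_basis_def)

text \<open>Orthonormal vectors are independent in indefinite signature too, because their squares
  are not zero. As many as the rank span the distribution, and both sides are linear, so it is
  enough to check the basis vectors.\<close>

lemma D_expansion:
  assumes e: "ortho_basis p e" and \<mu>: "\<mu> \<in> {1..k}" and v: "v \<in> D \<mu> p"
  shows "v = (\<Sum>a\<in>{1..n \<mu>}. (g p (e \<mu> a) (e \<mu> a) * g p v (e \<mu> a)) *\<^sub>R e \<mu> a)"
proof -
  let ?I = "{1..n \<mu>}"
  have os: "ortho_system \<mu> (n \<mu>) p (e \<mu>)" using e \<mu> by (simp add: ortho_basis_def)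
  have inj: "inj_on (e \<mu>) ?I"
  proof (rule inj_onI)
    fix a b assume ab: "a \<in> ?I" "b \<in> ?I" "e \<mu> a = e \<mu> b"
    then show "a = b" using ortho_systemD(3)[OF os ab(1)] ortho_systemD(4)[OF os ab(1,2)] by metis
  qed
  have "independent (e \<mu> ` ?I)"
    unfolding dependent_def
  proof clarify
    fix a assume a: "a \<in> ?I" and s: "e \<mu> a \<in> span (e \<mu> ` ?I - {e \<mu> a})"
    have "subspace {x. g p (e \<mu> a) x = 0}" by (intro subspaceI) (auto simp: g_linear)
    moreover have "e \<mu> ` ?I - {e \<mu> a} \<subseteq> {x. g p (e \<mu> a) x = 0}"
      using ortho_systemD(4)[OF os a] by fastforce
    ultimately have "span (e \<mu> ` ?I - {e \<mu> a}) \<subseteq> {x. g p (e \<mu> a) x = 0}" by (rule span_minimal[rotated])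
    with s ortho_systemD(3)[OF os a] show False by auto
  qed
  moreover have "e \<mu> ` ?I \<subseteq> D \<mu> p" using ortho_systemD(1)[OF os] by auto
  moreover have "dim (D \<mu> p) \<le> card (e \<mu> ` ?I)" using dim_D[OF \<mu>] card_image[OF inj] by simp
  ultimately have "D \<mu> p \<subseteq> span (e \<mu> ` ?I)" by (intro card_ge_dim_independent)
  with v have "v \<in> span (e \<mu> ` ?I)" by blast
  moreover have "linear (\<lambda>v. \<Sum>a\<in>?I. (g p (e \<mu> a) (e \<mu> a) * g p v (e \<mu> a)) *\<^sub>R e \<mu> a)"
    by (intro linearI) (simp_all add: g_linear algebra_simps sum.distrib scaleR_sum_right)
  moreover have "x = (\<Sum>a\<in>?I. (g p (e \<mu> a) (e \<mu> a) * g p x (e \<mu> a)) *\<^sub>R e \<mu> a)" if x: "x \<in> e \<mu> ` ?I" for x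
  proof -
    from x obtain b where b: "b \<in> ?I" "x = e \<mu> b" by auto
    have "(\<Sum>a\<in>?I. (g p (e \<mu> a) (e \<mu> a) * g p x (e \<mu> a)) *\<^sub>R e \<mu> a) = (\<Sum>a\<in>?I. if a = b then e \<mu> b else 0)"
    proof (intro sum.cong refl)
      fix a assume a: "a \<in> ?I"
      show "(g p (e \<mu> a) (e \<mu> a) * g p x (e \<mu> a)) *\<^sub>R e \<mu> a = (if a = b then e \<mu> b else 0)"
        using ortho_systemD(2)[OF os b(1)] ortho_systemD(4)[OF os b(1) a] b by (cases "a = b") auto
    qed
    then show ?thesis using b by simp
  qed
  ultimately show ?thesis
    using linear_eq_on_span[OF linear_ident, of "\<lambda>v. \<Sum>a\<in>?I. (g p (e \<mu> a) (e \<mu> a) * g p v (e \<mu> a)) *\<^sub>R e \<mu> a"] by blast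
qed

lemma frame_expansion:
  assumes e: "ortho_basis p e"
  shows "v = (\<Sum>\<mu>\<in>{1..k}. \<Sum>a\<in>{1..n \<mu>}. (g p (e \<mu> a) (e \<mu> a) * g p v (e \<mu> a)) *\<^sub>R e \<mu> a)"
proof -
  obtain w where w: "\<And>\<mu>. \<mu> \<in> {1..k} \<Longrightarrow> w \<mu> \<in> D \<mu> p" and v: "v = (\<Sum>\<mu>\<in>{1..k}. w \<mu>)"
    using D_decomposition by blast
  have "g p v (e \<mu> a) = g p (w \<mu>) (e \<mu> a)" if \<mu>: "\<mu> \<in> {1..k}" and a: "a \<in> {1..n \<mu>}" for \<mu> a
  proof -
    have "g p v (e \<mu> a) = (\<Sum>\<nu>\<in>{1..k}. if \<nu> = \<mu> then g p (w \<mu>) (e \<mu> a) else 0)"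
      unfolding v g_sum_left using \<mu> D_orth w ortho_basis_D[OF e \<mu> a] by (intro sum.cong) auto
    then show ?thesis using \<mu> by simp
  qed
  then have "(\<Sum>\<mu>\<in>{1..k}. \<Sum>a\<in>{1..n \<mu>}. (g p (e \<mu> a) (e \<mu> a) * g p v (e \<mu> a)) *\<^sub>R e \<mu> a)
     = (\<Sum>\<mu>\<in>{1..k}. w \<mu>)"
  proof (intro sum.cong refl)
    fix \<mu> assume \<mu>: "\<mu> \<in> {1..k}"
    assume "\<And>\<mu> a. \<mu> \<in> {1..k} \<Longrightarrow> a \<in> {1..n \<mu>} \<Longrightarrow> g p v (e \<mu> a) = g p (w \<mu>) (e \<mu> a)"
    then have "(\<Sum>a\<in>{1..n \<mu>}. (g p (e \<mu> a) (e \<mu> a) * g p v (e \<mu> a)) *\<^sub>R e \<mu> a)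
      = (\<Sum>a\<in>{1..n \<mu>}. (g p (e \<mu> a) (e \<mu> a) * g p (w \<mu>) (e \<mu> a)) *\<^sub>R e \<mu> a)"
      using \<mu> by (intro sum.cong refl) simp
    then show "(\<Sum>a\<in>{1..n \<mu>}. (g p (e \<mu> a) (e \<mu> a) * g p v (e \<mu> a)) *\<^sub>R e \<mu> a) = w \<mu>"
      using D_expansion[OF e \<mu> w[OF \<mu>]] by simp
  qed
  then show ?thesis using v by simp
qed

text \<open>The definitions choose a frame for each point separately; this puts a smooth frame, or
  one convenient at \<open>p\<close>, in its place. The first frame is expanded in the second, and
  the sum over the first then collapses.\<close>

lemma trace_frame_independent:
  fixes B :: "real^'n \<Rightarrow> real^'n \<Rightarrow> 'b::real_vector"
  assumes e: "ortho_basis p e" and e': "ortho_basis p e'" and \<mu>: "\<mu> \<in> {1..k}"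
    and B: "\<And>v. linear (\<lambda>u. B u v)" "\<And>u. linear (B u)"
  shows "(\<Sum>a\<in>{1..n \<mu>}. g p (e \<mu> a) (e \<mu> a) *\<^sub>R B (e \<mu> a) (e \<mu> a)) =
         (\<Sum>a\<in>{1..n \<mu>}. g p (e' \<mu> a) (e' \<mu> a) *\<^sub>R B (e' \<mu> a) (e' \<mu> a))"
proof -
  let ?I = "{1..n \<mu>}"
  let ?d = "\<lambda>a. g p (e \<mu> a) (e \<mu> a)" and ?d' = "\<lambda>a. g p (e' \<mu> a) (e' \<mu> a)"
  let ?x = "\<lambda>a c. g p (e \<mu> a) (e' \<mu> c)"
  have exp: "B (e \<mu> a) (e \<mu> a) = (\<Sum>c\<in>?I. \<Sum>d\<in>?I. (?d' c * ?d' d * (?x a c * ?x a d)) *\<^sub>R B (e' \<mu> c) (e' \<mu> d))"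
    if a: "a \<in> ?I" for a
  proof -
    note ex = D_expansion[OF e' \<mu> ortho_basis_D[OF e \<mu> a]]
    have 1: "B (e \<mu> a) (e \<mu> a) = (\<Sum>c\<in>?I. (?d' c * ?x a c) *\<^sub>R B (e' \<mu> c) (e \<mu> a))"
      by (rule trans[OF arg_cong[OF ex, of "\<lambda>u. B u (e \<mu> a)"] linear_sum_scaleR[OF B(1)]])
    have 2: "B (e' \<mu> c) (e \<mu> a) = (\<Sum>d\<in>?I. (?d' d * ?x a d) *\<^sub>R B (e' \<mu> c) (e' \<mu> d))" for c
      by (rule trans[OF arg_cong[OF ex, of "B (e' \<mu> c)"] linear_sum_scaleR[OF B(2)]])
    show ?thesis unfolding 1 unfolding 2 by (simp add: scaleR_sum_right mult_ac)
  qed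
  have "(\<Sum>a\<in>?I. ?d a *\<^sub>R B (e \<mu> a) (e \<mu> a)) =
     (\<Sum>a\<in>?I. \<Sum>c\<in>?I. \<Sum>d\<in>?I. (?d a * (?d' c * ?d' d * (?x a c * ?x a d))) *\<^sub>R B (e' \<mu> c) (e' \<mu> d))"
    using exp by (intro sum.cong refl) (simp add: scaleR_sum_right)
  also have "\<dots> = (\<Sum>c\<in>?I. \<Sum>a\<in>?I. \<Sum>d\<in>?I. (?d a * (?d' c * ?d' d * (?x a c * ?x a d))) *\<^sub>R B (e' \<mu> c) (e' \<mu> d))"
    by (rule sum.swap)
  also have "\<dots> = (\<Sum>c\<in>?I. \<Sum>d\<in>?I. \<Sum>a\<in>?I. (?d a * (?d' c * ?d' d * (?x a c * ?x a d))) *\<^sub>R B (e' \<mu> c) (e' \<mu> d))"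
    by (rule sum.cong[OF refl], rule sum.swap)
  \<comment> \<open>The sum over \<open>a\<close> is the expansion of \<open>e' \<mu> c\<close> in
    the first frame, paired with \<open>e' \<mu> d\<close>, hence a signed Kronecker delta.\<close>
  also have "\<dots> = (\<Sum>c\<in>?I. \<Sum>d\<in>?I. if d = c then ?d' c *\<^sub>R B (e' \<mu> c) (e' \<mu> c) else 0)"
  proof (intro sum.cong refl)
    fix c d assume c: "c \<in> ?I" and d: "d \<in> ?I"
    have os': "ortho_system \<mu> (n \<mu>) p (e' \<mu>)" using e' \<mu> by (simp add: ortho_basis_def)
    have "(\<Sum>a\<in>?I. ?d a * ?x a c * ?x a d) = g p (e' \<mu> c) (e' \<mu> d)"
      using arg_cong[OF D_expansion[OF e \<mu> ortho_basis_D[OF e' \<mu> c]], of "\<lambda>u. g p u (e' \<mu> d)"]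
      by (simp add: g_sum_left g_linear g_sym[of p "e' \<mu> c"])
    moreover have "(\<Sum>a\<in>?I. ?d a * (?d' c * ?d' d * (?x a c * ?x a d))) = ?d' c * ?d' d * (\<Sum>a\<in>?I. ?d a * ?x a c * ?x a d)"
      unfolding sum_distrib_left by (intro sum.cong refl) (simp only: mult_ac)
    ultimately have "(\<Sum>a\<in>?I. ?d a * (?d' c * ?d' d * (?x a c * ?x a d))) = ?d' c * ?d' d * g p (e' \<mu> c) (e' \<mu> d)"
      by simp
    also have "\<dots> = (if d = c then ?d' c else 0)"
      using ortho_system_delta[OF os' c d] ortho_systemD(2)[OF os' c] by auto
    finally have *: "(\<Sum>a\<in>?I. ?d a * (?d' c * ?d' d * (?x a c * ?x a d))) = (if d = c then ?d' c else 0)" .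
    show "(\<Sum>a\<in>?I. (?d a * (?d' c * ?d' d * (?x a c * ?x a d))) *\<^sub>R B (e' \<mu> c) (e' \<mu> d))
      = (if d = c then ?d' c *\<^sub>R B (e' \<mu> c) (e' \<mu> c) else 0)"
      unfolding scaleR_sum_left[symmetric] * by auto
  qed
  also have "\<dots> = (\<Sum>c\<in>?I. ?d' c *\<^sub>R B (e' \<mu> c) (e' \<mu> c))" by (simp add: sum.delta)
  finally show ?thesis .
qed

text \<open>A trace over the whole tangent space is a contraction with the inverse Gram matrix. No
  frame is left on the right, so dependence on the point and on the metric is visibly smooth, and
  orthonormal frames of a varying metric never have to be chosen smoothly in the parameter.\<close>

lemma full_trace_coord:
  fixes B :: "real^'n \<Rightarrow> real^'n \<Rightarrow> real"
  assumes e: "ortho_basis p e" and c: "c \<in> A" "p \<in> fst c"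
    and B: "\<And>v. linear (\<lambda>u. B u v)" "\<And>u. linear (B u)"
  shows "(\<Sum>\<mu>\<in>{1..k}. \<Sum>a\<in>{1..n \<mu>}. g p (e \<mu> a) (e \<mu> a) * B (e \<mu> a) (e \<mu> a)) =
    (\<Sum>i\<in>UNIV. \<Sum>j\<in>UNIV. matrix_inv (gram c p) $ i $ j * B (coord_field A c i p) (coord_field A c j p))"
proof -
  let ?h = "\<lambda>i j. matrix_inv (gram c p) $ i $ j" and ?X = "\<lambda>i. coord_field A c i p"
  let ?f = "\<lambda>\<mu> a i j. ?h i j * (g p (e \<mu> a) (e \<mu> a) * (g p (?X j) (e \<mu> a) * B (?X i) (e \<mu> a)))"
  have "g p (e \<mu> a) (e \<mu> a) * B (e \<mu> a) (e \<mu> a) = (\<Sum>i\<in>UNIV. \<Sum>j\<in>UNIV. ?f \<mu> a i j)" for \<mu> a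
  proof -
    have "B (e \<mu> a) (e \<mu> a) = (\<Sum>i\<in>UNIV. (\<Sum>j\<in>UNIV. ?h i j * g p (?X j) (e \<mu> a)) * B (?X i) (e \<mu> a))"
      using trans[OF arg_cong[OF coord_expansion[OF c, of "e \<mu> a"], of "\<lambda>u. B u (e \<mu> a)"] linear_sum_scaleR[OF B(1)]]
      by (simp add: gram_inv_mult[OF c])
    then show ?thesis by (simp add: sum_distrib_left sum_distrib_right mult_ac)
  qed
  moreover have "?h i j * B (?X i) (?X j) = (\<Sum>\<mu>\<in>{1..k}. \<Sum>a\<in>{1..n \<mu>}. ?f \<mu> a i j)" for i j
  proof -
    have "B (?X i) (?X j) = (\<Sum>\<mu>\<in>{1..k}. \<Sum>a\<in>{1..n \<mu>}. g p (e \<mu> a) (e \<mu> a) * (g p (?X j) (e \<mu> a) * B (?X i) (e \<mu> a)))"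
      using trans[OF arg_cong[OF frame_expansion[OF e, of "?X j"], of "B (?X i)"] linear_sum[OF B(2)]]
      by (simp add: linear_sum_scaleR[OF B(2)] mult_ac)
    then show ?thesis by (simp add: sum_distrib_left)
  qed
  ultimately show ?thesis by (simp only: sum_swap4)
qed

lemma orthoprojector_frame:
  assumes e: "ortho_basis p e" and \<mu>: "\<mu> \<in> {1..k}"
  shows "orthoprojector g (D \<mu>) p v = (\<Sum>a\<in>{1..n \<mu>}. (g p (e \<mu> a) (e \<mu> a) * g p v (e \<mu> a)) *\<^sub>R e \<mu> a)"
  unfolding orthoprojector_def
proof (rule the_equality)
  let ?u = "\<Sum>a\<in>{1..n \<mu>}. (g p (e \<mu> a) (e \<mu> a) * g p v (e \<mu> a)) *\<^sub>R e \<mu> a"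
  have u: "?u \<in> D \<mu> p" using ortho_basis_D[OF e \<mu>] by (intro subspace_sum subspace_scale subspace_D[OF \<mu>])
  have os: "ortho_system \<mu> (n \<mu>) p (e \<mu>)" using e \<mu> by (simp add: ortho_basis_def)
  have orth: "g p (v - ?u) w = 0" if "w \<in> D \<mu> p" for w
    using arg_cong[OF D_expansion[OF e \<mu> that], of "g p (v - ?u)"] ortho_system_projection[OF os, of _ v]
    by (simp add: g_sum_right g_linear)
  show "?u \<in> D \<mu> p \<and> (\<forall>w\<in>D \<mu> p. g p (v - ?u) w = 0)" using u orth by blast
  fix u' assume u': "u' \<in> D \<mu> p \<and> (\<forall>w\<in>D \<mu> p. g p (v - u') w = 0)"
  have "u' - ?u = 0"
  proof (rule D_nondeg[OF \<mu>])
    show "u' - ?u \<in> D \<mu> p" using u u' by (intro subspace_diff subspace_D \<mu>) auto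
    fix w assume "w \<in> D \<mu> p"
    then show "g p (u' - ?u) w = 0" using orth[of w] u' by (auto simp: g_linear)
  qed
  then show "u' = ?u" by simp
qed

end

section \<open>Mixed scalar curvature and contorsion\<close>

text \<open>Only the pairs containing \<open>\<mu>0\<close> contribute; by symmetry those with
  \<open>\<mu>0\<close> as smaller and as larger index combine into one sum over the other
  index.\<close>

lemma sum_pairs_through:
  fixes f :: "nat \<Rightarrow> nat \<Rightarrow> 'b::comm_monoid_add"
  assumes sym: "\<And>\<mu> \<nu>. \<mu> \<in> {1..k} \<Longrightarrow> \<nu> \<in> {1..k} \<Longrightarrow> f \<nu> \<mu> = f \<mu> \<nu>"
    and zero: "\<And>\<mu> \<nu>. \<mu> \<in> {1..k} \<Longrightarrow> \<nu> \<in> {1..k} \<Longrightarrow> \<mu> \<noteq> \<nu> \<Longrightarrow> \<mu> \<noteq> \<mu>0 \<Longrightarrow> \<nu> \<noteq> \<mu>0 \<Longrightarrow> f \<nu> \<mu> = 0"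
    and \<mu>0: "\<mu>0 \<in> {1..k}"
  shows "(\<Sum>\<mu>\<in>{1..k}. \<Sum>\<nu>\<in>{1..<\<mu>}. f \<nu> \<mu>) = (\<Sum>\<nu>\<in>{1..k} - {\<mu>0}. f \<mu>0 \<nu>)"
proof -
  have lt: "(\<Sum>\<nu>\<in>{1..<\<mu>}. f \<nu> \<mu>) = 0" if "\<mu> \<in> {1..<\<mu>0}" for \<mu>
    using that \<mu>0 by (intro sum.neutral ballI zero) auto
  have gt: "(\<Sum>\<nu>\<in>{1..<\<mu>}. f \<nu> \<mu>) = f \<mu>0 \<mu>" if "\<mu> \<in> {\<mu>0<..k}" for \<mu>
  proof -
    have "(\<Sum>\<nu>\<in>{1..<\<mu>}. f \<nu> \<mu>) = (\<Sum>\<nu>\<in>{1..<\<mu>}. if \<nu> = \<mu>0 then f \<mu>0 \<mu> else 0)"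
      using that by (intro sum.cong refl) (auto intro: zero)
    then show ?thesis using that \<mu>0 by simp
  qed
  have split: "{1..k} = {1..<\<mu>0} \<union> ({\<mu>0} \<union> {\<mu>0<..k})" using \<mu>0 by auto
  have split': "{1..k} - {\<mu>0} = {1..<\<mu>0} \<union> {\<mu>0<..k}" using \<mu>0 by auto
  have "(\<Sum>\<mu>\<in>{1..k}. \<Sum>\<nu>\<in>{1..<\<mu>}. f \<nu> \<mu>) = (\<Sum>\<mu>\<in>{1..<\<mu>0}. \<Sum>\<nu>\<in>{1..<\<mu>}. f \<nu> \<mu>) +
     ((\<Sum>\<nu>\<in>{1..<\<mu>0}. f \<nu> \<mu>0) + (\<Sum>\<mu>\<in>{\<mu>0<..k}. \<Sum>\<nu>\<in>{1..<\<mu>}. f \<nu> \<mu>))"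
    unfolding split by (subst sum.union_disjoint; auto)
  also have "\<dots> = (\<Sum>\<nu>\<in>{1..<\<mu>0}. f \<mu>0 \<nu>) + (\<Sum>\<nu>\<in>{\<mu>0<..k}. f \<mu>0 \<nu>)"
  proof -
    have "(\<Sum>\<mu>\<in>{1..<\<mu>0}. \<Sum>\<nu>\<in>{1..<\<mu>}. f \<nu> \<mu>) = 0" by (rule sum.neutral, rule ballI, rule lt)
    moreover have "(\<Sum>\<nu>\<in>{1..<\<mu>0}. f \<nu> \<mu>0) = (\<Sum>\<nu>\<in>{1..<\<mu>0}. f \<mu>0 \<nu>)"
      using \<mu>0 by (intro sum.cong refl sym) auto
    moreover have "(\<Sum>\<mu>\<in>{\<mu>0<..k}. \<Sum>\<nu>\<in>{1..<\<mu>}. f \<nu> \<mu>) = (\<Sum>\<mu>\<in>{\<mu>0<..k}. f \<mu>0 \<mu>)"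
      using gt by (rule sum.cong[OF refl])
    ultimately show ?thesis by simp
  qed
  also have "\<dots> = (\<Sum>\<nu>\<in>{1..k} - {\<mu>0}. f \<mu>0 \<nu>)"
    unfolding split' by (subst sum.union_disjoint; auto)
  finally show ?thesis .
qed

context pseudo_riemannian_manifold
begin

text \<open>Splitting the inner field under \<nabla> requires both summands to be smooth near
  \<open>p\<close>, since the rules of a connection hold for smooth fields only. The comparison term
  is written with zero contorsion, the form in which it enters the action of the metric
  alone.\<close>

lemma curvature_contorsion:
  assumes T: "tensor_field12 A T" and U: "open U" "p \<in> U"
    and X: "smooth_field A U X" and Y: "smooth_field A U Y" and Z: "smooth_field A U Z"
  shows "curvature A (add_contorsion \<nabla> T) X Y Z p = curvature A (add_contorsion \<nabla> (\<lambda>p u v. 0)) X Y Z p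
    + (\<nabla> p (Y p) (\<lambda>q. T q (X q) (Z q)) - \<nabla> p (X p) (\<lambda>q. T q (Y q) (Z q))
    + T p (Y p) (\<nabla> p (X p) Z) - T p (X p) (\<nabla> p (Y p) Z) + T p (lie_bracket A X Y p) (Z p)
    + T p (Y p) (T p (X p) (Z p)) - T p (X p) (T p (Y p) (Z p)))"
proof -
  have Ts: "smooth_field A U (\<lambda>q. T q (V q) (W q))" if "smooth_field A U V" "smooth_field A U W" for V W
    using T U(1) that unfolding tensor_field12_def by blast
  have bil: "bilinear (T p)" using T by (simp add: tensor_field12_def)
  have nab: "\<nabla> p v (\<lambda>q. \<nabla> q (V q) Z + T q (V q) (Z q)) = \<nabla> p v (\<lambda>q. \<nabla> q (V q) Z) + \<nabla> p v (\<lambda>q. T q (V q) (Z q))"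
    if "smooth_field A U V" for v V
    using smooth_nabla[OF U(1) that Z] Ts[OF that Z] by (rule nabla_add[OF U])
  show ?thesis
    unfolding curvature_def add_contorsion_def nab[OF X] nab[OF Y] bilinear_radd[OF bil]
    by (simp add: algebra_simps)
qed

text \<open>With contorsion the two orders of the fields may contribute differently, so their sum is
  the unit of comparison.\<close>

definition curv_pair :: "('m, 'n) tensor12 \<Rightarrow> ('m \<Rightarrow> real^'n) \<Rightarrow> ('m \<Rightarrow> real^'n) \<Rightarrow> 'm \<Rightarrow> real" where
  "curv_pair T X Y p = g p (curvature A (add_contorsion \<nabla> T) X Y X p) (Y p)
     + g p (curvature A (add_contorsion \<nabla> T) Y X Y p) (X p)"

lemma curv_pair_sym: "curv_pair T X Y p = curv_pair T Y X p"
  by (simp add: curv_pair_def)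

lemma nabla_g:
  assumes "open U" "p \<in> U" "smooth_field A U Y" "smooth_field A U Z"
  shows "g p (\<nabla> p v Y) (Z p) = dir_deriv A p v (\<lambda>q. g q (Y q) (Z q)) - g p (Y p) (\<nabla> p v Z)"
  using nabla_metric[OF assms] by simp

lemma nabla_g_orthogonal:
  assumes U: "open U" "p \<in> U" "smooth_field A U Y" "smooth_field A U Z" and "\<And>q. q \<in> U \<Longrightarrow> g q (Y q) (Z q) = 0"
  shows "g p (\<nabla> p v Y) (Z p) = - g p (Y p) (\<nabla> p v Z)"
  unfolding nabla_g[OF U] using dir_deriv_local[OF U(1,2) assms(5)] by simp

lemma nabla_zero:
  assumes "open U" "p \<in> U" "smooth_field A U Y" "\<And>q. q \<in> U \<Longrightarrow> Y q = 0"
  shows "\<nabla> p v Y = 0"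
proof -
  have "\<nabla> p v Y = \<nabla> p v (\<lambda>q. 0 *\<^sub>R Y q)"
    using assms(4) by (intro nabla_local[OF assms(1,2,3)]) auto
  also have "\<dots> = 0" using nabla_scaleR[OF assms(1,2) smooth_fun_const[OF assms(1)] assms(3), of v 0] by simp
  finally show ?thesis .
qed

text \<open>In the sum of both orders all terms linear in \<open>T\<close> cancel: by total symmetry
  the derivatives of the cubic form, and the terms containing \<nabla> of the fields, occur with
  opposite signs. The quadratic terms of the two orders are equal, whence the factor 2.\<close>

lemma curv_pair_statistical:
  assumes T: "statistical A g T" and U: "open U" "p \<in> U"
    and X: "smooth_field A U X" and Y: "smooth_field A U Y"
  shows "curv_pair T X Y p = curv_pair (\<lambda>p u v. 0) X Y p
    + 2 * (g p (T p (X p) (X p)) (T p (Y p) (Y p)) - g p (T p (X p) (Y p)) (T p (X p) (Y p)))"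
proof -
  have tf: "tensor_field12 A T" and s1: "g q (T q u v) w = g q (T q v u) w" and s2: "g q (T q u v) w = g q (T q u w) v" for q u v w
    using T unfolding statistical_def by blast+
  have Ts: "smooth_field A U (\<lambda>q. T q (V q) (W q))" if "smooth_field A U V" "smooth_field A U W" for V W
    using tf U(1) that unfolding tensor_field12_def by blast
  have bil: "bilinear (T p)" using tf by (simp add: tensor_field12_def)
  define C where "C u v w = g p (T p u v) w" for u v w
  have C1: "C u v w = C v u w" and C2: "C u v w = C u w v" for u v w
    unfolding C_def using s1 s2 by auto
  let ?x = "X p" and ?y = "Y p" and ?T = "T p"
  \<comment> \<open>Derivatives of the cubic form at (X, Y, Y) and at (X, X, Y); by symmetry each of
    them turns up in both orders.\<close>
  define dX where "dX = dir_deriv A p ?x (\<lambda>q. g q (T q (Y q) (X q)) (Y q))"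
  define dY where "dY = dir_deriv A p ?y (\<lambda>q. g q (T q (X q) (X q)) (Y q))"
  have m1: "g p (\<nabla> p ?y (\<lambda>q. T q (X q) (X q))) ?y = dY - C ?x ?x (\<nabla> p ?y Y)"
    unfolding dY_def C_def using nabla_g[OF U Ts[OF X X] Y] .
  have m2: "g p (\<nabla> p ?x (\<lambda>q. T q (Y q) (X q))) ?y = dX - C ?y ?x (\<nabla> p ?x Y)"
    unfolding dX_def C_def using nabla_g[OF U Ts[OF Y X] Y] .
  have "(\<lambda>q. g q (T q (Y q) (Y q)) (X q)) = (\<lambda>q. g q (T q (Y q) (X q)) (Y q))"
    by (rule ext) (rule s2)
  then have m3: "g p (\<nabla> p ?x (\<lambda>q. T q (Y q) (Y q))) ?x = dX - C ?y ?y (\<nabla> p ?x X)"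
    unfolding dX_def C_def using nabla_g[OF U Ts[OF Y Y] X, of ?x] by simp
  have "(\<lambda>q. g q (T q (X q) (Y q)) (X q)) = (\<lambda>q. g q (T q (X q) (X q)) (Y q))"
    by (rule ext) (rule s2)
  then have m4: "g p (\<nabla> p ?y (\<lambda>q. T q (X q) (Y q))) ?x = dY - C ?x ?y (\<nabla> p ?y X)"
    unfolding dY_def C_def using nabla_g[OF U Ts[OF X Y] X, of ?y] by simp
  have br: "lie_bracket A X Y p = \<nabla> p ?x Y - \<nabla> p ?y X" "lie_bracket A Y X p = \<nabla> p ?y X - \<nabla> p ?x Y"
    using nabla_torsion[OF U] X Y by auto
  have Cd: "C (u - u') v w = C u v w - C u' v w" for u u' v w
    unfolding C_def by (simp add: bilinear_lsub[OF bil] g_linear)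
  have fold: "g p (?T u v) w = C u v w" for u v w by (simp add: C_def)
  have e1: "g p (curvature A (add_contorsion \<nabla> T) X Y X p) ?y - g p (curvature A (add_contorsion \<nabla> (\<lambda>p u v. 0)) X Y X p) ?y
    = (dY - C ?x ?x (\<nabla> p ?y Y)) - (dX - C ?y ?x (\<nabla> p ?x Y)) + C ?y (\<nabla> p ?x X) ?y - C ?x (\<nabla> p ?y X) ?y
     + (C (\<nabla> p ?x Y) ?x ?y - C (\<nabla> p ?y X) ?x ?y) + C ?y (?T ?x ?x) ?y - C ?x (?T ?y ?x) ?y"
    unfolding curvature_contorsion[OF tf U X Y X] br by (simp only: g_linear m1 m2 fold Cd)
  have e2: "g p (curvature A (add_contorsion \<nabla> T) Y X Y p) ?x - g p (curvature A (add_contorsion \<nabla> (\<lambda>p u v. 0)) Y X Y p) ?x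
    = (dX - C ?y ?y (\<nabla> p ?x X)) - (dY - C ?x ?y (\<nabla> p ?y X)) + C ?x (\<nabla> p ?y Y) ?x - C ?y (\<nabla> p ?x Y) ?x
     + (C (\<nabla> p ?y X) ?y ?x - C (\<nabla> p ?x Y) ?y ?x) + C ?x (?T ?y ?y) ?x - C ?y (?T ?x ?y) ?x"
    unfolding curvature_contorsion[OF tf U Y X Y] br by (simp only: g_linear m3 m4 fold Cd)
  have "?T ?y ?x = ?T ?x ?y" by (rule g_eqI[of p]) (rule s1)
  then have q: "C ?x (?T ?y ?x) ?y = C ?x ?y (?T ?x ?y)" "C ?y (?T ?x ?y) ?x = C ?x ?y (?T ?x ?y)"
    "C ?y (?T ?x ?x) ?y = C ?y ?y (?T ?x ?x)" "C ?x (?T ?y ?y) ?x = C ?x ?x (?T ?y ?y)"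
    using C1 C2 by metis+
  have q': "C ?y ?y (?T ?x ?x) = C ?x ?x (?T ?y ?y)" unfolding C_def by (rule g_sym)
  have r: "C ?x (\<nabla> p ?y Y) ?x = C ?x ?x (\<nabla> p ?y Y)" "C ?y (\<nabla> p ?x X) ?y = C ?y ?y (\<nabla> p ?x X)"
    "C ?y (\<nabla> p ?x Y) ?x = C ?y ?x (\<nabla> p ?x Y)" "C ?x (\<nabla> p ?y X) ?y = C ?x ?y (\<nabla> p ?y X)"
    by (rule C2)+
  have s: "C (\<nabla> p ?x Y) ?y ?x = C (\<nabla> p ?x Y) ?x ?y" "C (\<nabla> p ?y X) ?y ?x = C (\<nabla> p ?y X) ?x ?y"
    by (rule C2)+
  show ?thesis
    using e1 e2 unfolding q q' r s curv_pair_def by (simp add: C_def)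
qed

end

context adapted_manifold
begin

lemma mixed_scalar_curvature_pairs:
  "mixed_scalar_curvature A k n D g T p = (let E = frame_at A k n D g p in
    (1/2) * (\<Sum>\<mu>\<in>{1..k}. \<Sum>\<nu>\<in>{1..<\<mu>}. \<Sum>a\<in>{1..n \<nu>}. \<Sum>b\<in>{1..n \<mu>}.
      g p (E \<nu> a p) (E \<nu> a p) * g p (E \<mu> b p) (E \<mu> b p) * curv_pair T (E \<nu> a) (E \<mu> b) p))"
  unfolding mixed_scalar_curvature_def Let_def curv_pair_def ..

text \<open>The quadratic form Q of the overview. It takes vectors at one point instead of local
  fields, so that any adapted orthonormal basis can be inserted.\<close>

definition quad :: "('m, 'n) tensor12 \<Rightarrow> 'm \<Rightarrow> (nat \<Rightarrow> nat \<Rightarrow> real^'n) \<Rightarrow> real" where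
  "quad S p e = (\<Sum>\<mu>\<in>{1..k}. \<Sum>\<nu>\<in>{1..<\<mu>}. \<Sum>a\<in>{1..n \<nu>}. \<Sum>b\<in>{1..n \<mu>}.
     g p (e \<nu> a) (e \<nu> a) * g p (e \<mu> b) (e \<mu> b) *
     (g p (S p (e \<nu> a) (e \<nu> a)) (S p (e \<mu> b) (e \<mu> b)) - g p (S p (e \<nu> a) (e \<mu> b)) (S p (e \<nu> a) (e \<mu> b))))"

text \<open>With one vector fixed, the summand is the diagonal of a bilinear form in the other, so
  the two traces can change their bases in turn.\<close>

lemma quad_frame_independent:
  assumes e: "ortho_basis p e" and e': "ortho_basis p e'" and S: "bilinear (S p)"
  shows "quad S p e = quad S p e'"
proof -
  let ?q = "\<lambda>u w. g p (S p u u) (S p w w) - g p (S p u w) (S p u w)"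
  have lin: "linear (\<lambda>u. g p (S p u v) z)" "linear (\<lambda>u. g p (S p v u) z)" "linear (\<lambda>u. g p z (S p u v))" "linear (\<lambda>u. g p z (S p v u))" for v z
    by (auto intro!: linearI simp: bilinear_ladd[OF S] bilinear_radd[OF S] bilinear_lmul[OF S] bilinear_rmul[OF S] g_linear)
  have swap: "(\<Sum>a\<in>{1..n \<nu>}. g p (e \<nu> a) (e \<nu> a) * ?q (e \<nu> a) w) = (\<Sum>a\<in>{1..n \<nu>}. g p (e' \<nu> a) (e' \<nu> a) * ?q (e' \<nu> a) w)"
    if "\<nu> \<in> {1..k}" for \<nu> w
    using trace_frame_independent[OF e e' that, of "\<lambda>u v. g p (S p u v) (S p w w) - g p (S p u w) (S p v w)"]
    by (simp add: linear_compose_sub lin)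
  have swap': "(\<Sum>b\<in>{1..n \<nu>}. g p (e \<nu> b) (e \<nu> b) * ?q w (e \<nu> b)) = (\<Sum>b\<in>{1..n \<nu>}. g p (e' \<nu> b) (e' \<nu> b) * ?q w (e' \<nu> b))"
    if "\<nu> \<in> {1..k}" for \<nu> w
    using trace_frame_independent[OF e e' that, of "\<lambda>u v. g p (S p w w) (S p u v) - g p (S p w u) (S p w v)"]
    by (simp add: linear_compose_sub lin)
  have "(\<Sum>a\<in>{1..n \<nu>}. \<Sum>b\<in>{1..n \<mu>}. g p (e \<nu> a) (e \<nu> a) * g p (e \<mu> b) (e \<mu> b) * ?q (e \<nu> a) (e \<mu> b))
     = (\<Sum>a\<in>{1..n \<nu>}. \<Sum>b\<in>{1..n \<mu>}. g p (e' \<nu> a) (e' \<nu> a) * g p (e' \<mu> b) (e' \<mu> b) * ?q (e' \<nu> a) (e' \<mu> b))"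
    if \<nu>: "\<nu> \<in> {1..k}" and \<mu>: "\<mu> \<in> {1..k}" for \<mu> \<nu>
  proof -
    have "(\<Sum>a\<in>{1..n \<nu>}. \<Sum>b\<in>{1..n \<mu>}. g p (e \<nu> a) (e \<nu> a) * g p (e \<mu> b) (e \<mu> b) * ?q (e \<nu> a) (e \<mu> b))
      = (\<Sum>b\<in>{1..n \<mu>}. \<Sum>a\<in>{1..n \<nu>}. g p (e \<nu> a) (e \<nu> a) * g p (e \<mu> b) (e \<mu> b) * ?q (e \<nu> a) (e \<mu> b))"
      by (rule sum.swap)
    also have "\<dots> = (\<Sum>b\<in>{1..n \<mu>}. g p (e \<mu> b) (e \<mu> b) * (\<Sum>a\<in>{1..n \<nu>}. g p (e \<nu> a) (e \<nu> a) * ?q (e \<nu> a) (e \<mu> b)))"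
      unfolding sum_distrib_left by (intro sum.cong refl) (simp only: mult_ac)
    also have "\<dots> = (\<Sum>b\<in>{1..n \<mu>}. g p (e \<mu> b) (e \<mu> b) * (\<Sum>a\<in>{1..n \<nu>}. g p (e' \<nu> a) (e' \<nu> a) * ?q (e' \<nu> a) (e \<mu> b)))"
      by (simp only: swap[OF \<nu>])
    also have "\<dots> = (\<Sum>b\<in>{1..n \<mu>}. \<Sum>a\<in>{1..n \<nu>}. g p (e' \<nu> a) (e' \<nu> a) * (g p (e \<mu> b) (e \<mu> b) * ?q (e' \<nu> a) (e \<mu> b)))"
      unfolding sum_distrib_left by (intro sum.cong refl) (simp only: mult_ac)
    also have "\<dots> = (\<Sum>a\<in>{1..n \<nu>}. \<Sum>b\<in>{1..n \<mu>}. g p (e' \<nu> a) (e' \<nu> a) * (g p (e \<mu> b) (e \<mu> b) * ?q (e' \<nu> a) (e \<mu> b)))"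
      by (rule sum.swap)
    also have "\<dots> = (\<Sum>a\<in>{1..n \<nu>}. g p (e' \<nu> a) (e' \<nu> a) * (\<Sum>b\<in>{1..n \<mu>}. g p (e \<mu> b) (e \<mu> b) * ?q (e' \<nu> a) (e \<mu> b)))"
      unfolding sum_distrib_left ..
    also have "\<dots> = (\<Sum>a\<in>{1..n \<nu>}. g p (e' \<nu> a) (e' \<nu> a) * (\<Sum>b\<in>{1..n \<mu>}. g p (e' \<mu> b) (e' \<mu> b) * ?q (e' \<nu> a) (e' \<mu> b)))"
      by (simp only: swap'[OF \<mu>])
    also have "\<dots> = (\<Sum>a\<in>{1..n \<nu>}. \<Sum>b\<in>{1..n \<mu>}. g p (e' \<nu> a) (e' \<nu> a) * g p (e' \<mu> b) (e' \<mu> b) * ?q (e' \<nu> a) (e' \<mu> b))"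
      unfolding sum_distrib_left by (intro sum.cong refl) (simp only: mult_ac)
    finally show ?thesis .
  qed
  then show ?thesis unfolding quad_def by (rule_tac sum.cong[OF refl], rule_tac sum.cong[OF refl]) auto
qed

lemma mixed_scalar_curvature_statistical:
  assumes S: "statistical A g S" and e: "ortho_basis p e"
  shows "mixed_scalar_curvature A k n D g S p = mixed_scalar_curvature A k n D g (\<lambda>p u v. 0) p + quad S p e"
proof -
  define E where "E = frame_at A k n D g p"
  obtain U where U: "open U" "p \<in> U" "adapted_frame A k n D g U E"
    using frame_at_adapted unfolding E_def by blast
  have "bilinear (S p)" using S by (simp add: statistical_def tensor_field12_def)
  then have q: "quad S p e = quad S p (\<lambda>\<mu> a. E \<mu> a p)"
    using quad_frame_independent[OF e adapted_frame_basis[OF U(3,2)]] by blast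
  have "(\<Sum>\<mu>\<in>{1..k}. \<Sum>\<nu>\<in>{1..<\<mu>}. \<Sum>a\<in>{1..n \<nu>}. \<Sum>b\<in>{1..n \<mu>}.
      g p (E \<nu> a p) (E \<nu> a p) * g p (E \<mu> b p) (E \<mu> b p) * curv_pair S (E \<nu> a) (E \<mu> b) p)
    = (\<Sum>\<mu>\<in>{1..k}. \<Sum>\<nu>\<in>{1..<\<mu>}. \<Sum>a\<in>{1..n \<nu>}. \<Sum>b\<in>{1..n \<mu>}.
      g p (E \<nu> a p) (E \<nu> a p) * g p (E \<mu> b p) (E \<mu> b p) * curv_pair (\<lambda>p u v. 0) (E \<nu> a) (E \<mu> b) p
      + 2 * (g p (E \<nu> a p) (E \<nu> a p) * g p (E \<mu> b p) (E \<mu> b p) *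
       (g p (S p (E \<nu> a p) (E \<nu> a p)) (S p (E \<mu> b p) (E \<mu> b p)) - g p (S p (E \<nu> a p) (E \<mu> b p)) (S p (E \<nu> a p) (E \<mu> b p)))))"
  proof (intro sum.cong refl)
    fix \<mu> \<nu> a b assume *: "\<mu> \<in> {1..k}" "\<nu> \<in> {1..<\<mu>}" "a \<in> {1..n \<nu>}" "b \<in> {1..n \<mu>}"
    then have X: "smooth_field A U (E \<nu> a)" and Y: "smooth_field A U (E \<mu> b)"
      using adapted_frame_smooth[OF U(3)] by auto
    show "g p (E \<nu> a p) (E \<nu> a p) * g p (E \<mu> b p) (E \<mu> b p) * curv_pair S (E \<nu> a) (E \<mu> b) p
      = g p (E \<nu> a p) (E \<nu> a p) * g p (E \<mu> b p) (E \<mu> b p) * curv_pair (\<lambda>p u v. 0) (E \<nu> a) (E \<mu> b) p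
      + 2 * (g p (E \<nu> a p) (E \<nu> a p) * g p (E \<mu> b p) (E \<mu> b p) *
       (g p (S p (E \<nu> a p) (E \<nu> a p)) (S p (E \<mu> b p) (E \<mu> b p)) - g p (S p (E \<nu> a p) (E \<mu> b p)) (S p (E \<nu> a p) (E \<mu> b p))))"
      unfolding curv_pair_statistical[OF S U(1,2) X Y] by (simp add: algebra_simps)
  qed
  then show ?thesis
    unfolding mixed_scalar_curvature_pairs Let_def E_def[symmetric] q unfolding quad_def
    by (simp add: sum.distrib sum_distrib_left[symmetric])
qed

text \<open>No metric occurs: the property persists when \<open>g\<close> is replaced by another
  adapted metric, whereas symmetry of the lowered tensor may be lost.\<close>

definition tensor_along :: "nat \<Rightarrow> ('m, 'n) tensor12 \<Rightarrow> bool" where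
  "tensor_along \<mu>0 T \<longleftrightarrow> (\<forall>p u v. T p u v \<in> D \<mu>0 p \<and> T p u v = T p v u) \<and>
     (\<forall>p. \<forall>\<nu>\<in>{1..k}. \<nu> \<noteq> \<mu>0 \<longrightarrow> (\<forall>u\<in>D \<nu> p. \<forall>v. T p u v = 0))"

lemma tensor_along_vanish:
  assumes "tensor_along \<mu>0 T" "\<nu> \<in> {1..k}" "\<nu> \<noteq> \<mu>0" "u \<in> D \<nu> p"
  shows "T p u v = 0" "T p v u = 0"
proof -
  show "T p u v = 0" using assms unfolding tensor_along_def by blast
  moreover have "T p v u = T p u v" using assms(1) unfolding tensor_along_def by blast
  ultimately show "T p v u = 0" by simp
qed

text \<open>\<open>T\<close> kills \<open>Y\<close> and takes values orthogonal to \<open>Y\<close>,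
  which removes every quadratic term. What survives is \<open>T\<close> applied to
  \<open>\<nabla> p (Y p) Y\<close>, and the derivative of \<open>T\<close> on \<open>X\<close>,
  \<open>X\<close>, which orthogonality to \<open>Y\<close> shifts onto \<open>Y\<close>.\<close>

lemma curv_pair_along:
  assumes T: "tensor_field12 A T" and al: "tensor_along \<mu>0 T" and U: "open U" "p \<in> U"
    and X: "smooth_field A U X" "\<And>q. q \<in> U \<Longrightarrow> X q \<in> D \<mu>0 q"
    and Y: "smooth_field A U Y" "\<And>q. q \<in> U \<Longrightarrow> Y q \<in> D \<nu> q"
    and \<mu>0: "\<mu>0 \<in> {1..k}" and \<nu>: "\<nu> \<in> {1..k}" "\<nu> \<noteq> \<mu>0"
  shows "curv_pair T X Y p = curv_pair (\<lambda>p u v. 0) X Y p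
    + (g p (T p (X p) (\<nabla> p (Y p) Y)) (X p) - g p (T p (X p) (X p)) (\<nabla> p (Y p) Y))"
proof -
  have TD: "T q u v \<in> D \<mu>0 q" and Tsym: "T q u v = T q v u" for q u v
    using al by (auto simp: tensor_along_def)
  have T0: "T q (Y q) v = 0" "T q v (Y q) = 0" if "q \<in> U" for q v
    using tensor_along_vanish[OF al \<nu> Y(2)[OF that]] by auto
  have Ts: "smooth_field A U (\<lambda>q. T q (V q) (W q))" if "smooth_field A U V" "smooth_field A U W" for V W
    using T U(1) that unfolding tensor_field12_def by blast
  have gTY: "g q (T q u v) (Y q) = 0" if "q \<in> U" for q u v
    using D_orth[OF \<mu>0 \<nu>(1) \<nu>(2)[symmetric] TD Y(2)[OF that]] .
  have z: "\<nabla> p v (\<lambda>q. T q (Y q) (X q)) = 0" "\<nabla> p v (\<lambda>q. T q (X q) (Y q)) = 0" "\<nabla> p v (\<lambda>q. T q (Y q) (Y q)) = 0" for v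
    by (intro nabla_zero[OF U Ts] X Y T0; assumption)+
  have "g p (\<nabla> p (Y p) (\<lambda>q. T q (X q) (X q))) (Y p) = - g p (T p (X p) (X p)) (\<nabla> p (Y p) Y)"
    by (rule nabla_g_orthogonal[OF U Ts[OF X(1) X(1)] Y(1) gTY])
  then show ?thesis
    unfolding curv_pair_def curvature_contorsion[OF T U X(1) Y(1) X(1)] curvature_contorsion[OF T U Y(1) X(1) Y(1)] z
      T0[OF U(2)]
    using T by (simp add: g_linear gTY[OF U(2)] tensor_field12_def bilinear_rzero)
qed

lemma curv_pair_away:
  assumes T: "tensor_field12 A T" and al: "tensor_along \<mu>0 T" and U: "open U" "p \<in> U"
    and X: "smooth_field A U X" "\<And>q. q \<in> U \<Longrightarrow> X q \<in> D \<mu> q"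
    and Y: "smooth_field A U Y" "\<And>q. q \<in> U \<Longrightarrow> Y q \<in> D \<nu> q"
    and \<mu>0: "\<mu>0 \<in> {1..k}" and \<mu>: "\<mu> \<in> {1..k}" "\<mu> \<noteq> \<mu>0" and \<nu>: "\<nu> \<in> {1..k}" "\<nu> \<noteq> \<mu>0"
  shows "curv_pair T X Y p = curv_pair (\<lambda>p u v. 0) X Y p"
proof -
  have TD: "T q u v \<in> D \<mu>0 q" and Tsym: "T q u v = T q v u" for q u v
    using al by (auto simp: tensor_along_def)
  have TY: "T q (Y q) v = 0" "T q v (Y q) = 0" and TX: "T q (X q) v = 0" "T q v (X q) = 0" if "q \<in> U" for q v
    using tensor_along_vanish[OF al \<nu> Y(2)[OF that]] tensor_along_vanish[OF al \<mu> X(2)[OF that]] by auto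
  have Ts: "smooth_field A U (\<lambda>q. T q (V q) (W q))" if "smooth_field A U V" "smooth_field A U W" for V W
    using T U(1) that unfolding tensor_field12_def by blast
  have z: "\<nabla> p v (\<lambda>q. T q (Y q) (X q)) = 0" "\<nabla> p v (\<lambda>q. T q (X q) (Y q)) = 0"
    "\<nabla> p v (\<lambda>q. T q (Y q) (Y q)) = 0" "\<nabla> p v (\<lambda>q. T q (X q) (X q)) = 0" for v
    by (intro nabla_zero[OF U Ts] X Y TY TX; assumption)+
  show ?thesis
    unfolding curv_pair_def curvature_contorsion[OF T U X(1) Y(1) X(1)] curvature_contorsion[OF T U Y(1) X(1) Y(1)] z
      TX[OF U(2)] TY[OF U(2)]
    by simp
qed

text \<open>Only the pairs through \<open>\<mu>0\<close> see \<open>T\<close>. The frame of the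
  definition is retained here because \<open>\<nabla> p (E p \<nu> b p) (E p \<nu> b)\<close> is not
  tensorial in the frame.\<close>

lemma mixed_scalar_curvature_along:
  assumes T: "tensor_field12 A T" and al: "tensor_along \<mu>0 T" and \<mu>0: "\<mu>0 \<in> {1..k}"
  defines "E \<equiv> \<lambda>p. frame_at A k n D g p"
  shows "mixed_scalar_curvature A k n D g T p = mixed_scalar_curvature A k n D g (\<lambda>p u v. 0) p +
    (1/2) * (\<Sum>\<nu>\<in>{1..k} - {\<mu>0}. \<Sum>b\<in>{1..n \<nu>}. g p (E p \<nu> b p) (E p \<nu> b p) *
      (\<Sum>a\<in>{1..n \<mu>0}. g p (E p \<mu>0 a p) (E p \<mu>0 a p) *
        (g p (T p (E p \<mu>0 a p) (\<nabla> p (E p \<nu> b p) (E p \<nu> b))) (E p \<mu>0 a p)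
         - g p (T p (E p \<mu>0 a p) (E p \<mu>0 a p)) (\<nabla> p (E p \<nu> b p) (E p \<nu> b)))))"
proof -
  define F where "F = E p"
  obtain U where U: "open U" "p \<in> U" "adapted_frame A k n D g U F"
    using frame_at_adapted unfolding F_def E_def by blast
  have Fs: "smooth_field A U (F \<mu> a)" and FD: "\<And>q. q \<in> U \<Longrightarrow> F \<mu> a q \<in> D \<mu> q" if "\<mu> \<in> {1..k}" "a \<in> {1..n \<mu>}" for \<mu> a
    using U(3) that by (auto simp: adapted_frame_def)
  let ?d = "\<lambda>\<mu> a. g p (F \<mu> a p) (F \<mu> a p)"
  define f where "f S \<nu> \<mu> = (\<Sum>a\<in>{1..n \<nu>}. \<Sum>b\<in>{1..n \<mu>}. ?d \<nu> a * ?d \<mu> b * curv_pair S (F \<nu> a) (F \<mu> b) p)" for S \<nu> \<mu>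
  have fsym: "f S \<nu> \<mu> = f S \<mu> \<nu>" for S \<mu> \<nu>
    unfolding f_def by (subst sum.swap) (simp add: curv_pair_sym mult_ac)
  have "(\<Sum>\<mu>\<in>{1..k}. \<Sum>\<nu>\<in>{1..<\<mu>}. f T \<nu> \<mu> - f (\<lambda>p u v. 0) \<nu> \<mu>) = (\<Sum>\<nu>\<in>{1..k} - {\<mu>0}. f T \<mu>0 \<nu> - f (\<lambda>p u v. 0) \<mu>0 \<nu>)"
  proof (rule sum_pairs_through[OF _ _ \<mu>0])
    fix \<mu> \<nu> assume *: "\<mu> \<in> {1..k}" "\<nu> \<in> {1..k}" "\<mu> \<noteq> \<mu>0" "\<nu> \<noteq> \<mu>0"
    have "f T \<nu> \<mu> = f (\<lambda>p u v. 0) \<nu> \<mu>"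
      unfolding f_def using * Fs FD
      by (intro sum.cong refl arg_cong2[of _ _ _ _ "(*)"] curv_pair_away[OF T al U(1,2) _ _ _ _ \<mu>0 *(2,4) *(1,3)]) auto
    then show "f T \<nu> \<mu> - f (\<lambda>p u v. 0) \<nu> \<mu> = 0" by simp
  qed (simp_all add: fsym)
  moreover have "f T \<mu>0 \<nu> - f (\<lambda>p u v. 0) \<mu>0 \<nu> = (\<Sum>b\<in>{1..n \<nu>}. ?d \<nu> b * (\<Sum>a\<in>{1..n \<mu>0}. ?d \<mu>0 a *
        (g p (T p (F \<mu>0 a p) (\<nabla> p (F \<nu> b p) (F \<nu> b))) (F \<mu>0 a p)
         - g p (T p (F \<mu>0 a p) (F \<mu>0 a p)) (\<nabla> p (F \<nu> b p) (F \<nu> b)))))"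
    if \<nu>: "\<nu> \<in> {1..k} - {\<mu>0}" for \<nu>
  proof -
    have "f T \<mu>0 \<nu> - f (\<lambda>p u v. 0) \<mu>0 \<nu> = (\<Sum>a\<in>{1..n \<mu>0}. \<Sum>b\<in>{1..n \<nu>}. ?d \<nu> b * (?d \<mu>0 a *
        (g p (T p (F \<mu>0 a p) (\<nabla> p (F \<nu> b p) (F \<nu> b))) (F \<mu>0 a p)
         - g p (T p (F \<mu>0 a p) (F \<mu>0 a p)) (\<nabla> p (F \<nu> b p) (F \<nu> b)))))"
      unfolding f_def sum_subtractf[symmetric]
    proof (intro sum.cong refl)
      fix a b assume "a \<in> {1..n \<mu>0}" "b \<in> {1..n \<nu>}"
      then have cp: "curv_pair T (F \<mu>0 a) (F \<nu> b) p = curv_pair (\<lambda>p u v. 0) (F \<mu>0 a) (F \<nu> b) p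
        + (g p (T p (F \<mu>0 a p) (\<nabla> p (F \<nu> b p) (F \<nu> b))) (F \<mu>0 a p) - g p (T p (F \<mu>0 a p) (F \<mu>0 a p)) (\<nabla> p (F \<nu> b p) (F \<nu> b)))"
        using \<nu> \<mu>0 Fs FD by (intro curv_pair_along[where \<nu>=\<nu>, OF T al U(1,2) _ _ _ _ \<mu>0]) auto
      show "?d \<mu>0 a * ?d \<nu> b * curv_pair T (F \<mu>0 a) (F \<nu> b) p
         - ?d \<mu>0 a * ?d \<nu> b * curv_pair (\<lambda>p u v. 0) (F \<mu>0 a) (F \<nu> b) p
        = ?d \<nu> b * (?d \<mu>0 a * (g p (T p (F \<mu>0 a p) (\<nabla> p (F \<nu> b p) (F \<nu> b))) (F \<mu>0 a p)
         - g p (T p (F \<mu>0 a p) (F \<mu>0 a p)) (\<nabla> p (F \<nu> b p) (F \<nu> b))))"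
        unfolding cp by (simp add: algebra_simps)
    qed
    then show ?thesis by (subst (asm) sum.swap) (simp only: sum_distrib_left)
  qed
  ultimately have "(\<Sum>\<mu>\<in>{1..k}. \<Sum>\<nu>\<in>{1..<\<mu>}. f T \<nu> \<mu>) - (\<Sum>\<mu>\<in>{1..k}. \<Sum>\<nu>\<in>{1..<\<mu>}. f (\<lambda>p u v. 0) \<nu> \<mu>) =
    (\<Sum>\<nu>\<in>{1..k} - {\<mu>0}. \<Sum>b\<in>{1..n \<nu>}. ?d \<nu> b * (\<Sum>a\<in>{1..n \<mu>0}. ?d \<mu>0 a *
        (g p (T p (F \<mu>0 a p) (\<nabla> p (F \<nu> b p) (F \<nu> b))) (F \<mu>0 a p)
         - g p (T p (F \<mu>0 a p) (F \<mu>0 a p)) (\<nabla> p (F \<nu> b p) (F \<nu> b)))))"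
    by (simp add: sum_subtractf)
  then show ?thesis
    unfolding mixed_scalar_curvature_pairs Let_def E_def[symmetric] F_def[symmetric] f_def by simp
qed

subsection \<open>The mean curvature as a divergence\<close>

text \<open>For \<open>X\<close> in \<open>D \<mu>0\<close> this is the pairing of \<open>X\<close>
  with the mean curvature vector: the projector disappears when paired with a vector of
  \<open>D \<mu>0\<close>.\<close>

definition mean_curvature_form :: "nat \<Rightarrow> ('m \<Rightarrow> real^'n) \<Rightarrow> 'm \<Rightarrow> real" where
  "mean_curvature_form \<mu>0 X p = (let E = frame_at A k n D g p in
    \<Sum>\<nu>\<in>{1..k} - {\<mu>0}. \<Sum>b\<in>{1..n \<nu>}. g p (E \<nu> b p) (E \<nu> b p) * g p (X p) (\<nabla> p (E \<nu> b p) (E \<nu> b)))"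

text \<open>The Lie derivative of the metric along \<open>X\<close>, written with the Levi-Civita
  connection.\<close>

definition metric_lie :: "('m \<Rightarrow> real^'n) \<Rightarrow> 'm \<Rightarrow> real^'n \<Rightarrow> real^'n \<Rightarrow> real" where
  "metric_lie X p u v = g p (\<nabla> p u X) v + g p u (\<nabla> p v X)"

lemma metric_lie_same: "metric_lie X p u u = 2 * g p (\<nabla> p u X) u"
  unfolding metric_lie_def using g_sym[of p u "\<nabla> p u X"] by simp

lemma linear_metric_lie:
  assumes "open U" "p \<in> U" "smooth_field A U X"
  shows "linear (\<lambda>u. metric_lie X p u v)" "linear (metric_lie X p u)"
  using linear_add[OF linear_nabla[OF assms]] linear_scale[OF linear_nabla[OF assms]]
  by (auto intro!: linearI simp: metric_lie_def g_linear algebra_simps)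

text \<open>Since \<open>X\<close> is orthogonal to the frame fields E, the pairing \<langle>X,
  \<nabla>_E E\<rangle> equals -\<langle>\<nabla>_E X, E\<rangle>, minus one half of the Lie
  derivative of the metric. This is tensorial in E, so any basis at \<open>p\<close> can replace the
  frame.\<close>

lemma mean_curvature_form_lie:
  assumes U: "open U" "p \<in> U" and X: "smooth_field A U X" "\<And>q. q \<in> U \<Longrightarrow> X q \<in> D \<mu>0 q"
    and \<mu>0: "\<mu>0 \<in> {1..k}" and e: "ortho_basis p e"
  shows "mean_curvature_form \<mu>0 X p = - (1/2) * (\<Sum>\<nu>\<in>{1..k} - {\<mu>0}. \<Sum>b\<in>{1..n \<nu>}.
    g p (e \<nu> b) (e \<nu> b) * metric_lie X p (e \<nu> b) (e \<nu> b))"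
proof -
  define E where "E = frame_at A k n D g p"
  obtain V where V: "open V" "p \<in> V" "adapted_frame A k n D g V E"
    using frame_at_adapted unfolding E_def by blast
  have UV: "open (U \<inter> V)" "p \<in> U \<inter> V" using U V by auto
  have "g p (X p) (\<nabla> p (E \<nu> b p) (E \<nu> b)) = - (1/2) * metric_lie X p (E \<nu> b p) (E \<nu> b p)"
    if "\<nu> \<in> {1..k} - {\<mu>0}" "b \<in> {1..n \<nu>}" for \<nu> b
  proof -
    have "g p (\<nabla> p (E \<nu> b p) X) (E \<nu> b p) = - g p (X p) (\<nabla> p (E \<nu> b p) (E \<nu> b))"
    proof (rule nabla_g_orthogonal[OF UV])
      show "smooth_field A (U \<inter> V) X" "smooth_field A (U \<inter> V) (E \<nu> b)"
        using smooth_field_subset[OF X(1)] smooth_field_subset[OF adapted_frame_smooth[OF V(3)]] that by auto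
      show "g q (X q) (E \<nu> b q) = 0" if "q \<in> U \<inter> V" for q
        using that \<open>\<nu> \<in> {1..k} - {\<mu>0}\<close> \<open>b \<in> {1..n \<nu>}\<close> X(2) V(3) \<mu>0
        by (intro D_orth[of \<mu>0 \<nu>]) (auto simp: adapted_frame_def)
    qed
    then show ?thesis by (simp add: metric_lie_def g_sym[of p "E \<nu> b p"])
  qed
  then have "mean_curvature_form \<mu>0 X p = (\<Sum>\<nu>\<in>{1..k} - {\<mu>0}. \<Sum>b\<in>{1..n \<nu>}.
    g p (E \<nu> b p) (E \<nu> b p) * (- (1/2) * metric_lie X p (E \<nu> b p) (E \<nu> b p)))"
    unfolding mean_curvature_form_def Let_def E_def[symmetric] by (intro sum.cong refl) simp
  also have "\<dots> = - (1/2) * (\<Sum>\<nu>\<in>{1..k} - {\<mu>0}. \<Sum>b\<in>{1..n \<nu>}.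
    g p (E \<nu> b p) (E \<nu> b p) * metric_lie X p (E \<nu> b p) (E \<nu> b p))"
    unfolding sum_distrib_left by (intro sum.cong refl) simp
  also have "(\<Sum>\<nu>\<in>{1..k} - {\<mu>0}. \<Sum>b\<in>{1..n \<nu>}. g p (E \<nu> b p) (E \<nu> b p) * metric_lie X p (E \<nu> b p) (E \<nu> b p))
    = (\<Sum>\<nu>\<in>{1..k} - {\<mu>0}. \<Sum>b\<in>{1..n \<nu>}. g p (e \<nu> b) (e \<nu> b) * metric_lie X p (e \<nu> b) (e \<nu> b))"
  proof (rule sum.cong[OF refl])
    fix \<nu> assume "\<nu> \<in> {1..k} - {\<mu>0}"
    then show "(\<Sum>b\<in>{1..n \<nu>}. g p (E \<nu> b p) (E \<nu> b p) * metric_lie X p (E \<nu> b p) (E \<nu> b p))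
      = (\<Sum>b\<in>{1..n \<nu>}. g p (e \<nu> b) (e \<nu> b) * metric_lie X p (e \<nu> b) (e \<nu> b))"
      using trace_frame_independent[OF adapted_frame_basis[OF V(3,2)] e, of \<nu> "metric_lie X p"] linear_metric_lie[OF U X(1)]
      by simp
  qed
  finally show ?thesis .
qed

text \<open>Removes the connection: apart from \<open>g\<close> only directional derivatives and
  brackets remain, and these operators do not depend on the metric.\<close>

lemma metric_lie_bracket:
  assumes U: "open U" "p \<in> U" and "smooth_field A U X" "smooth_field A U Y" "smooth_field A U Z"
  shows "metric_lie X p (Y p) (Z p) = dir_deriv A p (X p) (\<lambda>q. g q (Y q) (Z q))
    - g p (lie_bracket A X Y p) (Z p) - g p (Y p) (lie_bracket A X Z p)"
  using assms by (simp add: metric_lie_def nabla_metric[OF U] nabla_torsion[OF U] g_linear)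

text \<open>Precomposition with \<open>P\<close>, the projection along \<open>D \<mu>0\<close> onto
  the sum of the other distributions, turns the partial trace into a full one, to which the inverse
  Gram matrix applies. \<open>P\<close> is determined by the splitting, so the same fields
  \<open>Y\<close> serve for every adapted metric.\<close>

lemma mean_curvature_form_coord:
  assumes c: "c \<in> A" and N: "open N" "N \<subseteq> fst c" "p \<in> N"
    and X: "smooth_field A N X" "\<And>q. q \<in> N \<Longrightarrow> X q \<in> D \<mu>0 q" and \<mu>0: "\<mu>0 \<in> {1..k}"
    and Y: "\<And>i. smooth_field A N (Y i)" "\<And>i. Y i p = P (coord_field A c i p)" and P: "linear P"
      "\<And>u. u \<in> D \<mu>0 p \<Longrightarrow> P u = 0" "\<And>\<nu> u. \<nu> \<in> {1..k} \<Longrightarrow> \<nu> \<noteq> \<mu>0 \<Longrightarrow> u \<in> D \<nu> p \<Longrightarrow> P u = u"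
  shows "mean_curvature_form \<mu>0 X p = - (1/2) * (\<Sum>i\<in>UNIV. \<Sum>j\<in>UNIV. matrix_inv (gram c p) $ i $ j *
    (dir_deriv A p (X p) (\<lambda>q. g q (Y i q) (Y j q)) - g p (lie_bracket A X (Y i) p) (Y j p) - g p (Y i p) (lie_bracket A X (Y j) p)))"
proof -
  obtain U E where U: "open U" "p \<in> U" "adapted_frame A k n D g U E" using adapted_frame_exists by blast
  define e where "e = (\<lambda>\<mu> a. E \<mu> a p)"
  have e: "ortho_basis p e" unfolding e_def by (rule adapted_frame_basis[OF U(3,2)])
  let ?B = "\<lambda>u v. metric_lie X p (P u) (P v)"
  note L = linear_metric_lie[OF N(1,3) X(1)]
  have B: "linear (\<lambda>u. ?B u v)" "linear (?B u)" for u v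
    using linear_compose[OF P(1) L(1)] linear_compose[OF P(1) L(2)] by (simp_all add: o_def)
  have "(\<Sum>\<mu>\<in>{1..k}. \<Sum>a\<in>{1..n \<mu>}. g p (e \<mu> a) (e \<mu> a) * ?B (e \<mu> a) (e \<mu> a)) =
     (\<Sum>a\<in>{1..n \<mu>0}. g p (e \<mu>0 a) (e \<mu>0 a) * ?B (e \<mu>0 a) (e \<mu>0 a)) +
     (\<Sum>\<mu>\<in>{1..k} - {\<mu>0}. \<Sum>a\<in>{1..n \<mu>}. g p (e \<mu> a) (e \<mu> a) * ?B (e \<mu> a) (e \<mu> a))"
    using \<mu>0 by (intro sum.remove) auto
  also have "(\<Sum>a\<in>{1..n \<mu>0}. g p (e \<mu>0 a) (e \<mu>0 a) * ?B (e \<mu>0 a) (e \<mu>0 a)) = 0"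
    using P(2)[OF ortho_basis_D[OF e \<mu>0]] linear_0[OF L(2)] by (intro sum.neutral) simp
  also have "(\<Sum>\<mu>\<in>{1..k} - {\<mu>0}. \<Sum>a\<in>{1..n \<mu>}. g p (e \<mu> a) (e \<mu> a) * ?B (e \<mu> a) (e \<mu> a))
     = (\<Sum>\<nu>\<in>{1..k} - {\<mu>0}. \<Sum>b\<in>{1..n \<nu>}. g p (e \<nu> b) (e \<nu> b) * metric_lie X p (e \<nu> b) (e \<nu> b))"
  proof (intro sum.cong refl)
    fix \<mu> a assume "\<mu> \<in> {1..k} - {\<mu>0}" "a \<in> {1..n \<mu>}"
    then have "P (e \<mu> a) = e \<mu> a" using P(3)[OF _ _ ortho_basis_D[OF e]] by auto
    then show "g p (e \<mu> a) (e \<mu> a) * ?B (e \<mu> a) (e \<mu> a) = g p (e \<mu> a) (e \<mu> a) * metric_lie X p (e \<mu> a) (e \<mu> a)" by simp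
  qed
  finally have "mean_curvature_form \<mu>0 X p = - (1/2) * (\<Sum>\<mu>\<in>{1..k}. \<Sum>a\<in>{1..n \<mu>}. g p (e \<mu> a) (e \<mu> a) * ?B (e \<mu> a) (e \<mu> a))"
    using mean_curvature_form_lie[OF N(1,3) X \<mu>0 e] by simp
  also have "\<dots> = - (1/2) * (\<Sum>i\<in>UNIV. \<Sum>j\<in>UNIV. matrix_inv (gram c p) $ i $ j * ?B (coord_field A c i p) (coord_field A c j p))"
    using full_trace_coord[OF e c subsetD[OF N(2,3)] B] by simp
  finally show ?thesis
    unfolding Y(2)[symmetric] by (simp only: metric_lie_bracket[OF N(1,3) X(1) Y(1) Y(1)])
qed

lemma mean_curvature_in_D: "\<mu>0 \<in> {1..k} \<Longrightarrow> mean_curvature A k n D g \<mu>0 p \<in> D \<mu>0 p"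
  and g_mean_curvature: "\<mu>0 \<in> {1..k} \<Longrightarrow> X p \<in> D \<mu>0 p \<Longrightarrow>
    g p (X p) (mean_curvature A k n D g \<mu>0 p) = mean_curvature_form \<mu>0 X p"
proof -
  assume \<mu>0: "\<mu>0 \<in> {1..k}"
  define E where "E = frame_at A k n D g p"
  obtain V where V: "open V" "p \<in> V" "adapted_frame A k n D g V E"
    using frame_at_adapted unfolding E_def by blast
  note e = adapted_frame_basis[OF V(3,2)]
  let ?Q = "orthoprojector g (D \<mu>0) p"
  have Q2: "?Q (v + v) = 2 *\<^sub>R ?Q v" for v
    unfolding orthoprojector_frame[OF e \<mu>0] scaleR_2[symmetric] by (simp add: g_linear scaleR_sum_right mult_ac)
  have H: "mean_curvature A k n D g \<mu>0 p = (\<Sum>\<nu>\<in>{1..k} - {\<mu>0}. \<Sum>b\<in>{1..n \<nu>}. g p (E \<nu> b p) (E \<nu> b p) *\<^sub>R ?Q (\<nabla> p (E \<nu> b p) (E \<nu> b)))"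
    unfolding mean_curvature_def Let_def E_def[symmetric]
    by (intro sum.cong refl) (simp only: Q2, simp)
  have QD: "?Q v \<in> D \<mu>0 p" for v
    unfolding orthoprojector_frame[OF e \<mu>0]
    using ortho_basis_D[OF e \<mu>0] by (intro subspace_sum subspace_scale subspace_D[OF \<mu>0])
  show "mean_curvature A k n D g \<mu>0 p \<in> D \<mu>0 p"
    unfolding H by (intro subspace_sum subspace_scale subspace_D[OF \<mu>0] QD)
  assume X: "X p \<in> D \<mu>0 p"
  have "g p (X p) (?Q v) = g p (X p) v" for v
    using arg_cong[OF D_expansion[OF e \<mu>0 X], of "\<lambda>u. g p u v"]
    by (simp add: orthoprojector_frame[OF e \<mu>0] g_sum_left g_sum_right g_linear g_sym[of p _ v] mult_ac)
  then show "g p (X p) (mean_curvature A k n D g \<mu>0 p) = mean_curvature_form \<mu>0 X p"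
    unfolding H mean_curvature_form_def Let_def E_def[symmetric]
    by (simp add: g_sum_right g_linear)
qed

text \<open>The definition uses a frame chosen for each point. The pairings of the vector with a
  smooth frame of \<open>D \<mu>0\<close> are mean curvature forms, and these can be computed in the
  smooth frame.\<close>

lemma smooth_mean_curvature:
  assumes \<mu>0: "\<mu>0 \<in> {1..k}"
  shows "smooth_field A UNIV (mean_curvature A k n D g \<mu>0)"
proof (rule smooth_field_local)
  fix p
  let ?H = "mean_curvature A k n D g \<mu>0"
  obtain U E where U: "open U" "p \<in> U" "adapted_frame A k n D g U E" using adapted_frame_exists by blast
  have Es: "smooth_field A U (E \<mu> a)" if "\<mu> \<in> {1..k}" "a \<in> {1..n \<mu>}" for \<mu> a
    using adapted_frame_smooth[OF U(3)] that .
  define h where "h a q = - (\<Sum>\<nu>\<in>{1..k} - {\<mu>0}. \<Sum>b\<in>{1..n \<nu>}. g q (E \<nu> b q) (E \<nu> b q) * g q (\<nabla> q (E \<nu> b q) (E \<mu>0 a)) (E \<nu> b q))" for a q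
  have hs: "smooth_fun A U (h a)" if "a \<in> {1..n \<mu>0}" for a
  proof -
    have "smooth_fun A U (\<lambda>q. 0 - (\<Sum>\<nu>\<in>{1..k} - {\<mu>0}. \<Sum>b\<in>{1..n \<nu>}. g q (E \<nu> b q) (E \<nu> b q) * g q (\<nabla> q (E \<nu> b q) (E \<mu>0 a)) (E \<nu> b q)))"
      by (intro smooth_fun_diff smooth_fun_const smooth_fun_sum smooth_fun_mult smooth_g smooth_nabla U(1) Es \<mu>0 that) auto
    then show ?thesis by (simp add: h_def[abs_def])
  qed
  have "smooth_field A U (\<lambda>q. \<Sum>a\<in>{1..n \<mu>0}. (g q (E \<mu>0 a q) (E \<mu>0 a q) * h a q) *\<^sub>R E \<mu>0 a q)"
    by (intro smooth_field_sum smooth_field_scaleR smooth_fun_mult smooth_g U(1) Es \<mu>0 hs)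
  then have "smooth_field A U ?H"
  proof (rule smooth_field_cong[OF U(1), rotated])
    fix q assume q: "q \<in> U"
    note e = adapted_frame_basis[OF U(3) q]
    have "g q (?H q) (E \<mu>0 a q) = h a q" if a: "a \<in> {1..n \<mu>0}" for a
    proof -
      have D: "E \<mu>0 a r \<in> D \<mu>0 r" if "r \<in> U" for r using U(3) a \<mu>0 that by (auto simp: adapted_frame_def)
      have "g q (?H q) (E \<mu>0 a q) = mean_curvature_form \<mu>0 (E \<mu>0 a) q"
        using g_mean_curvature[OF \<mu>0, of "E \<mu>0 a" q] D[OF q] by (simp add: g_sym)
      also have "\<dots> = - (1/2) * (\<Sum>\<nu>\<in>{1..k} - {\<mu>0}. \<Sum>b\<in>{1..n \<nu>}.
        g q (E \<nu> b q) (E \<nu> b q) * metric_lie (E \<mu>0 a) q (E \<nu> b q) (E \<nu> b q))"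
        by (rule mean_curvature_form_lie[OF U(1) q Es[OF \<mu>0 a] D \<mu>0 e])
      also have "\<dots> = h a q"
        unfolding h_def metric_lie_same sum_distrib_left sum_negf[symmetric]
        by (intro sum.cong refl) simp
      finally show ?thesis .
    qed
    then have "(\<Sum>a\<in>{1..n \<mu>0}. (g q (E \<mu>0 a q) (E \<mu>0 a q) * h a q) *\<^sub>R E \<mu>0 a q) =
      (\<Sum>a\<in>{1..n \<mu>0}. (g q (E \<mu>0 a q) (E \<mu>0 a q) * g q (?H q) (E \<mu>0 a q)) *\<^sub>R E \<mu>0 a q)"
      by (intro sum.cong refl) simp
    also have "\<dots> = ?H q" using D_expansion[OF e \<mu>0 mean_curvature_in_D[OF \<mu>0]] by simp
    finally show "(\<Sum>a\<in>{1..n \<mu>0}. (g q (E \<mu>0 a q) (E \<mu>0 a q) * h a q) *\<^sub>R E \<mu>0 a q) = ?H q" .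
  qed
  then show "\<exists>N. open N \<and> p \<in> N \<and> smooth_field A N ?H" using U by blast
qed

end

section \<open>The Riemannian measure\<close>

text \<open>The change of variables formula of the library needs a well-ordered index type; a copy of
  an arbitrary finite index type carries such an order.\<close>

typedef 'a ordered_copy = "UNIV :: 'a set" by simp

instance ordered_copy :: (finite) finite
proof
  have "(UNIV :: 'a ordered_copy set) = Abs_ordered_copy ` UNIV"
    by (metis Rep_ordered_copy_inverse UNIV_I UNIV_eq_I image_eqI)
  then show "finite (UNIV :: 'a ordered_copy set)" by (metis finite finite_imageI)
qed

instantiation ordered_copy :: (finite) wellorder
begin

definition less_eq_ordered_copy :: "'a ordered_copy \<Rightarrow> 'a ordered_copy \<Rightarrow> bool" where
  "x \<le> y \<longleftrightarrow> to_nat_on UNIV (Rep_ordered_copy x) \<le> to_nat_on UNIV (Rep_ordered_copy y)"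

definition less_ordered_copy :: "'a ordered_copy \<Rightarrow> 'a ordered_copy \<Rightarrow> bool" where
  "x < y \<longleftrightarrow> to_nat_on UNIV (Rep_ordered_copy x) < to_nat_on UNIV (Rep_ordered_copy y)"

instance
proof
  fix x y z :: "'a ordered_copy"
  show "x < y \<longleftrightarrow> x \<le> y \<and> \<not> y \<le> x" by (auto simp: less_eq_ordered_copy_def less_ordered_copy_def)
  show "x \<le> x" by (simp add: less_eq_ordered_copy_def)
  show "x \<le> y \<Longrightarrow> y \<le> z \<Longrightarrow> x \<le> z" by (simp add: less_eq_ordered_copy_def)
  show "x \<le> y \<or> y \<le> x" by (auto simp: less_eq_ordered_copy_def)
  have inj: "inj_on (to_nat_on (UNIV :: 'a set)) UNIV" by (intro inj_on_to_nat_on countable_finite) simp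
  show "x = y" if "x \<le> y" "y \<le> x"
  proof -
    have "to_nat_on UNIV (Rep_ordered_copy x) = to_nat_on UNIV (Rep_ordered_copy y)"
      using that by (simp add: less_eq_ordered_copy_def)
    then show ?thesis using inj by (auto simp: inj_on_def Rep_ordered_copy_inject)
  qed
next
  fix P :: "'a ordered_copy \<Rightarrow> bool" and a
  assume step: "\<And>x. (\<And>y. y < x \<Longrightarrow> P y) \<Longrightarrow> P x"
  show "P a"
    by (induction a rule: measure_induct_rule[of "\<lambda>x. to_nat_on UNIV (Rep_ordered_copy x)"])
       (rule step, simp add: less_ordered_copy_def)
qed

end

lemma Abs_Rep_ordered_copy [simp]: "Rep_ordered_copy (Abs_ordered_copy a) = a"
  by (simp add: Abs_ordered_copy_inverse)

lemma bij_Rep_ordered_copy: "bij Rep_ordered_copy"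
  by (metis Abs_Rep_ordered_copy Rep_ordered_copy_inverse bijI')

definition relabel :: "real^'n::finite \<Rightarrow> real^'n ordered_copy" where
  "relabel x = (\<chi> i. x $ Rep_ordered_copy i)"

definition unlabel :: "real^'n::finite ordered_copy \<Rightarrow> real^'n" where
  "unlabel y = (\<chi> i. y $ Abs_ordered_copy i)"

lemma unlabel_relabel [simp]: "unlabel (relabel x) = x" and relabel_unlabel [simp]: "relabel (unlabel y) = y"
  by (simp_all add: relabel_def unlabel_def vec_eq_iff Rep_ordered_copy_inverse)

lemma bounded_linear_relabel: "bounded_linear relabel" and bounded_linear_unlabel: "bounded_linear unlabel"
  by (auto intro!: linear_conv_bounded_linear[THEN iffD1] linearI simp: relabel_def unlabel_def vec_eq_iff)

lemma borel_measurable_relabel [measurable]: "relabel \<in> borel_measurable borel"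
  and borel_measurable_unlabel [measurable]: "unlabel \<in> borel_measurable borel"
  by (intro borel_measurable_continuous_onI linear_continuous_on bounded_linear_relabel bounded_linear_unlabel)+

lemma prod_Basis_vec: "(\<Prod>b\<in>(Basis :: (real^'n::finite) set). f b) = (\<Prod>i\<in>UNIV. f (axis i 1))"
proof -
  have "(Basis :: (real^'n) set) = range (\<lambda>i. axis i 1)" by (auto simp: Basis_vec_def)
  moreover have "inj (\<lambda>i. axis i 1 :: real^'n)" by (auto simp: inj_def axis_eq_axis)
  ultimately show ?thesis using prod.reindex[of "\<lambda>i. axis i 1 :: real^'n" UNIV f] by (simp only: o_def)
qed

text \<open>Renaming coordinates maps boxes to boxes with the same side lengths, and the measure of
  boxes characterises Lebesgue measure.\<close>

lemma lborel_distr_relabel: "distr lborel borel (relabel :: real^'n::finite \<Rightarrow> _) = lborel"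
proof (rule lborel_eqI[symmetric])
  fix l u :: "real^'n ordered_copy" assume "\<And>b. b \<in> Basis \<Longrightarrow> l \<bullet> b \<le> u \<bullet> b"
  then have le: "l $ i \<le> u $ i" for i using axis_in_Basis_iff[of i "1::real"] by (metis cart_eq_inner_axis axis_in_Basis_iff real_inner_1_right inner_real_def mult_1 Basis_real_def insertI1)
  have vim: "relabel -` box l u = box (unlabel l) (unlabel u)"
  proof (intro set_eqI)
    fix x :: "real^'n"
    have "(\<forall>i. l $ i < x $ Rep_ordered_copy i \<and> x $ Rep_ordered_copy i < u $ i) \<longleftrightarrow>
      (\<forall>j. l $ Abs_ordered_copy j < x $ j \<and> x $ j < u $ Abs_ordered_copy j)"
      by (metis Abs_Rep_ordered_copy Rep_ordered_copy_inverse)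
    then show "x \<in> relabel -` box l u \<longleftrightarrow> x \<in> box (unlabel l) (unlabel u)"
      by (simp add: mem_box_cart relabel_def unlabel_def)
  qed
  have "emeasure (distr lborel borel (relabel :: real^'n \<Rightarrow> _)) (box l u) = emeasure lborel (box (unlabel l) (unlabel u))"
    by (subst emeasure_distr) (auto simp: vim)
  also have "\<dots> = (\<Prod>b\<in>Basis. (unlabel u - unlabel l) \<bullet> b)"
    using le by (intro emeasure_lborel_box) (auto simp: Basis_vec_def inner_axis unlabel_def)
  also have "(\<Prod>b\<in>Basis. (unlabel u - unlabel l) \<bullet> b) = (\<Prod>j\<in>UNIV. u $ Abs_ordered_copy j - l $ Abs_ordered_copy j)"
    by (simp add: prod_Basis_vec inner_axis unlabel_def)
  also have "\<dots> = (\<Prod>i\<in>UNIV. u $ i - l $ i)"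
    by (rule prod.reindex_bij_witness[of _ Rep_ordered_copy Abs_ordered_copy]) (auto simp: Rep_ordered_copy_inverse)
  also have "\<dots> = (\<Prod>b\<in>Basis. (u - l) \<bullet> b)" by (simp add: prod_Basis_vec inner_axis)
  finally show "emeasure (distr lborel borel (relabel :: real^'n \<Rightarrow> _)) (box l u) = (\<Prod>b\<in>Basis. (u - l) \<bullet> b)" .
qed simp

lemma nn_integral_relabel:
  assumes "f \<in> borel_measurable borel"
  shows "(\<integral>\<^sup>+x. f (relabel x) \<partial>lborel) = (\<integral>\<^sup>+y. f y \<partial>lborel)"
proof -
  have "(\<integral>\<^sup>+y. f y \<partial>distr lborel borel relabel) = (\<integral>\<^sup>+x. f (relabel x) \<partial>lborel)"
    using assms by (intro nn_integral_distr) auto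
  then show ?thesis unfolding lborel_distr_relabel by simp
qed

text \<open>Conjugation turns transpositions into transpositions, so the sign is preserved along a
  product of them.\<close>

lemma sign_conjugate:
  fixes f :: "'a::finite \<Rightarrow> 'b::finite"
  assumes f: "bij f" and p: "p permutes UNIV"
  shows "sign (f \<circ> p \<circ> inv f) = sign p"
proof -
  have inv: "inv f (f x) = x" "f (inv f y) = y" for x y
    using f by (simp_all add: bij_is_inj bij_is_surj surj_f_inv_f)
  have perm: "(f \<circ> q \<circ> inv f) permutes UNIV" if "q permutes UNIV" for q
    by (rule bij_imp_permutes, intro bij_comp f bij_imp_bij_inv[OF f] permutes_bij[OF that]) simp
  show ?thesis
    using p
  proof (rule permutes_induct)
    show "sign (f \<circ> id \<circ> inv f) = sign (id :: 'a \<Rightarrow> 'a)"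
    proof -
      have "f \<circ> id \<circ> inv f = id" using inv by (auto simp: fun_eq_iff)
      then show ?thesis by simp
    qed
    fix a b :: 'a and q :: "'a \<Rightarrow> 'a" assume q: "q permutes UNIV" and IH: "sign (f \<circ> q \<circ> inv f) = sign q"
    have "f \<circ> (Transposition.transpose a b \<circ> q) \<circ> inv f = Transposition.transpose (f a) (f b) \<circ> (f \<circ> q \<circ> inv f)"
      using inv by (auto simp: fun_eq_iff Transposition.transpose_def) metis+
    moreover have "permutation q" "permutation (f \<circ> q \<circ> inv f)"
      unfolding permutation_permutes by (rule exI[of _ UNIV], simp add: q perm[OF q])+
    moreover have "f a = f b \<longleftrightarrow> a = b" using f by (meson bij_is_inj inj_eq)
    ultimately show "sign (f \<circ> (Transposition.transpose a b \<circ> q) \<circ> inv f) = sign (Transposition.transpose a b \<circ> q)"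
      using IH by (simp add: sign_compose permutation_swap_id sign_swap_id)
  qed simp_all
qed

text \<open>Conjugation with the renaming matches the permutations of the two index types,
  preserving signs and products.\<close>

lemma det_relabel:
  fixes M :: "real^'n::finite^'n"
  shows "det (\<chi> i j. M $ Rep_ordered_copy i $ Rep_ordered_copy j) = det M"
proof -
  let ?R = "Rep_ordered_copy :: 'n ordered_copy \<Rightarrow> 'n" and ?A = "Abs_ordered_copy :: 'n \<Rightarrow> 'n ordered_copy"
  have invR: "inv ?R = ?A" by (rule inv_equality) (auto simp: Rep_ordered_copy_inverse)
  have invA: "inv ?A = ?R" by (rule inv_equality) (auto simp: Rep_ordered_copy_inverse)
  have bijA: "bij ?A" unfolding invR[symmetric] by (rule bij_imp_bij_inv[OF bij_Rep_ordered_copy])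
  show ?thesis unfolding det_def
  proof (rule sum.reindex_bij_witness[of _ "\<lambda>q. ?A \<circ> q \<circ> ?R" "\<lambda>p. ?R \<circ> p \<circ> ?A"])
    fix p :: "'n ordered_copy \<Rightarrow> 'n ordered_copy" assume p: "p \<in> {p. p permutes UNIV}"
    then have pb: "bij p" by (simp add: permutes_bij)
    show "?A \<circ> (?R \<circ> p \<circ> ?A) \<circ> ?R = p" by (simp add: fun_eq_iff Rep_ordered_copy_inverse)
    show "?R \<circ> p \<circ> ?A \<in> {p. p permutes UNIV}"
      using pb bijA bij_Rep_ordered_copy by (auto intro!: bij_imp_permutes bij_comp)
    have "sign (?R \<circ> p \<circ> ?A) = sign p"
      using sign_conjugate[OF bij_Rep_ordered_copy, of p] p by (simp add: invR)
    moreover have "(\<Prod>i\<in>UNIV. M $ i $ (?R \<circ> p \<circ> ?A) i) = (\<Prod>i\<in>UNIV. (\<chi> i j. M $ ?R i $ ?R j) $ i $ p i)"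
      by (rule prod.reindex_bij_witness[of _ ?R ?A]) (auto simp: Rep_ordered_copy_inverse)
    ultimately show "of_int (sign (?R \<circ> p \<circ> ?A)) * (\<Prod>i\<in>UNIV. M $ i $ (?R \<circ> p \<circ> ?A) i) =
      of_int (sign p) * (\<Prod>i\<in>UNIV. (\<chi> i j. M $ ?R i $ ?R j) $ i $ p i)" by simp
  next
    fix q :: "'n \<Rightarrow> 'n" assume q: "q \<in> {p. p permutes UNIV}"
    then have "bij q" by (simp add: permutes_bij)
    then show "?A \<circ> q \<circ> ?R \<in> {p. p permutes UNIV}"
      using bijA bij_Rep_ordered_copy by (auto intro!: bij_imp_permutes bij_comp)
    show "?R \<circ> (?A \<circ> q \<circ> ?R) \<circ> ?A = q" by (simp add: fun_eq_iff)
  qed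
qed

section \<open>Change of variables for nonnegative integrals\<close>

lemma nn_integral_absolutely_integrable:
  fixes h :: "'a::euclidean_space \<Rightarrow> real"
  assumes m: "(\<lambda>x. indicator S x * h x) \<in> borel_measurable borel" and pos: "\<And>x. x \<in> S \<Longrightarrow> h x \<ge> 0"
  shows "(\<integral>\<^sup>+x\<in>S. ennreal (h x) \<partial>lborel) = (if h absolutely_integrable_on S then ennreal (integral S h) else \<infinity>)"
proof -
  let ?h = "\<lambda>x. indicator S x * h x"
  have eq: "(\<integral>\<^sup>+x\<in>S. ennreal (h x) \<partial>lborel) = (\<integral>\<^sup>+x. ennreal (?h x) \<partial>lborel)"
    by (intro nn_integral_cong) (simp split: split_indicator)
  have iff: "h absolutely_integrable_on S \<longleftrightarrow> integrable lborel ?h"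
    unfolding set_integrable_def using integrable_completion[of ?h lborel] m by simp
  have pos': "?h x \<ge> 0" for x using pos by (simp split: split_indicator)
  show ?thesis
  proof (cases "integrable lborel ?h")
    case True
    then have "integral S h = (LINT x|lebesgue. ?h x)"
      using iff set_lebesgue_integral_eq_integral(2)[of S h] by (simp add: set_lebesgue_integral_def)
    also have "\<dots> = (LINT x|lborel. ?h x)" using m by (intro integral_completion) simp
    finally show ?thesis
      unfolding eq using True iff pos' by (simp add: nn_integral_eq_integral)
  next
    case False
    then have "\<not> (\<integral>\<^sup>+x. ennreal (?h x) \<partial>lborel) < \<infinity>"
      using integrableI_nonneg[of ?h lborel] m pos' by auto
    then show ?thesis unfolding eq using False iff by (simp add: less_top[symmetric])
  qed
qed

text \<open>Absolute integrability and the value of the integral transfer together; \<open>b\<close>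
  is taken once from each side, and if neither side is integrable both nonnegative integrals are
  infinite. The detour through \<open>real^1\<close> fits the vector-valued theorem to a scalar
  integrand.\<close>

lemma nn_integral_change_of_variables_ordered:
  fixes \<phi> :: "real^'n::{finite,wellorder} \<Rightarrow> real^'n::_" and f :: "real^'n::_ \<Rightarrow> real"
  assumes S: "S \<in> sets borel" and der: "\<And>x. x \<in> S \<Longrightarrow> (\<phi> has_derivative \<phi>' x) (at x)"
    and inj: "inj_on \<phi> S"
    and f: "(\<lambda>y. indicator (\<phi> ` S) y * f y) \<in> borel_measurable borel" "\<And>y. y \<in> \<phi> ` S \<Longrightarrow> f y \<ge> 0"
    and h: "(\<lambda>x. indicator S x * (\<bar>det (matrix (\<phi>' x))\<bar> * f (\<phi> x))) \<in> borel_measurable borel"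
  shows "(\<integral>\<^sup>+y\<in>\<phi> ` S. ennreal (f y) \<partial>lborel) = (\<integral>\<^sup>+x\<in>S. ennreal (\<bar>det (matrix (\<phi>' x))\<bar> * f (\<phi> x)) \<partial>lborel)"
proof -
  let ?h = "\<lambda>x. \<bar>det (matrix (\<phi>' x))\<bar> * f (\<phi> x)"
  have eq: "?h absolutely_integrable_on S \<and> integral S ?h = b \<longleftrightarrow> f absolutely_integrable_on (\<phi> ` S) \<and> integral (\<phi> ` S) f = b" for b
    using has_absolute_integral_change_of_variables[of S \<phi> \<phi>' "\<lambda>x. vec (f x) :: real^1" "vec b"]
      S has_derivative_at_withinI[OF der] inj
    by (simp add: absolutely_integrable_on_1_iff integral_on_1_eq)
  show ?thesis
    using nn_integral_absolutely_integrable[OF f] nn_integral_absolutely_integrable[OF h] f(2)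
      eq[of "integral S ?h"] eq[of "integral (\<phi> ` S) f"] by auto
qed

text \<open>Conjugation with \<open>relabel\<close> reduces this to an ordered index type; it
  preserves Lebesgue measure and Jacobian determinants.\<close>

lemma nn_integral_change_of_variables:
  fixes \<phi> :: "real^'n::finite \<Rightarrow> real^'n" and f :: "real^'n \<Rightarrow> real"
  assumes S: "S \<in> sets borel" and der: "\<And>x. x \<in> S \<Longrightarrow> (\<phi> has_derivative \<phi>' x) (at x)"
    and inj: "inj_on \<phi> S"
    and f: "(\<lambda>y. indicator (\<phi> ` S) y * f y) \<in> borel_measurable borel" "\<And>y. y \<in> \<phi> ` S \<Longrightarrow> f y \<ge> 0"
    and h: "(\<lambda>x. indicator S x * (\<bar>det (matrix (\<phi>' x))\<bar> * f (\<phi> x))) \<in> borel_measurable borel"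
  shows "(\<integral>\<^sup>+y\<in>\<phi> ` S. ennreal (f y) \<partial>lborel) = (\<integral>\<^sup>+x\<in>S. ennreal (\<bar>det (matrix (\<phi>' x))\<bar> * f (\<phi> x)) \<partial>lborel)"
proof -
  define S' where "S' = relabel ` S"
  define \<psi> where "\<psi> = relabel \<circ> \<phi> \<circ> unlabel"
  define \<psi>' where "\<psi>' x = relabel \<circ> \<phi>' (unlabel x) \<circ> unlabel" for x
  have S'_eq: "S' = unlabel -` S" unfolding S'_def by (auto simp: image_iff) (metis relabel_unlabel)
  have im: "\<psi> ` S' = unlabel -` (\<phi> ` S)"
    unfolding \<psi>_def S'_def by (auto simp: image_iff) (metis relabel_unlabel)
  have ind: "indicator (unlabel -` B) y = (indicator B (unlabel y) :: real)" for B :: "(real^'n) set" and y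
    by (simp split: split_indicator)
  have det: "det (matrix (\<psi>' x)) = det (matrix (\<phi>' (unlabel x)))" for x
  proof -
    have ax: "unlabel (axis j 1) = axis (Rep_ordered_copy j) 1" for j :: "'n ordered_copy"
      by (auto simp: unlabel_def axis_def vec_eq_iff Rep_ordered_copy_inverse)
    have "matrix (\<psi>' x) = (\<chi> i j. matrix (\<phi>' (unlabel x)) $ Rep_ordered_copy i $ Rep_ordered_copy j)"
      by (simp add: matrix_def \<psi>'_def ax) (simp add: relabel_def)
    then show ?thesis using det_relabel[of "matrix (\<phi>' (unlabel x))"] by simp
  qed
  have "(\<integral>\<^sup>+y\<in>\<psi> ` S'. ennreal (f (unlabel y)) \<partial>lborel) = (\<integral>\<^sup>+x\<in>S'. ennreal (\<bar>det (matrix (\<psi>' x))\<bar> * f (unlabel (\<psi> x))) \<partial>lborel)"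
  proof (rule nn_integral_change_of_variables_ordered)
    show "S' \<in> sets borel" unfolding S'_eq using measurable_sets[OF borel_measurable_unlabel S] by simp
    show "(\<psi> has_derivative \<psi>' x) (at x)" if "x \<in> S'" for x
    proof -
      have "(\<phi> has_derivative \<phi>' (unlabel x)) (at (unlabel x))" using der that by (simp add: S'_eq)
      from has_derivative_compose[OF bounded_linear_imp_has_derivative[OF bounded_linear_unlabel, of "at x"] this]
      have "((\<lambda>x. \<phi> (unlabel x)) has_derivative (\<lambda>v. \<phi>' (unlabel x) (unlabel v))) (at x)" .
      from bounded_linear.has_derivative[OF bounded_linear_relabel this]
      show ?thesis by (simp add: \<psi>_def \<psi>'_def o_def)
    qed
    show "inj_on \<psi> S'"
      using inj unfolding \<psi>_def S'_def by (auto simp: inj_on_def) (metis unlabel_relabel)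
    show "(\<lambda>y. indicator (\<psi> ` S') y * f (unlabel y)) \<in> borel_measurable borel"
      unfolding im ind using measurable_compose[OF borel_measurable_unlabel f(1)] .
    show "f (unlabel y) \<ge> 0" if "y \<in> \<psi> ` S'" for y using that f(2) unfolding im by simp
    have "(\<lambda>x. indicator S' x * (\<bar>det (matrix (\<psi>' x))\<bar> * f (unlabel (\<psi> x))))
       = (\<lambda>x. indicator S (unlabel x) * (\<bar>det (matrix (\<phi>' (unlabel x)))\<bar> * f (\<phi> (unlabel x))))"
      by (simp add: det S'_eq ind \<psi>_def)
    then show "(\<lambda>x. indicator S' x * (\<bar>det (matrix (\<psi>' x))\<bar> * f (unlabel (\<psi> x)))) \<in> borel_measurable borel"
      using measurable_compose[OF borel_measurable_unlabel h] by simp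
  qed
  also have "(\<integral>\<^sup>+y\<in>\<psi> ` S'. ennreal (f (unlabel y)) \<partial>lborel) = (\<integral>\<^sup>+y. ennreal (indicator (\<phi> ` S) (unlabel y) * f (unlabel y)) \<partial>lborel)"
    unfolding im by (intro nn_integral_cong) (simp split: split_indicator)
  also have "\<dots> = (\<integral>\<^sup>+y. ennreal (indicator (\<phi> ` S) y * f y) \<partial>lborel)"
    using nn_integral_relabel[of "\<lambda>y. ennreal (indicator (\<phi> ` S) (unlabel y) * f (unlabel y))"]
      measurable_compose[OF borel_measurable_unlabel f(1)] by simp
  also have "\<dots> = (\<integral>\<^sup>+y\<in>\<phi> ` S. ennreal (f y) \<partial>lborel)"
    by (intro nn_integral_cong) (simp split: split_indicator)
  also have "(\<integral>\<^sup>+x\<in>S'. ennreal (\<bar>det (matrix (\<psi>' x))\<bar> * f (unlabel (\<psi> x))) \<partial>lborel) =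
      (\<integral>\<^sup>+x. ennreal (indicator S (unlabel x) * (\<bar>det (matrix (\<phi>' (unlabel x)))\<bar> * f (\<phi> (unlabel x)))) \<partial>lborel)"
    by (intro nn_integral_cong) (simp add: S'_eq det \<psi>_def split: split_indicator)
  also have "\<dots> = (\<integral>\<^sup>+x. ennreal (indicator S x * (\<bar>det (matrix (\<phi>' x))\<bar> * f (\<phi> x))) \<partial>lborel)"
    using nn_integral_relabel[of "\<lambda>x. ennreal (indicator S (unlabel x) * (\<bar>det (matrix (\<phi>' (unlabel x)))\<bar> * f (\<phi> (unlabel x))))"]
      measurable_compose[OF borel_measurable_unlabel h] by simp
  also have "\<dots> = (\<integral>\<^sup>+x\<in>S. ennreal (\<bar>det (matrix (\<phi>' x))\<bar> * f (\<phi> x)) \<partial>lborel)"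
    by (intro nn_integral_cong) (simp split: split_indicator)
  finally show ?thesis .
qed

lemma suminf_swap_ennreal:
  fixes f :: "nat \<Rightarrow> nat \<Rightarrow> ennreal"
  shows "(\<Sum>k. \<Sum>i. f k i) = (\<Sum>i. \<Sum>k. f k i)"
proof -
  have "(\<Sum>k. \<Sum>i. f k i) = (\<integral>\<^sup>+k. (\<Sum>i. f k i) \<partial>count_space UNIV)" by (simp add: nn_integral_count_space_nat)
  also have "\<dots> = (\<Sum>i. \<integral>\<^sup>+k. f k i \<partial>count_space UNIV)" by (rule nn_integral_suminf) simp
  finally show ?thesis by (simp add: nn_integral_count_space_nat)
qed

section \<open>Gluing the chart densities to one measure\<close>

context pseudo_riemannian_manifold
begin

lemma coord_field_change:
  assumes "c \<in> A" "c' \<in> A" "p \<in> fst c" "p \<in> fst c'"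
  shows "coord_field A c i p = (\<Sum>j\<in>UNIV. matrix (change_coord c c' p) $ j $ i *\<^sub>R coord_field A c' j p)"
  using coord_expansion[OF assms(2,4), of "coord_field A c i p"] assms
  by (simp add: components_change[of c c'] matrix_def)

text \<open>The Gram matrices are congruent by the Jacobian. The densities therefore differ by the
  absolute value of its determinant, exactly the factor in the change of variables formula.\<close>

lemma det_gram_change:
  assumes "c \<in> A" "c' \<in> A" "p \<in> fst c" "p \<in> fst c'"
  shows "det (gram c p) = (det (matrix (change_coord c c' p)))\<^sup>2 * det (gram c' p)"
proof -
  let ?J = "matrix (change_coord c c' p)"
  have "gram c p = transpose ?J ** gram c' p ** ?J"
  proof -
    have "gram c p $ i $ j = (\<Sum>s\<in>UNIV. (\<Sum>r\<in>UNIV. ?J $ r $ i * gram c' p $ r $ s) * ?J $ s $ j)" for i j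
    proof -
      have "gram c p $ i $ j = (\<Sum>r\<in>UNIV. \<Sum>s\<in>UNIV. ?J $ r $ i * (?J $ s $ j * gram c' p $ r $ s))"
        unfolding gram_def coord_field_change[OF assms] g_sum_left vec_lambda_beta
        unfolding g_sum_right by (simp add: g_linear mult_ac)
      also have "\<dots> = (\<Sum>s\<in>UNIV. \<Sum>r\<in>UNIV. ?J $ r $ i * (?J $ s $ j * gram c' p $ r $ s))" by (rule sum.swap)
      also have "\<dots> = (\<Sum>s\<in>UNIV. (\<Sum>r\<in>UNIV. ?J $ r $ i * gram c' p $ r $ s) * ?J $ s $ j)"
        unfolding sum_distrib_right by (intro sum.cong refl) (simp only: mult_ac)
      finally show ?thesis .
    qed
    then show ?thesis by (simp add: matrix_matrix_mult_def transpose_def vec_eq_iff)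
  qed
  then show ?thesis by (simp add: det_mul det_transpose power2_eq_square)
qed

lemma volume_density_gram:
  "volume_density A g c y = sqrt \<bar>det (gram c (chart_inv c y))\<bar>"
  by (simp add: volume_density_def gram_def Let_def)

lemma volume_density_change:
  assumes "c \<in> A" "c' \<in> A" "p \<in> fst c" "p \<in> fst c'"
  shows "volume_density A g c (snd c p) = \<bar>det (matrix (change_coord c c' p))\<bar> * volume_density A g c' (snd c' p)"
  using assms by (simp add: volume_density_gram det_gram_change[OF assms] abs_mult real_sqrt_mult)

lemma continuous_volume_density:
  assumes "c \<in> A" shows "continuous_on (snd c ` fst c) (volume_density A g c)"
proof -
  have "smooth_on (snd c ` fst c) (\<lambda>y. det (\<chi> i j. gram c (chart_inv c y) $ i $ j))"
    by (intro smooth_on_det chart_image_open smooth_gram assms)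
  then have "continuous_on (snd c ` fst c) (\<lambda>y. sqrt \<bar>det (gram c (chart_inv c y))\<bar>)"
    by (intro continuous_intros) (drule smooth_on_continuous, simp)
  then show ?thesis by (simp add: volume_density_gram[abs_def])
qed

lemma chart_image_borel:
  assumes c: "c \<in> A" and B: "B \<in> sets borel" "B \<subseteq> fst c"
  shows "snd c ` B \<in> sets borel"
proof -
  have "chart_inv c \<in> borel_measurable (restrict_space borel (snd c ` fst c))"
    by (rule borel_measurable_continuous_on_restrict[OF continuous_on_chart_inv[OF c]])
  from measurable_sets[OF this B(1)]
  have "chart_inv c -` B \<inter> snd c ` fst c \<in> sets (restrict_space borel (snd c ` fst c))" by (simp add: space_restrict_space)
  then have "chart_inv c -` B \<inter> snd c ` fst c \<in> sets borel"
    using chart_image_open[OF c] by (simp add: sets_restrict_space_iff)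
  moreover have "chart_inv c -` B \<inter> snd c ` fst c = snd c ` B" using c B(2) by auto
  ultimately show ?thesis by simp
qed

lemma measurable_volume_density:
  assumes c: "c \<in> A" and B: "B \<in> sets borel" "B \<subseteq> fst c"
  shows "(\<lambda>y. indicator (snd c ` B) y * volume_density A g c y) \<in> borel_measurable borel"
proof -
  have "(\<lambda>y. indicator (snd c ` B) y *\<^sub>R volume_density A g c y) \<in> borel_measurable borel"
    by (intro borel_measurable_continuous_on_indicator chart_image_borel c B
        continuous_on_subset[OF continuous_volume_density[OF c]]) (use B in auto)
  then show ?thesis by simp
qed

definition chart_measure :: "('m, 'n) chart \<Rightarrow> 'm set \<Rightarrow> ennreal" where
  "chart_measure c B = (\<integral>\<^sup>+y\<in>snd c ` B. ennreal (volume_density A g c y) \<partial>lborel)"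

lemma chart_measure_change:
  assumes c: "c \<in> A" "c' \<in> A" and B: "B \<in> sets borel" "B \<subseteq> fst c" "B \<subseteq> fst c'"
  shows "chart_measure c' B = chart_measure c B"
proof -
  let ?\<phi> = "\<lambda>y. snd c' (chart_inv c y)"
  have im: "?\<phi> ` snd c ` B = snd c' ` B" using c B by (auto simp: image_image intro!: image_cong)
  have dens: "\<bar>det (matrix (change_coord c c' (chart_inv c y)))\<bar> * volume_density A g c' (?\<phi> y) = volume_density A g c y"
    if y: "y \<in> snd c ` B" for y
  proof -
    obtain p where "p \<in> B" "y = snd c p" using y by blast
    then show ?thesis using volume_density_change[OF c, of p] c B by (simp add: subset_iff)
  qed
  have "chart_measure c' B = (\<integral>\<^sup>+y\<in>?\<phi> ` snd c ` B. ennreal (volume_density A g c' y) \<partial>lborel)"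
    by (simp add: chart_measure_def im)
  also have "\<dots> = (\<integral>\<^sup>+y\<in>snd c ` B. ennreal (\<bar>det (matrix (change_coord c c' (chart_inv c y)))\<bar> * volume_density A g c' (?\<phi> y)) \<partial>lborel)"
  proof (rule nn_integral_change_of_variables)
    show "snd c ` B \<in> sets borel" using chart_image_borel[OF c(1) B(1,2)] .
    show "(?\<phi> has_derivative change_coord c c' (chart_inv c y)) (at y)" if "y \<in> snd c ` B" for y
      using that c B transition_differentiable[OF c] by (auto simp: subset_iff)
    show "inj_on ?\<phi> (snd c ` B)"
    proof (rule inj_onI)
      fix y z assume "y \<in> snd c ` B" "z \<in> snd c ` B" "?\<phi> y = ?\<phi> z"
      then obtain p q where "p \<in> B" "q \<in> B" "y = snd c p" "z = snd c q" "snd c' p = snd c' q"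
        using c B by (auto simp: subset_iff)
      then show "y = z" using chart_inv_left[OF c(2)] B by (metis subset_iff)
    qed
    show "(\<lambda>y. indicator (?\<phi> ` snd c ` B) y * volume_density A g c' y) \<in> borel_measurable borel"
      unfolding im by (rule measurable_volume_density[OF c(2) B(1,3)])
    show "volume_density A g c' y \<ge> 0" for y by (simp add: volume_density_gram)
    have "(\<lambda>y. indicator (snd c ` B) y * (\<bar>det (matrix (change_coord c c' (chart_inv c y)))\<bar> * volume_density A g c' (?\<phi> y)))
      = (\<lambda>y. indicator (snd c ` B) y * volume_density A g c y)"
      using dens by (auto simp: fun_eq_iff split: split_indicator)
    then show "(\<lambda>y. indicator (snd c ` B) y * (\<bar>det (matrix (change_coord c c' (chart_inv c y)))\<bar> * volume_density A g c' (?\<phi> y)))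
      \<in> borel_measurable borel"
      using measurable_volume_density[OF c(1) B(1,2)] by simp
  qed
  also have "\<dots> = chart_measure c B"
    unfolding chart_measure_def using dens by (intro nn_integral_cong) (simp split: split_indicator)
  finally show ?thesis .
qed

text \<open>The coordinate map is injective, so disjoint sets have disjoint images and a measure
  with density on Euclidean space does the counting. Truncating the density to the union makes it
  Borel on the whole space.\<close>

lemma chart_measure_suminf:
  assumes c: "c \<in> A" and B: "\<And>i::nat. B i \<in> sets borel" "\<And>i. B i \<subseteq> fst c" "disjoint_family B"
  shows "(\<Sum>i. chart_measure c (B i)) = chart_measure c (\<Union>i. B i)"
proof -
  let ?U = "\<Union>i. B i"
  have U: "?U \<in> sets borel" "?U \<subseteq> fst c" using B by auto
  define f where "f y = ennreal (indicator (snd c ` ?U) y * volume_density A g c y)" for y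
  have f: "f \<in> borel_measurable lborel"
    unfolding f_def using measurable_volume_density[OF c U] by simp
  have im: "snd c ` C \<in> sets lborel" if "C \<in> sets borel" "C \<subseteq> fst c" for C using chart_image_borel[OF c that] by simp
  have eq: "chart_measure c C = emeasure (density lborel f) (snd c ` C)" if "C \<in> sets borel" "C \<subseteq> ?U" for C
  proof -
    have "C \<subseteq> fst c" using that U by auto
    show ?thesis
      unfolding emeasure_density[OF f im[OF that(1) \<open>C \<subseteq> fst c\<close>]] chart_measure_def f_def
      using that by (intro nn_integral_cong) (auto split: split_indicator)
  qed
  have "disjoint_family (\<lambda>i. snd c ` B i)"
    unfolding disjoint_family_on_def
  proof (intro ballI impI)
    fix i j :: nat assume "i \<noteq> j"
    then have "B i \<inter> B j = {}" using B(3) by (auto simp: disjoint_family_on_def)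
    moreover have "inj_on (snd c) (fst c)" using chart_inv_left[OF c] by (metis inj_onI)
    ultimately show "snd c ` B i \<inter> snd c ` B j = {}"
      using inj_on_image_Int[of "snd c" "fst c" "B i" "B j"] B(2) by simp
  qed
  then have "(\<Sum>i. emeasure (density lborel f) (snd c ` B i)) = emeasure (density lborel f) (\<Union>i. snd c ` B i)"
    by (intro suminf_emeasure) (use chart_image_borel[OF c B(1,2)] in auto)
  then show ?thesis
    using eq[of "B _"] eq[of ?U] B U by (simp add: image_UN SUP_upper)
qed

text \<open>Second countability leaves countably many chart domains; making them disjoint destroys
  openness but keeps the pieces Borel.\<close>

lemma countable_chart_partition:
  "\<exists>(c :: nat \<Rightarrow> ('m, 'n) chart) V. (\<forall>i. c i \<in> A) \<and> (\<forall>i. V i \<in> sets borel \<and> V i \<subseteq> fst (c i)) \<and>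
     disjoint_family V \<and> (\<Union>i. V i) = UNIV"
proof -
  obtain F where F: "F \<subseteq> fst ` A" "countable F" "\<Union>F = \<Union>(fst ` A)"
    by (rule Lindelof_openin[of "fst ` A" UNIV]) (use chart_open in \<open>auto simp: openin_open\<close>)
  have "\<Union>F = UNIV" using F charts_cover by auto
  then have "F \<noteq> {}" by auto
  then have rng: "range (from_nat_into F) = F" using F(2) by (rule range_from_nat_into)
  then have "\<exists>c\<in>A. fst c = from_nat_into F i" for i using F(1) by (metis imageE rangeI subset_iff)
  then obtain c where c: "\<And>i. c i \<in> A" "\<And>i. fst (c i) = from_nat_into F i" by metis
  let ?V = "disjointed (\<lambda>i. fst (c i))"
  have "range ?V \<subseteq> sets borel"
    by (intro sets.range_disjointed_sets) (use chart_open[OF c(1)] in auto)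
  then have "\<forall>i. ?V i \<in> sets borel \<and> ?V i \<subseteq> fst (c i)"
    using disjointed_subset[of "\<lambda>i. fst (c i)"] by blast
  moreover have "(\<Union>i. ?V i) = UNIV"
    using rng \<open>\<Union>F = UNIV\<close> by (simp add: UN_disjointed_eq c(2))
  ultimately show ?thesis using c(1) disjoint_family_disjointed[of "\<lambda>i. fst (c i)"]
    by (intro exI[of _ c] exI[of _ ?V]) simp
qed

definition riemannian_measure :: "'m measure \<Rightarrow> bool" where
  "riemannian_measure M \<longleftrightarrow> sets M = sets borel \<and>
     (\<forall>c\<in>A. \<forall>B\<in>sets borel. B \<subseteq> fst c \<longrightarrow> emeasure M B = chart_measure c B)"

text \<open>Existence sums the chart measures over a countable partition subordinate to charts, and
  independence of the chart makes the sum right in every chart. Uniqueness holds because the values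
  on the pieces determine the measure. Hence the description in \<open>vol\<close> denotes.\<close>

lemma ex1_riemannian_measure: "\<exists>!M. riemannian_measure M"
proof -
  obtain c :: "nat \<Rightarrow> ('m, 'n) chart" and V where cV: "(\<forall>i. c i \<in> A) \<and> (\<forall>i. V i \<in> sets borel \<and> V i \<subseteq> fst (c i)) \<and>
     disjoint_family V \<and> (\<Union>i. V i) = UNIV"
    using countable_chart_partition by (elim exE)
  then have c: "c i \<in> A" and V: "V i \<in> sets borel" "V i \<subseteq> fst (c i)" "disjoint_family V" "(\<Union>i. V i) = UNIV" for i
    by blast+
  have disj: "disjoint_family (\<lambda>i. B \<inter> V i)" for B
    using V(3) unfolding disjoint_family_on_def by blast
  \<comment> \<open>Each piece \<open>V i\<close> is measured in the one chart \<open>c i\<close>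
    assigned to it.\<close>
  define m where "m B = (\<Sum>i. chart_measure (c i) (B \<inter> V i))" for B
  define M where "M = measure_of UNIV (sets borel) m"
  have sets: "sets M = sets borel" unfolding M_def using sets.sets_measure_of_eq[of borel] by simp
  have em: "emeasure M B = m B" if "B \<in> sets borel" for B
    unfolding M_def
  proof (rule emeasure_measure_of_sigma)
    show "sigma_algebra UNIV (sets borel)" using sets.sigma_algebra_axioms[of borel] by simp
    show "positive (sets borel) m" by (simp add: positive_def m_def chart_measure_def)
    show "countably_additive (sets borel) m"
    proof (rule countably_additiveI)
      fix F :: "nat \<Rightarrow> 'm set" assume F: "range F \<subseteq> sets borel" "disjoint_family F"
      have "(\<Sum>k. m (F k)) = (\<Sum>i. \<Sum>k. chart_measure (c i) (F k \<inter> V i))"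
        unfolding m_def by (rule suminf_swap_ennreal)
      also have "\<dots> = (\<Sum>i. chart_measure (c i) (\<Union>k. F k \<inter> V i))"
      proof (intro suminf_cong chart_measure_suminf c)
        fix i k show "F k \<inter> V i \<in> sets borel" using F V by auto
        show "F k \<inter> V i \<subseteq> fst (c i)" using V by auto
        show "disjoint_family (\<lambda>k. F k \<inter> V i)" using F(2) by (auto simp: disjoint_family_on_def)
      qed
      also have "\<dots> = m (\<Union>k. F k)" by (simp add: m_def Int_UN_distrib2 Int_commute)
      finally show "(\<Sum>k. m (F k)) = m (\<Union>k. F k)" .
    qed
  qed (rule that)
  have "riemannian_measure M"
    unfolding riemannian_measure_def
  proof (intro conjI ballI impI sets)
    fix c' B assume c': "c' \<in> A" and B: "B \<in> sets borel" "B \<subseteq> fst c'"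
    have "emeasure M B = (\<Sum>i. chart_measure c' (B \<inter> V i))"
      unfolding em[OF B(1)] m_def
    proof (intro suminf_cong chart_measure_change)
      fix i show "c' \<in> A" "c i \<in> A" "B \<inter> V i \<in> sets borel" "B \<inter> V i \<subseteq> fst c'" "B \<inter> V i \<subseteq> fst (c i)"
        using c c' B V(1) V(2)[of i] by auto
    qed
    also have "\<dots> = chart_measure c' (\<Union>i. B \<inter> V i)"
      using c' B V(1,2) disj by (intro chart_measure_suminf) auto
    also have "(\<Union>i. B \<inter> V i) = B" using V(4) by auto
    finally show "emeasure M B = chart_measure c' B" .
  qed
  moreover have "M' = M" if M': "riemannian_measure M'" for M'
  proof (rule measure_eqI)
    have s': "sets M' = sets borel" using M' by (simp add: riemannian_measure_def)
    show "sets M' = sets M" using s' sets by simp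
    fix B assume "B \<in> sets M'"
    then have B: "B \<in> sets borel" using s' by simp
    have eq: "emeasure N B = (\<Sum>i. chart_measure (c i) (B \<inter> V i))" if N: "riemannian_measure N" for N
    proof -
      have sN: "sets N = sets borel" using N by (simp add: riemannian_measure_def)
      have "(\<Sum>i. emeasure N (B \<inter> V i)) = emeasure N (\<Union>i. B \<inter> V i)"
        using V(1,2) B disj by (intro suminf_emeasure) (auto simp: sN)
      moreover have "(\<Union>i. B \<inter> V i) = B" using V(4) by auto
      moreover have "emeasure N (B \<inter> V i) = chart_measure (c i) (B \<inter> V i)" for i
        using N c[of i] V(1,2)[of i] B unfolding riemannian_measure_def by (metis inf.coboundedI2 sets.Int)
      ultimately show ?thesis by simp
    qed
    show "emeasure M' B = emeasure M B" using eq[OF M'] eq[OF \<open>riemannian_measure M\<close>] by simp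
  qed
  ultimately show ?thesis by blast
qed

lemma sets_vol [simp]: "sets (vol A g) = sets borel" and space_vol [simp]: "space (vol A g) = UNIV"
  and emeasure_vol: "c \<in> A \<Longrightarrow> B \<in> sets borel \<Longrightarrow> B \<subseteq> fst c \<Longrightarrow>
    emeasure (vol A g) B = (\<integral>\<^sup>+y\<in>snd c ` B. ennreal (volume_density A g c y) \<partial>lborel)"
proof -
  have "riemannian_measure (vol A g)"
    using theI'[OF ex1_riemannian_measure] unfolding vol_def riemannian_measure_def chart_measure_def .
  then show s: "sets (vol A g) = sets borel"
    and "c \<in> A \<Longrightarrow> B \<in> sets borel \<Longrightarrow> B \<subseteq> fst c \<Longrightarrow>
    emeasure (vol A g) B = (\<integral>\<^sup>+y\<in>snd c ` B. ennreal (volume_density A g c y) \<partial>lborel)"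
    by (auto simp: riemannian_measure_def chart_measure_def)
  show "space (vol A g) = UNIV" using sets_eq_imp_space_eq[OF s] by simp
qed

end

section \<open>Bump functions\<close>

text \<open>Differentiating exp(-1/x) produces powers of 1/x. With all of them included, derivatives
  of members are combinations of members, and smoothness follows by one induction over all
  \<open>k\<close>.\<close>

definition flat_exp :: "nat \<Rightarrow> real \<Rightarrow> real" where
  "flat_exp k x = (if x > 0 then (1 / x) ^ k * exp (- (1 / x)) else 0)"

lemma flat_exp_tendsto: "(flat_exp k \<longlongrightarrow> 0) (at_right 0)"
proof -
  have "((\<lambda>y::real. y ^ k / exp y) \<longlongrightarrow> 0) at_top" by (rule tendsto_power_div_exp_0)
  moreover have "filterlim (\<lambda>x::real. inverse x) at_top (at_right 0)" by (rule filterlim_inverse_at_top_right)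
  ultimately have "((\<lambda>x. inverse x ^ k / exp (inverse x)) \<longlongrightarrow> 0) (at_right (0::real))"
    by (rule filterlim_compose)
  then show ?thesis
  proof (rule tendsto_cong[THEN iffD1, rotated])
    show "\<forall>\<^sub>F x in at_right 0. inverse x ^ k / exp (inverse x) = flat_exp k x"
      by (rule eventually_at_right_less[THEN eventually_mono])
         (simp add: flat_exp_def exp_minus divide_inverse)
  qed
qed

lemma flat_exp_deriv:
  "(flat_exp k has_real_derivative (flat_exp (k + 2) x - k * flat_exp (k + 1) x)) (at x)"
proof (cases "x > 0 \<or> x < 0")
  case True
  then show ?thesis
  proof
    assume x: "x > 0"
    have i: "((\<lambda>x::real. 1 / x) has_real_derivative - (1 / x^2)) (at x)"
      using x by (auto intro!: derivative_eq_intros simp: power2_eq_square)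
    have "((\<lambda>x. exp (- (1 / x))) has_real_derivative exp (- (1 / x)) * (1 / x^2)) (at x)"
      using DERIV_fun_exp[OF DERIV_minus[OF i]] by simp
    note DERIV_mult[OF DERIV_power[OF i, of k] this]
    moreover have "real k * (- (1 / x^2) * (1 / x) ^ (k - Suc 0)) * exp (- (1 / x)) + exp (- (1 / x)) * (1 / x^2) * (1 / x) ^ k
      = flat_exp (k + 2) x - k * flat_exp (k + 1) x"
    proof (cases k)
      case 0
      then show ?thesis using x by (simp add: flat_exp_def power2_eq_square)
    next
      case (Suc j)
      have p: "1 / x^2 = (1 / x) * (1 / x)" by (simp add: power2_eq_square)
      show ?thesis using x unfolding p by (simp add: flat_exp_def Suc power_add algebra_simps)
    qed
    ultimately have "((\<lambda>x. (1 / x) ^ k * exp (- (1 / x))) has_real_derivative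
        (flat_exp (k + 2) x - k * flat_exp (k + 1) x)) (at x)" by simp
    then show ?thesis
      by (rule has_field_derivative_transform_within_open[of _ _ _ "{0<..}"]) (use x in \<open>auto simp: flat_exp_def\<close>)
  next
    assume x: "x < 0"
    have "((\<lambda>x::real. 0) has_real_derivative 0) (at x)" by simp
    then have "(flat_exp k has_real_derivative 0) (at x)"
      by (rule has_field_derivative_transform_within_open[of _ _ _ "{..<0}"]) (use x in \<open>auto simp: flat_exp_def\<close>)
    then show ?thesis using x by (simp add: flat_exp_def)
  qed
next
  case False
  then have x: "x = 0" by simp
  \<comment> \<open>From the right the difference quotient at 0 is
    \<open>flat_exp (Suc k) h\<close>; from the left it is 0.\<close>
  have "((\<lambda>h. (flat_exp k h - flat_exp k 0) / (h - 0)) \<longlongrightarrow> 0) (at 0)"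
    unfolding filterlim_at_split
  proof
    show "((\<lambda>h. (flat_exp k h - flat_exp k 0) / (h - 0)) \<longlongrightarrow> 0) (at_left 0)"
      by (rule tendsto_cong[THEN iffD1, OF _ tendsto_const[of 0]]) (simp add: eventually_at_filter flat_exp_def)
    show "((\<lambda>h. (flat_exp k h - flat_exp k 0) / (h - 0)) \<longlongrightarrow> 0) (at_right 0)"
      by (rule tendsto_cong[THEN iffD1, OF _ flat_exp_tendsto[of "Suc k"]], rule eventually_at_right_less[THEN eventually_mono])
         (simp add: flat_exp_def)
  qed
  then show ?thesis unfolding x by (simp add: has_field_derivative_iff flat_exp_def)
qed

lemma smooth_flat_exp: "smooth_on UNIV (flat_exp k)"
proof -
  have d: "(flat_exp k has_derivative (\<lambda>v. (flat_exp (k + 2) x - k * flat_exp (k + 1) x) * v)) (at x)" for k x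
    using flat_exp_deriv[of k x] by (simp add: has_field_derivative_def mult_commute_abs)
  have "Ck_on r UNIV (flat_exp k)" for r k
  proof (induction r arbitrary: k)
    case 0
    show ?case unfolding Ck_on.simps
      by (intro continuous_at_imp_continuous_on ballI has_derivative_continuous[OF d])
  next
    case (Suc r)
    have neg: "(\<lambda>x. (flat_exp (k + 2) x - k * flat_exp (k + 1) x) * v)
      = (\<lambda>x. (flat_exp (k + 2) x + (- real k) * flat_exp (k + 1) x) * v)" for v by auto
    show ?case
    proof (rule Ck_on_SucI[OF open_UNIV d])
      show "Ck_on r UNIV (\<lambda>x. (flat_exp (k + 2) x - k * flat_exp (k + 1) x) * v)" for v
        unfolding neg
        by (intro Ck_on_bounded_bilinear[OF open_UNIV bounded_bilinear_mult] Ck_on_add[OF open_UNIV] Ck_on_const Suc)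
    qed
  qed
  then show ?thesis by (simp add: smooth_on_def)
qed

context smooth_manifold
begin

text \<open>\<open>flat_exp 0\<close> of r^2 minus the squared coordinate distance vanishes outside
  a closed ball. The preimage \<open>K\<close> of the ball in the manifold is compact, hence closed
  by the Hausdorff property, so extension by zero is smooth.\<close>

lemma bump_function:
  assumes U: "open U" "p \<in> U"
  obtains \<phi> K where "smooth_fun A UNIV \<phi>" "\<phi> p \<noteq> 0" "closed K" "K \<subseteq> U" "\<And>q. q \<notin> K \<Longrightarrow> \<phi> q = 0"
proof -
  define c where "c = chart_at A p"
  have c: "c \<in> A" "p \<in> fst c" by (auto simp: c_def)
  have op: "open (snd c ` (fst c \<inter> U))" by (rule chart_open_map[OF c(1) U(1)])
  have "snd c p \<in> snd c ` (fst c \<inter> U)" using c U by auto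
  then obtain r where r: "r > 0" "cball (snd c p) r \<subseteq> snd c ` (fst c \<inter> U)"
    using op open_contains_cball by blast
  define F where "F y = flat_exp 0 (r^2 - (y - snd c p) \<bullet> (y - snd c p))" for y
  have F: "smooth_on UNIV F"
    unfolding F_def
    by (rule smooth_on_compose[OF open_UNIV open_UNIV _ smooth_flat_exp])
       (auto intro!: smooth_on_diff smooth_on_bounded_bilinear[OF _ bounded_bilinear_inner] smooth_on_id)
  define \<phi> where "\<phi> q = (if q \<in> fst c then F (snd c q) else 0)" for q
  define K where "K = chart_inv c ` cball (snd c p) r"
  have sub: "cball (snd c p) r \<subseteq> snd c ` fst c" using r by auto
  have "compact K"
    unfolding K_def using continuous_on_subset[OF continuous_on_chart_inv[OF c(1)] sub]
    by (intro compact_continuous_image) auto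
  then have K: "closed K" by (rule compact_imp_closed)
  have KU: "K \<subseteq> U" unfolding K_def using r(2) c(1) by fastforce
  have zero: "\<phi> q = 0" if "q \<notin> K" for q
  proof (cases "q \<in> fst c")
    case True
    have "\<not> norm (snd c q - snd c p) \<le> r"
    proof
      assume "norm (snd c q - snd c p) \<le> r"
      then have "snd c q \<in> cball (snd c p) r" by (simp add: dist_norm norm_minus_commute)
      then have "chart_inv c (snd c q) \<in> K" unfolding K_def by blast
      then show False using that True c(1) by simp
    qed
    then have "r^2 < (norm (snd c q - snd c p))^2" using r(1) by (intro power_strict_mono) auto
    then show ?thesis using True by (simp add: \<phi>_def F_def flat_exp_def power2_norm_eq_inner)
  qed (simp add: \<phi>_def)
  have "smooth_fun A UNIV \<phi>"
  proof (rule smooth_fun_local)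
    fix q
    show "\<exists>N. open N \<and> q \<in> N \<and> smooth_fun A N \<phi>"
    proof (cases "q \<in> fst c")
      case True
      have "smooth_on (snd c ` fst c) (\<lambda>y. \<phi> (chart_inv c y))"
        by (rule smooth_on_cong[OF chart_image_open[OF c(1)] _ smooth_on_subset[OF F]]) (use c in \<open>auto simp: \<phi>_def\<close>)
      then have "smooth_fun A (fst c) \<phi>"
        by (rule smooth_fun_chartI[OF c(1) chart_open[OF c(1)] order_refl])
      then show ?thesis using True chart_open[OF c(1)] by blast
    next
      case False
      \<comment> \<open>At points outside the chart domain the open complement of \<open>K\<close>
        is a neighbourhood on which the function is 0.\<close>
      then have "q \<in> - K" unfolding K_def using sub c(1) by fastforce
      moreover have "smooth_fun A (- K) \<phi>"
        by (rule smooth_fun_cong[OF open_Compl[OF K] _ smooth_fun_const[OF open_Compl[OF K], of 0]]) (use zero in auto)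
      ultimately show ?thesis using open_Compl[OF K] by blast
    qed
  qed
  moreover have "\<phi> p \<noteq> 0" using c r(1) by (simp add: \<phi>_def F_def flat_exp_def)
  ultimately show ?thesis using that K KU zero by blast
qed

lemma smooth_field_cutoff:
  assumes "open U" "smooth_field A U X" "smooth_fun A UNIV \<phi>" "closed K" "K \<subseteq> U" "\<And>q. q \<notin> K \<Longrightarrow> \<phi> q = 0"
  shows "smooth_field A UNIV (\<lambda>q. if q \<in> U then \<phi> q *\<^sub>R X q else 0)"
proof (rule smooth_field_local)
  fix q
  let ?X = "\<lambda>q. if q \<in> U then \<phi> q *\<^sub>R X q else 0"
  show "\<exists>N. open N \<and> q \<in> N \<and> smooth_field A N ?X"
  proof (cases "q \<in> U")
    case True
    have "smooth_field A U (\<lambda>q. \<phi> q *\<^sub>R X q)"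
      using assms(1,2) smooth_fun_subset[OF assms(3)] by (intro smooth_field_scaleR) auto
    then have "smooth_field A U ?X" by (rule smooth_field_cong[OF assms(1), rotated]) simp
    then show ?thesis using True assms(1) by blast
  next
    case False
    have "smooth_field A (- K) ?X"
      by (rule smooth_field_cong[OF open_Compl[OF assms(4)] _ smooth_field_zero[OF open_Compl[OF assms(4)]]]) (use assms in auto)
    moreover have "q \<in> - K" using False assms(5) by auto
    ultimately show ?thesis using open_Compl[OF assms(4)] by blast
  qed
qed

end

section \<open>Trace-free cubic contorsion\<close>

text \<open>For covectors \<open>\<alpha>\<close>, \<open>\<beta>\<close> dual to orthogonal vectors \<open>e\<close>, \<open>f\<close> this is the cubic form
  \<open>a \<alpha>\<^sup>3 - 3 b \<alpha> \<beta>\<^sup>2\<close> with its last index raised; it is trace-free when \<open>a \<alpha>(e) = b \<beta>(f)\<close>.\<close>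

definition cubic :: "real \<Rightarrow> real \<Rightarrow> (real^'n \<Rightarrow> real) \<Rightarrow> (real^'n \<Rightarrow> real) \<Rightarrow> real^'n \<Rightarrow> real^'n \<Rightarrow>
    real^'n \<Rightarrow> real^'n \<Rightarrow> real^'n::finite" where
  "cubic a b \<alpha> \<beta> e f u v = (a * (\<alpha> u * \<alpha> v) - b * (\<beta> u * \<beta> v)) *\<^sub>R e - (b * (\<alpha> u * \<beta> v + \<beta> u * \<alpha> v)) *\<^sub>R f"

lemma bilinear_cubic:
  assumes "linear \<alpha>" "linear \<beta>" shows "bilinear (cubic a b \<alpha> \<beta> e f)"
  unfolding bilinear_def
  by (intro conjI allI linearI)
     (simp_all add: cubic_def linear_add[OF assms(1)] linear_add[OF assms(2)] linear_scale[OF assms(1)] linear_scale[OF assms(2)]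
       algebra_simps)

context adapted_manifold
begin

lemma frame_pairing:
  assumes e: "ortho_basis p E" and \<mu>: "\<mu> \<in> {1..k}" and x: "x \<in> D \<mu> p" and \<alpha>: "linear (\<alpha> :: real^'n \<Rightarrow> real)"
  shows "(\<Sum>a\<in>{1..n \<mu>}. g p (E \<mu> a) (E \<mu> a) * (\<alpha> (E \<mu> a) * g p x (E \<mu> a))) = \<alpha> x"
proof -
  have "\<alpha> x = (\<Sum>a\<in>{1..n \<mu>}. (g p (E \<mu> a) (E \<mu> a) * g p x (E \<mu> a)) *\<^sub>R \<alpha> (E \<mu> a))"
    by (rule trans[OF arg_cong[OF D_expansion[OF e \<mu> x], of \<alpha>] linear_sum_scaleR[OF \<alpha>]])
  then show ?thesis by (simp add: mult_ac)
qed

text \<open>The scalar product of the restrictions of \<open>\<alpha>\<close> and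
  \<open>\<beta>\<close> to \<open>D \<mu>0\<close>. The metric enters only through the frame, so
  covectors lowered with one metric can be traced with another.\<close>

definition covector_trace :: "nat \<Rightarrow> (real^'n \<Rightarrow> real) \<Rightarrow> (real^'n \<Rightarrow> real) \<Rightarrow> 'm \<Rightarrow> real" where
  "covector_trace \<mu>0 \<alpha> \<beta> p = (let E = frame_at A k n D g p in
     \<Sum>a\<in>{1..n \<mu>0}. g p (E \<mu>0 a p) (E \<mu>0 a p) * (\<alpha> (E \<mu>0 a p) * \<beta> (E \<mu>0 a p)))"

text \<open>Since \<open>\<alpha>\<close> vanishes on the other distributions, their frame vectors
  can be added to the sum at no cost, and the result is a full trace.\<close>

lemma covector_trace_coord:
  assumes c: "c \<in> A" "p \<in> fst c" and \<mu>0: "\<mu>0 \<in> {1..k}" and lin: "linear \<alpha>" "linear \<beta>"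
    and \<alpha>0: "\<And>\<nu> u. \<nu> \<in> {1..k} \<Longrightarrow> \<nu> \<noteq> \<mu>0 \<Longrightarrow> u \<in> D \<nu> p \<Longrightarrow> \<alpha> u = 0"
  shows "covector_trace \<mu>0 \<alpha> \<beta> p =
    (\<Sum>i\<in>UNIV. \<Sum>j\<in>UNIV. matrix_inv (gram c p) $ i $ j * (\<alpha> (coord_field A c i p) * \<beta> (coord_field A c j p)))"
proof -
  define E where "E = frame_at A k n D g p"
  obtain V where V: "open V" "p \<in> V" "adapted_frame A k n D g V E"
    using frame_at_adapted unfolding E_def by blast
  note e = adapted_frame_basis[OF V(3,2)]
  have "(\<Sum>\<mu>\<in>{1..k}. \<Sum>a\<in>{1..n \<mu>}. g p (E \<mu> a p) (E \<mu> a p) * (\<alpha> (E \<mu> a p) * \<beta> (E \<mu> a p))) =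
    (\<Sum>\<mu>\<in>{1..k}. if \<mu> = \<mu>0 then (\<Sum>a\<in>{1..n \<mu>0}. g p (E \<mu>0 a p) (E \<mu>0 a p) * (\<alpha> (E \<mu>0 a p) * \<beta> (E \<mu>0 a p))) else 0)"
  proof (rule sum.cong[OF refl])
    fix \<mu> assume \<mu>: "\<mu> \<in> {1..k}"
    have "\<alpha> (E \<mu> a p) = 0" if "\<mu> \<noteq> \<mu>0" "a \<in> {1..n \<mu>}" for a
      using \<alpha>0[OF \<mu> that(1) ortho_basis_D[OF e \<mu> that(2)]] .
    then show "(\<Sum>a\<in>{1..n \<mu>}. g p (E \<mu> a p) (E \<mu> a p) * (\<alpha> (E \<mu> a p) * \<beta> (E \<mu> a p))) =
      (if \<mu> = \<mu>0 then (\<Sum>a\<in>{1..n \<mu>0}. g p (E \<mu>0 a p) (E \<mu>0 a p) * (\<alpha> (E \<mu>0 a p) * \<beta> (E \<mu>0 a p))) else 0)"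
      by (cases "\<mu> = \<mu>0") auto
  qed
  also have "\<dots> = covector_trace \<mu>0 \<alpha> \<beta> p"
    using \<mu>0 unfolding covector_trace_def Let_def E_def[symmetric] by simp
  finally have *: "covector_trace \<mu>0 \<alpha> \<beta> p =
    (\<Sum>\<mu>\<in>{1..k}. \<Sum>a\<in>{1..n \<mu>}. g p (E \<mu> a p) (E \<mu> a p) * (\<alpha> (E \<mu> a p) * \<beta> (E \<mu> a p)))" by simp
  have "linear (\<lambda>u. \<alpha> u * \<beta> v)" "linear (\<lambda>v. \<alpha> u * \<beta> v)" for u v
    using lin by (auto intro!: linearI simp: linear_add linear_scale algebra_simps)
  then show ?thesis unfolding * using full_trace_coord[OF e c, of "\<lambda>u v. \<alpha> u * \<beta> v"] by simp
qed

text \<open>The covectors are left arbitrary: they can be dual to \<open>e\<close>, \<open>f\<close>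
  in one metric while the curvature belongs to another. The relations \<open>orth\<close> involve
  only pairings of covectors with vectors and make each endomorphism u -> \<open>T p u w\<close>
  trace-free; what remains is the metric trace of \<open>T\<close> paired with the mean
  curvature.\<close>

lemma mixed_scalar_curvature_cubic:
  assumes T: "tensor_field12 A T" and T_eq: "\<And>q. T q = cubic (a q) (b q) (\<alpha> q) (\<beta> q) (e q) (f q)"
    and \<mu>0: "\<mu>0 \<in> {1..k}" and lin: "\<And>q. linear (\<alpha> q)" "\<And>q. linear (\<beta> q)"
    and van: "\<And>q \<nu> u. \<nu> \<in> {1..k} \<Longrightarrow> \<nu> \<noteq> \<mu>0 \<Longrightarrow> u \<in> D \<nu> q \<Longrightarrow> \<alpha> q u = 0"
      "\<And>q \<nu> u. \<nu> \<in> {1..k} \<Longrightarrow> \<nu> \<noteq> \<mu>0 \<Longrightarrow> u \<in> D \<nu> q \<Longrightarrow> \<beta> q u = 0"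
    and ef: "\<And>q. e q \<in> D \<mu>0 q" "\<And>q. f q \<in> D \<mu>0 q"
    and orth: "\<And>q. \<alpha> q (f q) = 0" "\<And>q. \<beta> q (e q) = 0" "\<And>q. a q * \<alpha> q (e q) = b q * \<beta> q (f q)"
  shows "mixed_scalar_curvature A k n D g T p = mixed_scalar_curvature A k n D g (\<lambda>p u v. 0) p
    - (1/2) * ((a p * covector_trace \<mu>0 (\<alpha> p) (\<alpha> p) p - b p * covector_trace \<mu>0 (\<beta> p) (\<beta> p) p) * mean_curvature_form \<mu>0 e p
      - 2 * b p * covector_trace \<mu>0 (\<alpha> p) (\<beta> p) p * mean_curvature_form \<mu>0 f p)"
proof -
  have al: "tensor_along \<mu>0 T"
    unfolding tensor_along_def T_eq cubic_def
    using van by (auto intro!: subspace_diff subspace_scale subspace_D \<mu>0 ef simp: mult_ac add_ac)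
  define E where "E = frame_at A k n D g p"
  obtain V where V: "open V" "p \<in> V" "adapted_frame A k n D g V E"
    using frame_at_adapted unfolding E_def by blast
  note eb = adapted_frame_basis[OF V(3,2)]
  let ?d = "\<lambda>\<mu> a. g p (E \<mu> a p) (E \<mu> a p)"
  let ?I = "{1..n \<mu>0}"
  \<comment> \<open>\<open>t1\<close> and \<open>- t2\<close> are the components on \<open>e\<close>
    and \<open>f\<close> of the metric trace of \<open>T\<close>. They need not vanish when the
    covectors are dual with respect to a different metric.\<close>
  define t1 where "t1 = a p * covector_trace \<mu>0 (\<alpha> p) (\<alpha> p) p - b p * covector_trace \<mu>0 (\<beta> p) (\<beta> p) p"
  define t2 where "t2 = 2 * b p * covector_trace \<mu>0 (\<alpha> p) (\<beta> p) p"
  have inner: "(\<Sum>c\<in>?I. ?d \<mu>0 c * (g p (T p (E \<mu>0 c p) w) (E \<mu>0 c p) - g p (T p (E \<mu>0 c p) (E \<mu>0 c p)) w))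
    = - (t1 * g p (e p) w - t2 * g p (f p) w)" for w
  proof -
    have pair: "(\<Sum>c\<in>?I. ?d \<mu>0 c * (\<gamma> (E \<mu>0 c p) * g p x (E \<mu>0 c p))) = \<gamma> x" if "x \<in> D \<mu>0 p" "linear \<gamma>" for x and \<gamma> :: "real^'n \<Rightarrow> real"
      using frame_pairing[OF eb \<mu>0 that] .
    have "(\<Sum>c\<in>?I. ?d \<mu>0 c * g p (T p (E \<mu>0 c p) w) (E \<mu>0 c p)) =
      (\<Sum>c\<in>?I. (a p * \<alpha> p w) * (?d \<mu>0 c * (\<alpha> p (E \<mu>0 c p) * g p (e p) (E \<mu>0 c p)))
        - (b p * \<beta> p w) * (?d \<mu>0 c * (\<beta> p (E \<mu>0 c p) * g p (e p) (E \<mu>0 c p)))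
        - ((b p * \<beta> p w) * (?d \<mu>0 c * (\<alpha> p (E \<mu>0 c p) * g p (f p) (E \<mu>0 c p)))
        + (b p * \<alpha> p w) * (?d \<mu>0 c * (\<beta> p (E \<mu>0 c p) * g p (f p) (E \<mu>0 c p)))))"
      unfolding T_eq cubic_def by (intro sum.cong refl) (simp add: g_linear algebra_simps)
    also have "\<dots> = a p * \<alpha> p w * \<alpha> p (e p) - b p * \<beta> p w * \<beta> p (e p) - (b p * \<beta> p w * \<alpha> p (f p) + b p * \<alpha> p w * \<beta> p (f p))"
      unfolding sum_subtractf sum.distrib sum_distrib_left[symmetric] pair[OF ef(1) lin(1)] pair[OF ef(1) lin(2)]
        pair[OF ef(2) lin(1)] pair[OF ef(2) lin(2)] ..
    also have "\<dots> = \<alpha> p w * (a p * \<alpha> p (e p) - b p * \<beta> p (f p))" by (simp add: orth(1,2) algebra_simps)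
    also have "\<dots> = 0" by (simp add: orth(3))
    finally have 1: "(\<Sum>c\<in>?I. ?d \<mu>0 c * g p (T p (E \<mu>0 c p) w) (E \<mu>0 c p)) = 0" .
    have tr: "(\<Sum>c\<in>?I. ?d \<mu>0 c * (\<gamma> (E \<mu>0 c p) * \<delta> (E \<mu>0 c p))) = covector_trace \<mu>0 \<gamma> \<delta> p" for \<gamma> \<delta>
      unfolding covector_trace_def Let_def E_def ..
    have "(\<Sum>c\<in>?I. ?d \<mu>0 c * g p (T p (E \<mu>0 c p) (E \<mu>0 c p)) w) =
      (\<Sum>c\<in>?I. (a p * g p (e p) w) * (?d \<mu>0 c * (\<alpha> p (E \<mu>0 c p) * \<alpha> p (E \<mu>0 c p)))
        - (b p * g p (e p) w) * (?d \<mu>0 c * (\<beta> p (E \<mu>0 c p) * \<beta> p (E \<mu>0 c p)))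
        - (2 * b p * g p (f p) w) * (?d \<mu>0 c * (\<alpha> p (E \<mu>0 c p) * \<beta> p (E \<mu>0 c p))))"
      unfolding T_eq cubic_def by (intro sum.cong refl) (simp add: g_linear algebra_simps)
    also have "\<dots> = t1 * g p (e p) w - t2 * g p (f p) w"
      unfolding sum_subtractf sum_distrib_left[symmetric] tr t1_def t2_def by (simp add: algebra_simps)
    finally have 2: "(\<Sum>c\<in>?I. ?d \<mu>0 c * g p (T p (E \<mu>0 c p) (E \<mu>0 c p)) w) = t1 * g p (e p) w - t2 * g p (f p) w" .
    show ?thesis unfolding right_diff_distrib sum_subtractf 1 2 by simp
  qed
  have "mixed_scalar_curvature A k n D g T p = mixed_scalar_curvature A k n D g (\<lambda>p u v. 0) p +
    (1/2) * (\<Sum>\<nu>\<in>{1..k} - {\<mu>0}. \<Sum>b\<in>{1..n \<nu>}. ?d \<nu> b * (- (t1 * g p (e p) (\<nabla> p (E \<nu> b p) (E \<nu> b)) - t2 * g p (f p) (\<nabla> p (E \<nu> b p) (E \<nu> b)))))"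
    unfolding mixed_scalar_curvature_along[OF T al \<mu>0] E_def[symmetric] inner ..
  also have "(\<Sum>\<nu>\<in>{1..k} - {\<mu>0}. \<Sum>b\<in>{1..n \<nu>}. ?d \<nu> b * (- (t1 * g p (e p) (\<nabla> p (E \<nu> b p) (E \<nu> b)) - t2 * g p (f p) (\<nabla> p (E \<nu> b p) (E \<nu> b)))))
    = (\<Sum>\<nu>\<in>{1..k} - {\<mu>0}. \<Sum>b\<in>{1..n \<nu>}. t2 * (?d \<nu> b * g p (f p) (\<nabla> p (E \<nu> b p) (E \<nu> b))) - t1 * (?d \<nu> b * g p (e p) (\<nabla> p (E \<nu> b p) (E \<nu> b))))"
    by (intro sum.cong refl) (simp add: algebra_simps)
  also have "\<dots> = t2 * mean_curvature_form \<mu>0 f p - t1 * mean_curvature_form \<mu>0 e p"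
    unfolding mean_curvature_form_def Let_def E_def[symmetric] sum_subtractf sum_distrib_left ..
  finally show ?thesis unfolding t1_def t2_def by (simp add: algebra_simps)
qed

text \<open>Here the covectors are dual to \<open>e\<close>, \<open>f\<close> in the metric that
  also lowers the index of \<open>T\<close>; this is what makes the cubic form totally
  symmetric.\<close>

lemma statistical_cubic:
  assumes "smooth_fun A UNIV a" "smooth_fun A UNIV b" "smooth_field A UNIV e" "smooth_field A UNIV f"
  shows "statistical A g (\<lambda>p. cubic (a p) (b p) (g p (e p)) (g p (f p)) (e p) (f p))"
  unfolding statistical_def tensor_field12_def
proof (intro conjI allI impI)
  show "bilinear (cubic (a p) (b p) (g p (e p)) (g p (f p)) (e p) (f p))" for p
    by (intro bilinear_cubic linear_g_right)
  fix U X Y assume *: "open U \<and> smooth_field A U X \<and> smooth_field A U Y"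
  have sm: "smooth_fun A U a" "smooth_fun A U b" "smooth_field A U e" "smooth_field A U f"
    using smooth_fun_subset[OF assms(1)] smooth_fun_subset[OF assms(2)]
      smooth_field_subset[OF assms(3)] smooth_field_subset[OF assms(4)] by auto
  show "smooth_field A U (\<lambda>p. cubic (a p) (b p) (g p (e p)) (g p (f p)) (e p) (f p) (X p) (Y p))"
    unfolding cubic_def using *
    by (intro smooth_field_diff smooth_field_scaleR smooth_fun_diff smooth_fun_add smooth_fun_mult smooth_g sm) auto
next
  fix p u v w
  let ?T = "cubic (a p) (b p) (g p (e p)) (g p (f p)) (e p) (f p)"
  show "g p (?T u v) w = g p (?T v u) w" "g p (?T u v) w = g p (?T u w) v"
    by (simp_all add: cubic_def g_linear algebra_simps)
qed

text \<open>The cubic form has to be nonzero at one point only, so sections supported in a small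
  neighbourhood suffice and no global frame is involved.\<close>

lemma cubic_sections_exist:
  assumes \<mu>0: "\<mu>0 \<in> {1..k}" and n: "n \<mu>0 \<ge> 3 \<or> (n \<mu>0 = 2 \<and> (\<forall>p. mean_curvature A k n D g \<mu>0 p = 0))"
  shows "\<exists>a b e f. smooth_fun A UNIV a \<and> smooth_fun A UNIV b \<and> smooth_field A UNIV e \<and> smooth_field A UNIV f \<and>
    (\<forall>q. e q \<in> D \<mu>0 q \<and> f q \<in> D \<mu>0 q \<and> g q (e q) (f q) = 0 \<and> a q * g q (e q) (e q) = b q * g q (f q) (f q) \<and>
      g q (e q) (mean_curvature A k n D g \<mu>0 q) = 0 \<and> g q (f q) (mean_curvature A k n D g \<mu>0 q) = 0) \<and>
    (\<exists>p u v. cubic (a p) (b p) (g p (e p)) (g p (f p)) (e p) (f p) u v \<noteq> 0)"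
proof -
  let ?H = "mean_curvature A k n D g \<mu>0"
  have H: "smooth_field A UNIV ?H" by (rule smooth_mean_curvature[OF \<mu>0])
  have HD: "?H q \<in> D \<mu>0 q" for q by (rule mean_curvature_in_D[OF \<mu>0])
  have zD: "0 \<in> D \<mu>0 q" for q using subspace_0[OF subspace_D[OF \<mu>0]] .
  have local: ?thesis
    if U: "open U" "p \<in> U" and X: "smooth_field A U X" "smooth_field A U Y"
      and XY: "\<And>q. q \<in> U \<Longrightarrow> X q \<in> D \<mu>0 q \<and> Y q \<in> D \<mu>0 q \<and> g q (X q) (Y q) = 0 \<and> g q (X q) (?H q) = 0 \<and> g q (Y q) (?H q) = 0"
      and nz: "g p (X p) (X p) \<noteq> 0" "g p (Y p) (Y p) \<noteq> 0" for U p X Y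
  proof -
    obtain \<phi> K where \<phi>: "smooth_fun A UNIV \<phi>" "\<phi> p \<noteq> 0" "closed K" "K \<subseteq> U" "\<And>q. q \<notin> K \<Longrightarrow> \<phi> q = 0"
      using bump_function[OF U] by blast
    define e where "e = (\<lambda>q. if q \<in> U then \<phi> q *\<^sub>R X q else 0)"
    define f where "f = (\<lambda>q. if q \<in> U then \<phi> q *\<^sub>R Y q else 0)"
    have es: "smooth_field A UNIV e" "smooth_field A UNIV f"
      unfolding e_def f_def using smooth_field_cutoff[OF U(1) _ \<phi>(1,3,4,5)] X by auto
    \<comment> \<open>Each factor is the square of the opposite section. The trace condition then
      reads symmetrically and holds everywhere, also where the sections vanish.\<close>
    let ?a = "\<lambda>q. g q (f q) (f q)" and ?b = "\<lambda>q. g q (e q) (e q)"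
    have "smooth_fun A UNIV ?a" "smooth_fun A UNIV ?b" using es smooth_g[OF open_UNIV] by auto
    moreover have "e q \<in> D \<mu>0 q \<and> f q \<in> D \<mu>0 q \<and> g q (e q) (f q) = 0 \<and> ?a q * g q (e q) (e q) = ?b q * g q (f q) (f q) \<and>
      g q (e q) (?H q) = 0 \<and> g q (f q) (?H q) = 0" for q
      using XY[of q] zD by (auto simp: e_def f_def g_linear intro: subspace_scale[OF subspace_D[OF \<mu>0]])
    moreover have "cubic (?a p) (?b p) (g p (e p)) (g p (f p)) (e p) (f p) (e p) (e p) \<noteq> 0"
    proof -
      have fe: "g p (f p) (e p) = 0" using XY[OF U(2)] U(2) g_sym[of p "Y p" "X p"] by (simp add: e_def f_def g_linear)
      have "e p \<noteq> 0" "?b p \<noteq> 0" "?a p \<noteq> 0"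
        using nz \<phi>(2) U(2) by (auto simp: e_def f_def g_linear)
      then show ?thesis by (simp add: cubic_def fe)
    qed
    ultimately show ?thesis using es
      by (intro exI[of _ ?a] exI[of _ ?b] exI[of _ e] exI[of _ f]) blast
  qed
  \<comment> \<open>The mean curvature is non-null somewhere, or zero everywhere, or null everywhere
    but nonzero somewhere; the last can occur only in indefinite signature.\<close>
  consider p where "g p (?H p) (?H p) \<noteq> 0" | "\<forall>p. ?H p = 0" | p where "\<forall>q. g q (?H q) (?H q) = 0" "?H p \<noteq> 0" by blast
  then show ?thesis
  proof cases
    case (1 p)
    define h where "h q = g q (?H q) (?H q)" for q
    have hs: "smooth_fun A UNIV h" unfolding h_def[abs_def] by (intro smooth_g H open_UNIV)
    define U where "U = {q. h q \<noteq> 0}"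
    have "U = h -` (- {0})" by (auto simp: U_def)
    then have U: "open U" "p \<in> U"
      using open_vimage[OF _ smooth_fun_continuous[OF open_UNIV hs], of "- {0}"] 1 by (auto simp: U_def h_def)
    \<comment> \<open>The mean curvature is nonzero at \<open>p\<close>, which excludes the
      alternative of rank 2. Its normalisation becomes the first field of a frame, and the next two
      fields are orthogonal to it.\<close>
    have n3: "n \<mu>0 \<ge> 3" using n 1 by (auto simp: g_linear)
    let ?E = "\<lambda>(a::nat) q. inverse (sqrt \<bar>h q\<bar>) *\<^sub>R ?H q"
    have Es: "smooth_field A U (?E a)" for a
      by (intro smooth_field_scaleR U smooth_fun_inverse_sqrt_abs smooth_fun_subset[OF hs] smooth_field_subset[OF H])
         (auto simp: U_def)
    have norm1: "\<bar>g q (?E a q) (?E a q)\<bar> = 1" if "q \<in> U" for q and a :: nat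
    proof -
      have gen: "inverse s * (inverse s * x) = x / (s * s)" for s x :: real
        by (simp add: divide_inverse mult_ac)
      have "g q (?E a q) (?E a q) = inverse (sqrt \<bar>h q\<bar>) * (inverse (sqrt \<bar>h q\<bar>) * h q)"
        by (simp add: g_linear h_def)
      also have "\<dots> = h q / \<bar>h q\<bar>" unfolding gen by simp
      finally show ?thesis using that by (simp add: abs_divide U_def)
    qed
    have "section_frame \<mu>0 1 U ?E"
      unfolding section_frame_def ortho_system_def
      using Es norm1 HD by (auto intro: subspace_scale[OF subspace_D[OF \<mu>0]])
    from section_frame_complete[OF \<mu>0 U this, of 3] n3 obtain V F where V: "open V" "p \<in> V" "V \<subseteq> U"
      "section_frame \<mu>0 3 V F" "F 1 = ?E 1" by auto
    have os: "ortho_system \<mu>0 3 q (\<lambda>a. F a q)" if "q \<in> V" for q using V(4) that by (simp add: section_frame_def)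
    have perp: "g q (F a q) (?H q) = 0" if "q \<in> V" "a \<in> {2,3}" for q a
    proof -
      have "a \<in> {1..3}" "1 \<in> {1..3::nat}" "1 \<noteq> a" using that by auto
      then have "g q (F a q) (F 1 q) = 0" using ortho_systemD(4)[OF os[OF that(1)], of a 1] by auto
      then have "inverse (sqrt \<bar>h q\<bar>) * g q (F a q) (?H q) = 0" unfolding V(5) by (simp only: g_linear real_scaleR_def)
      moreover have "h q \<noteq> 0" using that V(3) by (auto simp: U_def)
      ultimately show ?thesis by simp
    qed
    show ?thesis
    proof (rule local[OF V(1,2), of "F 2" "F 3"])
      show "smooth_field A V (F 2)" "smooth_field A V (F 3)" using V(4) by (auto simp: section_frame_def)
      show "F 2 q \<in> D \<mu>0 q \<and> F 3 q \<in> D \<mu>0 q \<and> g q (F 2 q) (F 3 q) = 0 \<and> g q (F 2 q) (?H q) = 0 \<and> g q (F 3 q) (?H q) = 0"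
        if "q \<in> V" for q
        using ortho_systemD(1,4)[OF os[OF that], of 2] ortho_systemD(1)[OF os[OF that], of 3] perp[OF that] by auto
      show "g p (F 2 p) (F 2 p) \<noteq> 0" "g p (F 3 p) (F 3 p) \<noteq> 0"
        using ortho_systemD(3)[OF os[OF V(2)], of 2] ortho_systemD(3)[OF os[OF V(2)], of 3] by auto
    qed
  next
    case 2
    fix p :: 'm
    have n2: "n \<mu>0 \<ge> 2" using n by auto
    have "section_frame \<mu>0 0 UNIV (\<lambda>_ _. 0)" by (simp add: section_frame_def ortho_system_def)
    from section_frame_complete[OF \<mu>0 open_UNIV UNIV_I this, of 2 p] n2 obtain V F where V: "open V" "p \<in> V"
      "section_frame \<mu>0 2 V F" by auto
    have os: "ortho_system \<mu>0 2 q (\<lambda>a. F a q)" if "q \<in> V" for q using V(3) that by (simp add: section_frame_def)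
    show ?thesis
    proof (rule local[OF V(1,2), of "F 1" "F 2"])
      show "smooth_field A V (F 1)" "smooth_field A V (F 2)" using V(3) by (auto simp: section_frame_def)
      show "F 1 q \<in> D \<mu>0 q \<and> F 2 q \<in> D \<mu>0 q \<and> g q (F 1 q) (F 2 q) = 0 \<and> g q (F 1 q) (?H q) = 0 \<and> g q (F 2 q) (?H q) = 0"
        if "q \<in> V" for q
        using ortho_systemD(1,4)[OF os[OF that], of 1] ortho_systemD(1)[OF os[OF that], of 2] 2 by (auto simp: g_linear)
      show "g p (F 1 p) (F 1 p) \<noteq> 0" "g p (F 2 p) (F 2 p) \<noteq> 0"
        using ortho_systemD(3)[OF os[OF V(2)], of 1] ortho_systemD(3)[OF os[OF V(2)], of 2] by auto
    qed
  next
    case (3 p)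
    obtain u where u: "g p (?H p) u \<noteq> 0" using g_nondeg 3(2) by blast
    \<comment> \<open>A null mean curvature is orthogonal to itself, so it can serve as
      \<open>e\<close> with \<open>f = 0\<close>; the cubic form is the cube of its dual
      covector.\<close>
    have "cubic 1 0 (g p (?H p)) (g p 0) (?H p) 0 u u \<noteq> 0" using u 3(2) by (simp add: cubic_def)
    then show ?thesis
      using 3 H HD zD smooth_fun_const[OF open_UNIV] smooth_field_zero[OF open_UNIV]
      by (intro exI[of _ "\<lambda>_. 1"] exI[of _ "\<lambda>_. 0"] exI[of _ ?H] exI[of _ "\<lambda>_. 0"])
         (auto simp: g_linear)
  qed
qed

end

section \<open>Variations of the action\<close>

lemma set_integral_perturbation:
  fixes s l :: "'a \<Rightarrow> real"
  assumes l: "set_integrable M \<Omega> l"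
  shows "\<bar>(LINT p:\<Omega>|M. s p + l p) - (LINT p:\<Omega>|M. s p)\<bar> \<le> (LINT p:\<Omega>|M. \<bar>l p\<bar>)"
proof (cases "set_integrable M \<Omega> s")
  case True
  then have "(LINT p:\<Omega>|M. s p + l p) - (LINT p:\<Omega>|M. s p) = (LINT p:\<Omega>|M. l p)"
    using l by simp
  also have "\<bar>\<dots>\<bar> \<le> (LINT p:\<Omega>|M. \<bar>l p\<bar>)" using set_integral_norm_bound[OF l] by simp
  finally show ?thesis .
next
  case False
  have "\<not> set_integrable M \<Omega> (\<lambda>p. s p + l p)"
  proof
    assume "set_integrable M \<Omega> (\<lambda>p. s p + l p)"
    from set_integral_diff(1)[OF this l] False show False by simp
  qed
  then have "(LINT p:\<Omega>|M. s p + l p) = 0" "(LINT p:\<Omega>|M. s p) = 0"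
    using False by (simp_all add: set_lebesgue_integral_def set_integrable_def not_integrable_integral_eq)
  moreover have "(LINT p:\<Omega>|M. \<bar>l p\<bar>) \<ge> 0"
    unfolding set_lebesgue_integral_def by (intro Bochner_Integration.integral_nonneg) simp
  ultimately show ?thesis by simp
qed

lemma set_integrable_bounded:
  fixes l :: "'a \<Rightarrow> real"
  assumes m: "l \<in> borel_measurable M" and \<Omega>: "\<Omega> \<in> sets M" and B: "\<And>p. p \<in> \<Omega> \<Longrightarrow> \<bar>l p\<bar> \<le> B" "B \<ge> 0"
    and V: "emeasure M \<Omega> \<le> ennreal V" "V \<ge> 0"
  shows "set_integrable M \<Omega> l" "(LINT p:\<Omega>|M. \<bar>l p\<bar>) \<le> B * V"
proof -
  have fin: "emeasure M \<Omega> < \<infinity>" using V(1) by (rule le_less_trans) simp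
  have ind: "set_integrable M \<Omega> (\<lambda>_. B)"
    using fin \<Omega> by (simp add: set_integrable_def integrable_real_indicator)
  show i: "set_integrable M \<Omega> l"
    by (rule set_integrable_bound[OF ind]) (use m \<Omega> B in \<open>auto intro!: AE_I2 simp: set_borel_measurable_def\<close>)
  have "(LINT p:\<Omega>|M. \<bar>l p\<bar>) \<le> (LINT p:\<Omega>|M. B)"
    by (rule set_integral_mono[OF set_integrable_abs[OF i] ind]) (use B in auto)
  also have "\<dots> = B * measure M \<Omega>" using \<Omega> fin by (simp add: set_lebesgue_integral_def)
  also have "\<dots> \<le> B * V"
    using V B(2) fin by (intro mult_left_mono) (auto simp: measure_def enn2real_leI)
  finally show "(LINT p:\<Omega>|M. \<bar>l p\<bar>) \<le> B * V" .
qed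

lemma has_derivative_zero_quadratic:
  fixes d :: "real \<Rightarrow> real"
  assumes "\<delta> > 0" "\<And>t. \<bar>t\<bar> < \<delta> \<Longrightarrow> \<bar>d t\<bar> \<le> C * t\<^sup>2"
  shows "(d has_real_derivative 0) (at 0)"
proof -
  have d0: "d 0 = 0" using assms(2)[of 0] assms(1) by simp
  have "((\<lambda>h. (d h - d 0) / (h - 0)) \<longlongrightarrow> 0) (at 0)"
  proof (rule Lim_null_comparison)
    show "\<forall>\<^sub>F h in at 0. norm ((d h - d 0) / (h - 0)) \<le> C * \<bar>h\<bar>"
      unfolding eventually_at
    proof (intro exI[of _ \<delta>] conjI ballI impI assms(1))
      fix h :: real assume h: "h \<noteq> 0 \<and> dist h 0 < \<delta>"
      then have "\<bar>d h\<bar> \<le> C * h\<^sup>2" using assms(2) by simp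
      then have "\<bar>d h\<bar> / \<bar>h\<bar> \<le> C * h\<^sup>2 / \<bar>h\<bar>" by (rule divide_right_mono) simp
      also have "C * h\<^sup>2 / \<bar>h\<bar> = C * \<bar>h\<bar>"
        using h by (simp add: power2_eq_square abs_if)
      finally show "norm ((d h - d 0) / (h - 0)) \<le> C * \<bar>h\<bar>" by (simp add: d0 abs_divide)
    qed
    show "((\<lambda>h. C * \<bar>h\<bar>) \<longlongrightarrow> 0) (at 0)" by (auto intro!: tendsto_eq_intros)
  qed
  then show ?thesis by (simp add: has_field_derivative_iff)
qed

text \<open>A bound O(|t|^r), uniform near the point. Being local it can be checked in a chart;
  compactness makes it uniform on the integration domain.\<close>

definition locally_order :: "nat \<Rightarrow> (real \<Rightarrow> 'm::topological_space \<Rightarrow> real) \<Rightarrow> 'm \<Rightarrow> bool" where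
  "locally_order r f p \<longleftrightarrow> (\<exists>N C \<delta>. open N \<and> p \<in> N \<and> C \<ge> 0 \<and> \<delta> > 0 \<and>
     (\<forall>t q. \<bar>t\<bar> < \<delta> \<longrightarrow> q \<in> N \<longrightarrow> \<bar>f t q\<bar> \<le> C * \<bar>t\<bar> ^ r))"

lemma locally_order_mult:
  assumes "locally_order r f p" "locally_order s h p"
  shows "locally_order (r + s) (\<lambda>t q. f t q * h t q) p"
proof -
  obtain N C \<delta> where 1: "open N" "p \<in> N" "C \<ge> 0" "\<delta> > 0" "\<And>t q. \<bar>t\<bar> < \<delta> \<Longrightarrow> q \<in> N \<Longrightarrow> \<bar>f t q\<bar> \<le> C * \<bar>t\<bar> ^ r"
    using assms(1) unfolding locally_order_def by blast
  obtain N' C' \<delta>' where 2: "open N'" "p \<in> N'" "C' \<ge> 0" "\<delta>' > 0" "\<And>t q. \<bar>t\<bar> < \<delta>' \<Longrightarrow> q \<in> N' \<Longrightarrow> \<bar>h t q\<bar> \<le> C' * \<bar>t\<bar> ^ s"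
    using assms(2) unfolding locally_order_def by blast
  have "\<bar>f t q * h t q\<bar> \<le> C * C' * \<bar>t\<bar> ^ (r + s)" if "\<bar>t\<bar> < min \<delta> \<delta>'" "q \<in> N \<inter> N'" for t q
  proof -
    have "\<bar>f t q\<bar> * \<bar>h t q\<bar> \<le> (C * \<bar>t\<bar> ^ r) * (C' * \<bar>t\<bar> ^ s)"
      using that 1 2 by (intro mult_mono) auto
    then show ?thesis by (simp add: abs_mult power_add mult_ac)
  qed
  then show ?thesis unfolding locally_order_def
    using 1 2 by (intro exI[of _ "N \<inter> N'"] exI[of _ "C * C'"] exI[of _ "min \<delta> \<delta>'"]) auto
qed

lemma locally_order_add:
  assumes "locally_order r f p" "locally_order r h p"
  shows "locally_order r (\<lambda>t q. f t q + h t q) p"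
proof -
  obtain N C \<delta> where 1: "open N" "p \<in> N" "C \<ge> 0" "\<delta> > 0" "\<And>t q. \<bar>t\<bar> < \<delta> \<Longrightarrow> q \<in> N \<Longrightarrow> \<bar>f t q\<bar> \<le> C * \<bar>t\<bar> ^ r"
    using assms(1) unfolding locally_order_def by blast
  obtain N' C' \<delta>' where 2: "open N'" "p \<in> N'" "C' \<ge> 0" "\<delta>' > 0" "\<And>t q. \<bar>t\<bar> < \<delta>' \<Longrightarrow> q \<in> N' \<Longrightarrow> \<bar>h t q\<bar> \<le> C' * \<bar>t\<bar> ^ r"
    using assms(2) unfolding locally_order_def by blast
  have "\<bar>f t q + h t q\<bar> \<le> (C + C') * \<bar>t\<bar> ^ r" if "\<bar>t\<bar> < min \<delta> \<delta>'" "q \<in> N \<inter> N'" for t q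
  proof -
    have "\<bar>f t q + h t q\<bar> \<le> \<bar>f t q\<bar> + \<bar>h t q\<bar>" by simp
    also have "\<dots> \<le> C * \<bar>t\<bar> ^ r + C' * \<bar>t\<bar> ^ r" using that 1 2 by (intro add_mono) auto
    finally show ?thesis by (simp add: algebra_simps)
  qed
  then show ?thesis unfolding locally_order_def
    using 1 2 by (intro exI[of _ "N \<inter> N'"] exI[of _ "C + C'"] exI[of _ "min \<delta> \<delta>'"]) auto
qed

lemma locally_order_zero: "locally_order r (\<lambda>t q. 0) p"
  unfolding locally_order_def by (intro exI[of _ UNIV] exI[of _ 0] exI[of _ 1]) simp

lemma locally_order_sum:
  "(\<And>i. i \<in> I \<Longrightarrow> locally_order r (f i) p) \<Longrightarrow> locally_order r (\<lambda>t q. \<Sum>i\<in>I. f i t q) p"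
  by (induction I rule: infinite_finite_induct) (auto intro: locally_order_zero locally_order_add)

lemma locally_order_cong:
  assumes f: "locally_order r f p" and N: "open N" "p \<in> N" "\<delta> > 0"
    and eq: "\<And>t q. \<bar>t\<bar> < \<delta> \<Longrightarrow> q \<in> N \<Longrightarrow> f t q = h t q"
  shows "locally_order r h p"
proof -
  obtain N' C' \<delta>' where 2: "open N'" "p \<in> N'" "C' \<ge> 0" "\<delta>' > 0" "\<And>t q. \<bar>t\<bar> < \<delta>' \<Longrightarrow> q \<in> N' \<Longrightarrow> \<bar>f t q\<bar> \<le> C' * \<bar>t\<bar> ^ r"
    using f unfolding locally_order_def by blast
  have "\<bar>h t q\<bar> \<le> C' * \<bar>t\<bar> ^ r" if "\<bar>t\<bar> < min \<delta> \<delta>'" "q \<in> N \<inter> N'" for t q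
    using 2(5)[of t q] eq[of t q] that by auto
  then show ?thesis unfolding locally_order_def
    using N 2 by (intro exI[of _ "N \<inter> N'"] exI[of _ C'] exI[of _ "min \<delta> \<delta>'"]) auto
qed

text \<open>The measure may vary with \<open>t\<close> as well, so one bound has to hold for all
  small \<open>t\<close>.\<close>

definition locally_bounded_mass :: "(real \<Rightarrow> 'm::topological_space measure) \<Rightarrow> 'm \<Rightarrow> bool" where
  "locally_bounded_mass M p \<longleftrightarrow> (\<exists>N C \<delta>. open N \<and> p \<in> N \<and> C \<ge> 0 \<and> \<delta> > 0 \<and>
     (\<forall>t. \<bar>t\<bar> < \<delta> \<longrightarrow> emeasure (M t) N \<le> ennreal C))"

text \<open>Nothing is differentiated under the integral sign: the difference of the two integrals
  is bounded by a multiple of t^2, so it has derivative 0 at 0 whatever the behaviour of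
  \<open>s\<close>.\<close>

lemma action_perturbation:
  fixes M :: "real \<Rightarrow> 'm::topological_space measure"
  assumes \<Omega>: "\<Omega> \<in> sets borel" "compact (closure \<Omega>)" and \<epsilon>: "\<epsilon> > 0"
    and M: "\<And>t. \<bar>t\<bar> < \<epsilon> \<Longrightarrow> sets (M t) = sets borel"
    and l: "\<And>t. \<bar>t\<bar> < \<epsilon> \<Longrightarrow> l t \<in> borel_measurable borel"
    and order: "\<And>p. locally_order 2 l p" and mass: "\<And>p. locally_bounded_mass M p"
    and der: "((\<lambda>t. LINT p:\<Omega>|M t. s t p) has_real_derivative 0) (at 0)"
  shows "((\<lambda>t. LINT p:\<Omega>|M t. s t p + l t p) has_real_derivative 0) (at 0)"
proof -
  \<comment> \<open>Merges the order bound and the mass bound on one neighbourhood with one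
    constant.\<close>
  define Q where "Q p N C \<delta> \<longleftrightarrow> open N \<and> p \<in> N \<and> C \<ge> 0 \<and> \<delta> > 0 \<and>
     (\<forall>t. \<bar>t\<bar> < \<delta> \<longrightarrow> emeasure (M t) N \<le> ennreal C \<and> (\<forall>q\<in>N. \<bar>l t q\<bar> \<le> C * t\<^sup>2))" for p N C \<delta>
  have "\<exists>N C \<delta>. Q p N C \<delta>" for p
  proof -
    obtain N C \<delta> where 1: "open N" "p \<in> N" "C \<ge> 0" "\<delta> > 0" "\<And>t q. \<bar>t\<bar> < \<delta> \<Longrightarrow> q \<in> N \<Longrightarrow> \<bar>l t q\<bar> \<le> C * \<bar>t\<bar> ^ 2"
      using order[of p] unfolding locally_order_def by blast
    obtain N' C' \<delta>' where 2: "open N'" "p \<in> N'" "C' \<ge> 0" "\<delta>' > 0" "\<And>t. \<bar>t\<bar> < \<delta>' \<Longrightarrow> emeasure (M t) N' \<le> ennreal C'"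
      using mass[of p] unfolding locally_bounded_mass_def by blast
    have "emeasure (M t) (N \<inter> N') \<le> ennreal (max C C') \<and> (\<forall>q\<in>N \<inter> N'. \<bar>l t q\<bar> \<le> max C C' * t\<^sup>2)"
      if t: "\<bar>t\<bar> < min \<epsilon> (min \<delta> \<delta>')" for t
    proof (intro conjI ballI)
      have "emeasure (M t) (N \<inter> N') \<le> emeasure (M t) N'"
        using t 2(1) M[of t] by (intro emeasure_mono) auto
      also have "\<dots> \<le> ennreal C'" using 2(5) t by simp
      also have "\<dots> \<le> ennreal (max C C')" by (intro ennreal_leI) simp
      finally show "emeasure (M t) (N \<inter> N') \<le> ennreal (max C C')" .
      fix q assume "q \<in> N \<inter> N'"
      then have "\<bar>l t q\<bar> \<le> C * t\<^sup>2" using 1(5)[of t q] t by simp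
      also have "\<dots> \<le> max C C' * t\<^sup>2" by (intro mult_right_mono) auto
      finally show "\<bar>l t q\<bar> \<le> max C C' * t\<^sup>2" .
    qed
    then show ?thesis unfolding Q_def
      using 1(1-4) 2(1-4) \<epsilon> by (intro exI[of _ "N \<inter> N'"] exI[of _ "max C C'"] exI[of _ "min \<epsilon> (min \<delta> \<delta>')"]) auto
  qed
  then obtain N C \<delta> where NQ: "\<And>p. Q p (N p) (C p) (\<delta> p)" by metis
  have N: "\<And>p. open (N p)" "\<And>p. p \<in> N p" "\<And>p. C p \<ge> 0" "\<And>p. \<delta> p > 0"
    "\<And>p t. \<bar>t\<bar> < \<delta> p \<Longrightarrow> emeasure (M t) (N p) \<le> ennreal (C p)"
    "\<And>p t q. \<bar>t\<bar> < \<delta> p \<Longrightarrow> q \<in> N p \<Longrightarrow> \<bar>l t q\<bar> \<le> C p * t\<^sup>2"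
    using NQ unfolding Q_def by simp_all
  have "closure \<Omega> \<subseteq> (\<Union>p\<in>UNIV. N p)" using N(2) by auto
  from compactE_image[OF \<Omega>(2) N(1) this] obtain F where F: "finite F" "closure \<Omega> \<subseteq> (\<Union>p\<in>F. N p)" by metis
  \<comment> \<open>As a sum of nonnegative constants \<open>K\<close> bounds every single
    \<open>C p\<close> and also the total mass of the finite cover; hence the factor
    \<open>K * K\<close> below.\<close>
  define K where "K = (\<Sum>p\<in>F. C p)"
  have CK: "C p \<le> K" if "p \<in> F" for p unfolding K_def using that F(1) N(3) by (intro member_le_sum) auto
  have K: "K \<ge> 0" unfolding K_def using N(3) by (intro sum_nonneg) auto
  define d where "d = Min (insert \<epsilon> (\<delta> ` F))"
  have d: "d > 0" unfolding d_def using F(1) N(4) \<epsilon> by (subst Min_gr_iff) auto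
  have dF: "\<bar>t\<bar> < \<delta> p" if "\<bar>t\<bar> < d" "p \<in> F" for t p using that F(1) by (auto simp: d_def)
  have d\<epsilon>: "\<bar>t\<bar> < \<epsilon>" if "\<bar>t\<bar> < d" for t using that F(1) by (auto simp: d_def)
  define D where "D t = (LINT p:\<Omega>|M t. s t p + l t p) - (LINT p:\<Omega>|M t. s t p)" for t
  have "\<bar>D t\<bar> \<le> (K * K) * t\<^sup>2" if t: "\<bar>t\<bar> < d" for t
  proof -
    have s: "sets (M t) = sets borel" using M[OF d\<epsilon>[OF t]] .
    have "open (\<Union>p\<in>F. N p)" using N(1) by blast
    then have "emeasure (M t) \<Omega> \<le> emeasure (M t) (\<Union>p\<in>F. N p)"
      using F(2) closure_subset[of \<Omega>] s by (intro emeasure_mono) auto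
    also have "\<dots> \<le> (\<Sum>p\<in>F. emeasure (M t) (N p))"
      using F(1) N(1) s by (intro emeasure_subadditive_finite) auto
    also have "\<dots> \<le> (\<Sum>p\<in>F. ennreal (C p))" using N(5)[OF dF[OF t]] by (intro sum_mono)
    also have "\<dots> = ennreal K" unfolding K_def using N(3) by simp
    finally have V: "emeasure (M t) \<Omega> \<le> ennreal K" .
    have B: "\<bar>l t q\<bar> \<le> K * t\<^sup>2" if q: "q \<in> \<Omega>" for q
    proof -
      obtain p where p: "p \<in> F" "q \<in> N p" using q F(2) closure_subset[of \<Omega>] by blast
      have "\<bar>l t q\<bar> \<le> C p * t\<^sup>2" using N(6)[OF dF[OF t p(1)] p(2)] .
      also have "\<dots> \<le> K * t\<^sup>2" using CK[OF p(1)] by (intro mult_right_mono) auto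
      finally show ?thesis .
    qed
    have lm: "l t \<in> borel_measurable (M t)"
      using l[OF d\<epsilon>[OF t]] by (simp add: measurable_cong_sets[OF s refl])
    have \<Omega>M: "\<Omega> \<in> sets (M t)" using \<Omega>(1) s by simp
    have "K * t\<^sup>2 \<ge> 0" using K by simp
    note si = set_integrable_bounded[OF lm \<Omega>M B this V K]
    have "\<bar>D t\<bar> \<le> (LINT p:\<Omega>|M t. \<bar>l t p\<bar>)"
      unfolding D_def by (rule set_integral_perturbation[OF si(1)])
    also have "\<dots> \<le> (K * t\<^sup>2) * K" by (rule si(2))
    finally show ?thesis by (simp add: mult_ac)
  qed
  from has_derivative_zero_quadratic[OF d this] have "(D has_real_derivative 0) (at 0)" .
  from DERIV_add[OF der this] show ?thesis by (simp add: D_def)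
qed

lemma integration_domainD:
  assumes "integration_domain \<Omega>" shows "\<Omega> \<in> sets borel" "compact (closure \<Omega>)"
  using assms unfolding integration_domain_def by (auto split: if_splits)

section \<open>Families of functions\<close>

context smooth_manifold
begin

text \<open>Smoothness jointly in \<open>t\<close> and in the coordinates of one fixed chart, the
  form from which bounds uniform in both can be read off.\<close>

definition chart_family :: "('m, 'n) chart \<Rightarrow> real \<Rightarrow> 'm set \<Rightarrow> (real \<Rightarrow> 'm \<Rightarrow> real) \<Rightarrow> bool" where
  "chart_family c \<epsilon> N f \<longleftrightarrow> smooth_on ({-\<epsilon><..<\<epsilon>} \<times> snd c ` N) (\<lambda>z. f (fst z) (chart_inv c (snd z)))"

context
  fixes c :: "('m, 'n) chart" and \<epsilon> :: real and N :: "'m set"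
  assumes c: "c \<in> A" and N: "open N" "N \<subseteq> fst c"
begin

lemma family_domain_open: "open ({-\<epsilon><..<\<epsilon>} \<times> snd c ` N)"
  by (intro open_Times open_greaterThanLessThan chart_open_map' c N)

lemma chart_family_cong:
  assumes "\<And>t q. \<bar>t\<bar> < \<epsilon> \<Longrightarrow> q \<in> N \<Longrightarrow> f t q = h t q" "chart_family c \<epsilon> N f"
  shows "chart_family c \<epsilon> N h"
  unfolding chart_family_def
  by (rule smooth_on_cong[OF family_domain_open _ assms(2)[unfolded chart_family_def]])
     (use assms(1) c N(2) in \<open>auto simp: subset_iff abs_less_iff\<close>)

lemma smooth_on_family_snd:
  assumes "smooth_on (snd c ` N) F"
  shows "smooth_on ({-\<epsilon><..<\<epsilon>} \<times> snd c ` N) (\<lambda>z. F (snd z))"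
  by (rule smooth_on_compose[OF family_domain_open chart_open_map'[OF c N] _ assms])
     (auto intro!: smooth_on_bounded_linear[OF family_domain_open bounded_linear_snd] smooth_on_id family_domain_open)

lemma chart_family_const: "smooth_fun A N f \<Longrightarrow> chart_family c \<epsilon> N (\<lambda>t. f)"
  unfolding chart_family_def
  by (rule smooth_on_family_snd[of "\<lambda>y. f (chart_inv c y)"]) (rule smooth_fun_chart[OF _ c order_refl N(2)])

lemma chart_family_real_const: "chart_family c \<epsilon> N (\<lambda>t q. r)"
  unfolding chart_family_def by (rule smooth_on_const)

lemma chart_family_add: "chart_family c \<epsilon> N f \<Longrightarrow> chart_family c \<epsilon> N h \<Longrightarrow> chart_family c \<epsilon> N (\<lambda>t q. f t q + h t q)"
  and chart_family_diff: "chart_family c \<epsilon> N f \<Longrightarrow> chart_family c \<epsilon> N h \<Longrightarrow> chart_family c \<epsilon> N (\<lambda>t q. f t q - h t q)"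
  and chart_family_mult: "chart_family c \<epsilon> N f \<Longrightarrow> chart_family c \<epsilon> N h \<Longrightarrow> chart_family c \<epsilon> N (\<lambda>t q. f t q * h t q)"
  unfolding chart_family_def
  by (rule smooth_on_add smooth_on_diff smooth_on_mult, rule family_domain_open, assumption, assumption)+

lemma chart_family_sum: "(\<And>i. i \<in> I \<Longrightarrow> chart_family c \<epsilon> N (f i)) \<Longrightarrow> chart_family c \<epsilon> N (\<lambda>t q. \<Sum>i\<in>I. f i t q)"
  unfolding chart_family_def by (rule smooth_on_sum[OF family_domain_open])

lemma chart_family_continuous:
  assumes f: "chart_family c \<epsilon> N f" and t: "\<bar>t\<bar> < \<epsilon>" shows "continuous_on N (f t)"
proof -
  have "continuous_on ({-\<epsilon><..<\<epsilon>} \<times> snd c ` N) (\<lambda>z. f (fst z) (chart_inv c (snd z)))"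
    using f smooth_on_continuous by (auto simp: chart_family_def)
  moreover have "continuous_on N (\<lambda>q. (t, snd c q))"
    by (intro continuous_on_Pair continuous_on_const continuous_on_subset[OF continuous_on_chart[OF c] N(2)])
  moreover have "(\<lambda>q. (t, snd c q)) ` N \<subseteq> {-\<epsilon><..<\<epsilon>} \<times> snd c ` N" using t by (auto simp: abs_less_iff)
  ultimately have "continuous_on N (\<lambda>q. f (fst (t, snd c q)) (chart_inv c (snd (t, snd c q))))"
    by (rule continuous_on_compose2)
  then show ?thesis by (rule continuous_on_eq) (use c N in auto)
qed

text \<open>The closed box supplies compactness for the bounds, the open coordinate ball the
  neighbourhood on which they are stated.\<close>

lemma family_box:
  assumes p: "p \<in> N" and \<epsilon>: "\<epsilon> > 0"
  obtains r where "r > 0" "{-(\<epsilon>/2)..\<epsilon>/2} \<times> cball (snd c p) r \<subseteq> {-\<epsilon><..<\<epsilon>} \<times> snd c ` N"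
    "open {q \<in> fst c. snd c q \<in> ball (snd c p) r}" "p \<in> {q \<in> fst c. snd c q \<in> ball (snd c p) r}"
proof -
  obtain r where r: "r > 0" "cball (snd c p) r \<subseteq> snd c ` N"
    using chart_open_map'[OF c N] p open_contains_cball by blast
  have "open (fst c \<inter> snd c -` ball (snd c p) r)"
    by (intro continuous_open_preimage continuous_on_chart chart_open c) simp
  moreover have "fst c \<inter> snd c -` ball (snd c p) r = {q \<in> fst c. snd c q \<in> ball (snd c p) r}" by auto
  ultimately show ?thesis using r p N \<epsilon> by (intro that[of r]) auto
qed

lemma chart_family_bounded:
  assumes f: "chart_family c \<epsilon> N f" and p: "p \<in> N" and \<epsilon>: "\<epsilon> > 0"
  shows "locally_order 0 f p"
proof -
  obtain r where r: "r > 0" "{-(\<epsilon>/2)..\<epsilon>/2} \<times> cball (snd c p) r \<subseteq> {-\<epsilon><..<\<epsilon>} \<times> snd c ` N"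
    "open {q \<in> fst c. snd c q \<in> ball (snd c p) r}" "p \<in> {q \<in> fst c. snd c q \<in> ball (snd c p) r}"
    by (rule family_box[OF p \<epsilon>])
  let ?F = "\<lambda>z. f (fst z) (chart_inv c (snd z))" and ?K = "{-(\<epsilon>/2)..\<epsilon>/2} \<times> cball (snd c p) r"
  have "continuous_on ?K ?F"
    using f smooth_on_continuous continuous_on_subset[OF _ r(2)] by (auto simp: chart_family_def)
  then have "bounded (?F ` ?K)"
    by (intro compact_imp_bounded compact_continuous_image compact_Times) auto
  then obtain C where B: "\<forall>x\<in>?F ` ?K. norm x \<le> C" unfolding bounded_iff by blast
  have C: "\<bar>?F z\<bar> \<le> C" if "z \<in> ?K" for z using bspec[OF B imageI[OF that]] by simp
  have "\<bar>f t q\<bar> \<le> \<bar>C\<bar> * \<bar>t\<bar> ^ 0" if "\<bar>t\<bar> < \<epsilon>/2" "q \<in> {q \<in> fst c. snd c q \<in> ball (snd c p) r}" for t q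
    using C[of "(t, snd c q)"] that c by (auto simp: abs_less_iff less_imp_le)
  then show ?thesis unfolding locally_order_def using r \<epsilon> by (meson abs_ge_zero half_gt_zero)
qed

text \<open>The derivative in \<open>t\<close> is bounded on a compact box, and the mean value
  theorem in \<open>t\<close> starts from the value 0.\<close>

lemma chart_family_order_one:
  assumes f: "chart_family c \<epsilon> N f" and p: "p \<in> N" and \<epsilon>: "\<epsilon> > 0" and zero: "\<And>q. q \<in> N \<Longrightarrow> f 0 q = 0"
  shows "locally_order 1 f p"
proof -
  let ?S = "{-\<epsilon><..<\<epsilon>} \<times> snd c ` N"
  obtain r where r: "r > 0" "{-(\<epsilon>/2)..\<epsilon>/2} \<times> cball (snd c p) r \<subseteq> ?S"
    "open {q \<in> fst c. snd c q \<in> ball (snd c p) r}" "p \<in> {q \<in> fst c. snd c q \<in> ball (snd c p) r}"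
    by (rule family_box[OF p \<epsilon>])
  let ?F = "\<lambda>z. f (fst z) (chart_inv c (snd z))" and ?K = "{-(\<epsilon>/2)..\<epsilon>/2} \<times> cball (snd c p) r"
  \<comment> \<open>The partial derivative in \<open>t\<close>: direction 1 in the parameter and 0
    in the coordinates.\<close>
  let ?D = "\<lambda>z. frechet_derivative ?F (at z) (1, 0)"
  have F: "smooth_on ?S ?F" using f by (simp add: chart_family_def)
  have "continuous_on ?K ?D"
    using smooth_on_continuous[OF smooth_on_derivative[OF F]] continuous_on_subset[OF _ r(2)] by blast
  then have "bounded (?D ` ?K)"
    by (intro compact_imp_bounded compact_continuous_image compact_Times) auto
  then obtain C where B: "\<forall>x\<in>?D ` ?K. norm x \<le> C" unfolding bounded_iff by blast
  have C: "\<bar>?D z\<bar> \<le> C" if "z \<in> ?K" for z using bspec[OF B imageI[OF that]] by simp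
  have "\<bar>f t q\<bar> \<le> \<bar>C\<bar> * \<bar>t\<bar> ^ 1" if t: "\<bar>t\<bar> < \<epsilon>/2" and q: "q \<in> {q \<in> fst c. snd c q \<in> ball (snd c p) r}" for t q
  proof -
    let ?y = "snd c q" and ?I = "{-(\<epsilon>/2)..\<epsilon>/2}"
    have yK: "(s, ?y) \<in> ?K" if "s \<in> ?I" for s using that q by (auto simp: less_imp_le)
    have "norm (?F (t, ?y) - ?F (0, ?y)) \<le> \<bar>C\<bar> * norm (t - 0)"
    proof (rule field_differentiable_bound[of ?I])
      fix s assume s: "s \<in> ?I"
      then have sS: "(s, ?y) \<in> ?S" using yK r(2) by blast
      have d: "((\<lambda>s. (s, ?y)) has_derivative (\<lambda>v. (v, 0))) (at s)" by (auto intro!: derivative_eq_intros)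
      have hd: "((\<lambda>s. ?F (s, ?y)) has_derivative (\<lambda>v. frechet_derivative ?F (at (s, ?y)) (v, 0))) (at s)"
        by (rule has_derivative_compose[OF d smooth_on_has_derivative[OF F family_domain_open sS]])
      have lin: "frechet_derivative ?F (at (s, ?y)) (v, 0) = ?D (s, ?y) * v" for v
        using linear_scale[OF linear_frechet_derivative[OF smooth_on_differentiable[OF F family_domain_open sS]], of v "(1, 0)"]
        by simp
      have "((\<lambda>s. ?F (s, ?y)) has_real_derivative ?D (s, ?y)) (at s)"
        unfolding has_field_derivative_def by (rule has_derivative_eq_rhs[OF hd]) (rule ext, rule lin)
      then show "((\<lambda>s. ?F (s, ?y)) has_real_derivative ?D (s, ?y)) (at s within ?I)"
        by (rule has_field_derivative_at_within)
      show "norm (?D (s, ?y)) \<le> \<bar>C\<bar>" using C[OF yK[OF s]] by simp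
    qed (use t \<epsilon> in \<open>auto simp: abs_less_iff\<close>)
    \<comment> \<open>The coordinate ball lies in the image of \<open>N\<close>, and the coordinate
      map is injective on the chart domain.\<close>
    moreover have "q \<in> N"
    proof -
      have "(0, ?y) \<in> ?S" by (rule subsetD[OF r(2) yK]) (use \<epsilon> in simp)
      then obtain q' where q': "q' \<in> N" "?y = snd c q'" by blast
      have "q = chart_inv c ?y" using c q by simp
      also have "\<dots> = q'" using q' c N by (simp add: subset_iff)
      finally show ?thesis using q'(1) by simp
    qed
    ultimately show ?thesis using zero q c by simp
  qed
  then show ?thesis unfolding locally_order_def using r \<epsilon> by (meson abs_ge_zero half_gt_zero)
qed

text \<open>A derivative along the manifold is the joint derivative in a direction whose parameter
  component is 0, so smoothness in \<open>t\<close> is kept.\<close>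

lemma chart_family_dir_deriv:
  assumes f: "chart_family c \<epsilon> N f" and X: "smooth_field A N X"
  shows "chart_family c \<epsilon> N (\<lambda>t q. dir_deriv A q (X q) (f t))"
proof -
  let ?S = "{-\<epsilon><..<\<epsilon>} \<times> snd c ` N"
  let ?F = "\<lambda>z. f (fst z) (chart_inv c (snd z))"
  have F: "smooth_on ?S ?F" using f by (simp add: chart_family_def)
  have rX: "smooth_on ?S (\<lambda>z. field_rep A c X (snd z))"
    by (rule smooth_on_family_snd[OF smooth_field_chart[OF X c order_refl N(2)]])
  have "smooth_on ?S (\<lambda>z. \<Sum>j\<in>UNIV. field_rep A c X (snd z) $ j * frechet_derivative ?F (at z) (0, axis j 1))"
    by (intro smooth_on_sum smooth_on_mult smooth_on_vec_nth family_domain_open rX smooth_on_derivative F)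
  then show ?thesis
    unfolding chart_family_def
  proof (rule smooth_on_cong[OF family_domain_open, rotated])
    fix z assume z: "z \<in> ?S"
    then obtain t q where tq: "z = (t, snd c q)" "q \<in> N" "t \<in> {-\<epsilon><..<\<epsilon>}" by auto
    have q: "q \<in> fst c" using tq N by auto
    have dF: "?F differentiable (at z)" using smooth_on_differentiable[OF F family_domain_open z] .
    have ft: "smooth_fun A N (f t)"
    proof (rule smooth_fun_chartI[OF c N])
      have "smooth_on (snd c ` N) (\<lambda>y. ?F (t, y))"
        by (rule smooth_on_compose[OF chart_open_map'[OF c N] family_domain_open _ F])
           (use tq in \<open>auto intro!: smooth_on_Pair smooth_on_id chart_open_map' c N\<close>)
      then show "smooth_on (snd c ` N) (\<lambda>y. f t (chart_inv c y))" by simp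
    qed
    have slice: "frechet_derivative (\<lambda>y. f t (chart_inv c y)) (at (snd c q)) v = frechet_derivative ?F (at z) (0, v)" for v
      using frechet_derivative_slice[of ?F t "snd c q" v] dF tq by simp
    have lin: "linear (frechet_derivative (\<lambda>y. f t (chart_inv c y)) (at (snd c q)))"
      using has_derivative_linear[OF smooth_fun_rep_derivative[OF c N(1) tq(2) q ft]] .
    have "dir_deriv A q (X q) (f t) = (\<Sum>j\<in>UNIV. components A c q (X q) $ j * frechet_derivative ?F (at z) (0, axis j 1))"
      unfolding dir_deriv_chart[OF c N(1) tq(2) q ft] unfolding linear_axis_expansion[OF lin, of "components A c q (X q)"]
      unfolding slice by simp
    then show "(\<Sum>j\<in>UNIV. field_rep A c X (snd z) $ j * frechet_derivative ?F (at z) (0, axis j 1))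
      = dir_deriv A (chart_inv c (snd z)) (X (chart_inv c (snd z))) (f (fst z))"
      using tq q c by simp
  qed
qed

lemma chart_family_matrix_inv:
  assumes "\<And>i j :: 'k::finite. chart_family c \<epsilon> N (a i j)" "\<And>t q. \<bar>t\<bar> < \<epsilon> \<Longrightarrow> q \<in> N \<Longrightarrow> det (\<chi> i j. a i j t q) \<noteq> 0"
  shows "chart_family c \<epsilon> N (\<lambda>t q. matrix_inv (\<chi> i j. a i j t q) $ i $ j)"
  unfolding chart_family_def
  by (rule smooth_on_matrix_inv[OF family_domain_open])
     (use assms c N in \<open>auto simp: chart_family_def subset_iff abs_less_iff\<close>)

lemma chart_family_det:
  assumes "\<And>i j :: 'k::finite. chart_family c \<epsilon> N (a i j)"
  shows "chart_family c \<epsilon> N (\<lambda>t q. det (\<chi> i j. a i j t q))"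
  unfolding chart_family_def
  by (rule smooth_on_det[OF family_domain_open]) (use assms in \<open>simp add: chart_family_def\<close>)

lemma chart_family_of_family:
  assumes "smooth_fun_family A {-\<epsilon><..<\<epsilon>} U f" "N \<subseteq> U"
  shows "chart_family c \<epsilon> N f"
proof -
  have "smooth_on ({-\<epsilon><..<\<epsilon>} \<times> snd c ` (fst c \<inter> U)) (\<lambda>(t, y). f t (chart_inv c y))"
    using assms(1) c by (simp add: smooth_fun_family_def)
  from smooth_on_subset[OF this, of "{-\<epsilon><..<\<epsilon>} \<times> snd c ` N"] show ?thesis
    using assms(2) N(2) unfolding chart_family_def case_prod_beta' by blast
qed

end

end

lemma locally_order_one_mult:
  "locally_order 1 f p \<Longrightarrow> locally_order 1 h p \<Longrightarrow> locally_order 2 (\<lambda>t q. f t q * h t q) p"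
  using locally_order_mult[of 1 f p 1 h] by (simp add: numeral_2_eq_2)

lemma locally_order_zero_mult:
  "locally_order 0 f p \<Longrightarrow> locally_order r h p \<Longrightarrow> locally_order r (\<lambda>t q. f t q * h t q) p"
  using locally_order_mult[of 0 f p r h] by simp

context smooth_manifold
begin

lemma borel_measurable_local_family:
  assumes "\<And>p. \<exists>c\<in>A. \<exists>N. open N \<and> p \<in> N \<and> N \<subseteq> fst c \<and> chart_family c \<epsilon> N l" and t: "\<bar>t\<bar> < \<epsilon>"
  shows "l t \<in> borel_measurable borel"
proof (rule borel_measurable_continuous_onI)
  show "continuous_on UNIV (l t)"
  proof (intro continuous_at_imp_continuous_on ballI)
    fix p
    obtain c N where N: "c \<in> A" "open N" "p \<in> N" "N \<subseteq> fst c" "chart_family c \<epsilon> N l" using assms(1)[of p] by blast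
    from chart_family_continuous[OF N(1,2,4,5) t] show "isCont (l t) p"
      using N continuous_on_eq_continuous_at by blast
  qed
qed

text \<open>The Gram determinants are bounded for small \<open>t\<close> near \<open>p\<close>, and
  a coordinate ball has finite Lebesgue measure.\<close>

lemma volume_locally_bounded:
  assumes \<epsilon>: "\<epsilon> > 0" and c: "c \<in> A" "p \<in> fst c"
    and G: "\<And>t. \<bar>t\<bar> < \<epsilon> \<Longrightarrow> pseudo_riemannian A (G t)"
    and fam: "\<And>i j. chart_family c \<epsilon> (fst c) (\<lambda>t q. G t q (coord_field A c i q) (coord_field A c j q))"
  shows "locally_bounded_mass (\<lambda>t. vol A (G t)) p"
proof -
  note oc = chart_open[OF c(1)]
  let ?d = "\<lambda>t q. det (\<chi> i j. G t q (coord_field A c i q) (coord_field A c j q))"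
  have "chart_family c \<epsilon> (fst c) ?d" by (rule chart_family_det[OF c(1) oc order_refl fam])
  then have "locally_order 0 ?d p" by (rule chart_family_bounded[OF c(1) oc order_refl _ c(2) \<epsilon>])
  then obtain N C \<delta> where N: "open N" "p \<in> N" "C \<ge> 0" "\<delta> > 0" "\<And>t q. \<bar>t\<bar> < \<delta> \<Longrightarrow> q \<in> N \<Longrightarrow> \<bar>?d t q\<bar> \<le> C * \<bar>t\<bar> ^ 0"
    unfolding locally_order_def by blast
  obtain r where r: "r > 0" "open {q \<in> fst c. snd c q \<in> ball (snd c p) r}" "p \<in> {q \<in> fst c. snd c q \<in> ball (snd c p) r}"
    by (rule family_box[OF c(1) oc order_refl c(2) \<epsilon>]) blast
  define W where "W = N \<inter> {q \<in> fst c. snd c q \<in> ball (snd c p) r}"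
  have W: "open W" "p \<in> W" "W \<subseteq> fst c" "snd c ` W \<subseteq> ball (snd c p) r" using N r by (auto simp: W_def)
  define V where "V = measure lborel (ball (snd c p) r)"
  have V: "emeasure lborel (ball (snd c p) r) = ennreal V"
    unfolding V_def by (intro emeasure_eq_ennreal_measure less_imp_neq) (use emeasure_bounded_finite[OF bounded_ball] in \<open>simp add: top_ennreal_def infinity_ennreal_def\<close>)
  have "emeasure (vol A (G t)) W \<le> ennreal (sqrt C * V)" if t: "\<bar>t\<bar> < min \<epsilon> \<delta>" for t
  proof -
    interpret Gt: pseudo_riemannian_manifold A "G t" using G t by unfold_locales simp
    have "emeasure (vol A (G t)) W = (\<integral>\<^sup>+y\<in>snd c ` W. ennreal (volume_density A (G t) c y) \<partial>lborel)"
      using W by (intro Gt.emeasure_vol c) auto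
    also have "\<dots> \<le> (\<integral>\<^sup>+y. ennreal (sqrt C) * indicator (ball (snd c p) r) y \<partial>lborel)"
    proof (rule nn_integral_mono)
      fix y
      show "ennreal (volume_density A (G t) c y) * indicator (snd c ` W) y \<le> ennreal (sqrt C) * indicator (ball (snd c p) r) y"
      proof (cases "y \<in> snd c ` W")
        case True
        then obtain q where q: "q \<in> W" "y = snd c q" by blast
        have "volume_density A (G t) c y = sqrt \<bar>?d t q\<bar>"
          using q W(3) c by (simp add: Gt.volume_density_gram Gt.gram_def subset_iff)
        also have "\<dots> \<le> sqrt C" using N(5)[of t q] q t by (auto simp: W_def)
        finally show ?thesis using True W(4) by (auto simp: indicator_def intro: ennreal_leI)
      qed simp
    qed
    also have "\<dots> = ennreal (sqrt C) * ennreal V" by (subst nn_integral_cmult_indicator) (auto simp: V)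
    also have "\<dots> = ennreal (sqrt C * V)" using N(3) by (simp add: ennreal_mult V_def)
    finally show ?thesis .
  qed
  moreover have "sqrt C * V \<ge> 0" using N(3) by (simp add: V_def)
  ultimately show ?thesis
    unfolding locally_bounded_mass_def using W N \<epsilon> by (intro exI[of _ W] exI[of _ "sqrt C * V"] exI[of _ "min \<epsilon> \<delta>"]) auto
qed

end

section \<open>Varying the metric with the contorsion fixed\<close>

context adapted_manifold
begin

text \<open>Evaluates the traces at the initial metric, for which the covectors are dual to the
  sections.\<close>

lemma covector_trace_dual:
  assumes "\<mu>0 \<in> {1..k}" "f \<in> D \<mu>0 p" "linear \<alpha>"
  shows "covector_trace \<mu>0 \<alpha> (g p f) p = \<alpha> f"
proof -
  obtain V where V: "open V" "p \<in> V" "adapted_frame A k n D g V (frame_at A k n D g p)"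
    using frame_at_adapted by blast
  show ?thesis
    unfolding covector_trace_def Let_def
    using frame_pairing[OF adapted_frame_basis[OF V(3,2)] assms] by simp
qed

text \<open>Written with an orthonormal basis of one metric but determined by the splitting, hence
  the same map for every adapted metric.\<close>

definition complement_projection :: "nat \<Rightarrow> (nat \<Rightarrow> nat \<Rightarrow> real^'n) \<Rightarrow> 'm \<Rightarrow> real^'n \<Rightarrow> real^'n" where
  "complement_projection \<mu>0 e p u = (\<Sum>\<nu>\<in>{1..k} - {\<mu>0}. \<Sum>b\<in>{1..n \<nu>}. (g p (e \<nu> b) (e \<nu> b) * g p u (e \<nu> b)) *\<^sub>R e \<nu> b)"

lemma complement_projection:
  assumes e: "ortho_basis p e" and \<mu>0: "\<mu>0 \<in> {1..k}"
  shows "linear (complement_projection \<mu>0 e p)"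
    and "u \<in> D \<mu>0 p \<Longrightarrow> complement_projection \<mu>0 e p u = 0"
    and "\<nu> \<in> {1..k} \<Longrightarrow> \<nu> \<noteq> \<mu>0 \<Longrightarrow> u \<in> D \<nu> p \<Longrightarrow> complement_projection \<mu>0 e p u = u"
proof -
  show "linear (complement_projection \<mu>0 e p)"
    unfolding complement_projection_def
    by (intro linearI) (simp_all add: g_linear algebra_simps sum.distrib scaleR_sum_right)
  have z: "g p u (e \<nu>' b) = 0" if "u \<in> D \<nu> p" "\<nu> \<in> {1..k}" "\<nu>' \<in> {1..k}" "\<nu> \<noteq> \<nu>'" "b \<in> {1..n \<nu>'}" for \<nu> \<nu>' b u
    using D_orth[OF that(2,3,4,1) ortho_basis_D[OF e that(3,5)]] .
  show "complement_projection \<mu>0 e p u = 0" if "u \<in> D \<mu>0 p"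
    unfolding complement_projection_def using z[OF that \<mu>0] by (intro sum.neutral ballI) auto
  show "complement_projection \<mu>0 e p u = u" if \<nu>: "\<nu> \<in> {1..k}" "\<nu> \<noteq> \<mu>0" and u: "u \<in> D \<nu> p"
  proof -
    have "complement_projection \<mu>0 e p u = (\<Sum>\<nu>'\<in>{1..k} - {\<mu>0}. if \<nu>' = \<nu> then u else 0)"
      unfolding complement_projection_def
    proof (rule sum.cong[OF refl])
      fix \<nu>' assume \<nu>': "\<nu>' \<in> {1..k} - {\<mu>0}"
      show "(\<Sum>b\<in>{1..n \<nu>'}. (g p (e \<nu>' b) (e \<nu>' b) * g p u (e \<nu>' b)) *\<^sub>R e \<nu>' b) = (if \<nu>' = \<nu> then u else 0)"
      proof (cases "\<nu>' = \<nu>")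
        case True
        then show ?thesis using D_expansion[OF e \<nu>(1) u] by simp
      next
        case False
        then show ?thesis using z[OF u \<nu>(1)] \<nu>' by (auto intro!: sum.neutral)
      qed
    qed
    then show ?thesis using \<nu> by simp
  qed
qed

text \<open>Joint smoothness is the point. In coordinates the trace of \<open>T\<close> and the mean
  curvature forms involve \<open>t\<close> only through the inverse Gram matrix of
  \<open>G t\<close> and its values on fixed fields. A factor that vanishes at t = 0 is then of
  order one, uniformly near \<open>p0\<close>.\<close>

lemma cubic_metric_variation:
  assumes \<mu>0: "\<mu>0 \<in> {1..k}"
    and ab: "smooth_fun A UNIV a" "smooth_fun A UNIV b" and ef: "smooth_field A UNIV e" "smooth_field A UNIV f"
    and rel: "\<And>q. e q \<in> D \<mu>0 q" "\<And>q. f q \<in> D \<mu>0 q" "\<And>q. g q (e q) (f q) = 0"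
      "\<And>q. a q * g q (e q) (e q) = b q * g q (f q) (f q)"
      "\<And>q. g q (e q) (mean_curvature A k n D g \<mu>0 q) = 0" "\<And>q. g q (f q) (mean_curvature A k n D g \<mu>0 q) = 0"
    and G: "adapted_variation A k D \<Omega> g \<epsilon> G"
  defines "T \<equiv> \<lambda>p. cubic (a p) (b p) (g p (e p)) (g p (f p)) (e p) (f p)"
  defines "l \<equiv> \<lambda>t p. mixed_scalar_curvature A k n D (G t) T p - mixed_scalar_curvature A k n D (G t) (\<lambda>p u v. 0) p"
  shows "locally_order 2 l p0 \<and> (\<exists>c\<in>A. \<exists>N. open N \<and> p0 \<in> N \<and> N \<subseteq> fst c \<and> chart_family c \<epsilon> N l)"
proof -
  have \<epsilon>: "\<epsilon> > 0" and G0: "G 0 = g" and Gad: "\<And>t. \<bar>t\<bar> < \<epsilon> \<Longrightarrow> adapted_metric A k D (G t)"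
    and Gfam: "\<And>U X Y. open U \<Longrightarrow> smooth_field A U X \<Longrightarrow> smooth_field A U Y \<Longrightarrow>
      smooth_fun_family A {-\<epsilon><..<\<epsilon>} U (\<lambda>t p. G t p (X p) (Y p))"
    using G unfolding adapted_variation_def by (auto simp: abs_less_iff)
  have Gloc: "adapted_manifold A k n D (G t)" if "\<bar>t\<bar> < \<epsilon>" for t
    using Gad[OF that] splitting by unfold_locales
  have Ttensor: "tensor_field12 A T"
    using statistical_cubic[OF ab ef] unfolding T_def statistical_def by blast
  obtain U Z where U: "open U" "p0 \<in> U" "adapted_frame A k n D g U Z" using adapted_frame_exists by blast
  define c where "c = chart_at A p0"
  define N where "N = U \<inter> fst c"
  have c: "c \<in> A" "p0 \<in> fst c" by (auto simp: c_def)
  have N: "open N" "N \<subseteq> fst c" "p0 \<in> N" "N \<subseteq> U" using U c chart_open[OF c(1)] by (auto simp: N_def)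
  note cN = c(1) N(1,2)
  define X where "X i = coord_field A c i" for i
  have Xs: "smooth_field A N (X i)" for i unfolding X_def using smooth_field_subset[OF smooth_coord_field[OF c(1)] N(2)] .
  have Zs: "smooth_field A N (Z \<mu> m)" if "\<mu> \<in> {1..k}" "m \<in> {1..n \<mu>}" for \<mu> m
    using smooth_field_subset[OF adapted_frame_smooth[OF U(3) that] N(4)] .
  have efN: "smooth_field A N e" "smooth_field A N f" and abN: "smooth_fun A N a" "smooth_fun A N b"
    using smooth_field_subset[OF ef(1)] smooth_field_subset[OF ef(2)] smooth_fun_subset[OF ab(1)] smooth_fun_subset[OF ab(2)] by auto
  have GN: "chart_family c \<epsilon> N (\<lambda>t q. G t q (V q) (W q))" if "smooth_field A N V" "smooth_field A N W" for V W
    by (rule chart_family_of_family[OF cN Gfam[OF N(1) that] order_refl])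
  \<comment> \<open>Built from an orthonormal frame of \<open>g\<close> and not of
    \<open>G t\<close>, so these fields do not depend on \<open>t\<close>.\<close>
  define Y where "Y i q = complement_projection \<mu>0 (\<lambda>\<mu> m. Z \<mu> m q) q (X i q)" for i q
  have Ys: "smooth_field A N (Y i)" for i
    unfolding Y_def[abs_def] complement_projection_def
    by (intro smooth_field_sum smooth_field_scaleR smooth_fun_mult smooth_g N(1) Xs Zs) auto
  define h where "h i j t q = matrix_inv (\<chi> i j. G t q (X i q) (X j q)) $ i $ j" for i j t q
  have gram: "(\<chi> i j. G t q (X i q) (X j q)) = pseudo_riemannian_manifold.gram A (G t) c q" if "\<bar>t\<bar> < \<epsilon>" for t q
  proof -
    interpret Gt: adapted_manifold A k n D "G t" by (rule Gloc[OF that])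
    show ?thesis by (simp add: Gt.gram_def X_def)
  qed
  have hs: "chart_family c \<epsilon> N (h i j)" for i j
    unfolding h_def[abs_def]
  proof (rule chart_family_matrix_inv[OF cN GN[OF Xs Xs]])
    fix t q assume t: "\<bar>t\<bar> < \<epsilon>" and q: "q \<in> N"
    interpret Gt: adapted_manifold A k n D "G t" by (rule Gloc[OF t])
    show "det (\<chi> i j. G t q (X i q) (X j q)) \<noteq> 0" unfolding gram[OF t] using Gt.det_gram[OF c(1)] q N by auto
  qed
  \<comment> \<open>Together with \<open>mf\<close> below: the coordinate forms of the covector
    traces and mean curvature forms of \<open>G t\<close>, with the covectors still lowered by
    \<open>g\<close>.\<close>
  define ct where "ct V W t q = (\<Sum>i\<in>UNIV. \<Sum>j\<in>UNIV. h i j t q * (g q (V q) (X i q) * g q (W q) (X j q)))" for V W t q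
  define mf where "mf V t q = (-1/2) * (\<Sum>i\<in>UNIV. \<Sum>j\<in>UNIV. h i j t q *
    (dir_deriv A q (V q) (\<lambda>q. G t q (Y i q) (Y j q)) - G t q (lie_bracket A V (Y i) q) (Y j q) - G t q (Y i q) (lie_bracket A V (Y j) q)))" for V t q
  have ct: "chart_family c \<epsilon> N (ct V W)" if "smooth_field A N V" "smooth_field A N W" for V W
    unfolding ct_def[abs_def]
    by (intro chart_family_sum[OF cN] chart_family_mult[OF cN] hs chart_family_const[OF cN] smooth_g N(1) Xs that)
  have mf: "chart_family c \<epsilon> N (mf V)" if "smooth_field A N V" for V
    unfolding mf_def[abs_def]
    by (intro chart_family_mult[OF cN] chart_family_real_const[OF cN] chart_family_sum[OF cN] chart_family_diff[OF cN]
        chart_family_dir_deriv[OF cN] hs GN Ys smooth_lie_bracket N(1) that)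
  have van: "g q (V q) u = 0" if "\<And>q. V q \<in> D \<mu>0 q" "\<nu> \<in> {1..k}" "\<nu> \<noteq> \<mu>0" "u \<in> D \<nu> q" for V \<nu> u q
    using D_orth[OF \<mu>0 that(2) that(3)[symmetric] that(1) that(4)] .
  have ct_eq: "adapted_manifold.covector_trace A k n D (G t) \<mu>0 (g q (V q)) (g q (W q)) q = ct V W t q"
    if t: "\<bar>t\<bar> < \<epsilon>" and q: "q \<in> N" and V: "\<And>q. V q \<in> D \<mu>0 q" for t q V W
  proof -
    interpret Gt: adapted_manifold A k n D "G t" by (rule Gloc[OF t])
    show ?thesis
      unfolding ct_def h_def gram[OF t] unfolding X_def
      using q N by (intro Gt.covector_trace_coord c(1) \<mu>0 linear_g_right van[OF V]) auto
  qed
  have mf_eq: "adapted_manifold.mean_curvature_form A k n D (G t) \<mu>0 V q = mf V t q"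
    if t: "\<bar>t\<bar> < \<epsilon>" and q: "q \<in> N" and V: "\<And>q. V q \<in> D \<mu>0 q" "smooth_field A N V" for t q V
  proof -
    interpret Gt: adapted_manifold A k n D "G t" by (rule Gloc[OF t])
    have qU: "q \<in> U" using q N by auto
    note P = complement_projection[OF adapted_frame_basis[OF U(3) qU] \<mu>0]
    have "Gt.mean_curvature_form \<mu>0 V q = - (1/2) * (\<Sum>i\<in>UNIV. \<Sum>j\<in>UNIV. matrix_inv (Gt.gram c q) $ i $ j *
      (dir_deriv A q (V q) (\<lambda>q. G t q (Y i q) (Y j q)) - G t q (lie_bracket A V (Y i) q) (Y j q) - G t q (Y i q) (lie_bracket A V (Y j) q)))"
      by (rule Gt.mean_curvature_form_coord[OF c(1) N(1,2) q V(2,1) \<mu>0 Ys _ P(1)])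
         (use P(2,3) in \<open>auto simp: Y_def X_def\<close>)
    then show ?thesis unfolding mf_def h_def gram[OF t] by simp
  qed
  \<comment> \<open>\<open>c1\<close> and \<open>c2\<close> are minus one half of the components of
    the metric trace of \<open>T\<close> on \<open>e\<close> and \<open>f\<close>. At t = 0 they
    vanish, by the trace condition and by orthogonality of \<open>e\<close> and \<open>f\<close>
    respectively.\<close>
  define c1 where "c1 t q = (-1/2) * (a q * ct e e t q - b q * ct f f t q)" for t q
  define c2 where "c2 t q = b q * ct e f t q" for t q
  have c1s: "chart_family c \<epsilon> N c1" and c2s: "chart_family c \<epsilon> N c2"
    unfolding c1_def[abs_def] c2_def[abs_def]
    by (intro chart_family_mult[OF cN] chart_family_diff[OF cN] chart_family_real_const[OF cN] chart_family_const[OF cN] ct efN abN)+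
  have zero\<epsilon>: "\<bar>0\<bar> < \<epsilon>" using \<epsilon> by simp
  have ct0: "ct V W 0 q = g q (V q) (W q)" if "q \<in> N" "\<And>q. V q \<in> D \<mu>0 q" "\<And>q. W q \<in> D \<mu>0 q" for V W q
    using ct_eq[OF zero\<epsilon> that(1,2), of W] covector_trace_dual[OF \<mu>0 that(3) linear_g_right] by (simp add: G0)
  have mf0: "mf V 0 q = 0"
    if "q \<in> N" "\<And>q. V q \<in> D \<mu>0 q" "smooth_field A N V" "g q (V q) (mean_curvature A k n D g \<mu>0 q) = 0" for V q
    using mf_eq[OF zero\<epsilon> that(1-3)] g_mean_curvature[OF \<mu>0, of V q] that by (simp add: G0)
  have c10: "c1 0 q = 0" and c20: "c2 0 q = 0" if "q \<in> N" for q
    using ct0[OF that] rel by (simp_all add: c1_def c2_def)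
  have l_eq: "l t q = c1 t q * mf e t q + c2 t q * mf f t q" if t: "\<bar>t\<bar> < \<epsilon>" and q: "q \<in> N" for t q
  proof -
    interpret Gt: adapted_manifold A k n D "G t" by (rule Gloc[OF t])
    have T_eq: "T q = cubic (a q) (b q) (g q (e q)) (g q (f q)) (e q) (f q)" for q by (simp add: T_def)
    have sym: "g q (f q) (e q) = 0" for q using rel(3)[of q] g_sym[of q "f q" "e q"] by simp
    have "l t q = - (1/2) * ((a q * ct e e t q - b q * ct f f t q) * mf e t q - 2 * b q * ct e f t q * mf f t q)"
      unfolding l_def
      using Gt.mixed_scalar_curvature_cubic[where p = q, OF Ttensor T_eq \<mu>0 linear_g_right linear_g_right van[OF rel(1)] van[OF rel(2)]
          rel(1,2,3) sym rel(4)]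
        ct_eq[OF t q rel(1)] ct_eq[OF t q rel(2)] mf_eq[OF t q rel(1) efN(1)] mf_eq[OF t q rel(2) efN(2)] by simp
    then show ?thesis unfolding c1_def c2_def by (simp add: algebra_simps)
  qed
  have fam: "chart_family c \<epsilon> N (\<lambda>t q. c1 t q * mf e t q + c2 t q * mf f t q)"
    by (intro chart_family_add[OF cN] chart_family_mult[OF cN] c1s c2s mf efN)
  have "chart_family c \<epsilon> N l" by (rule chart_family_cong[OF cN _ fam]) (simp add: l_eq)
  moreover have "locally_order 2 (\<lambda>t q. c1 t q * mf e t q + c2 t q * mf f t q) p0"
    using c10 c20 mf0[OF _ rel(1) efN(1) rel(5)] mf0[OF _ rel(2) efN(2) rel(6)]
    by (intro locally_order_add locally_order_one_mult chart_family_order_one[OF cN _ N(3) \<epsilon>] c1s c2s mf efN)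
  then have "locally_order 2 l p0"
    by (rule locally_order_cong[OF _ N(1,3) \<epsilon>]) (simp add: l_eq)
  ultimately show ?thesis using c(1) N by blast
qed

lemma cubic_metric_critical:
  assumes \<mu>0: "\<mu>0 \<in> {1..k}"
    and ab: "smooth_fun A UNIV a" "smooth_fun A UNIV b" and ef: "smooth_field A UNIV e" "smooth_field A UNIV f"
    and rel: "\<And>q. e q \<in> D \<mu>0 q" "\<And>q. f q \<in> D \<mu>0 q" "\<And>q. g q (e q) (f q) = 0"
      "\<And>q. a q * g q (e q) (e q) = b q * g q (f q) (f q)"
      "\<And>q. g q (e q) (mean_curvature A k n D g \<mu>0 q) = 0" "\<And>q. g q (f q) (mean_curvature A k n D g \<mu>0 q) = 0"
    and crit: "metric_critical A k n D g (\<lambda>p u v. 0)"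
  shows "metric_critical A k n D g (\<lambda>p. cubic (a p) (b p) (g p (e p)) (g p (f p)) (e p) (f p))"
  unfolding metric_critical_def
proof (intro allI impI, elim conjE)
  fix \<Omega> \<epsilon> G assume \<Omega>: "integration_domain \<Omega>" and G: "adapted_variation A k D \<Omega> g \<epsilon> G"
  let ?T = "\<lambda>p. cubic (a p) (b p) (g p (e p)) (g p (f p)) (e p) (f p)"
  define s where "s t p = mixed_scalar_curvature A k n D (G t) (\<lambda>p u v. 0) p" for t p
  define l where "l t p = mixed_scalar_curvature A k n D (G t) ?T p - mixed_scalar_curvature A k n D (G t) (\<lambda>p u v. 0) p" for t p
  have \<epsilon>: "\<epsilon> > 0" and Gpr: "\<And>t. \<bar>t\<bar> < \<epsilon> \<Longrightarrow> pseudo_riemannian A (G t)"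
    and Gfam: "\<And>U X Y. open U \<Longrightarrow> smooth_field A U X \<Longrightarrow> smooth_field A U Y \<Longrightarrow>
      smooth_fun_family A {-\<epsilon><..<\<epsilon>} U (\<lambda>t p. G t p (X p) (Y p))"
    using G unfolding adapted_variation_def adapted_metric_def by (auto simp: abs_less_iff)
  note var = cubic_metric_variation[OF \<mu>0 ab ef rel G, folded l_def]
  have "((\<lambda>t. LINT p:\<Omega>|vol A (G t). s t p + l t p) has_real_derivative 0) (at 0)"
  proof (rule action_perturbation[OF integration_domainD[OF \<Omega>] \<epsilon>])
    show "sets (vol A (G t)) = sets borel" if "\<bar>t\<bar> < \<epsilon>" for t
    proof -
      interpret Gt: pseudo_riemannian_manifold A "G t" using Gpr[OF that] by unfold_locales
      show ?thesis by simp
    qed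
    show "l t \<in> borel_measurable borel" if "\<bar>t\<bar> < \<epsilon>" for t
      using var that by (intro borel_measurable_local_family[of \<epsilon>]) auto
    show "locally_order 2 l p" for p using var by blast
    show "locally_bounded_mass (\<lambda>t. vol A (G t)) p" for p
      by (rule volume_locally_bounded[OF \<epsilon> chart_at_in in_chart_at Gpr], assumption)
         (rule chart_family_of_family[OF chart_at_in chart_open[OF chart_at_in] order_refl
           Gfam[OF chart_open[OF chart_at_in] smooth_coord_field[OF chart_at_in] smooth_coord_field[OF chart_at_in]] order_refl])
    show "((\<lambda>t. LINT p:\<Omega>|vol A (G t). s t p) has_real_derivative 0) (at 0)"
      using crit \<Omega> G unfolding metric_critical_def action_def s_def by blast
  qed
  then show "((\<lambda>t. action A k n D \<Omega> (G t) ?T) has_real_derivative 0) (at 0)"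
    unfolding action_def s_def l_def by simp
qed

section \<open>Varying the contorsion with the metric fixed\<close>

lemma quad_along:
  assumes e: "ortho_basis p e" and al: "tensor_along \<mu>0 T" and S: "bilinear (S p)"
    and tr: "\<And>\<nu>. \<nu> \<in> {1..k} \<Longrightarrow> (\<Sum>a\<in>{1..n \<nu>}. g p (e \<nu> a) (e \<nu> a) *\<^sub>R T p (e \<nu> a) (e \<nu> a)) = 0"
  shows "quad S p e = quad (\<lambda>p u v. S p u v - T p u v) p e"
  unfolding quad_def
proof (rule sum.cong[OF refl], rule sum.cong[OF refl])
  fix \<mu> \<nu> assume "\<mu> \<in> {1..k}" "\<nu> \<in> {1..<\<mu>}"
  then have \<mu>: "\<mu> \<in> {1..k}" and \<nu>: "\<nu> \<in> {1..k}" and ne: "\<nu> \<noteq> \<mu>" by auto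
  let ?d = "\<lambda>\<nu> a. g p (e \<nu> a) (e \<nu> a)"
  let ?S = "\<lambda>\<nu> a \<mu> b. S p (e \<nu> a) (e \<mu> b)" and ?T = "\<lambda>\<nu> a \<mu> b. T p (e \<nu> a) (e \<mu> b)"
  \<comment> \<open>At least one of the two indices differs from \<open>\<mu>0\<close>, and
    \<open>T\<close> kills the corresponding vector.\<close>
  have T0: "?T \<nu> a \<mu> b = 0" if "a \<in> {1..n \<nu>}" "b \<in> {1..n \<mu>}" for a b
  proof (cases "\<nu> = \<mu>0")
    case True
    then show ?thesis using tensor_along_vanish(2)[OF al \<mu> _ ortho_basis_D[OF e \<mu> that(2)]] ne by simp
  next
    case False
    then show ?thesis using tensor_along_vanish(1)[OF al \<nu> _ ortho_basis_D[OF e \<nu> that(1)]] by simp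
  qed
  have "(\<Sum>a\<in>{1..n \<nu>}. \<Sum>b\<in>{1..n \<mu>}. ?d \<nu> a * ?d \<mu> b * g p (?T \<nu> a \<nu> a) (?S \<mu> b \<mu> b)) =
     g p (\<Sum>a\<in>{1..n \<nu>}. ?d \<nu> a *\<^sub>R ?T \<nu> a \<nu> a) (\<Sum>b\<in>{1..n \<mu>}. ?d \<mu> b *\<^sub>R ?S \<mu> b \<mu> b)"
    unfolding g_sum_left unfolding g_sum_right by (intro sum.cong refl) (simp add: g_linear)
  also have "\<dots> = 0" unfolding tr[OF \<nu>] by (simp only: g_linear)
  finally have z1: "(\<Sum>a\<in>{1..n \<nu>}. \<Sum>b\<in>{1..n \<mu>}. ?d \<nu> a * ?d \<mu> b * g p (?T \<nu> a \<nu> a) (?S \<mu> b \<mu> b)) = 0" .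
  have "(\<Sum>a\<in>{1..n \<nu>}. \<Sum>b\<in>{1..n \<mu>}. ?d \<nu> a * ?d \<mu> b * g p (?S \<nu> a \<nu> a - ?T \<nu> a \<nu> a) (?T \<mu> b \<mu> b)) =
     g p (\<Sum>a\<in>{1..n \<nu>}. ?d \<nu> a *\<^sub>R (?S \<nu> a \<nu> a - ?T \<nu> a \<nu> a)) (\<Sum>b\<in>{1..n \<mu>}. ?d \<mu> b *\<^sub>R ?T \<mu> b \<mu> b)"
    unfolding g_sum_left unfolding g_sum_right by (intro sum.cong refl) (simp add: g_linear)
  also have "\<dots> = 0" unfolding tr[OF \<mu>] by (simp only: g_linear)
  finally have z2: "(\<Sum>a\<in>{1..n \<nu>}. \<Sum>b\<in>{1..n \<mu>}. ?d \<nu> a * ?d \<mu> b * g p (?S \<nu> a \<nu> a - ?T \<nu> a \<nu> a) (?T \<mu> b \<mu> b)) = 0" .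
  \<comment> \<open>The diagonal product is expanded with S = (S - T) + T. Both additional sums
    contain a trace of \<open>T\<close> and are the vanishing sums \<open>z1\<close> and
    \<open>z2\<close>; the mixed product is unchanged because of \<open>T0\<close>.\<close>
  have "(\<Sum>a\<in>{1..n \<nu>}. \<Sum>b\<in>{1..n \<mu>}. ?d \<nu> a * ?d \<mu> b * (g p (?S \<nu> a \<nu> a) (?S \<mu> b \<mu> b) - g p (?S \<nu> a \<mu> b) (?S \<nu> a \<mu> b)))
    = (\<Sum>a\<in>{1..n \<nu>}. \<Sum>b\<in>{1..n \<mu>}. ?d \<nu> a * ?d \<mu> b * (g p (?S \<nu> a \<nu> a - ?T \<nu> a \<nu> a) (?S \<mu> b \<mu> b - ?T \<mu> b \<mu> b)
        - g p (?S \<nu> a \<mu> b - ?T \<nu> a \<mu> b) (?S \<nu> a \<mu> b - ?T \<nu> a \<mu> b))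
      + ?d \<nu> a * ?d \<mu> b * g p (?T \<nu> a \<nu> a) (?S \<mu> b \<mu> b)
      + ?d \<nu> a * ?d \<mu> b * g p (?S \<nu> a \<nu> a - ?T \<nu> a \<nu> a) (?T \<mu> b \<mu> b))"
    by (intro sum.cong refl) (simp add: T0 g_linear algebra_simps)
  then show "(\<Sum>a\<in>{1..n \<nu>}. \<Sum>b\<in>{1..n \<mu>}. ?d \<nu> a * ?d \<mu> b * (g p (?S \<nu> a \<nu> a) (?S \<mu> b \<mu> b) - g p (?S \<nu> a \<mu> b) (?S \<nu> a \<mu> b)))
    = (\<Sum>a\<in>{1..n \<nu>}. \<Sum>b\<in>{1..n \<mu>}. ?d \<nu> a * ?d \<mu> b * (g p (?S \<nu> a \<nu> a - ?T \<nu> a \<nu> a) (?S \<mu> b \<mu> b - ?T \<mu> b \<mu> b)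
        - g p (?S \<nu> a \<mu> b - ?T \<nu> a \<mu> b) (?S \<nu> a \<mu> b - ?T \<nu> a \<mu> b)))"
    unfolding sum.distrib z1 z2 by simp
qed

text \<open>Turns a pairing of two vectors that depend on \<open>t\<close> into sums of products of
  scalar functions, to which the order bounds apply.\<close>

lemma g_frame:
  assumes e: "ortho_basis p e"
  shows "g p u v = (\<Sum>\<mu>\<in>{1..k}. \<Sum>a\<in>{1..n \<mu>}. g p (e \<mu> a) (e \<mu> a) * (g p u (e \<mu> a) * g p v (e \<mu> a)))"
  using arg_cong[OF frame_expansion[OF e, of u], of "\<lambda>u. g p u v"]
  by (simp add: g_sum_left g_linear g_sym[of p v] mult_ac)

lemma chart_family_g_field:
  assumes c: "c \<in> A" "open N" "N \<subseteq> fst c"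
    and X: "smooth_field_family A {-\<epsilon><..<\<epsilon>} N X" and W: "smooth_field A N W"
  shows "chart_family c \<epsilon> N (\<lambda>t q. g q (X t q) (W q))"
proof -
  have X': "chart_family c \<epsilon> N (\<lambda>t q. components A c q (X t q) $ i)" for i
  proof -
    have "smooth_on ({-\<epsilon><..<\<epsilon>} \<times> snd c ` (fst c \<inter> N)) (\<lambda>(t, y). field_rep A c (X t) y)"
      using X c(1) by (simp add: smooth_field_family_def)
    moreover have "fst c \<inter> N = N" using c(3) by auto
    ultimately have "smooth_on ({-\<epsilon><..<\<epsilon>} \<times> snd c ` N) (\<lambda>z. field_rep A c (X (fst z)) (snd z))"
      by (simp add: case_prod_beta')
    from smooth_on_vec_nth[OF family_domain_open[OF c] this]
    show ?thesis by (simp add: chart_family_def field_rep_def)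
  qed
  have "chart_family c \<epsilon> N (\<lambda>t q. \<Sum>i\<in>UNIV. components A c q (X t q) $ i * g q (coord_field A c i q) (W q))"
    by (intro chart_family_sum[OF c] chart_family_mult[OF c] X' chart_family_const[OF c] smooth_g c(2) W
        smooth_field_subset[OF smooth_coord_field[OF c(1)] c(3)])
  then show ?thesis
  proof (rule chart_family_cong[OF c, rotated])
    fix t q assume "q \<in> N"
    then show "(\<Sum>i\<in>UNIV. components A c q (X t q) $ i * g q (coord_field A c i q) (W q)) = g q (X t q) (W q)"
      using arg_cong[OF coord_expansion[OF c(1), of q "X t q"], of "\<lambda>u. g q u (W q)"] c(3)
      by (simp add: g_sum_left g_linear subset_iff)
  qed
qed

text \<open>By \<open>quad_along\<close> only the difference from \<open>T\<close> enters, and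
  quadratically. Each of its components is jointly smooth and vanishes at t = 0. One fixed smooth
  frame suffices because the metric does not move.\<close>

lemma cubic_contorsion_variation:
  assumes \<mu>0: "\<mu>0 \<in> {1..k}"
    and rel: "\<And>q. e q \<in> D \<mu>0 q" "\<And>q. f q \<in> D \<mu>0 q" "\<And>q. g q (e q) (f q) = 0"
      "\<And>q. a q * g q (e q) (e q) = b q * g q (f q) (f q)"
  defines "T \<equiv> \<lambda>p. cubic (a p) (b p) (g p (e p)) (g p (f p)) (e p) (f p)"
  assumes S: "statistical_variation A \<Omega> g T \<epsilon> S"
  defines "l \<equiv> \<lambda>t p. mixed_scalar_curvature A k n D g (S t) p - mixed_scalar_curvature A k n D g (\<lambda>p u v. 0) p"
  shows "locally_order 2 l p0 \<and> (\<exists>c\<in>A. \<exists>N. open N \<and> p0 \<in> N \<and> N \<subseteq> fst c \<and> chart_family c \<epsilon> N l)"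
proof -
  have \<epsilon>: "\<epsilon> > 0" and S0: "S 0 = T" and Sst: "\<And>t. \<bar>t\<bar> < \<epsilon> \<Longrightarrow> statistical A g (S t)"
    and Sfam: "\<And>U X Y. open U \<Longrightarrow> smooth_field A U X \<Longrightarrow> smooth_field A U Y \<Longrightarrow>
      smooth_field_family A {-\<epsilon><..<\<epsilon>} U (\<lambda>t p. S t p (X p) (Y p))"
    using S unfolding statistical_variation_def by (auto simp: abs_less_iff)
  have Tst: "statistical A g T" using Sst[of 0] \<epsilon> S0 by simp
  then have Ttensor: "tensor_field12 A T" by (simp add: statistical_def)
  obtain U Z where U: "open U" "p0 \<in> U" "adapted_frame A k n D g U Z" using adapted_frame_exists by blast
  define c where "c = chart_at A p0"
  define N where "N = U \<inter> fst c"
  have c: "c \<in> A" "p0 \<in> fst c" by (auto simp: c_def)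
  have N: "open N" "N \<subseteq> fst c" "p0 \<in> N" "N \<subseteq> U" using U c chart_open[OF c(1)] by (auto simp: N_def)
  note cN = c(1) N(1,2)
  have Zs: "smooth_field A N (Z \<mu> m)" if "\<mu> \<in> {1..k}" "m \<in> {1..n \<mu>}" for \<mu> m
    using smooth_field_subset[OF adapted_frame_smooth[OF U(3) that] N(4)] .
  have al: "tensor_along \<mu>0 T"
    unfolding tensor_along_def T_def cubic_def
    using D_orth[OF \<mu>0 _ _ rel(1)] D_orth[OF \<mu>0 _ _ rel(2)]
    by (auto intro!: subspace_diff subspace_scale subspace_D \<mu>0 rel(1,2) simp: mult_ac add_ac)
  define R where "R t p u v = S t p u v - T p u v" for t p u v
  define \<rho> where "\<rho> x y z t q = g q (R t q (x q) (y q)) (z q)" for x y z t q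
  have \<rho>s: "chart_family c \<epsilon> N (\<rho> x y z)" if "smooth_field A N x" "smooth_field A N y" "smooth_field A N z" for x y z
  proof -
    have "smooth_fun A N (\<lambda>q. g q (T q (x q) (y q)) (z q))"
      using Ttensor that N(1) by (intro smooth_g) (auto simp: tensor_field12_def)
    then have "chart_family c \<epsilon> N (\<lambda>t q. g q (S t q (x q) (y q)) (z q) - g q (T q (x q) (y q)) (z q))"
      by (intro chart_family_diff[OF cN] chart_family_g_field[OF cN Sfam[OF N(1) that(1,2)] that(3)] chart_family_const[OF cN])
    then show ?thesis by (simp add: \<rho>_def[abs_def] R_def g_linear)
  qed
  have \<rho>0: "\<rho> x y z 0 q = 0" for x y z q by (simp add: \<rho>_def R_def S0 g_linear)
  define gg where "gg x y x' y' t q = (\<Sum>\<mu>\<in>{1..k}. \<Sum>m\<in>{1..n \<mu>}. g q (Z \<mu> m q) (Z \<mu> m q) * (\<rho> x y (Z \<mu> m) t q * \<rho> x' y' (Z \<mu> m) t q))"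
    for x y x' y' t q
  have gg: "g q (R t q (x q) (y q)) (R t q (x' q) (y' q)) = gg x y x' y' t q" if "q \<in> N" for t q x y x' y'
    unfolding gg_def \<rho>_def using adapted_frame_basis[OF U(3), of q] that N(4) by (intro g_frame) auto
  have ds: "chart_family c \<epsilon> N (\<lambda>t q. g q (Z \<mu> m q) (Z \<mu> m q))" if "\<mu> \<in> {1..k}" "m \<in> {1..n \<mu>}" for \<mu> m
    by (intro chart_family_const[OF cN] smooth_g N(1) Zs that)
  have ggs: "chart_family c \<epsilon> N (gg x y x' y')" and ggo: "locally_order 2 (gg x y x' y') p0"
    if "smooth_field A N x" "smooth_field A N y" "smooth_field A N x'" "smooth_field A N y'" for x y x' y'
  proof -
    show "chart_family c \<epsilon> N (gg x y x' y')"
      unfolding gg_def[abs_def]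
      by (intro chart_family_sum[OF cN] chart_family_mult[OF cN] ds \<rho>s Zs that)
    show "locally_order 2 (gg x y x' y') p0"
      unfolding gg_def[abs_def]
      by (intro locally_order_sum locally_order_zero_mult locally_order_one_mult
          chart_family_bounded[OF cN _ N(3) \<epsilon>] chart_family_order_one[OF cN _ N(3) \<epsilon>] ds \<rho>s \<rho>0 Zs that)
  qed
  \<comment> \<open>The difference is written as a sum with coefficient -1, because the order bounds
    are stated for sums and products.\<close>
  define L where "L t q = (\<Sum>\<mu>\<in>{1..k}. \<Sum>\<nu>\<in>{1..<\<mu>}. \<Sum>i\<in>{1..n \<nu>}. \<Sum>j\<in>{1..n \<mu>}.
     (g q (Z \<nu> i q) (Z \<nu> i q) * g q (Z \<mu> j q) (Z \<mu> j q)) *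
     (gg (Z \<nu> i) (Z \<nu> i) (Z \<mu> j) (Z \<mu> j) t q + (-1) * gg (Z \<nu> i) (Z \<mu> j) (Z \<nu> i) (Z \<mu> j) t q))" for t q
  have l_eq: "l t q = L t q" if t: "\<bar>t\<bar> < \<epsilon>" and q: "q \<in> N" for t q
  proof -
    have qU: "q \<in> U" using q N by auto
    note e = adapted_frame_basis[OF U(3) qU]
    have bil: "bilinear (S t q)" using Sst[OF t] by (simp add: statistical_def tensor_field12_def)
    have tr: "(\<Sum>i\<in>{1..n \<nu>}. g q (Z \<nu> i q) (Z \<nu> i q) *\<^sub>R T q (Z \<nu> i q) (Z \<nu> i q)) = 0" if \<nu>: "\<nu> \<in> {1..k}" for \<nu>
    proof (cases "\<nu> = \<mu>0")
      case False
      have "T q (Z \<nu> i q) (Z \<nu> i q) = 0" if "i \<in> {1..n \<nu>}" for i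
        using tensor_along_vanish(1)[OF al \<nu> False ortho_basis_D[OF e \<nu> that]] .
      then show ?thesis by (intro sum.neutral) simp
    next
      case True
      let ?d = "\<lambda>i. g q (Z \<mu>0 i q) (Z \<mu>0 i q)"
      have pair: "(\<Sum>i\<in>{1..n \<mu>0}. ?d i * (g q x (Z \<mu>0 i q) * g q y (Z \<mu>0 i q))) = g q x y" if "y \<in> D \<mu>0 q" for x y
        using frame_pairing[OF e \<mu>0 that linear_g_right[of q x]] .
      have "(\<Sum>i\<in>{1..n \<mu>0}. ?d i *\<^sub>R T q (Z \<mu>0 i q) (Z \<mu>0 i q)) =
        (\<Sum>i\<in>{1..n \<mu>0}. (a q * (?d i * (g q (e q) (Z \<mu>0 i q) * g q (e q) (Z \<mu>0 i q)))
            - b q * (?d i * (g q (f q) (Z \<mu>0 i q) * g q (f q) (Z \<mu>0 i q)))) *\<^sub>R e q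
          - (2 * b q * (?d i * (g q (e q) (Z \<mu>0 i q) * g q (f q) (Z \<mu>0 i q)))) *\<^sub>R f q)"
        unfolding T_def cubic_def by (intro sum.cong refl) (simp add: algebra_simps)
      also have "\<dots> = (a q * g q (e q) (e q) - b q * g q (f q) (f q)) *\<^sub>R e q - (2 * b q * g q (e q) (f q)) *\<^sub>R f q"
        unfolding sum_subtractf scaleR_sum_left[symmetric] sum_distrib_left[symmetric] pair[OF rel(1)] pair[OF rel(2)] ..
      also have "\<dots> = 0" using rel(3,4) by simp
      finally show ?thesis unfolding True .
    qed
    have "l t q = quad (S t) q (\<lambda>\<mu> m. Z \<mu> m q)"
      unfolding l_def using mixed_scalar_curvature_statistical[OF Sst[OF t] e] by simp
    also have "\<dots> = quad (R t) q (\<lambda>\<mu> m. Z \<mu> m q)"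
      unfolding R_def[abs_def] by (rule quad_along[where S = "S t", OF e al bil tr])
    also have "\<dots> = L t q"
      unfolding quad_def L_def gg[OF q] by simp
    finally show ?thesis .
  qed
  have Zs': "smooth_field A N (Z \<nu> i)" if "\<mu> \<in> {1..k}" "\<nu> \<in> {1..<\<mu>}" "i \<in> {1..n \<nu>}" for \<mu> \<nu> i
    using that by (intro Zs) auto
  have ds': "chart_family c \<epsilon> N (\<lambda>t q. g q (Z \<nu> i q) (Z \<nu> i q))" if "\<mu> \<in> {1..k}" "\<nu> \<in> {1..<\<mu>}" "i \<in> {1..n \<nu>}" for \<mu> \<nu> i
    using that by (intro ds) auto
  have Ls: "chart_family c \<epsilon> N L"
    unfolding L_def[abs_def]
  proof (intro chart_family_sum[OF cN])
    fix \<mu> \<nu> i j assume *: "\<mu> \<in> {1..k}" "\<nu> \<in> {1..<\<mu>}" "i \<in> {1..n \<nu>}" "j \<in> {1..n \<mu>}"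
    note z = Zs'[OF *(1-3)] Zs[OF *(1,4)]
    show "chart_family c \<epsilon> N (\<lambda>t q. (g q (Z \<nu> i q) (Z \<nu> i q) * g q (Z \<mu> j q) (Z \<mu> j q)) *
      (gg (Z \<nu> i) (Z \<nu> i) (Z \<mu> j) (Z \<mu> j) t q + (-1) * gg (Z \<nu> i) (Z \<mu> j) (Z \<nu> i) (Z \<mu> j) t q))"
      by (rule chart_family_mult[OF cN chart_family_mult[OF cN ds'[OF *(1-3)] ds[OF *(1,4)]] chart_family_add[OF cN
          ggs[OF z(1,1,2,2)] chart_family_mult[OF cN chart_family_real_const[OF cN] ggs[OF z(1,2,1,2)]]]])
  qed
  have "locally_order 2 L p0"
    unfolding L_def[abs_def]
  proof (intro locally_order_sum)
    fix \<mu> \<nu> i j assume *: "\<mu> \<in> {1..k}" "\<nu> \<in> {1..<\<mu>}" "i \<in> {1..n \<nu>}" "j \<in> {1..n \<mu>}"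
    note z = Zs'[OF *(1-3)] Zs[OF *(1,4)]
    show "locally_order 2 (\<lambda>t q. (g q (Z \<nu> i q) (Z \<nu> i q) * g q (Z \<mu> j q) (Z \<mu> j q)) *
      (gg (Z \<nu> i) (Z \<nu> i) (Z \<mu> j) (Z \<mu> j) t q + (-1) * gg (Z \<nu> i) (Z \<mu> j) (Z \<nu> i) (Z \<mu> j) t q)) p0"
      by (rule locally_order_zero_mult[OF chart_family_bounded[OF cN chart_family_mult[OF cN ds'[OF *(1-3)] ds[OF *(1,4)]] N(3) \<epsilon>]
          locally_order_add[OF ggo[OF z(1,1,2,2)] locally_order_zero_mult[OF
            chart_family_bounded[OF cN chart_family_real_const[OF cN] N(3) \<epsilon>] ggo[OF z(1,2,1,2)]]]])
  qed
  then have "locally_order 2 l p0"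
    by (rule locally_order_cong[OF _ N(1,3) \<epsilon>]) (simp add: l_eq)
  moreover have "chart_family c \<epsilon> N l" by (rule chart_family_cong[OF cN _ Ls]) (simp add: l_eq)
  ultimately show ?thesis using c(1) N by blast
qed

lemma cubic_contorsion_critical:
  assumes \<mu>0: "\<mu>0 \<in> {1..k}"
    and rel: "\<And>q. e q \<in> D \<mu>0 q" "\<And>q. f q \<in> D \<mu>0 q" "\<And>q. g q (e q) (f q) = 0"
      "\<And>q. a q * g q (e q) (e q) = b q * g q (f q) (f q)"
  shows "contorsion_critical A k n D g (\<lambda>p. cubic (a p) (b p) (g p (e p)) (g p (f p)) (e p) (f p))"
  unfolding contorsion_critical_def
proof (intro allI impI, elim conjE)
  let ?T = "\<lambda>p. cubic (a p) (b p) (g p (e p)) (g p (f p)) (e p) (f p)"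
  fix \<Omega> \<epsilon> S assume \<Omega>: "integration_domain \<Omega>" and S: "statistical_variation A \<Omega> g ?T \<epsilon> S"
  \<comment> \<open>Constant in \<open>t\<close>; the parameter is there to fit the perturbation
    lemma, and the derivative of the unperturbed action is 0 outright.\<close>
  define s where "s t p = mixed_scalar_curvature A k n D g (\<lambda>p u v. 0) p" for t :: real and p
  define l where "l t p = mixed_scalar_curvature A k n D g (S t) p - mixed_scalar_curvature A k n D g (\<lambda>p u v. 0) p" for t p
  have \<epsilon>: "\<epsilon> > 0" using S by (simp add: statistical_variation_def)
  note var = cubic_contorsion_variation[OF \<mu>0 rel S, folded l_def]
  have "((\<lambda>t. LINT p:\<Omega>|vol A g. s t p + l t p) has_real_derivative 0) (at 0)"
  proof (rule action_perturbation[OF integration_domainD[OF \<Omega>] \<epsilon>])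
    show "sets (vol A g) = sets borel" by simp
    show "l t \<in> borel_measurable borel" if "\<bar>t\<bar> < \<epsilon>" for t
      using var that by (intro borel_measurable_local_family[of \<epsilon>]) auto
    show "locally_order 2 l p" for p using var by blast
    show "locally_bounded_mass (\<lambda>t. vol A g) p" for p
      by (rule volume_locally_bounded[OF \<epsilon> chart_at_in in_chart_at metric])
         (auto intro!: chart_family_const chart_open smooth_g smooth_coord_field)
    show "((\<lambda>t. LINT p:\<Omega>|vol A g. s t p) has_real_derivative 0) (at 0)" by (simp add: s_def)
  qed
  then show "((\<lambda>t. action A k n D \<Omega> g (S t)) has_real_derivative 0) (at 0)"
    unfolding action_def s_def l_def by simp
qed

end

theorem corollary8:
  fixes A :: "('m::{t2_space,second_countable_topology}, 'n::finite) chart set"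
    and k :: nat and n :: "nat \<Rightarrow> nat"
    and D :: "('m, 'n) dist" and g :: "('m, 'n) metric"
  assumes "smooth_atlas A" and "connected (UNIV :: 'm set)"
    and "k \<ge> 2" and "tangent_splitting A k n D"
    and "adapted_metric A k D g"
    and "metric_critical A k n D g (\<lambda>p u v. 0)"
    and "\<exists>\<mu>\<in>{1..k}. n \<mu> \<ge> 3 \<or> (n \<mu> = 2 \<and> (\<forall>p. mean_curvature A k n D g \<mu> p = 0))"
  shows "\<exists>T. statistical A g T \<and> (\<exists>p u v. T p u v \<noteq> 0) \<and>
             metric_critical A k n D g T \<and> contorsion_critical A k n D g T"
proof -
  interpret adapted_manifold A k n D g
    using assms(1,4,5) by unfold_locales
  obtain \<mu> where \<mu>: "\<mu> \<in> {1..k}" "n \<mu> \<ge> 3 \<or> (n \<mu> = 2 \<and> (\<forall>p. mean_curvature A k n D g \<mu> p = 0))"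
    using assms(7) by blast
  obtain a b e f where sm: "smooth_fun A UNIV a" "smooth_fun A UNIV b" "smooth_field A UNIV e" "smooth_field A UNIV f"
    and rel: "\<forall>q. e q \<in> D \<mu> q \<and> f q \<in> D \<mu> q \<and> g q (e q) (f q) = 0 \<and> a q * g q (e q) (e q) = b q * g q (f q) (f q) \<and>
      g q (e q) (mean_curvature A k n D g \<mu> q) = 0 \<and> g q (f q) (mean_curvature A k n D g \<mu> q) = 0"
    and nz: "\<exists>p u v. cubic (a p) (b p) (g p (e p)) (g p (f p)) (e p) (f p) u v \<noteq> 0"
    using cubic_sections_exist[OF \<mu>] by metis
  have "metric_critical A k n D g (\<lambda>p. cubic (a p) (b p) (g p (e p)) (g p (f p)) (e p) (f p))"
    using rel by (intro cubic_metric_critical[OF \<mu>(1) sm] assms(6)) auto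
  moreover have "contorsion_critical A k n D g (\<lambda>p. cubic (a p) (b p) (g p (e p)) (g p (f p)) (e p) (f p))"
    using rel by (intro cubic_contorsion_critical[OF \<mu>(1)]) auto
  ultimately show ?thesis using statistical_cubic[OF sm] nz by blast
qed

end
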